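(* Let $\Omega\subset\mathbb{R}^3$ be a convex polyhedral domain and let $v\in W^{2,p}(\Omega)\cap W^{1,p}_0(\Omega)$ for some $1<p<\infty$. Then the normal derivative $\partial_n v$ on $\partial\Omega$ is well defined (in the trace sense) with $$\partial_n v\in W^{1-\frac1p,p}(\partial\Omega).$$ There is a constant $c>0$ independent of $v$ such that $$\|\partial_n v\|_{W^{1-\frac1p,p}(\partial\Omega)}\le c\,\|v\|_{W^{2,p}(\Omega)}.$$
   Context: Polyhedral domains are bounded. $n$ denotes the outer unit normal on $\partial\Omega$ (defined on the open faces, hence almost everywhere on $\partial\Omega$), and $\partial_n v=\nabla v\cdot n$ with $\nabla v$ taken in the sense of traces. For $0<s<1$, the Sobolev--Slobodeckij space $W^{s,p}(\partial\Omega)$ consists of all $g\in L^p(\partial\Omega)$ with finite norm given by $$\|g\|_{W^{s,p}(\partial\Omega)}^p=\|g\|_{L^p(\partial\Omega)}^p+\int_{\partial\Omega}\int_{\partial\Omega}\frac{|g(x)-g(y)|^p}{|x-y|^{2+sp}}\,dx\,dy .$$ *)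

theory Defs
  imports "HOL-Analysis.Analysis"
begin

section \<open>Convex polyhedral domains in three dimensions\<close>

text \<open>A polytope is in particular compact, so boundedness is part of this definition.\<close>

definition convex_polyhedral_domain :: "(real^3) set \<Rightarrow> bool" where
  "convex_polyhedral_domain \<Omega> \<longleftrightarrow>
     open \<Omega> \<and> \<Omega> \<noteq> {} \<and> convex \<Omega> \<and> polytope (closure \<Omega>)"

text \<open>
  The surface measure on \<open>\<partial>\<Omega>\<close> is the sum over the (closed) facets of planar Lebesgue measure,
  transported by a distance-preserving parametrisation of the plane that contains the facet.
  Translation and rotation invariance of Lebesgue measure make it independent of the chosen
  parametrisation; the overlaps of facets are contained in lines and are null sets.
\<close>

definition facet_chart :: "(real^3) set \<Rightarrow> real^2 \<Rightarrow> real^3" where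
  "facet_chart F =
     (SOME \<psi>. (\<forall>x y. dist (\<psi> x) (\<psi> y) = dist x y) \<and> range \<psi> = affine hull F)"

definition surface_measure :: "(real^3) set \<Rightarrow> (real^3) measure" where
  "surface_measure \<Omega> =
     measure_of (frontier \<Omega>) (sets (restrict_space borel (frontier \<Omega>)))
       (\<lambda>A. \<Sum>F | F facet_of closure \<Omega>. emeasure lborel (facet_chart F -` (A \<inter> F)))"

text \<open>
  The next lemmas confirm that the choice in facet_chart is from a nonempty set and that
  the set function above really is a measure.
\<close>

lemma facet_chart_works:
  assumes "convex_polyhedral_domain \<Omega>" and "F facet_of closure \<Omega>"
  shows "dist (facet_chart F x) (facet_chart F y) = dist x y"
    and "range (facet_chart F) = affine hull F"
proof -
  have "interior (closure \<Omega>) \<noteq> {}"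
    using assms(1) interior_maximal[OF closure_subset[of \<Omega>]]
    by (auto simp: convex_polyhedral_domain_def)
  then have "aff_dim (closure \<Omega>) = 3"
    using aff_dim_nonempty_interior[of "closure \<Omega>"] by simp
  then have 2: "aff_dim F = 2" and "F \<noteq> {}"
    using assms(2) by (auto simp: facet_of_def)
  then obtain a where a: "a \<in> F" by auto
  define S where "S = (+) (- a) ` (affine hull F)"
  have aS: "a \<in> affine hull F" using a by (simp add: hull_inc)
  have S: "subspace S"
    unfolding S_def using affine_diffs_subspace[OF affine_affine_hull aS] .
  have aff: "aff_dim S = 2"
    unfolding S_def aff_dim_translation_eq by (simp add: 2)
  have dS: "dim S = DIM(real^2)"
    using aff_dim_subspace[OF S] aff by simp
  have "dim (UNIV :: (real^2) set) = dim S" by (simp add: dS)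
  then obtain f :: "real^2 \<Rightarrow> real^3"
    where fg: "linear f" "range f = S" "\<forall>x. norm (f x) = norm x"
    using isometry_subspaces[OF subspace_UNIV S] by (metis UNIV_I)
  define \<psi> where "\<psi> = (\<lambda>x. a + f x)"
  have "\<forall>x y. dist (\<psi> x) (\<psi> y) = dist x y"
    unfolding \<psi>_def dist_norm using fg(3) by (simp add: linear_diff[OF fg(1), symmetric])
  moreover have "range \<psi> = (+) a ` S"
    using fg(2) unfolding \<psi>_def by (auto simp: image_iff)
  then have "range \<psi> = affine hull F"
    by (simp add: S_def image_image)
  ultimately have "\<exists>\<psi> :: real^2 \<Rightarrow> real^3. (\<forall>x y. dist (\<psi> x) (\<psi> y) = dist x y) \<and> range \<psi> = affine hull F"
    by blast
  from someI_ex[OF this] have *: "(\<forall>x y. dist (facet_chart F x) (facet_chart F y) = dist x y)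
      \<and> range (facet_chart F) = affine hull F"
    unfolding facet_chart_def .
  then show "dist (facet_chart F x) (facet_chart F y) = dist x y"
    and "range (facet_chart F) = affine hull F"
    by simp_all
qed

lemma facet_chart_continuous:
  assumes "convex_polyhedral_domain \<Omega>" and "F facet_of closure \<Omega>"
  shows "continuous_on UNIV (facet_chart F)"
  using facet_chart_works(1)[OF assms] by (auto simp: continuous_on_iff)

lemma space_surface_measure [simp]: "space (surface_measure \<Omega>) = frontier \<Omega>"
  unfolding surface_measure_def
  using sets.space_closed[of "restrict_space borel (frontier \<Omega>)"]
  by (simp add: space_restrict_space)

lemma sets_surface_measure [simp]:
  "sets (surface_measure \<Omega>) = sets (restrict_space borel (frontier \<Omega>))"
  unfolding surface_measure_def
  using sets.sigma_sets_eq[of "restrict_space borel (frontier \<Omega>)"]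
    sets.space_closed[of "restrict_space borel (frontier \<Omega>)"]
  by (simp add: space_restrict_space)

lemma emeasure_surface_measure:
  assumes "convex_polyhedral_domain \<Omega>" and A: "A \<in> sets (surface_measure \<Omega>)"
  shows "emeasure (surface_measure \<Omega>) A =
    (\<Sum>F | F facet_of closure \<Omega>. emeasure lborel (facet_chart F -` (A \<inter> F)))"
proof -
  let ?B = "restrict_space borel (frontier \<Omega>)"
  let ?\<mu> = "\<lambda>A. \<Sum>F | F facet_of closure \<Omega>. emeasure lborel (facet_chart F -` (A \<inter> F))"
  have meas: "facet_chart F -` (A \<inter> F) \<in> sets lborel"
    if F: "F facet_of closure \<Omega>" and A: "A \<in> sets ?B" for F A
  proof -
    have "polyhedron (closure \<Omega>)"
      using assms(1) by (simp add: convex_polyhedral_domain_def polytope_imp_polyhedron)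
    then have "closed F"
      using face_of_polyhedron_polyhedron[OF _ facet_of_imp_face_of[OF F]]
      by (simp add: polyhedron_imp_closed)
    moreover have "A \<in> sets borel"
      using A by (simp add: sets_restrict_space_iff borel_closed)
    ultimately have "A \<inter> F \<in> sets borel" by (simp add: borel_closed)
    then show ?thesis
      using borel_measurable_continuous_onI[OF facet_chart_continuous[OF assms(1) F]]
      using measurable_sets_borel by (auto simp del: vimage_Int)
  qed
  have "countably_additive (sets (surface_measure \<Omega>)) ?\<mu>"
  proof (rule countably_additiveI)
    fix A :: "nat \<Rightarrow> (real^3) set"
    assume A: "range A \<subseteq> sets (surface_measure \<Omega>)" "disjoint_family A"
      and "(\<Union>i. A i) \<in> sets (surface_measure \<Omega>)"
    have "(\<Sum>i. emeasure lborel (facet_chart F -` (A i \<inter> F))) =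
        emeasure lborel (facet_chart F -` ((\<Union>i. A i) \<inter> F))" if F: "F facet_of closure \<Omega>" for F
    proof -
      have "range (\<lambda>i. facet_chart F -` (A i \<inter> F)) \<subseteq> sets lborel"
        using meas[OF F] A(1) by auto
      moreover have "disjoint_family (\<lambda>i. facet_chart F -` (A i \<inter> F))"
        using A(2) by (auto simp: disjoint_family_on_def)
      moreover have "(\<Union>i. facet_chart F -` (A i \<inter> F)) = facet_chart F -` ((\<Union>i. A i) \<inter> F)"
        by auto
      ultimately show ?thesis
        using suminf_emeasure[of "\<lambda>i. facet_chart F -` (A i \<inter> F)" lborel] by simp
    qed
    then show "(\<Sum>i. ?\<mu> (A i)) = ?\<mu> (\<Union>i. A i)"
      by (subst suminf_sum) auto
  qed
  moreover have "positive (sets (surface_measure \<Omega>)) ?\<mu>"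
    by (simp add: positive_def)
  moreover have "sets ?B \<subseteq> Pow (frontier \<Omega>)"
    using sets.space_closed[of ?B] by (simp add: space_restrict_space)
  ultimately show ?thesis
    using A by (intro emeasure_measure_of[OF surface_measure_def])
qed

text \<open>
  The outer unit normal is characterised on the open facets; on the remaining points of the
  boundary, which form a null set, the value is irrelevant.
\<close>

definition outer_normal :: "(real^3) set \<Rightarrow> real^3 \<Rightarrow> real^3" where
  "outer_normal \<Omega> x =
     (THE \<nu>. norm \<nu> = 1 \<and>
        (\<exists>F. F facet_of closure \<Omega> \<and> x \<in> rel_interior F \<and>
             (\<forall>y\<in>F. \<nu> \<bullet> (y - x) = 0) \<and> (\<forall>y\<in>\<Omega>. \<nu> \<bullet> (y - x) < 0)))"


section \<open>Sobolev spaces\<close>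

definition Lp :: "'a measure \<Rightarrow> real \<Rightarrow> ('a \<Rightarrow> real) set" where
  "Lp M p = {f \<in> borel_measurable M. integrable M (\<lambda>x. \<bar>f x\<bar> powr p)}"

definition Lp_norm :: "'a measure \<Rightarrow> real \<Rightarrow> ('a \<Rightarrow> real) \<Rightarrow> real" where
  "Lp_norm M p f = (LINT x|M. \<bar>f x\<bar> powr p) powr (1 / p)"

definition partial_deriv :: "3 \<Rightarrow> (real^3 \<Rightarrow> real) \<Rightarrow> real^3 \<Rightarrow> real" where
  "partial_deriv i f x = frechet_derivative f (at x) (axis i 1)"

text \<open>Only applied to smooth functions, for which the order of differentiation is immaterial.\<close>

definition multi_deriv :: "(3 \<Rightarrow> nat) \<Rightarrow> (real^3 \<Rightarrow> real) \<Rightarrow> real^3 \<Rightarrow> real" where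
  "multi_deriv \<alpha> f =
     (partial_deriv 1 ^^ \<alpha> 1) ((partial_deriv 2 ^^ \<alpha> 2) ((partial_deriv 3 ^^ \<alpha> 3) f))"

text \<open>
  All iterated partial derivatives, in any order, are (Frechet) differentiable everywhere, and
  hence continuous.
\<close>

definition smooth :: "(real^3 \<Rightarrow> real) \<Rightarrow> bool" where
  "smooth f \<longleftrightarrow> (\<forall>js. foldr partial_deriv js f differentiable_on UNIV)"

definition test_functions :: "(real^3) set \<Rightarrow> (real^3 \<Rightarrow> real) set" where
  "test_functions \<Omega> =
     {\<phi>. smooth \<phi> \<and> compact (closure {x. \<phi> x \<noteq> 0}) \<and> closure {x. \<phi> x \<noteq> 0} \<subseteq> \<Omega>}"

definition locally_integrable :: "(real^3) set \<Rightarrow> (real^3 \<Rightarrow> real) \<Rightarrow> bool" where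
  "locally_integrable \<Omega> f \<longleftrightarrow> (\<forall>K. compact K \<and> K \<subseteq> \<Omega> \<longrightarrow> set_integrable lebesgue K f)"

definition has_weak_deriv ::
  "(real^3) set \<Rightarrow> (3 \<Rightarrow> nat) \<Rightarrow> (real^3 \<Rightarrow> real) \<Rightarrow> (real^3 \<Rightarrow> real) \<Rightarrow> bool" where
  "has_weak_deriv \<Omega> \<alpha> u w \<longleftrightarrow>
     locally_integrable \<Omega> u \<and> locally_integrable \<Omega> w \<and>
     (\<forall>\<phi>\<in>test_functions \<Omega>.
        (LINT x|lebesgue_on \<Omega>. u x * multi_deriv \<alpha> \<phi> x) =
        (-1) ^ sum \<alpha> UNIV * (LINT x|lebesgue_on \<Omega>. w x * \<phi> x))"

text \<open>Weak derivatives are unique up to null sets, so the choice does not affect norms.\<close>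

definition weak_deriv ::
  "(real^3) set \<Rightarrow> (3 \<Rightarrow> nat) \<Rightarrow> (real^3 \<Rightarrow> real) \<Rightarrow> real^3 \<Rightarrow> real" where
  "weak_deriv \<Omega> \<alpha> u = (SOME w. has_weak_deriv \<Omega> \<alpha> u w)"

definition sobolev_space :: "nat \<Rightarrow> real \<Rightarrow> (real^3) set \<Rightarrow> (real^3 \<Rightarrow> real) set" where
  "sobolev_space k p \<Omega> =
     {u \<in> Lp (lebesgue_on \<Omega>) p.
        \<forall>\<alpha>. sum \<alpha> UNIV \<le> k \<longrightarrow> (\<exists>w\<in>Lp (lebesgue_on \<Omega>) p. has_weak_deriv \<Omega> \<alpha> u w)}"

definition sobolev_norm :: "nat \<Rightarrow> real \<Rightarrow> (real^3) set \<Rightarrow> (real^3 \<Rightarrow> real) \<Rightarrow> real" where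
  "sobolev_norm k p \<Omega> u =
     (\<Sum>\<alpha> | sum \<alpha> UNIV \<le> k. Lp_norm (lebesgue_on \<Omega>) p (weak_deriv \<Omega> \<alpha> u) powr p) powr (1 / p)"

lemma finite_multi_indices: "finite {\<alpha> :: 3 \<Rightarrow> nat. sum \<alpha> UNIV \<le> k}"
proof (rule finite_subset)
  have "\<alpha> i \<le> sum \<alpha> UNIV" for \<alpha> :: "3 \<Rightarrow> nat" and i
    by (rule member_le_sum) auto
  then show "{\<alpha> :: 3 \<Rightarrow> nat. sum \<alpha> UNIV \<le> k} \<subseteq> Pi\<^sub>E UNIV (\<lambda>_. {..k})"
    by (auto intro: order_trans)
  show "finite (Pi\<^sub>E (UNIV :: 3 set) (\<lambda>_. {..k}))"
    by (intro finite_PiE) auto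
qed

definition sobolev_space_0 :: "nat \<Rightarrow> real \<Rightarrow> (real^3) set \<Rightarrow> (real^3 \<Rightarrow> real) set" where
  "sobolev_space_0 k p \<Omega> =
     {u \<in> sobolev_space k p \<Omega>. \<exists>\<phi>. (\<forall>m. \<phi> m \<in> test_functions \<Omega>) \<and>
        (\<lambda>m::nat. sobolev_norm k p \<Omega> (\<lambda>x. u x - \<phi> m x)) \<longlonglongrightarrow> 0}"


section \<open>Traces and the normal derivative\<close>

text \<open>
  The trace is the continuous extension to \<open>W\<^sup>1\<^sup>,\<^sup>p(\<Omega>)\<close> of the restriction
  to \<open>\<partial>\<Omega>\<close>, defined first for functions that are smooth up to the boundary.
  Functions on \<open>\<partial>\<Omega>\<close> are represented by total functions; the surface measure only sees their
  values on \<open>\<partial>\<Omega>\<close>.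
\<close>

definition has_trace ::
  "real \<Rightarrow> (real^3) set \<Rightarrow> (real^3 \<Rightarrow> real) \<Rightarrow> (real^3 \<Rightarrow> real) \<Rightarrow> bool" where
  "has_trace p \<Omega> u g \<longleftrightarrow>
     u \<in> sobolev_space 1 p \<Omega> \<and> g \<in> Lp (surface_measure \<Omega>) p \<and>
     (\<exists>\<phi>. (\<forall>m. smooth (\<phi> m)) \<and>
        (\<lambda>m::nat. sobolev_norm 1 p \<Omega> (\<lambda>x. u x - \<phi> m x)) \<longlonglongrightarrow> 0 \<and>
        (\<lambda>m. Lp_norm (surface_measure \<Omega>) p (\<lambda>x. g x - \<phi> m x)) \<longlonglongrightarrow> 0)"

definition has_normal_deriv ::
  "real \<Rightarrow> (real^3) set \<Rightarrow> (real^3 \<Rightarrow> real) \<Rightarrow> (real^3 \<Rightarrow> real) \<Rightarrow> bool" where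
  "has_normal_deriv p \<Omega> v d \<longleftrightarrow>
     d \<in> borel_measurable (surface_measure \<Omega>) \<and>
     (\<exists>w t. (\<forall>i. has_weak_deriv \<Omega> ((\<lambda>_. 0)(i := 1)) v (w i) \<and> has_trace p \<Omega> (w i) (t i)) \<and>
        (AE x in surface_measure \<Omega>. d x = (\<Sum>i\<in>UNIV. t i x * outer_normal \<Omega> x $ i)))"


section \<open>Sobolev--Slobodeckij spaces on the boundary\<close>

definition slobodeckij_energy :: "real \<Rightarrow> real \<Rightarrow> (real^3) set \<Rightarrow> (real^3 \<Rightarrow> real) \<Rightarrow> ennreal" where
  "slobodeckij_energy s p \<Omega> g =
     (\<integral>\<^sup>+x. ennreal (\<bar>g x\<bar> powr p) \<partial>surface_measure \<Omega>) +
     (\<integral>\<^sup>+x. \<integral>\<^sup>+y. ennreal (\<bar>g x - g y\<bar> powr p / norm (x - y) powr (2 + s * p))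
        \<partial>surface_measure \<Omega> \<partial>surface_measure \<Omega>)"

definition slobodeckij_space :: "real \<Rightarrow> real \<Rightarrow> (real^3) set \<Rightarrow> (real^3 \<Rightarrow> real) set" where
  "slobodeckij_space s p \<Omega> =
     {g \<in> Lp (surface_measure \<Omega>) p. slobodeckij_energy s p \<Omega> g < \<infinity>}"

definition slobodeckij_norm :: "real \<Rightarrow> real \<Rightarrow> (real^3) set \<Rightarrow> (real^3 \<Rightarrow> real) \<Rightarrow> real" where
  "slobodeckij_norm s p \<Omega> g = enn2real (slobodeckij_energy s p \<Omega> g) powr (1 / p)"

end

theory Submission
  imports Defs
begin

text \<open>
  Contracting the domain towards an interior point before mollifying approximates a Sobolev function by
  functions that are smooth up to the boundary. A Hardy inequality along the segments that join boundary
  points to the points of an inner ball bounds the \<open>L\<^sup>p\<close> norm and the Gagliardo seminorm of a smooth function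
  on the boundary by its \<open>W\<^sup>1\<^sup>,\<^sup>p\<close> norm, so every first derivative of \<open>v\<close> has a trace
  \<open>t\<^sub>i\<close> in the Slobodeckij space. Since \<open>v\<close> vanishes on the boundary, integration by parts against test
  functions supported near the interior of one facet shows that the tangential components of \<open>t\<close> vanish, so
  \<open>t = d n\<close> with \<open>d\<close> the normal derivative. For unit vectors \<open>a \<noteq> - b\<close>
  the difference \<open>s - r\<close> is bounded by a multiple of the length of \<open>s a - r b\<close>, so differences
  of \<open>d\<close> between two facets are controlled by differences of \<open>t\<close>; facets with opposite normals are disjoint,
  hence at positive distance, and there the singular kernel is bounded.
\<close>

section \<open>Smooth functions\<close>

text \<open>Two obstacles shape the argument. The normal jumps across the edges, and for p \<ge> 2
  multiplication by a function with such jumps can lead out of \<open>W^(1-1/p,p)\<close>. Bounds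
  for the components of t alone therefore cannot bound t . n; the vanishing of the tangential part
  is needed for regularity, not just to identify t. The other obstacle is the shape of the boundary
  at edges and vertices. No local flattening is used, only that segments from points of the closure
  to a fixed inner ball lie in \<Omega>; these segments carry both the mollification and the trace
  estimates. Two close boundary points x, y are compared through common points at parameter l of
  order |x - y| on segments from each of them. A surface ball of radius proportional to l has
  measure O(l^2), which turns the Gagliardo weight, spread over l, into the weight l^(-p) of Hardy's
  inequality. In the boundary identity for tangential derivatives the second derivatives of the
  approximants cancel by symmetry, so its volume terms pass to the limit under convergence in
  \<open>W^(1,p)\<close>.\<close>

lemma partial_derivI:
  assumes "(f has_derivative f') (at x)"
  shows "partial_deriv i f x = f' (axis i 1)"
  unfolding partial_deriv_def using frechet_derivative_at[OF assms] by simp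

lemma vec3_expansion: "(\<Sum>i\<in>UNIV. h $ i *\<^sub>R axis i (1::real)) = (h::real^3)"
  by (simp add: vec_eq_iff axis_def if_distrib cong: if_cong)

lemma sum_axis [simp]: "(\<Sum>j\<in>UNIV. axis i 1 $ j * f j) = (f i :: real)"
proof -
  have "(\<Sum>j\<in>UNIV. axis i 1 $ j * f j) = (\<Sum>j\<in>UNIV. if j = i then f j else 0)"
    by (intro sum.cong) (auto simp: axis_def)
  then show ?thesis by simp
qed

lemma sum_axis_scaled [simp]: "(\<Sum>j\<in>UNIV. c * axis i 1 $ j * f j) = (c * f i :: real)"
  using sum_axis[of i "\<lambda>j. c * f j"] by (simp add: ac_simps)

lemma has_derivative_partial:
  assumes "f differentiable (at x)"
  shows "(f has_derivative (\<lambda>h. \<Sum>i\<in>UNIV. h $ i * partial_deriv i f x)) (at x)"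
proof -
  let ?D = "frechet_derivative f (at x)"
  have D: "(f has_derivative ?D) (at x)" using assms frechet_derivative_works by blast
  then interpret linear ?D by (rule has_derivative_linear)
  have "?D h = (\<Sum>i\<in>UNIV. h $ i * partial_deriv i f x)" for h
    by (subst vec3_expansion[symmetric, of h]) (simp add: sum scale partial_deriv_def)
  with D show ?thesis by (metis (no_types, lifting) ext)
qed

text \<open>The words \<open>foldr partial_deriv js f\<close> in the definition of
  \<open>smooth\<close> never leave a set that is closed under \<open>partial_deriv\<close>.
  Smoothness thus costs one derivative of a general member, provided that the set is chosen large
  enough.\<close>

lemma smooth_coinduct:
  assumes "f \<in> S" "\<And>g. g \<in> S \<Longrightarrow> g differentiable_on UNIV" "\<And>g i. g \<in> S \<Longrightarrow> partial_deriv i g \<in> S"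
  shows "smooth f"
proof -
  have "foldr partial_deriv js f \<in> S" for js
    by (induction js) (auto simp: assms)
  then show ?thesis by (auto simp: smooth_def assms(2))
qed

lemma smooth_partial_deriv [intro]:
  assumes "smooth f" shows "smooth (partial_deriv i f)"
  unfolding smooth_def
proof
  fix js
  have "foldr partial_deriv (js @ [i]) f differentiable_on UNIV"
    using assms unfolding smooth_def by blast
  then show "foldr partial_deriv js (partial_deriv i f) differentiable_on UNIV" by simp
qed

lemma smooth_differentiable:
  assumes "smooth f" shows "f differentiable (at x)"
proof -
  have "foldr partial_deriv [] f differentiable_on UNIV"
    using assms unfolding smooth_def by blast
  then show ?thesis by (simp add: differentiable_on_def)
qed

lemma smooth_has_derivative:
  "smooth f \<Longrightarrow> (f has_derivative (\<lambda>h. \<Sum>i\<in>UNIV. h $ i * partial_deriv i f x)) (at x)"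
  by (rule has_derivative_partial[OF smooth_differentiable])

lemma smooth_continuous: "smooth f \<Longrightarrow> continuous_on S f"
  by (meson continuous_at_imp_continuous_on differentiable_imp_continuous_within smooth_differentiable)

lemma smooth_borel: "smooth f \<Longrightarrow> f \<in> borel_measurable borel"
  by (simp add: borel_measurable_continuous_onI smooth_continuous)

text \<open>Serves as invariant set for \<open>smooth_coinduct\<close>: by the product rule it is
  closed under \<open>partial_deriv\<close> as soon as the derivatives of the generators lie in it,
  even where they are not generators themselves.\<close>

inductive_set function_algebra :: "(real^3 \<Rightarrow> real) set \<Rightarrow> (real^3 \<Rightarrow> real) set" for G where
  base: "g \<in> G \<Longrightarrow> g \<in> function_algebra G"
| const: "(\<lambda>x. c) \<in> function_algebra G"
| add: "f \<in> function_algebra G \<Longrightarrow> g \<in> function_algebra G \<Longrightarrow> (\<lambda>x. f x + g x) \<in> function_algebra G"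
| mult: "f \<in> function_algebra G \<Longrightarrow> g \<in> function_algebra G \<Longrightarrow> (\<lambda>x. f x * g x) \<in> function_algebra G"

lemma partial_deriv_const: "partial_deriv i (\<lambda>x. c) = (\<lambda>x. 0)"
  by (rule ext) (simp add: partial_derivI[OF has_derivative_const])

lemma partial_deriv_add:
  assumes "f differentiable (at x)" "g differentiable (at x)"
  shows "partial_deriv i (\<lambda>x. f x + g x) x = partial_deriv i f x + partial_deriv i g x"
  using partial_derivI[OF has_derivative_add[OF has_derivative_partial[OF assms(1)] has_derivative_partial[OF assms(2)]], of i]
  by simp

lemma partial_deriv_mult:
  assumes "f differentiable (at x)" "g differentiable (at x)"
  shows "partial_deriv i (\<lambda>x. f x * g x) x = f x * partial_deriv i g x + partial_deriv i f x * g x"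
  using partial_derivI[OF has_derivative_mult[OF has_derivative_partial[OF assms(1)] has_derivative_partial[OF assms(2)]], of i]
  by simp

lemma smooth_function_algebra:
  assumes f: "f \<in> function_algebra G" and G: "\<And>g. g \<in> G \<Longrightarrow> g differentiable_on UNIV"
    "\<And>g i. g \<in> G \<Longrightarrow> partial_deriv i g \<in> function_algebra G"
  shows "smooth f"
proof -
  have *: "g differentiable_on UNIV \<and> (\<forall>i. partial_deriv i g \<in> function_algebra G)"
    if "g \<in> function_algebra G" for g
    using that
  proof induction
    case (base g) then show ?case by (simp add: G)
  next
    case (const c) show ?case by (simp add: partial_deriv_const function_algebra.const)
  next
    case (add f g)
    then have "partial_deriv i (\<lambda>x. f x + g x) = (\<lambda>x. partial_deriv i f x + partial_deriv i g x)" for i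
      by (intro ext partial_deriv_add) (auto simp: differentiable_on_def)
    moreover have "(\<lambda>x. f x + g x) differentiable_on UNIV"
      using add by (simp add: differentiable_on_def)
    ultimately show ?case using add(3,4) function_algebra.add by simp
  next
    case (mult f g)
    then have "partial_deriv i (\<lambda>x. f x * g x) = (\<lambda>x. f x * partial_deriv i g x + partial_deriv i f x * g x)" for i
      by (intro ext partial_deriv_mult) (auto simp: differentiable_on_def)
    moreover have "(\<lambda>x. f x * partial_deriv i g x + partial_deriv i f x * g x) \<in> function_algebra G" for i
      using mult by (intro function_algebra.add[OF function_algebra.mult function_algebra.mult]) blast+
    moreover have "(\<lambda>x. f x * g x) differentiable_on UNIV"
      using mult by (simp add: differentiable_on_def)
    ultimately show ?case by simp
  qed
  show ?thesis using f by (rule smooth_coinduct) (blast dest: *)+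
qed

lemma smooth_algebra: "f \<in> function_algebra {g. smooth g} \<Longrightarrow> smooth f"
  by (erule smooth_function_algebra)
    (simp_all add: function_algebra.base smooth_differentiable smooth_partial_deriv differentiable_on_def)

lemma smooth_const [intro]: "smooth (\<lambda>x. c)"
  by (rule smooth_algebra, rule function_algebra.const)

lemma smooth_add [intro]: "smooth f \<Longrightarrow> smooth g \<Longrightarrow> smooth (\<lambda>x. f x + g x)"
  by (rule smooth_algebra, rule function_algebra.add; rule function_algebra.base; simp)

lemma smooth_mult [intro]: "smooth f \<Longrightarrow> smooth g \<Longrightarrow> smooth (\<lambda>x. f x * g x)"
  by (rule smooth_algebra, rule function_algebra.mult; rule function_algebra.base; simp)

lemma smooth_diff [intro]: assumes "smooth f" "smooth g" shows "smooth (\<lambda>x. f x - g x)"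
  using smooth_add[OF assms(1) smooth_mult[OF smooth_const[of "-1"] assms(2)]] by simp

lemma smooth_sum [intro]: "(\<And>i. i \<in> A \<Longrightarrow> smooth (f i)) \<Longrightarrow> smooth (\<lambda>x. \<Sum>i\<in>A. f i x)"
  by (induction A rule: infinite_finite_induct) (simp_all add: smooth_const smooth_add smooth_mult)

lemma smooth_prod [intro]: "(\<And>i. i \<in> A \<Longrightarrow> smooth (f i)) \<Longrightarrow> smooth (\<lambda>x. \<Prod>i\<in>A. f i x)"
  by (induction A rule: infinite_finite_induct) (simp_all add: smooth_const smooth_add smooth_mult)

lemma partial_deriv_diff:
  assumes "smooth f" "smooth g"
  shows "partial_deriv i (\<lambda>x. f x - g x) x = partial_deriv i f x - partial_deriv i g x"
  using partial_derivI[OF has_derivative_diff[OF smooth_has_derivative[OF assms(1)] smooth_has_derivative[OF assms(2)]], of i]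
  by simp

lemma partial_deriv_cmult:
  assumes "smooth f"
  shows "partial_deriv i (\<lambda>x. c * f x) x = c * partial_deriv i f x"
  using partial_deriv_mult[OF smooth_differentiable[OF smooth_const[of c]] smooth_differentiable[OF assms], of i x]
  by (simp add: partial_deriv_const)

lemma smooth_exp [intro]: assumes "smooth f" shows "smooth (\<lambda>x. exp (f x))"
proof (rule smooth_function_algebra)
  \<comment> \<open>The generators are all smooth functions and all their exponentials: the
    derivative of an exponential is a product of one function of each kind.\<close>
  let ?G = "{g. smooth g} \<union> {\<lambda>x. exp (g x) |g. smooth g}"
  show "(\<lambda>x. exp (f x)) \<in> function_algebra ?G"
    using assms by (intro function_algebra.base) auto
  have D: "((\<lambda>x. exp (g x)) has_derivative (\<lambda>h. exp (g x) * (\<Sum>i\<in>UNIV. h $ i * partial_deriv i g x))) (at x)"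
    if "smooth g" for g x
    using has_derivative_compose[OF smooth_has_derivative[OF that] DERIV_exp[unfolded has_field_derivative_def]] .
  fix g assume g: "g \<in> ?G"
  then consider "smooth g" | g' where "g = (\<lambda>x. exp (g' x))" "smooth g'" by auto
  then show "g differentiable_on UNIV"
  proof cases
    case 2
    then show ?thesis unfolding 2(1) differentiable_on_def differentiable_def using D[OF 2(2)] by blast
  qed (simp add: differentiable_on_def smooth_differentiable)
  fix i
  from g consider "smooth g" | g' where "g = (\<lambda>x. exp (g' x))" "smooth g'" by auto
  then show "partial_deriv i g \<in> function_algebra ?G"
  proof cases
    case 1
    then show ?thesis by (simp add: function_algebra.base smooth_partial_deriv)
  next
    case 2
    have "partial_deriv i g = (\<lambda>x. exp (g' x) * partial_deriv i g' x)"
      unfolding 2(1) by (rule ext, rule trans[OF partial_derivI[OF D[OF 2(2)]]]) simp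
    moreover have "(\<lambda>x. exp (g' x) * partial_deriv i g' x) \<in> function_algebra ?G"
      by (rule function_algebra.mult; rule function_algebra.base) (use 2 in auto)
    ultimately show ?thesis by simp
  qed
qed

lemma has_derivative_affine:
  assumes "smooth f"
  shows "((\<lambda>x. f (c *\<^sub>R x + a)) has_derivative (\<lambda>h. \<Sum>i\<in>UNIV. (c * h $ i) * partial_deriv i f (c *\<^sub>R x + a))) (at x)"
proof -
  have "((\<lambda>x. c *\<^sub>R x + a) has_derivative (\<lambda>h. c *\<^sub>R h)) (at x)"
    by (auto intro!: derivative_eq_intros)
  from has_derivative_compose[OF this smooth_has_derivative[OF assms]] show ?thesis by simp
qed

lemma partial_deriv_affine:
  assumes "smooth f"
  shows "partial_deriv i (\<lambda>x. f (c *\<^sub>R x + a)) x = c * partial_deriv i f (c *\<^sub>R x + a)"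
  using partial_derivI[OF has_derivative_affine[OF assms], of i]
  by simp

lemma smooth_affine [intro]:
  assumes "smooth f" shows "smooth (\<lambda>x. f (c *\<^sub>R x + a))"
proof (rule smooth_coinduct)
  \<comment> \<open>The factor \<open>k\<close> collects the powers of \<open>c\<close> that the
    chain rule produces.\<close>
  let ?S = "{\<lambda>x. k * g (c *\<^sub>R x + a) | k g. smooth g}"
  show "(\<lambda>x. f (c *\<^sub>R x + a)) \<in> ?S" using assms by (auto intro!: exI[of _ 1] exI[of _ f])
  fix g assume "g \<in> ?S"
  then obtain k h where g: "g = (\<lambda>x. k * h (c *\<^sub>R x + a))" "smooth h" by auto
  have D: "(g has_derivative (\<lambda>d. k * (\<Sum>i\<in>UNIV. (c * d $ i) * partial_deriv i h (c *\<^sub>R x + a)))) (at x)" for x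
    unfolding g(1) by (intro has_derivative_mult_right has_derivative_affine g)
  then show "g differentiable_on UNIV" by (auto simp: differentiable_on_def differentiable_def)
  fix i
  have "partial_deriv i g = (\<lambda>x. (k * c) * partial_deriv i h (c *\<^sub>R x + a))"
    using partial_derivI[OF D, of i] by auto
  then show "partial_deriv i g \<in> ?S" using g(2) by auto
qed

text \<open>The derivatives of the flat function \<open>exp (-1/t)\<close> are combinations of these.\<close>

definition flat :: "nat \<Rightarrow> real \<Rightarrow> real" where
  "flat k t = (if t \<le> 0 then 0 else exp (- 1 / t) / t ^ k)"

text \<open>The term of degree k + 2 in the series of exp (1/t) is at most the whole sum. The
  surplus factor t^2 makes the difference quotient of \<open>flat k\<close> at 0 vanish in the
  limit.\<close>

lemma flat_le: "\<bar>flat k t\<bar> \<le> fact (k + 2) * t\<^sup>2"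
proof (cases "t \<le> 0")
  case False
  have "(1 / t) ^ (k + 2) / fact (k + 2) \<le> exp (1 / t)"
    using False sum_le_suminf[OF summable_exp_generic, of "{k+2}" "1 / t"]
    by (simp add: exp_def divide_inverse ac_simps)
  then have "1 \<le> exp (1 / t) * fact (k + 2) * t ^ (k + 2)"
    using False by (simp add: power_divide field_simps del: fact_Suc power_Suc add_2_eq_Suc')
  from mult_left_mono[OF this, of "exp (- 1 / t) / t ^ k"]
  have "exp (- 1 / t) / t ^ k \<le> (exp (- 1 / t) / t ^ k) * (exp (1 / t) * fact (k + 2) * t ^ (k + 2))"
    using False by (simp del: fact_Suc power_Suc add_2_eq_Suc')
  also have "\<dots> = (exp (- 1 / t) * exp (1 / t)) * fact (k + 2) * t\<^sup>2"
    using False by (simp add: power_add power2_eq_square field_simps del: fact_Suc)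
  also have "exp (- 1 / t) * exp (1 / t) = 1" by (simp flip: exp_add)
  finally show ?thesis using False by (simp add: flat_def)
qed (simp add: flat_def)

lemma flat_deriv: "(flat k has_real_derivative (flat (k + 2) t - of_nat k * flat (k + 1) t)) (at t)"
proof -
  consider "t < 0" | "t = 0" | "t > 0" by linarith
  then show ?thesis
  proof cases
    case 1
    have "((\<lambda>_. 0) has_real_derivative 0) (at t)" by simp
    then have "(flat k has_real_derivative 0) (at t)"
      by (rule has_field_derivative_transform_within_open[where S="{..<0}"]) (use 1 in \<open>auto simp: flat_def\<close>)
    then show ?thesis using 1 by (simp add: flat_def)
  next
    case 2
    have "((\<lambda>h. (flat k (0 + h) - flat k 0) / h) \<longlongrightarrow> 0) (at 0)"
    proof (rule Lim_null_comparison)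
      have "norm ((flat k (0 + h) - flat k 0) / h) \<le> fact (k + 2) * \<bar>h\<bar>" if "h \<noteq> 0" for h
        using flat_le[of k h] that by (simp add: flat_def divide_simps power2_eq_square abs_mult del: fact_Suc)
      then show "\<forall>\<^sub>F h in at 0. norm ((flat k (0 + h) - flat k 0) / h) \<le> fact (k + 2) * \<bar>h\<bar>"
        by (auto simp: eventually_at_filter)
      show "((\<lambda>h. fact (k + 2) * \<bar>h\<bar>) \<longlongrightarrow> (0::real)) (at 0)"
        by (auto intro!: tendsto_eq_intros)
    qed
    then show ?thesis using 2 by (simp add: DERIV_def flat_def)
  next
    case 3
    have "((\<lambda>t. exp (- 1 / t) / t ^ k) has_real_derivative (flat (k + 2) t - of_nat k * flat (k + 1) t)) (at t)"
      using 3 by (auto intro!: derivative_eq_intros simp: flat_def field_simps power2_eq_square)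
        (cases k; simp add: field_simps)
    then show ?thesis
      by (rule has_field_derivative_transform_within_open[where S="{0<..}"]) (use 3 in \<open>auto simp: flat_def\<close>)
  qed
qed

lemma smooth_flat: "smooth (\<lambda>x. flat k (a * x $ j + b))"
proof (rule smooth_function_algebra)
  let ?G = "{\<lambda>x. flat k (a * x $ j + b) |k. True}"
  show "(\<lambda>x. flat k (a * x $ j + b)) \<in> function_algebra ?G"
    by (intro function_algebra.base) auto
  fix g assume "g \<in> ?G"
  then obtain k where g: "g = (\<lambda>x. flat k (a * x $ j + b))" by auto
  have D: "(g has_derivative (\<lambda>h. (a * h $ j) * (flat (k + 2) (a * x $ j + b) - of_nat k * flat (k + 1) (a * x $ j + b)))) (at x)" for x
  proof -
    have "((\<lambda>x::real^3. a * x $ j + b) has_derivative (\<lambda>h. a * h $ j)) (at x)"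
      by (auto intro!: derivative_eq_intros bounded_linear_imp_has_derivative bounded_linear_vec_nth)
    from has_derivative_compose[OF this flat_deriv[unfolded has_field_derivative_def]]
    show ?thesis unfolding g by (simp add: mult.commute)
  qed
  then show "g differentiable_on UNIV" by (auto simp: differentiable_on_def differentiable_def)
  fix i
  have "partial_deriv i g = (\<lambda>x. (a * axis i 1 $ j) * (flat (k + 2) (a * x $ j + b) + (- of_nat k) * flat (k + 1) (a * x $ j + b)))"
    using partial_derivI[OF D, of i] by auto
  moreover have "(\<lambda>x. flat k (a * x $ j + b)) \<in> function_algebra ?G" for k
    by (intro function_algebra.base) auto
  ultimately show "partial_deriv i g \<in> function_algebra ?G"
    by (simp only: function_algebra.add function_algebra.mult function_algebra.const)
qed

section \<open>Directional derivatives and the symmetry of second derivatives\<close>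

definition dir_deriv :: "real^3 \<Rightarrow> (real^3 \<Rightarrow> real) \<Rightarrow> real^3 \<Rightarrow> real" where
  "dir_deriv v f x = (\<Sum>i\<in>UNIV. v $ i * partial_deriv i f x)"

lemma smooth_dir_deriv [intro]: "smooth f \<Longrightarrow> smooth (dir_deriv v f)"
  unfolding dir_deriv_def[abs_def] by (intro smooth_sum smooth_mult smooth_const smooth_partial_deriv)

lemma dir_deriv_axis [simp]: "dir_deriv (axis i 1) f = partial_deriv i f"
  by (simp add: dir_deriv_def[abs_def])

lemma smooth_has_derivative_dir: "smooth f \<Longrightarrow> (f has_derivative (\<lambda>h. dir_deriv h f x)) (at x)"
  unfolding dir_deriv_def by (rule smooth_has_derivative)

lemma dir_deriv_scaleR: "dir_deriv (c *\<^sub>R v) f x = c * dir_deriv v f x"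
  by (simp add: dir_deriv_def sum_distrib_left ac_simps)

lemma smooth_line_derivative:
  assumes "smooth f"
  shows "((\<lambda>t. f (x + t *\<^sub>R v)) has_real_derivative dir_deriv v f (x + t *\<^sub>R v)) (at t within S)"
proof -
  have "((\<lambda>t. x + t *\<^sub>R v) has_derivative (\<lambda>t. t *\<^sub>R v)) (at t within S)"
    by (auto intro!: derivative_eq_intros)
  from has_derivative_compose[OF this smooth_has_derivative_dir[OF assms]]
  show ?thesis by (simp add: has_field_derivative_def dir_deriv_scaleR mult_commute_abs)
qed

text \<open>The mean value theorem is used twice: along v for the difference of f on two parallel
  lines, then along w for the directional derivative. The left side is symmetric in v and w, which
  is what Schwarz's theorem exploits.\<close>

lemma second_difference_mean_value:
  assumes f: "smooth f" and h: "0 < h"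
  obtains \<xi> \<eta> where "0 < \<xi>" "\<xi> < h" "0 < \<eta>" "\<eta> < h"
    "f (x + h *\<^sub>R v + h *\<^sub>R w) - f (x + h *\<^sub>R v) - (f (x + h *\<^sub>R w) - f x)
      = h * (h * dir_deriv w (dir_deriv v f) (x + \<xi> *\<^sub>R v + \<eta> *\<^sub>R w))"
proof -
  let ?u = "\<lambda>s. f (x + h *\<^sub>R w + s *\<^sub>R v) - f (x + s *\<^sub>R v)"
  have "DERIV ?u s :> dir_deriv v f (x + h *\<^sub>R w + s *\<^sub>R v) - dir_deriv v f (x + s *\<^sub>R v)" for s
    by (intro DERIV_diff smooth_line_derivative f)
  with MVT2[OF h] obtain \<xi> where \<xi>: "0 < \<xi>" "\<xi> < h"
    "?u h - ?u 0 = (h - 0) * (dir_deriv v f (x + h *\<^sub>R w + \<xi> *\<^sub>R v) - dir_deriv v f (x + \<xi> *\<^sub>R v))"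
    by (metis (no_types, lifting))
  let ?w = "\<lambda>t. dir_deriv v f (x + \<xi> *\<^sub>R v + t *\<^sub>R w)"
  have "DERIV ?w t :> dir_deriv w (dir_deriv v f) (x + \<xi> *\<^sub>R v + t *\<^sub>R w)" for t
    by (intro smooth_line_derivative smooth_dir_deriv f)
  with MVT2[OF h, of ?w "\<lambda>t. dir_deriv w (dir_deriv v f) (x + \<xi> *\<^sub>R v + t *\<^sub>R w)"] obtain \<eta> where \<eta>: "0 < \<eta>" "\<eta> < h"
    "?w h - ?w 0 = (h - 0) * dir_deriv w (dir_deriv v f) (x + \<xi> *\<^sub>R v + \<eta> *\<^sub>R w)"
    by blast
  show thesis
    by (rule that[of \<xi> \<eta>]) (use \<xi> \<eta> in \<open>simp_all add: add_ac\<close>)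
qed

text \<open>Both orders of differentiation, taken at intermediate points that tend to x, are the
  same second difference divided by h^2; continuity of the second derivatives identifies the
  limits.\<close>

lemma dir_deriv_commute:
  assumes f: "smooth f"
  shows "dir_deriv w (dir_deriv v f) x = dir_deriv v (dir_deriv w f) x"
proof -
  let ?h = "\<lambda>n::nat. inverse (real (Suc n))"
  have seq: "\<exists>P. P \<longlonglongrightarrow> x \<and> (\<forall>n. f (x + ?h n *\<^sub>R v + ?h n *\<^sub>R w) - f (x + ?h n *\<^sub>R v) - (f (x + ?h n *\<^sub>R w) - f x)
      = ?h n * (?h n * dir_deriv w (dir_deriv v f) (P n)))" for v w
  proof -
    have "\<exists>\<xi> \<eta>. 0 < \<xi> \<and> \<xi> < ?h n \<and> 0 < \<eta> \<and> \<eta> < ?h n \<and>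
      f (x + ?h n *\<^sub>R v + ?h n *\<^sub>R w) - f (x + ?h n *\<^sub>R v) - (f (x + ?h n *\<^sub>R w) - f x)
      = ?h n * (?h n * dir_deriv w (dir_deriv v f) (x + \<xi> *\<^sub>R v + \<eta> *\<^sub>R w))" for n
      using second_difference_mean_value[OF f, of "?h n" x v w] by (metis inverse_positive_iff_positive of_nat_0_less_iff zero_less_Suc)
    then obtain \<xi> \<eta> where *: "\<And>n. 0 < \<xi> n \<and> \<xi> n < ?h n \<and> 0 < \<eta> n \<and> \<eta> n < ?h n \<and>
      f (x + ?h n *\<^sub>R v + ?h n *\<^sub>R w) - f (x + ?h n *\<^sub>R v) - (f (x + ?h n *\<^sub>R w) - f x)
      = ?h n * (?h n * dir_deriv w (dir_deriv v f) (x + \<xi> n *\<^sub>R v + \<eta> n *\<^sub>R w))" by metis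
    have z: "\<xi> \<longlonglongrightarrow> 0" "\<eta> \<longlonglongrightarrow> 0"
      by (rule tendsto_sandwich[OF _ _ tendsto_const LIMSEQ_inverse_real_of_nat];
          use * in \<open>intro always_eventually allI less_imp_le, blast\<close>)+
    have "(\<lambda>n. x + \<xi> n *\<^sub>R v + \<eta> n *\<^sub>R w) \<longlonglongrightarrow> x + 0 *\<^sub>R v + 0 *\<^sub>R w"
      by (intro tendsto_intros z)
    with * show ?thesis by (intro exI[of _ "\<lambda>n. x + \<xi> n *\<^sub>R v + \<eta> n *\<^sub>R w"]) simp
  qed
  obtain P where P: "P \<longlonglongrightarrow> x" "\<And>n. f (x + ?h n *\<^sub>R v + ?h n *\<^sub>R w) - f (x + ?h n *\<^sub>R v) - (f (x + ?h n *\<^sub>R w) - f x)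
      = ?h n * (?h n * dir_deriv w (dir_deriv v f) (P n))" using seq[of v w] by auto
  obtain Q where Q: "Q \<longlonglongrightarrow> x" "\<And>n. f (x + ?h n *\<^sub>R w + ?h n *\<^sub>R v) - f (x + ?h n *\<^sub>R w) - (f (x + ?h n *\<^sub>R v) - f x)
      = ?h n * (?h n * dir_deriv v (dir_deriv w f) (Q n))" using seq[of w v] by auto
  have eq: "dir_deriv w (dir_deriv v f) (P n) = dir_deriv v (dir_deriv w f) (Q n)" for n
  proof -
    have "?h n * (?h n * dir_deriv w (dir_deriv v f) (P n)) = ?h n * (?h n * dir_deriv v (dir_deriv w f) (Q n))"
      unfolding P(2)[symmetric] Q(2)[symmetric] by (simp add: algebra_simps)
    then show ?thesis by simp
  qed
  have cont: "isCont (dir_deriv a (dir_deriv b f)) x" for a b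
    by (simp add: f smooth_dir_deriv smooth_differentiable differentiable_imp_continuous_within)
  show ?thesis
    using isCont_tendsto_compose[OF cont P(1), of w v] isCont_tendsto_compose[OF cont Q(1), of v w]
    unfolding eq by (rule LIMSEQ_unique)
qed

lemma partial_deriv_commute: "smooth f \<Longrightarrow> partial_deriv i (partial_deriv j f) = partial_deriv j (partial_deriv i f)"
  using dir_deriv_commute[of f "axis i 1" "axis j 1"] by auto

section \<open>Bump functions and cutoffs of boxes\<close>

definition box_bump :: "real^3 \<Rightarrow> real^3 \<Rightarrow> real^3 \<Rightarrow> real" where
  "box_bump a b x = (\<Prod>j\<in>UNIV. flat 0 (x $ j - a $ j) * flat 0 (b $ j - x $ j))"

lemma smooth_box_bump: "smooth (box_bump a b)"
proof -
  have "smooth (\<lambda>x. flat 0 (1 * x $ j + - a $ j) * flat 0 (- 1 * x $ j + b $ j))" for j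
    by (intro smooth_mult smooth_flat)
  then show ?thesis unfolding box_bump_def[abs_def] by (intro smooth_prod) simp
qed

lemma flat_0: "flat 0 t \<ge> 0" "flat 0 t = 0 \<longleftrightarrow> t \<le> 0"
  by (auto simp: flat_def)

lemma box_bump_pos: "box_bump a b x \<ge> 0" "box_bump a b x = 0 \<longleftrightarrow> x \<notin> box a b"
  by (auto simp: box_bump_def flat_0 prod_nonneg mem_box_cart not_less)

text \<open>Smooth functions between 0 and 1 that tend pointwise to the indicator of the open box:
  exp (- n b) tends to 0 where the bump b is positive and equals 1 where b vanishes. Pointwise
  convergence suffices for dominated convergence.\<close>

definition cutoff :: "nat \<Rightarrow> real^3 \<Rightarrow> real^3 \<Rightarrow> real^3 \<Rightarrow> real" where
  "cutoff n a b x = 1 - exp (- of_nat n * box_bump a b x)"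

lemma cutoff:
  shows smooth_cutoff: "smooth (cutoff n a b)"
    and cutoff_range: "0 \<le> cutoff n a b x" "cutoff n a b x \<le> 1"
    and cutoff_support: "x \<notin> box a b \<Longrightarrow> cutoff n a b x = 0"
    and cutoff_limit: "(\<lambda>n. cutoff n a b x) \<longlonglongrightarrow> indicator (box a b) x"
proof -
  show "smooth (cutoff n a b)"
    unfolding cutoff_def[abs_def]
    by (intro smooth_diff smooth_const smooth_exp smooth_mult[OF smooth_const smooth_box_bump])
  show "0 \<le> cutoff n a b x" "cutoff n a b x \<le> 1"
    using box_bump_pos(1)[of a b x] by (auto simp: cutoff_def)
  show "cutoff n a b x = 0" if "x \<notin> box a b"
    using that box_bump_pos(2)[of a b x] by (simp add: cutoff_def)
  show "(\<lambda>n. cutoff n a b x) \<longlonglongrightarrow> indicator (box a b) x"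
  proof (cases "x \<in> box a b")
    case True
    then have pos: "box_bump a b x > 0" using box_bump_pos[of a b x] by linarith
    have "(\<lambda>n. exp (- box_bump a b x) ^ n) \<longlonglongrightarrow> 0"
      using pos by (intro LIMSEQ_realpow_zero) auto
    then have "(\<lambda>n. exp (- of_nat n * box_bump a b x)) \<longlonglongrightarrow> 0"
      by (simp add: exp_of_nat_mult[symmetric])
    from tendsto_diff[OF tendsto_const[of 1] this] show ?thesis
      using True by (simp add: cutoff_def)
  next
    case False
    then show ?thesis using box_bump_pos(2)[of a b x] by (simp add: cutoff_def)
  qed
qed

lemma closure_support_subset: "(\<And>x. x \<notin> box a b \<Longrightarrow> f x = 0) \<Longrightarrow> closure {x. f x \<noteq> 0} \<subseteq> cbox a b"
  by (rule closure_minimal) (use box_subset_cbox in \<open>auto simp: closed_cbox\<close>)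

lemma cutoff_test_function: "cbox a b \<subseteq> U \<Longrightarrow> cutoff n a b \<in> test_functions U"
  using closure_support_subset[of a b "cutoff n a b", OF cutoff_support] bounded_subset[OF bounded_cbox]
  by (auto simp: test_functions_def smooth_cutoff compact_eq_bounded_closed)

section \<open>Integration by parts in a half-space\<close>

lemma AE_local:
  fixes U :: "'a::second_countable_topology set"
  assumes "\<And>x. x \<in> U \<Longrightarrow> \<exists>V. open V \<and> x \<in> V \<and> (AE y in M. y \<in> V \<longrightarrow> P y)"
  shows "AE y in M. y \<in> U \<longrightarrow> P y"
proof -
  let ?F = "{V. open V \<and> (AE y in M. y \<in> V \<longrightarrow> P y)}"
  \<comment> \<open>By Lindelof, countably many of the good neighbourhoods have the same union, and
    countably many exceptional null sets can be joined.\<close>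
  obtain F' where F': "F' \<subseteq> ?F" "countable F'" "\<Union>F' = \<Union>?F"
    using Lindelof[of ?F] by (metis (mono_tags, lifting) mem_Collect_eq)
  have "AE y in M. \<forall>V\<in>F'. y \<in> V \<longrightarrow> P y"
    using F' by (subst AE_ball_countable) auto
  moreover have "U \<subseteq> \<Union>F'" using assms F'(3) by blast
  ultimately show ?thesis by (auto elim!: eventually_mono)
qed

text \<open>Dominated convergence passes from cutoffs to indicators of boxes. The sets A for which g
  integrates to 0 over the part of A in the given box are then closed under complements and disjoint
  unions, so they exhaust the Borel sets; the sets where g is positive or negative finish the
  argument.\<close>

lemma orthogonal_test_functions_box:
  fixes g :: "real^3 \<Rightarrow> real"
  assumes sets: "sets M = sets borel" and g: "integrable M g"
    and zero: "\<And>n c d. cbox c d \<subseteq> cbox a b \<Longrightarrow> (LINT x|M. g x * cutoff n c d x) = 0"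
  shows "AE x in M. x \<in> box a b \<longrightarrow> g x = 0"
proof -
  have [measurable_cong]: "sets M = sets borel" by (rule sets)
  have [measurable]: "g \<in> borel_measurable M" using g by simp
  have cut [measurable]: "cutoff n c d \<in> borel_measurable borel" for n c d
    by (intro smooth_borel smooth_cutoff)
  have box0: "(LINT x|M. g x * indicator (box c d) x) = 0" if "cbox c d \<subseteq> cbox a b" for c d
  proof (rule LIMSEQ_unique)
    show "(\<lambda>n. LINT x|M. g x * cutoff n c d x) \<longlonglongrightarrow> (LINT x|M. g x * indicator (box c d) x)"
    proof (rule integral_dominated_convergence[where w="\<lambda>x. \<bar>g x\<bar>"])
      show "AE x in M. (\<lambda>n. g x * cutoff n c d x) \<longlonglongrightarrow> g x * indicator (box c d) x"
        by (intro always_eventually allI tendsto_intros cutoff_limit)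
      show "AE x in M. norm (g x * cutoff n c d x) \<le> \<bar>g x\<bar>" for n
        using cutoff_range[of n c d] by (auto simp: abs_mult mult_left_le)
    qed (use g in auto)
    show "(\<lambda>n. LINT x|M. g x * cutoff n c d x) \<longlonglongrightarrow> 0" using zero[OF that] by simp
  qed
  have intgA: "integrable M (\<lambda>x. g x * indicator A x)" if "A \<in> sets borel" for A
    using that by (intro integrable_real_mult_indicator g) (simp add: sets)
  have A0: "(LINT x|M. g x * indicator (A \<inter> box a b) x) = 0" if "A \<in> sets borel" for A
  proof -
    let ?E = "range (\<lambda>(a, b). box a b) :: (real^3) set set"
    have "Int_stable ?E" by (auto simp: Int_stable_def box_Int_box)
    moreover have "?E \<subseteq> Pow UNIV" by auto
    moreover have "A \<in> sigma_sets UNIV ?E" using that unfolding borel_eq_box by simp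
    ultimately show ?thesis
    proof (induction rule: sigma_sets_induct_disjoint)
      case (basic A)
      then obtain c d where A: "A = box c d" by auto
      show ?case
      proof (cases "box c d \<inter> box a b = {}")
        case False
        obtain c' d' where cd: "box c d \<inter> box a b = box c' d'" by (auto simp: box_Int_box)
        \<comment> \<open>Non-emptiness matters: only then is the closed box the closure of the open
          one, and hence contained in \<open>cbox a b\<close> as the hypothesis \<open>zero\<close>
          demands.\<close>
        with False have "cbox c' d' = closure (box c' d')" by simp
        also have "\<dots> \<subseteq> closure (box a b)" using cd by (intro closure_mono) auto
        also have "\<dots> \<subseteq> cbox a b" by (simp add: closure_minimal box_subset_cbox closed_cbox)
        finally show ?thesis using box0 cd A by simp
      qed (simp add: A)
    next
      case (compl A)
      have A: "A \<in> sets borel" using compl(1) unfolding borel_eq_box by simp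
      have "(\<lambda>x. g x * indicator ((UNIV - A) \<inter> box a b) x) =
          (\<lambda>x. g x * indicator (box a b) x - g x * indicator (A \<inter> box a b) x)"
        by (auto split: split_indicator)
      then show ?case using A compl(2) box0[of a b] by (simp add: Bochner_Integration.integral_diff intgA)
    next
      case (union A)
      have A: "A i \<in> sets borel" for i using union(2) unfolding borel_eq_box by auto
      have "integral\<^sup>L M (\<lambda>x. g x * indicator ((\<Union>i. A i) \<inter> box a b) x)
          = (LINT x:(\<Union>i. A i \<inter> box a b)|M. g x)"
        by (simp add: set_lebesgue_integral_def mult.commute Int_UN_distrib2)
      also have "\<dots> = (\<Sum>i. LINT x:(A i \<inter> box a b)|M. g x)"
      proof (rule lebesgue_integral_countable_add)
        show "A i \<inter> box a b \<in> sets M" for i using A sets by auto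
        show "\<And>i j. i \<noteq> j \<Longrightarrow> (A i \<inter> box a b) \<inter> (A j \<inter> box a b) = {}"
          using union(1) by (auto simp: disjoint_family_on_def)
        show "set_integrable M (\<Union>i. A i \<inter> box a b) g"
          using intgA[of "\<Union>i. A i \<inter> box a b"] A by (simp add: set_integrable_def mult.commute)
      qed
      also have "\<dots> = 0" using union(3) by (simp add: set_lebesgue_integral_def mult.commute)
      finally show ?case .
    qed simp
  qed
  have "{x. g x > 0} \<in> sets borel" "{x. g x < 0} \<in> sets borel"
    using sets by (auto simp flip: sets)
  note pn = A0[OF this(1)] A0[OF this(2)] intgA[OF sets.Int[OF this(1) borel_open[OF open_box[of a b]]]]
     intgA[OF sets.Int[OF this(2) borel_open[OF open_box[of a b]]]]
  have "AE x in M. g x * indicator ({x. g x > 0} \<inter> box a b) x = 0"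
    using pn by (subst (asm) integral_nonneg_eq_0_iff_AE) (auto split: split_indicator)
  moreover have "AE x in M. - (g x * indicator ({x. g x < 0} \<inter> box a b) x) = 0"
    using pn by (subst integral_nonneg_eq_0_iff_AE[symmetric]) (auto split: split_indicator)
  ultimately show ?thesis
    by eventually_elim (auto split: split_indicator_asm)
qed

text \<open>The measure may be any one on the Borel sets, because this form is applied to the
  surface measure.\<close>

lemma orthogonal_test_functions:
  fixes g :: "real^3 \<Rightarrow> real"
  assumes "sets M = sets borel" "integrable M g" "open U"
    and "\<And>\<phi>. \<phi> \<in> test_functions U \<Longrightarrow> (LINT x|M. g x * \<phi> x) = 0"
  shows "AE x in M. x \<in> U \<longrightarrow> g x = 0"
proof (rule AE_local)
  fix x assume "x \<in> U"
  with \<open>open U\<close> obtain a b where ab: "x \<in> box a b" "cbox a b \<subseteq> U"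
    by (meson open_contains_cbox)
  have "AE x in M. x \<in> box a b \<longrightarrow> g x = 0"
    by (rule orthogonal_test_functions_box[OF assms(1,2)]) (use ab cutoff_test_function assms(4) in blast)
  with ab show "\<exists>V. open V \<and> x \<in> V \<and> (AE y in M. y \<in> V \<longrightarrow> g y = 0)"
    by (intro exI[of _ "box a b"]) (auto simp: open_box)
qed

section \<open>Integrals of derivatives of functions with bounded support\<close>

lemma bounded_support_bound:
  fixes f :: "'a::euclidean_space \<Rightarrow> real"
  assumes "continuous_on UNIV f" "\<And>x. R < norm x \<Longrightarrow> f x = 0"
  obtains M where "0 \<le> M" "\<And>x. \<bar>f x\<bar> \<le> M * indicator (cball 0 R) x"
proof -
  have "bounded (f ` cball 0 R)"
    by (intro compact_imp_bounded compact_continuous_image continuous_on_subset[OF assms(1)]) auto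
  then obtain M where M: "\<And>x. x \<in> cball 0 R \<Longrightarrow> \<bar>f x\<bar> \<le> M"
    unfolding bounded_iff by (metis imageI real_norm_def)
  show thesis
  proof (rule that[of "max M 0"])
    show "\<bar>f x\<bar> \<le> max M 0 * indicator (cball 0 R) x" for x
      using M[of x] assms(2)[of x] by (auto split: split_indicator simp: not_le)
  qed simp
qed

lemma integrable_bounded_support:
  fixes f :: "'a::euclidean_space \<Rightarrow> real"
  assumes "continuous_on UNIV f" "\<And>x. R < norm x \<Longrightarrow> f x = 0" "A \<in> sets borel"
  shows "integrable lborel (\<lambda>x. indicator A x * f x)"
proof -
  obtain M where M: "\<And>x. \<bar>f x\<bar> \<le> M * indicator (cball 0 R) x" using bounded_support_bound[OF assms(1,2)] by blast
  have [measurable]: "f \<in> borel_measurable borel" by (rule borel_measurable_continuous_onI[OF assms(1)])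
  have "emeasure lborel (cball 0 R :: 'a set) < \<infinity>" by (rule emeasure_lborel_cball_finite)
  then have "integrable lborel (\<lambda>x::'a. M * indicator (cball 0 R) x)"
    by (intro integrable_mult_right integrable_real_indicator) auto
  then show ?thesis
  proof (rule Bochner_Integration.integrable_bound)
    have "norm (indicator A x * f x) \<le> norm (M * indicator (cball 0 R) x)" for x
      using M[of x] by (auto split: split_indicator)
    then show "AE x in lborel. norm (indicator A x * f x) \<le> norm (M * indicator (cball 0 R) x)" by simp
  qed (use assms(3) in measurable)
qed

lemma LINT_translation:
  fixes f :: "'a::euclidean_space \<Rightarrow> real"
  assumes [measurable]: "f \<in> borel_measurable borel"
  shows "(LINT x|lborel. f (x + a)) = (LINT x|lborel. f x)"
  by (subst lborel_distr_plus[of a, symmetric], subst integral_distr) (auto simp: add.commute)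

lemma dir_deriv_eq_0_outside:
  assumes "smooth f" "\<And>x. R < norm x \<Longrightarrow> f x = 0" "R < norm x"
  shows "dir_deriv v f x = 0"
proof -
  have "open {x::real^3. R < norm x}" by (intro open_Collect_less continuous_intros)
  then have "(f has_derivative (\<lambda>h. 0)) (at x)"
    by (rule has_derivative_transform_within_open[OF has_derivative_const[of 0]]) (use assms in auto)
  from has_derivative_unique[OF this smooth_has_derivative_dir[OF assms(1)]] show ?thesis
    by metis
qed

text \<open>A is invariant under translation along v, so each difference quotient along v integrates
  to 0 over A; dominated convergence does the rest. With A the whole space this is integration by
  parts, with A a half-space and v parallel to its boundary it is the tangential part of Gauss's
  theorem.\<close>

lemma LINT_dir_deriv_eq_0:
  assumes f: "smooth f" and R: "\<And>x. R < norm x \<Longrightarrow> f x = 0" and A [measurable]: "A \<in> sets borel"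
    and inv: "\<And>x t. x + t *\<^sub>R v \<in> A \<longleftrightarrow> x \<in> A"
  shows "(LINT x|lborel. indicator A x * dir_deriv v f x) = 0"
proof (rule LIMSEQ_unique)
  let ?h = "\<lambda>n::nat. inverse (real (Suc n))"
  let ?q = "\<lambda>n x. indicator A x * ((f (x + ?h n *\<^sub>R v) - f x) / ?h n)"
  have [measurable]: "f \<in> borel_measurable borel" "dir_deriv v f \<in> borel_measurable borel"
    by (intro smooth_borel f smooth_dir_deriv)+
  obtain M where M: "0 \<le> M" "\<And>x. \<bar>dir_deriv v f x\<bar> \<le> M * indicator (cball 0 R) x"
    using bounded_support_bound[OF smooth_continuous[OF smooth_dir_deriv[OF f]], of R v] dir_deriv_eq_0_outside[of f R] f R by blast
  have bnd: "\<bar>f (x + t *\<^sub>R v) - f x\<bar> \<le> M * t" if t: "0 < t" for x t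
  proof -
    obtain z where "f (x + t *\<^sub>R v) - f (x + 0 *\<^sub>R v) = (t - 0) * dir_deriv v f (x + z *\<^sub>R v)"
      using MVT2[OF t, of "\<lambda>t. f (x + t *\<^sub>R v)" "\<lambda>t. dir_deriv v f (x + t *\<^sub>R v)"] smooth_line_derivative[OF f] by blast
    moreover have "\<bar>dir_deriv v f (x + z *\<^sub>R v)\<bar> \<le> M"
      using M(2)[of "x + z *\<^sub>R v"] M(1) by (auto split: split_indicator_asm)
    ultimately show ?thesis using t by (simp add: abs_mult mult.commute mult_left_mono)
  qed
  have intf: "integrable lborel (\<lambda>x. indicator A x * f x)"
    by (rule integrable_bounded_support[OF smooth_continuous[OF f] R A])
  have eq: "indicator A x * f (x + t *\<^sub>R v) = indicator A (x + t *\<^sub>R v) * f (x + t *\<^sub>R v)" for x t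
    using inv by (simp add: indicator_def)
  have inth: "integrable lborel (\<lambda>x. indicator A x * f (x + t *\<^sub>R v))" for t
    unfolding eq using intf by (subst (asm) lborel_distr_plus[of "t *\<^sub>R v", symmetric], subst (asm) integrable_distr_eq) (auto simp: add.commute)
  have q0: "(LINT x|lborel. ?q n x) = 0" for n
  proof -
    have "(LINT x|lborel. ?q n x) = (LINT x|lborel. (indicator A x * f (x + ?h n *\<^sub>R v) - indicator A x * f x) / ?h n)"
      by (intro Bochner_Integration.integral_cong) (auto simp: field_simps)
    also have "\<dots> = ((LINT x|lborel. indicator A x * f (x + ?h n *\<^sub>R v)) - (LINT x|lborel. indicator A x * f x)) / ?h n"
      by (simp only: integral_divide_zero Bochner_Integration.integral_diff[OF inth intf])
    also have "(LINT x|lborel. indicator A x * f (x + ?h n *\<^sub>R v)) = (LINT x|lborel. indicator A x * f x)"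
      unfolding eq by (rule LINT_translation) measurable
    finally show ?thesis by simp
  qed
  \<comment> \<open>The increments are at most 1, so every difference quotient vanishes outside the
    ball of this radius.\<close>
  let ?K = "R + norm v"
  show "(\<lambda>n. LINT x|lborel. ?q n x) \<longlonglongrightarrow> (LINT x|lborel. indicator A x * dir_deriv v f x)"
  proof (rule integral_dominated_convergence[where w="\<lambda>x. M * indicator (cball 0 ?K) x"])
    have "emeasure lborel (cball 0 ?K :: (real^3) set) < \<infinity>" by (rule emeasure_lborel_cball_finite)
    then show "integrable lborel (\<lambda>x::real^3. M * indicator (cball 0 ?K) x)"
      by (intro integrable_mult_right integrable_real_indicator) auto
    have "(\<lambda>n. (f (x + ?h n *\<^sub>R v) - f x) / ?h n) \<longlonglongrightarrow> dir_deriv v f x" for x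
    proof -
      have "((\<lambda>h. (f (x + (0 + h) *\<^sub>R v) - f (x + 0 *\<^sub>R v)) / h) \<longlongrightarrow> dir_deriv v f (x + 0 *\<^sub>R v)) (at 0)"
        using smooth_line_derivative[OF f, of x v 0 UNIV] unfolding DERIV_def by simp
      then have *: "((\<lambda>h. (f (x + h *\<^sub>R v) - f x) / h) \<longlongrightarrow> dir_deriv v f x) (at 0)" by simp
      have "filterlim ?h (at 0) sequentially"
        by (simp add: filterlim_at LIMSEQ_inverse_real_of_nat del: of_nat_Suc)
      from filterlim_compose[OF * this] show ?thesis .
    qed
    then show "AE x in lborel. (\<lambda>n. ?q n x) \<longlonglongrightarrow> indicator A x * dir_deriv v f x"
      by (intro always_eventually allI tendsto_intros)
    show "AE x in lborel. norm (?q n x) \<le> M * indicator (cball 0 ?K) x" for n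
    proof (intro always_eventually allI)
      fix x
      show "norm (?q n x) \<le> M * indicator (cball 0 ?K) x"
      proof (cases "x \<in> cball 0 ?K")
        case True
        have "\<bar>f (x + ?h n *\<^sub>R v) - f x\<bar> / ?h n \<le> M"
          using bnd[of "?h n" x] by (subst pos_divide_le_eq) auto
        then show ?thesis using True M(1) by (auto simp: abs_mult split: split_indicator)
      next
        case False
        have "norm (?h n *\<^sub>R v) \<le> norm v"
          by (simp add: mult_left_le_one_le inverse_le_1_iff)
        with norm_triangle_ineq4[of "x + ?h n *\<^sub>R v" "?h n *\<^sub>R v"] False
        have "R < norm (x + ?h n *\<^sub>R v)" "R < norm x" by (auto simp: not_le) (smt (verit) norm_ge_zero)
        then show ?thesis using R False by simp
      qed
    qed
  qed measurable
  show "(\<lambda>n. LINT x|lborel. ?q n x) \<longlonglongrightarrow> 0" using q0 by simp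
qed

section \<open>Lebesgue measure in coordinates adapted to a plane\<close>

lemma prod_Basis_vec:
  fixes f :: "real^'n \<Rightarrow> 'b::comm_monoid_mult"
  shows "(\<Prod>b\<in>Basis. f b) = (\<Prod>i\<in>UNIV. f (axis i (1::real)))"
proof -
  have "inj (\<lambda>i::'n. axis i (1::real))" by (simp add: inj_on_def axis_eq_axis)
  then show ?thesis
    unfolding Basis_vec_def by (simp add: UNION_singleton_eq_range prod.reindex)
qed

lemma emeasure_lborel_box_vec:
  fixes a b :: "real^'n"
  assumes "\<forall>i. a $ i \<le> b $ i"
  shows "emeasure lborel (box a b) = ennreal (\<Prod>i\<in>UNIV. b $ i - a $ i)"
proof -
  have "emeasure lborel (box a b) = (\<Prod>x\<in>Basis. (b - a) \<bullet> x)"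
    using assms by (intro emeasure_lborel_box) (auto simp: Basis_vec_def inner_axis)
  then show ?thesis by (simp only: prod_Basis_vec inner_axis) simp
qed

lemma borel_measurable_coordinates:
  "(\<lambda>(\<xi>::real^2, t). vector [\<xi> $ 1, \<xi> $ 2, t] :: real^3) \<in> borel_measurable (borel :: ((real^2) \<times> real) measure)"
proof (rule borel_measurable_continuous_onI)
  have "(\<lambda>(\<xi>::real^2, t). vector [\<xi> $ 1, \<xi> $ 2, t] :: real^3) =
      (\<lambda>x::(real^2) \<times> real. (fst x $ 1) *\<^sub>R axis 1 1 + (fst x $ 2) *\<^sub>R axis 2 1 + snd x *\<^sub>R axis 3 1)"
    by (auto simp: fun_eq_iff vec_eq_iff forall_3 axis_def)
  then show "continuous_on UNIV (\<lambda>(\<xi>::real^2, t). vector [\<xi> $ 1, \<xi> $ 2, t] :: real^3)"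
    by (auto intro!: continuous_intros)
qed

text \<open>Makes Fubini's theorem available for a plane and a normal direction. Preimages of boxes
  are products of boxes with the same volume, and Lebesgue measure is determined by its values on
  boxes.\<close>

lemma lborel_distr_coordinates:
  "distr (lborel :: ((real^2) \<times> real) measure) borel (\<lambda>(\<xi>::real^2, t). vector [\<xi> $ 1, \<xi> $ 2, t] :: real^3) = lborel"
proof (rule lborel_eqI[symmetric])
  let ?C = "\<lambda>(\<xi>::real^2, t::real). vector [\<xi> $ 1, \<xi> $ 2, t] :: real^3"
  note meas = borel_measurable_coordinates
  fix l u :: "real^3" assume le: "\<And>b. b \<in> Basis \<Longrightarrow> l \<bullet> b \<le> u \<bullet> b"
  then have le': "l $ i \<le> u $ i" for i using le[of "axis i 1"] by (simp add: inner_axis)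
  have "?C -` box l u = box (vector [l $ 1, l $ 2]) (vector [u $ 1, u $ 2]) \<times> box (l $ 3) (u $ 3)"
    by (auto simp: mem_box_cart forall_2 forall_3)
  then have "emeasure (distr (lborel :: ((real^2) \<times> real) measure) borel ?C) (box l u) =
      emeasure (lborel \<Otimes>\<^sub>M lborel) (box (vector [l $ 1, l $ 2]) (vector [u $ 1, u $ 2] :: real^2) \<times> box (l $ 3) (u $ 3))"
    using meas by (subst emeasure_distr) (auto simp: lborel_prod)
  also have "\<dots> = emeasure lborel (box (vector [l $ 1, l $ 2]) (vector [u $ 1, u $ 2] :: real^2)) * emeasure lborel (box (l $ 3) (u $ 3))"
    by (subst lborel.emeasure_pair_measure_Times) auto
  also have "emeasure lborel (box (vector [l $ 1, l $ 2]) (vector [u $ 1, u $ 2] :: real^2))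
      = ennreal ((u $ 1 - l $ 1) * (u $ 2 - l $ 2))"
  proof -
    have "\<forall>i. (vector [l $ 1, l $ 2] :: real^2) $ i \<le> vector [u $ 1, u $ 2] $ i"
      using le'[of 1] le'[of 2] by (simp add: forall_2)
    then show ?thesis by (simp add: emeasure_lborel_box_vec UNIV_2)
  qed
  also have "\<dots> * emeasure lborel (box (l $ 3) (u $ 3)) = ennreal (\<Prod>b\<in>Basis. (u - l) \<bullet> b)"
  proof -
    have "emeasure lborel (box (l $ 3) (u $ 3)) = ennreal (u $ 3 - l $ 3)" using le' by (simp add: box_real)
    moreover have "(\<Prod>b\<in>Basis. (u - l) \<bullet> b) = (u $ 1 - l $ 1) * (u $ 2 - l $ 2) * (u $ 3 - l $ 3)"
    proof -
      have "(\<Prod>b\<in>Basis. (u - l) \<bullet> b) = (\<Prod>i\<in>UNIV. u $ i - l $ i)"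
        by (simp only: prod_Basis_vec inner_axis) simp
      also have "\<dots> = (u $ 1 - l $ 1) * (u $ 2 - l $ 2) * (u $ 3 - l $ 3)"
        unfolding UNIV_3 by simp
      finally show ?thesis .
    qed
    ultimately show ?thesis using le' by (simp add: ennreal_mult)
  qed
  finally show "emeasure (distr (lborel :: ((real^2) \<times> real) measure) borel ?C) (box l u) = ennreal (\<Prod>b\<in>Basis. (u - l) \<bullet> b)" .
qed simp

text \<open>The preimage of a box is its image under the inverse, an orthogonal map whose
  determinant has modulus 1.\<close>

lemma lborel_distr_orthogonal:
  fixes L :: "real^3 \<Rightarrow> real^3"
  assumes L: "orthogonal_transformation L"
  shows "distr lborel borel L = lborel"
proof (rule lborel_eqI[symmetric])
  have lin: "linear L" using L by (simp add: orthogonal_transformation_def)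
  have [measurable]: "L \<in> borel_measurable borel"
    by (intro borel_measurable_continuous_onI linear_continuous_on linear_conv_bounded_linear[THEN iffD1] lin)
  fix l u :: "real^3" assume le: "\<And>b. b \<in> Basis \<Longrightarrow> l \<bullet> b \<le> u \<bullet> b"
  have inv: "orthogonal_transformation (inv L)" using L by (rule orthogonal_transformation_inv)
  then have lin': "linear (inv L)" by (simp add: orthogonal_transformation_def)
  have "bij L" using L by (rule orthogonal_transformation_bij)
  then have eq: "L -` box l u = inv L ` box l u" by (rule bij_vimage_eq_inv_image)
  have "emeasure (distr lborel borel L) (box l u) = emeasure lborel (L -` box l u)"
    by (subst emeasure_distr) auto
  also have "\<dots> = emeasure lebesgue (inv L ` box l u)"
    using measurable_sets_borel[of L borel "box l u"] eq by simp
  also have "\<dots> = emeasure lebesgue (box l u)"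
    using measurable_linear_image[OF lin', of "box l u"] measure_linear_image[OF lin', of "box l u"]
      orthogonal_transformation_det[OF inv]
    by (simp add: emeasure_eq_measure2 lmeasurable_box)
  also have "\<dots> = ennreal (\<Prod>b\<in>Basis. (u - l) \<bullet> b)" using le by simp
  finally show "emeasure (distr lborel borel L) (box l u) = ennreal (\<Prod>b\<in>Basis. (u - l) \<bullet> b)" .
qed simp

text \<open>\<open>facet_chart\<close> is a choice among isometric parametrisations, so nothing more
  than isometry is assumed of the chart. That it is affine is derived in
  \<open>chart_affine\<close>.\<close>

locale plane_chart =
  fixes \<psi> :: "real^2 \<Rightarrow> real^3" and \<nu> :: "real^3"
  assumes isometric: "dist (\<psi> \<xi>) (\<psi> \<eta>) = dist \<xi> \<eta>"
    and unit_normal: "norm \<nu> = 1"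
    and normal: "\<nu> \<bullet> (\<psi> \<xi> - \<psi> \<eta>) = 0"
begin

lemma continuous_chart: "continuous_on S \<psi>"
  using isometric by (auto simp: continuous_on_iff)

lemma borel_chart [measurable]: "\<psi> \<in> borel_measurable borel"
  by (rule borel_measurable_continuous_onI[OF continuous_chart])

text \<open>An isometry of space that fixes the origin, carries the first two coordinate axes into
  the directions of the plane and the third onto the normal. As such it is orthogonal, hence linear,
  and this is how the affinity of the chart is obtained.\<close>

definition straighten :: "real^3 \<Rightarrow> real^3" where
  "straighten z = \<psi> (vector [z $ 1, z $ 2]) - \<psi> 0 + z $ 3 *\<^sub>R \<nu>"

lemma orthogonal_straighten: "orthogonal_transformation straighten"
  unfolding orthogonal_transformation_isometry
proof (intro conjI allI)
  have "vector [0, 0] = (0 :: real^2)" by (simp add: vec_eq_iff forall_2)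
  then show "straighten 0 = 0" by (simp add: straighten_def)
  fix x y :: "real^3"
  define a where "a = \<psi> (vector [x $ 1, x $ 2]) - \<psi> (vector [y $ 1, y $ 2])"
  have an: "\<nu> \<bullet> \<nu> = 1" "\<nu> \<bullet> a = 0" "a \<bullet> \<nu> = 0"
    using unit_normal normal unfolding a_def by (simp_all add: norm_eq_1 inner_commute)
  have "straighten x - straighten y = a + (x $ 3 - y $ 3) *\<^sub>R \<nu>"
    by (simp add: straighten_def a_def algebra_simps)
  then have "(dist (straighten x) (straighten y))\<^sup>2 = a \<bullet> a + (x $ 3 - y $ 3)\<^sup>2"
    unfolding dist_norm power2_norm_eq_inner
    by (simp add: inner_add_left inner_add_right an power2_eq_square)
  also have "a \<bullet> a = (dist (vector [x $ 1, x $ 2]) (vector [y $ 1, y $ 2] :: real^2))\<^sup>2"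
    unfolding a_def isometric[symmetric] dist_norm power2_norm_eq_inner by (rule refl)
  also have "\<dots> + (x $ 3 - y $ 3)\<^sup>2 = (dist x y)\<^sup>2"
    unfolding dist_norm power2_norm_eq_inner by (simp add: inner_vec_def sum_2 sum_3 power2_eq_square)
  finally show "dist (straighten x) (straighten y) = dist x y"
    by (metis power2_eq_iff_nonneg zero_le_dist)
qed

lemma straighten_coordinates: "\<psi> 0 + straighten (vector [\<xi> $ 1, \<xi> $ 2, t]) = \<psi> \<xi> + t *\<^sub>R \<nu>"
proof -
  have "vector [\<xi> $ 1, \<xi> $ 2] = \<xi>" by (simp add: vec_eq_iff forall_2)
  then show ?thesis by (simp add: straighten_def)
qed

lemma chart_affine: "\<psi> ((1 - s) *\<^sub>R \<xi> + s *\<^sub>R \<omega>) = (1 - s) *\<^sub>R \<psi> \<xi> + s *\<^sub>R \<psi> \<omega>"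
proof -
  have lin: "linear straighten" using orthogonal_straighten by (simp add: orthogonal_transformation_def)
  have *: "\<psi> \<xi> = \<psi> 0 + straighten (vector [\<xi> $ 1, \<xi> $ 2, 0])" for \<xi>
    using straighten_coordinates[of \<xi> 0] by simp
  let ?x = "(1 - s) *\<^sub>R \<xi> + s *\<^sub>R \<omega>"
  have "(vector [?x $ 1, ?x $ 2, 0] :: real^3)
      = (1 - s) *\<^sub>R vector [\<xi> $ 1, \<xi> $ 2, 0] + s *\<^sub>R vector [\<omega> $ 1, \<omega> $ 2, 0]"
    by (simp add: vec_eq_iff forall_3)
  then have "straighten (vector [?x $ 1, ?x $ 2, 0])
      = (1 - s) *\<^sub>R straighten (vector [\<xi> $ 1, \<xi> $ 2, 0]) + s *\<^sub>R straighten (vector [\<omega> $ 1, \<omega> $ 2, 0])"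
    by (simp only: linear_add[OF lin] linear_scale[OF lin])
  with *[of ?x] *[of \<xi>] *[of \<omega>] show ?thesis
    by (simp only:) (simp add: algebra_simps)
qed

lemma distr_chart: "distr (lborel \<Otimes>\<^sub>M lborel) borel (\<lambda>(\<xi>, t). \<psi> \<xi> + t *\<^sub>R \<nu>) = lborel"
proof -
  have lin: "linear straighten" using orthogonal_straighten by (simp add: orthogonal_transformation_def)
  have [measurable]: "straighten \<in> borel_measurable borel"
    by (intro borel_measurable_continuous_onI linear_continuous_on linear_conv_bounded_linear[THEN iffD1] lin)
  note borel_measurable_coordinates [measurable]
  have "distr (lborel :: ((real^2) \<times> real) measure) borel (\<lambda>(\<xi>, t). \<psi> \<xi> + t *\<^sub>R \<nu>)
      = distr (distr (distr lborel borel (\<lambda>(\<xi>::real^2, t). vector [\<xi> $ 1, \<xi> $ 2, t])) borel straighten) borel ((+) (\<psi> 0))"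
  proof -
    have [measurable]: "(\<lambda>p. vector [fst p $ 1, fst p $ 2, snd p] :: real^3) \<in> borel_measurable (borel :: ((real^2) \<times> real) measure)"
      using borel_measurable_coordinates by (simp add: case_prod_unfold)
    show ?thesis
      by (simp add: distr_distr comp_def case_prod_unfold straighten_coordinates)
  qed
  then show ?thesis
    by (simp add: lborel_prod lborel_distr_coordinates lborel_distr_orthogonal[OF orthogonal_straighten] lborel_distr_plus)
qed

lemma borel_chart_normal [measurable]: "(\<lambda>(\<xi>, t). \<psi> \<xi> + t *\<^sub>R \<nu>) \<in> borel_measurable (lborel \<Otimes>\<^sub>M lborel)"
  by measurable

lemma nn_integral_chart:
  assumes [measurable]: "h \<in> borel_measurable borel"
  shows "(\<integral>\<^sup>+x. h x \<partial>lborel) = (\<integral>\<^sup>+\<xi>. \<integral>\<^sup>+t. h (\<psi> \<xi> + t *\<^sub>R \<nu>) \<partial>lborel \<partial>lborel)"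
  by (subst distr_chart[symmetric], subst nn_integral_distr, measurable)
    (simp add: lborel.nn_integral_fst[symmetric])

lemma integral_chart:
  fixes h :: "real^3 \<Rightarrow> real"
  assumes "integrable lborel h"
  shows "(LINT x|lborel. h x) = (LINT \<xi>|lborel. LINT t|lborel. h (\<psi> \<xi> + t *\<^sub>R \<nu>))"
proof -
  have [measurable]: "h \<in> borel_measurable borel" using assms by auto
  have "integrable (lborel \<Otimes>\<^sub>M lborel) (\<lambda>(\<xi>, t). h (\<psi> \<xi> + t *\<^sub>R \<nu>))"
    using assms by (subst (asm) distr_chart[symmetric], subst (asm) integrable_distr_eq) (auto simp: case_prod_unfold)
  from lborel_pair.integral_fst'[OF this] show ?thesis
    by (subst distr_chart[symmetric], subst integral_distr) (auto simp: case_prod_unfold)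
qed

text \<open>Fubini along the chart reduces it to the fundamental theorem of calculus on each normal
  line, from a point beyond the support up to the plane. The half-space lies on the negative side of
  \<nu>, so \<nu> is its outer normal and no sign appears.\<close>

lemma halfspace_gauss_normal:
  assumes f: "smooth f" and R: "\<And>x. R < norm x \<Longrightarrow> f x = 0"
  shows "(LINT x|lborel. indicator {x. \<nu> \<bullet> (x - \<psi> 0) < 0} x * dir_deriv \<nu> f x) = (LINT \<xi>|lborel. f (\<psi> \<xi>))"
proof -
  let ?H = "{x. \<nu> \<bullet> (x - \<psi> 0) < 0}"
  have "open ?H" by (intro open_Collect_less continuous_intros)
  then have "integrable lborel (\<lambda>x. indicator ?H x * dir_deriv \<nu> f x)"
    by (intro integrable_bounded_support[of _ R] smooth_continuous smooth_dir_deriv f dir_deriv_eq_0_outside[OF f R]) auto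
  then have "(LINT x|lborel. indicator ?H x * dir_deriv \<nu> f x)
      = (LINT \<xi>|lborel. LINT t|lborel. indicator ?H (\<psi> \<xi> + t *\<^sub>R \<nu>) * dir_deriv \<nu> f (\<psi> \<xi> + t *\<^sub>R \<nu>))"
    by (rule integral_chart)
  also have "\<dots> = (LINT \<xi>|lborel. f (\<psi> \<xi>))"
  proof (intro Bochner_Integration.integral_cong refl)
    fix \<xi>
    have nn: "\<nu> \<bullet> \<nu> = 1" using unit_normal by (simp add: norm_eq_1)
    have H: "\<psi> \<xi> + t *\<^sub>R \<nu> \<in> ?H \<longleftrightarrow> t < 0" for t
    proof -
      have "\<psi> \<xi> + t *\<^sub>R \<nu> - \<psi> 0 = (\<psi> \<xi> - \<psi> 0) + t *\<^sub>R \<nu>" by simp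
      then have "\<nu> \<bullet> (\<psi> \<xi> + t *\<^sub>R \<nu> - \<psi> 0) = t"
        using normal[of \<xi> 0] nn by (simp only: inner_add_right inner_scaleR_right mult_1_right add_0)
      then show ?thesis by simp
    qed
    \<comment> \<open>For parameters up to -K the normal line has left the ball that contains the
      support.\<close>
    define K where "K = \<bar>R\<bar> + norm (\<psi> \<xi>) + 1"
    have "K > 0" by (simp add: K_def add_nonneg_pos)
    have out: "R < norm (\<psi> \<xi> + t *\<^sub>R \<nu>)" if "t \<le> - K" for t
      using norm_triangle_ineq4[of "\<psi> \<xi> + t *\<^sub>R \<nu>" "\<psi> \<xi>"] that unit_normal by (simp add: K_def)
    have "(LINT t|lborel. indicator ?H (\<psi> \<xi> + t *\<^sub>R \<nu>) * dir_deriv \<nu> f (\<psi> \<xi> + t *\<^sub>R \<nu>))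
        = (LINT t|lborel. indicator {-K..0} t *\<^sub>R dir_deriv \<nu> f (\<psi> \<xi> + t *\<^sub>R \<nu>))"
    proof (rule integral_cong_AE)
      have [measurable]: "dir_deriv \<nu> f \<in> borel_measurable borel" "?H \<in> sets borel"
        using \<open>open ?H\<close> by (auto intro!: smooth_borel smooth_dir_deriv f)
      show "(\<lambda>t. indicat_real ?H (\<psi> \<xi> + t *\<^sub>R \<nu>) * dir_deriv \<nu> f (\<psi> \<xi> + t *\<^sub>R \<nu>)) \<in> borel_measurable lborel"
        "(\<lambda>t. indicat_real {-K..0} t *\<^sub>R dir_deriv \<nu> f (\<psi> \<xi> + t *\<^sub>R \<nu>)) \<in> borel_measurable lborel"
        by measurable
      have "AE t in lborel. t \<noteq> (0::real)" by (rule AE_lborel_singleton)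
      then show "AE t in lborel. indicat_real ?H (\<psi> \<xi> + t *\<^sub>R \<nu>) * dir_deriv \<nu> f (\<psi> \<xi> + t *\<^sub>R \<nu>)
          = indicat_real {-K..0} t *\<^sub>R dir_deriv \<nu> f (\<psi> \<xi> + t *\<^sub>R \<nu>)"
      proof eventually_elim
        case (elim t)
        show ?case
        proof (cases "t \<le> - K")
          case True
          with dir_deriv_eq_0_outside[OF f R out] show ?thesis by simp
        next
          case False
          with elim show ?thesis unfolding indicator_def H by auto
        qed
      qed
    qed
    also have "\<dots> = f (\<psi> \<xi> + 0 *\<^sub>R \<nu>) - f (\<psi> \<xi> + (-K) *\<^sub>R \<nu>)"
    proof (rule integral_FTC_Icc)
      have "continuous_on UNIV (dir_deriv \<nu> f)" by (intro smooth_continuous smooth_dir_deriv f)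
      then show "continuous_on {-K..0} (\<lambda>t. dir_deriv \<nu> f (\<psi> \<xi> + t *\<^sub>R \<nu>))"
        by (rule continuous_on_compose2) (auto intro!: continuous_intros)
    qed (use \<open>K > 0\<close> smooth_line_derivative[OF f] in \<open>auto simp: has_real_derivative_iff_has_vector_derivative[symmetric]\<close>)
    also have "f (\<psi> \<xi> + (-K) *\<^sub>R \<nu>) = 0" by (intro R out) simp
    finally show "(LINT t|lborel. indicator ?H (\<psi> \<xi> + t *\<^sub>R \<nu>) * dir_deriv \<nu> f (\<psi> \<xi> + t *\<^sub>R \<nu>)) = f (\<psi> \<xi>)" by simp
  qed
  finally show ?thesis .
qed

text \<open>A half-space is invariant under translations parallel to its boundary plane.\<close>

lemma halfspace_gauss_tangential:
  assumes f: "smooth f" and R: "\<And>x. R < norm x \<Longrightarrow> f x = 0" and "\<tau> \<bullet> \<nu> = 0"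
  shows "(LINT x|lborel. indicator {x. \<nu> \<bullet> (x - \<psi> 0) < 0} x * dir_deriv \<tau> f x) = 0"
proof (rule LINT_dir_deriv_eq_0[OF f R])
  show "{x. \<nu> \<bullet> (x - \<psi> 0) < 0} \<in> sets borel"
    by (intro borel_open open_Collect_less continuous_intros)
  show "x + t *\<^sub>R \<tau> \<in> {x. \<nu> \<bullet> (x - \<psi> 0) < 0} \<longleftrightarrow> x \<in> {x. \<nu> \<bullet> (x - \<psi> 0) < 0}" for x t
    using assms(3) by (simp add: inner_diff_right inner_add_right inner_commute)
qed

end

section \<open>Hardy inequality\<close>

lemma nn_integral_affine:
  fixes a :: "'a::euclidean_space"
  assumes [measurable]: "h \<in> borel_measurable borel" and c: "c \<noteq> 0"
  shows "(\<integral>\<^sup>+x. h x \<partial>lborel) = ennreal (\<bar>c\<bar> ^ DIM('a)) * (\<integral>\<^sup>+x. h (a + c *\<^sub>R x) \<partial>lborel)"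
  by (subst lborel_affine[OF c, of a])
     (simp add: nn_integral_density nn_integral_distr nn_integral_cmult)

lemma nn_integral_translation:
  fixes a :: "'a::euclidean_space"
  assumes [measurable]: "h \<in> borel_measurable borel"
  shows "(\<integral>\<^sup>+x. h (x + a) \<partial>lborel) = (\<integral>\<^sup>+x. h x \<partial>lborel)"
  using nn_integral_affine[of h 1 a] by (simp add: add.commute)

text \<open>The sum is at most the number of terms times the largest one. Convexity is avoided, so
  the bound covers all p > 0.\<close>

lemma sum_powr_le:
  fixes a :: "'a \<Rightarrow> real"
  assumes "finite A" "0 < p" "\<And>i. i \<in> A \<Longrightarrow> 0 \<le> a i"
  shows "(\<Sum>i\<in>A. a i) powr p \<le> real (card A) powr p * (\<Sum>i\<in>A. a i powr p)"
proof (cases "A = {}")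
  case False
  let ?m = "Max (a ` A)"
  have m: "?m \<in> a ` A" using assms False by (intro Max_in) auto
  then obtain j where j: "j \<in> A" "?m = a j" by auto
  have "(\<Sum>i\<in>A. a i) \<le> real (card A) * a j"
    using assms(1) j by (intro sum_bounded_above) (metis Max_ge finite_imageI imageI)
  then have "(\<Sum>i\<in>A. a i) powr p \<le> (real (card A) * a j) powr p"
    using assms by (intro powr_mono2 sum_nonneg) auto
  also have "\<dots> = real (card A) powr p * a j powr p"
    using assms j by (simp add: powr_mult)
  also have "a j powr p \<le> (\<Sum>i\<in>A. a i powr p)"
    using j assms by (intro member_le_sum) auto
  finally show ?thesis by (simp add: mult_left_mono)
qed simp

lemma abs_add_powr_le:
  fixes a b :: real
  assumes "0 < p"
  shows "\<bar>a + b\<bar> powr p \<le> 2 powr p * (\<bar>a\<bar> powr p + \<bar>b\<bar> powr p)"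
proof -
  have "\<bar>a + b\<bar> powr p \<le> (\<bar>a\<bar> + \<bar>b\<bar>) powr p" using assms by (intro powr_mono2) auto
  also have "\<dots> \<le> 2 powr p * (\<bar>a\<bar> powr p + \<bar>b\<bar> powr p)"
    using sum_powr_le[of "UNIV :: bool set" p "\<lambda>b'. if b' then \<bar>a\<bar> else \<bar>b\<bar>"] assms
    by (auto simp: UNIV_bool add.commute)
  finally show ?thesis .
qed

section \<open>The one-dimensional Hardy inequality\<close>

lemma DERIV_abs_powr:
  fixes p :: real
  assumes p: "1 < p"
  shows "((\<lambda>y. \<bar>y\<bar> powr p) has_real_derivative p * \<bar>y\<bar> powr (p - 1) * sgn y) (at y)"
proof -
  consider "y > 0" | "y < 0" | "y = 0" by linarith
  then show ?thesis
  proof cases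
    case 1
    have "((\<lambda>y. y powr p) has_real_derivative p * y powr (p - 1)) (at y)"
      using 1 by (auto intro!: derivative_eq_intros)
    then have "((\<lambda>y. \<bar>y\<bar> powr p) has_real_derivative p * y powr (p - 1)) (at y)"
      by (rule has_field_derivative_transform_within_open[where S="{0<..}"]) (use 1 in auto)
    then show ?thesis using 1 by simp
  next
    case 2
    have "((\<lambda>y. (- y) powr p) has_real_derivative p * (- y) powr (p - 1) * (-1)) (at y)"
      using 2 by (auto intro!: derivative_eq_intros)
    then have "((\<lambda>y. \<bar>y\<bar> powr p) has_real_derivative p * (- y) powr (p - 1) * (-1)) (at y)"
      by (rule has_field_derivative_transform_within_open[where S="{..<0}"]) (use 2 in auto)
    then show ?thesis using 2 by simp
  next
    case 3
    have "((\<lambda>h. (\<bar>0 + h\<bar> powr p - \<bar>0\<bar> powr p) / h) \<longlongrightarrow> 0) (at 0)"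
    proof (rule Lim_null_comparison)
      have "norm ((\<bar>0 + h\<bar> powr p - \<bar>0\<bar> powr p) / h) \<le> \<bar>h\<bar> powr (p - 1)" if "h \<noteq> 0" for h :: real
        using that by (simp add: powr_diff)
      then show "\<forall>\<^sub>F h in at 0. norm ((\<bar>0 + h\<bar> powr p - \<bar>0\<bar> powr p) / h) \<le> \<bar>h\<bar> powr (p - 1)"
        by (auto simp: eventually_at_filter)
      have "((\<lambda>h::real. \<bar>h\<bar> powr (p - 1)) \<longlongrightarrow> \<bar>0\<bar> powr (p - 1)) (at 0)"
        using p by (intro tendsto_intros) auto
      then show "((\<lambda>h::real. \<bar>h\<bar> powr (p - 1)) \<longlongrightarrow> 0) (at 0)" by simp
    qed
    then show ?thesis using 3 by (simp add: DERIV_def)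
  qed
qed

text \<open>The constant is chosen so that the first term carries the coefficient (p - 1) / 2, which
  the applications can absorb. With k = (p - 1) / (2 p), the case b \<le> k a is paid for by the
  first term and the case b > k a by the second.\<close>

lemma powr_young:
  fixes a b p :: real
  assumes "1 < p" "0 \<le> a" "0 \<le> b"
  shows "p * a powr (p - 1) * b \<le> (p - 1) / 2 * a powr p + p * ((p - 1) / (2 * p)) powr (1 - p) * b powr p"
proof -
  define k where "k = (p - 1) / (2 * p)"
  have k: "k > 0" using assms by (simp add: k_def)
  have pw: "x powr (p - 1) * x = x powr p" if "0 \<le> x" for x :: real
    using that assms powr_mult_base[of x "p - 1"] by (simp add: mult.commute)
  show ?thesis
  proof (cases "b \<le> k * a")
    case True
    have "p * a powr (p - 1) * b \<le> p * a powr (p - 1) * (k * a)"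
      using True assms by (intro mult_left_mono) auto
    also have "\<dots> = (p - 1) / 2 * (a powr (p - 1) * a)" using assms by (simp add: k_def field_simps)
    also have "\<dots> \<le> (p - 1) / 2 * a powr p + p * k powr (1 - p) * b powr p"
      using assms by (simp add: pw)
    finally show ?thesis unfolding k_def .
  next
    case False
    then have "a * k \<le> b" by (simp only: not_le mult.commute[of a] less_imp_le)
    then have "a \<le> b / k" by (subst pos_le_divide_eq[OF k])
    then have "a powr (p - 1) \<le> (b / k) powr (p - 1)" using assms by (intro powr_mono2) auto
    also have "\<dots> = k powr (1 - p) * b powr (p - 1)"
      using assms k powr_minus_divide[of k "p - 1"] by (simp add: powr_divide)
    finally have "p * a powr (p - 1) * b \<le> p * (k powr (1 - p) * b powr (p - 1)) * b"
      using assms by (intro mult_right_mono mult_left_mono) auto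
    also have "\<dots> = p * k powr (1 - p) * b powr p" using pw[OF assms(3)] by (simp add: mult.assoc)
    also have "\<dots> \<le> (p - 1) / 2 * a powr p + \<dots>" using assms by simp
    finally show ?thesis unfolding k_def .
  qed
qed

lemma continuous_on_powr_const:
  fixes f :: "'a::topological_space \<Rightarrow> real"
  assumes "continuous_on S f" "\<And>x. x \<in> S \<Longrightarrow> 0 \<le> f x" "0 < p"
  shows "continuous_on S (\<lambda>x. f x powr p)"
  using assms by (intro continuous_on_powr') auto

lemma continuous_on_abs_powr_sgn:
  assumes "0 < q"
  shows "continuous_on UNIV (\<lambda>y::real. \<bar>y\<bar> powr q * sgn y)"
proof -
  let ?f = "\<lambda>y::real. if y \<ge> 0 then y powr q else - ((- y) powr q)"
  have "continuous_on {0..} (\<lambda>y::real. y powr q)"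
    by (rule continuous_on_powr_const) (use assms in \<open>auto intro!: continuous_intros\<close>)
  moreover have "continuous_on {..0} (\<lambda>y::real. - ((- y) powr q))"
    by (rule continuous_on_minus, rule continuous_on_powr_const) (use assms in \<open>auto intro!: continuous_intros\<close>)
  ultimately have "continuous_on ({0..} \<union> {..0}) ?f"
    by (intro continuous_on_If) auto
  moreover have "{0..} \<union> {..0} = (UNIV :: real set)" by auto
  moreover have "?f = (\<lambda>y. \<bar>y\<bar> powr q * sgn y)" by (auto simp: fun_eq_iff sgn_if)
  ultimately show ?thesis by (simp only:)
qed

text \<open>The constant of \<open>powr_young\<close> divided by the coefficient (p - 1) / 2 that
  remains after absorption.\<close>

definition hardy_const :: "real \<Rightarrow> real" where
  "hardy_const p = p * ((p - 1) / (2 * p)) powr (1 - p) * 2 / (p - 1)"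

lemma hardy_const_pos: "1 < p \<Longrightarrow> 0 < hardy_const p"
  by (simp add: hardy_const_def)

text \<open>
  Integrating the derivative of \<open>|u|\<^sup>p s\<^sup>1\<^sup>-\<^sup>p\<close> and absorbing by Young's inequality gives Hardy's
  inequality away from the origin, with an error term that vanishes in the limit.
\<close>

lemma hardy_away_from_0:
  fixes u u' :: "real \<Rightarrow> real"
  assumes p: "1 < p" and \<epsilon>: "0 < \<epsilon>" "\<epsilon> \<le> \<Lambda>"
    and der: "\<And>s. (u has_real_derivative u' s) (at s)" and cont: "continuous_on UNIV u'"
    and M: "\<And>s. s \<in> {0..\<Lambda>} \<Longrightarrow> \<bar>u s\<bar> \<le> M * s"
  shows "(\<integral>\<^sup>+s. ennreal ((\<bar>u s\<bar> / s) powr p) * indicator {\<epsilon>..\<Lambda>} s \<partial>lborel)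
    \<le> ennreal (hardy_const p) * (\<integral>\<^sup>+s. ennreal (\<bar>u' s\<bar> powr p) * indicator {0..\<Lambda>} s \<partial>lborel)
      + ennreal (2 / (p - 1) * M powr p * \<epsilon>)"
proof -
  define K where "K = p * ((p - 1) / (2 * p)) powr (1 - p)"
  let ?a = "\<lambda>s. (\<bar>u s\<bar> / s) powr p"
  let ?b = "\<lambda>s. \<bar>u' s\<bar> powr p"
  let ?H = "\<lambda>s. \<bar>u s\<bar> powr p * s powr (1 - p)"
  define H' where "H' s = \<bar>u s\<bar> powr p * ((1 - p) * s powr (1 - p - 1)) + p * \<bar>u s\<bar> powr (p - 1) * sgn (u s) * u' s * s powr (1 - p)" for s
  have "0 \<le> M * \<epsilon>" using M[of \<epsilon>] \<epsilon> by simp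
  then have M0: "0 \<le> M" using \<epsilon> by (simp add: zero_le_mult_iff)
  have contu: "continuous_on UNIV u" using der by (meson DERIV_isCont continuous_at_imp_continuous_on)
  have H: "(?H has_real_derivative H' s) (at s)" if "0 < s" for s
  proof -
    have "((\<lambda>s. \<bar>u s\<bar> powr p) has_real_derivative p * \<bar>u s\<bar> powr (p - 1) * sgn (u s) * u' s) (at s)"
      by (rule DERIV_chain2[OF DERIV_abs_powr[OF p] der])
    moreover have "((\<lambda>s. s powr (1 - p)) has_real_derivative (1 - p) * s powr (1 - p - 1)) (at s)"
      using that by (auto intro!: derivative_eq_intros)
    ultimately show ?thesis unfolding H'_def by (rule DERIV_mult')
  qed
  \<comment> \<open>Differentiating the weight contributes -(p - 1) times the Hardy integrand;
    Young's inequality for the other term gives back only half of it.\<close>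
  have ineq: "(p - 1) / 2 * ?a s \<le> K * ?b s - H' s" if "0 < s" for s
  proof -
    have a: "?a s = \<bar>u s\<bar> powr p * s powr (1 - p - 1)"
      using that by (simp add: powr_divide powr_minus_divide)
    have "(\<bar>u s\<bar> / s) powr (p - 1) = \<bar>u s\<bar> powr (p - 1) * s powr (1 - p)"
      using that powr_minus_divide[of s "p - 1"] by (simp add: powr_divide)
    moreover have "- (sgn (u s) * u' s) \<le> \<bar>u' s\<bar>" "sgn (u s) * u' s \<le> \<bar>u' s\<bar>" by (auto simp: sgn_if)
    ultimately have "p * \<bar>u s\<bar> powr (p - 1) * sgn (u s) * u' s * s powr (1 - p)
        \<le> p * (\<bar>u s\<bar> / s) powr (p - 1) * \<bar>u' s\<bar>"
      using mult_left_mono[of "sgn (u s) * u' s" "\<bar>u' s\<bar>" "p * (\<bar>u s\<bar> powr (p - 1) * s powr (1 - p))"] p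
      by (simp add: ac_simps)
    also have "\<dots> \<le> (p - 1) / 2 * ?a s + K * ?b s"
      using powr_young[OF p, of "\<bar>u s\<bar> / s" "\<bar>u' s\<bar>"] that by (simp add: K_def)
    finally have "H' s \<le> (1 - p) * ?a s + (p - 1) / 2 * ?a s + K * ?b s"
      unfolding H'_def a by (simp add: ac_simps)
    then show ?thesis by (simp add: field_simps)
  qed
  have cu: "continuous_on {\<epsilon>..\<Lambda>} u" and cu': "continuous_on {\<epsilon>..\<Lambda>} u'"
    using contu cont by (auto intro: continuous_on_subset)
  have ca: "continuous_on {\<epsilon>..\<Lambda>} ?a"
    by (rule continuous_on_powr_const) (use \<epsilon> p in \<open>auto intro!: continuous_intros cu\<close>)
  have cb: "continuous_on {\<epsilon>..\<Lambda>} ?b"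
    by (rule continuous_on_powr_const) (use \<epsilon> p in \<open>auto intro!: continuous_intros cu'\<close>)
  have cup: "continuous_on {\<epsilon>..\<Lambda>} (\<lambda>s. \<bar>u s\<bar> powr p)"
    by (rule continuous_on_powr_const) (use \<epsilon> p in \<open>auto intro!: continuous_intros cu\<close>)
  have cs: "continuous_on {\<epsilon>..\<Lambda>} (\<lambda>s. s powr r)" for r
    using \<epsilon> by (intro continuous_on_powr) (auto intro!: continuous_intros)
  have csg: "continuous_on {\<epsilon>..\<Lambda>} (\<lambda>s. \<bar>u s\<bar> powr (p - 1) * sgn (u s))"
    by (rule continuous_on_compose2[OF continuous_on_abs_powr_sgn cu]) (use p in auto)
  have cH: "continuous_on {\<epsilon>..\<Lambda>} H'"
    unfolding H'_def[abs_def] mult.assoc[symmetric, of "\<bar>_\<bar> powr (p - 1)"]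
    using continuous_on_add[OF continuous_on_mult[OF cup continuous_on_mult[OF continuous_on_const cs]]
        continuous_on_mult[OF continuous_on_mult[OF continuous_on_mult[OF continuous_on_const csg] cu'] cs]]
    by (simp only: mult.assoc)
  let ?I = "indicator {\<epsilon>..\<Lambda>} :: real \<Rightarrow> real"
  have intI: "integrable lborel (\<lambda>s. ?I s *\<^sub>R g s)" if "continuous_on {\<epsilon>..\<Lambda>} g" for g :: "real \<Rightarrow> real"
    using borel_integrable_compact[OF compact_Icc that] by simp
  have nnI: "(\<integral>\<^sup>+s. ennreal (g s) * indicator {\<epsilon>..\<Lambda>} s \<partial>lborel) = ennreal (LINT s|lborel. ?I s *\<^sub>R g s)"
    if "continuous_on {\<epsilon>..\<Lambda>} g" "\<And>s. 0 \<le> g s" for g :: "real \<Rightarrow> real"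
    by (subst nn_integral_eq_integral[symmetric, OF intI[OF that(1)]])
      (auto intro!: nn_integral_cong simp: that split: split_indicator)
  have FTC: "(LINT s|lborel. ?I s *\<^sub>R H' s) = ?H \<Lambda> - ?H \<epsilon>"
    by (rule integral_FTC_Icc[OF \<epsilon>(2) _ cH])
      (use H \<epsilon> in \<open>auto simp: has_real_derivative_iff_has_vector_derivative[symmetric] intro: has_field_derivative_at_within\<close>)
  have "(p - 1) / 2 * (LINT s|lborel. ?I s *\<^sub>R ?a s) = (LINT s|lborel. ?I s *\<^sub>R ((p - 1) / 2 * ?a s))"
    by (subst integral_mult_right_zero[symmetric]) (simp add: ac_simps)
  also have "\<dots> \<le> (LINT s|lborel. ?I s *\<^sub>R (K * ?b s - H' s))"
    by (intro integral_mono intI continuous_on_diff continuous_on_mult continuous_on_const ca cb cH) (use ineq \<epsilon> in \<open>auto split: split_indicator\<close>)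
  also have "\<dots> = (LINT s|lborel. K * (?I s *\<^sub>R ?b s) - ?I s *\<^sub>R H' s)"
    by (intro Bochner_Integration.integral_cong) (auto simp: algebra_simps)
  also have "\<dots> = K * (LINT s|lborel. ?I s *\<^sub>R ?b s) - (?H \<Lambda> - ?H \<epsilon>)"
    using Bochner_Integration.integral_diff[OF integrable_mult_right[OF intI[OF cb], of K] intI[OF cH]] FTC
    by (simp only: integral_mult_right_zero)
  \<comment> \<open>The boundary term at \<Lambda> has the favourable sign. At \<epsilon> the linear
    bound on u makes it at most (M \<epsilon>)^p \<epsilon>^(1-p), which is M^p \<epsilon>.\<close>
  also have "\<dots> \<le> K * (LINT s|lborel. ?I s *\<^sub>R ?b s) + M powr p * \<epsilon>"
  proof -
    have "\<bar>u \<epsilon>\<bar> powr p \<le> (M * \<epsilon>) powr p" using M[of \<epsilon>] \<epsilon> p by (intro powr_mono2) auto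
    then have "?H \<epsilon> \<le> (M powr p * \<epsilon> powr p) * \<epsilon> powr (1 - p)"
      using M0 \<epsilon> by (intro mult_right_mono) (auto simp: powr_mult)
    also have "\<dots> = M powr p * \<epsilon>" using \<epsilon> by (simp add: mult.assoc powr_add[symmetric])
    moreover have "0 \<le> ?H \<Lambda>" by simp
    ultimately show ?thesis by linarith
  qed
  finally have fin: "(p - 1) / 2 * (LINT s|lborel. ?I s *\<^sub>R ?a s) \<le> K * (LINT s|lborel. ?I s *\<^sub>R ?b s) + M powr p * \<epsilon>" .
  have "(LINT s|lborel. ?I s *\<^sub>R ?a s) = 2 / (p - 1) * ((p - 1) / 2 * (LINT s|lborel. ?I s *\<^sub>R ?a s))"
    using p by simp
  also have "\<dots> \<le> 2 / (p - 1) * (K * (LINT s|lborel. ?I s *\<^sub>R ?b s) + M powr p * \<epsilon>)"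
    using fin p by (intro mult_left_mono) auto
  also have "\<dots> = K * 2 / (p - 1) * (LINT s|lborel. ?I s *\<^sub>R ?b s) + 2 / (p - 1) * M powr p * \<epsilon>"
    by (simp add: distrib_left mult_ac)
  finally have *: "(LINT s|lborel. ?I s *\<^sub>R ?a s) \<le> hardy_const p * (LINT s|lborel. ?I s *\<^sub>R ?b s) + 2 / (p - 1) * M powr p * \<epsilon>"
    by (simp only: hardy_const_def K_def)
  have "(\<integral>\<^sup>+s. ennreal (?a s) * indicator {\<epsilon>..\<Lambda>} s \<partial>lborel)
      \<le> ennreal (hardy_const p * (LINT s|lborel. ?I s *\<^sub>R ?b s) + 2 / (p - 1) * M powr p * \<epsilon>)"
    using * by (subst nnI[OF ca]) (auto intro: ennreal_leI)
  also have "\<dots> = ennreal (hardy_const p) * ennreal (LINT s|lborel. ?I s *\<^sub>R ?b s) + ennreal (2 / (p - 1) * M powr p * \<epsilon>)"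
    using p \<epsilon> hardy_const_pos[OF p] by (subst ennreal_plus) (auto intro!: integral_nonneg_AE simp: ennreal_mult)
  also have "ennreal (LINT s|lborel. ?I s *\<^sub>R ?b s) \<le> (\<integral>\<^sup>+s. ennreal (?b s) * indicator {0..\<Lambda>} s \<partial>lborel)"
    using \<epsilon> by (subst nnI[OF cb, symmetric]) (auto intro!: nn_integral_mono split: split_indicator)
  finally show ?thesis by (simp add: mult_left_mono add_right_mono)
qed

lemma hardy:
  fixes u u' :: "real \<Rightarrow> real"
  assumes p: "1 < p" and \<Lambda>: "0 < \<Lambda>" and u0: "u 0 = 0"
    and der: "\<And>s. (u has_real_derivative u' s) (at s)" and cont: "continuous_on UNIV u'"
  shows "(\<integral>\<^sup>+s. ennreal ((\<bar>u s\<bar> / s) powr p) * indicator {0<..\<Lambda>} s \<partial>lborel)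
    \<le> ennreal (hardy_const p) * (\<integral>\<^sup>+s. ennreal (\<bar>u' s\<bar> powr p) * indicator {0..\<Lambda>} s \<partial>lborel)"
    (is "?L \<le> ?R")
proof -
  have "bounded (u' ` {0..\<Lambda>})"
    by (intro compact_imp_bounded compact_continuous_image continuous_on_subset[OF cont]) auto
  then obtain M where M: "\<And>s. s \<in> {0..\<Lambda>} \<Longrightarrow> \<bar>u' s\<bar> \<le> M" unfolding bounded_iff by (metis imageI real_norm_def)
  \<comment> \<open>As u vanishes at 0, a bound on the derivative becomes the linear bound that
    keeps the boundary error of order \<epsilon>.\<close>
  have uM: "\<bar>u s\<bar> \<le> M * s" if s: "s \<in> {0..\<Lambda>}" for s
  proof (cases "s = 0")
    case False
    then have "0 < s" using s by simp
    from MVT2[OF this der] obtain z where z: "0 < z" "z < s" "u s - u 0 = (s - 0) * u' z" by auto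
    then have "\<bar>u s\<bar> = s * \<bar>u' z\<bar>" using u0 s by (simp add: abs_mult)
    also have "\<dots> \<le> s * M" using z s M[of z] by (intro mult_left_mono) auto
    finally show ?thesis by (simp add: mult.commute)
  qed (simp add: u0)
  have [measurable]: "u \<in> borel_measurable borel"
    by (intro borel_measurable_continuous_onI) (meson der DERIV_isCont continuous_at_imp_continuous_on)
  let ?e = "\<lambda>n::nat. \<Lambda> * inverse (real (Suc n))"
  let ?f = "\<lambda>s. ennreal ((\<bar>u s\<bar> / s) powr p)"
  have e0: "?e \<longlonglongrightarrow> 0" using tendsto_mult_left[OF LIMSEQ_inverse_real_of_nat, of \<Lambda>] by simp
  have e: "0 < ?e n" "?e n \<le> \<Lambda>" for n
    using \<Lambda> by (auto simp: field_simps)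
  have "(\<lambda>n. \<integral>\<^sup>+s. ?f s * indicator {?e n..\<Lambda>} s \<partial>lborel) \<longlonglongrightarrow> ?L"
  proof (rule nn_integral_LIMSEQ)
    show "incseq (\<lambda>n s. ?f s * indicator {?e n..\<Lambda>} s)"
    proof (intro incseq_SucI le_funI mult_left_mono)
      fix n s
      have "?e (Suc n) \<le> ?e n" using \<Lambda> by (intro mult_left_mono le_imp_inverse_le) auto
      then show "(indicator {?e n..\<Lambda>} s :: ennreal) \<le> indicator {?e (Suc n)..\<Lambda>} s"
        by (auto split: split_indicator)
    qed simp
    fix s
    show "(\<lambda>n. ?f s * indicator {?e n..\<Lambda>} s) \<longlonglongrightarrow> ?f s * indicator {0<..\<Lambda>} s"
    proof (cases "0 < s \<and> s \<le> \<Lambda>")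
      case True
      then have "\<forall>\<^sub>F n in sequentially. ?e n < s" using order_tendstoD(2)[OF e0] by auto
      then have "\<forall>\<^sub>F n in sequentially. ?f s * indicator {?e n..\<Lambda>} s = ?f s * indicator {0<..\<Lambda>} s"
        by eventually_elim (use True in auto)
      then show ?thesis by (rule tendsto_eventually)
    next
      case False
      then have "indicator {?e n..\<Lambda>} s = (0::ennreal)" for n
        using e(1)[of n] by (auto simp: indicator_def not_le simp del: of_nat_Suc)
      with False show ?thesis by (auto simp del: of_nat_Suc)
    qed
  qed measurable
  moreover have "(\<lambda>n. ?R + ennreal (2 / (p - 1) * M powr p * ?e n)) \<longlonglongrightarrow> ?R + ennreal (2 / (p - 1) * M powr p * 0)"
    by (intro tendsto_add tendsto_const tendsto_ennrealI tendsto_mult_left e0)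
  ultimately have "?L \<le> ?R + ennreal (2 / (p - 1) * M powr p * 0)"
    by (rule LIMSEQ_le) (use hardy_away_from_0[OF p e der cont uM] in auto)
  then show ?thesis by simp
qed

section \<open>Cones over a plane\<close>

context plane_chart begin

text \<open>The pieces \<open>(1 - s)\<psi> + s w\<close> of a cone with apex \<open>w\<close> are scaled copies of the base plane.\<close>

lemma nn_integral_cone:
  assumes [measurable]: "G \<in> borel_measurable borel" and w: "w = \<psi> \<omega> + h *\<^sub>R \<nu>" and h: "h \<noteq> 0"
  shows "(\<integral>\<^sup>+\<xi>. \<integral>\<^sup>+s. G ((1 - s) *\<^sub>R \<psi> \<xi> + s *\<^sub>R w) * indicator {0..1/2} s \<partial>lborel \<partial>lborel)
    \<le> ennreal (4 / \<bar>h\<bar>) * (\<integral>\<^sup>+x. G x \<partial>lborel)"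
proof -
  have pt: "(1 - s) *\<^sub>R \<psi> \<xi> + s *\<^sub>R w = \<psi> (s *\<^sub>R \<omega> + (1 - s) *\<^sub>R \<xi>) + (s * h) *\<^sub>R \<nu>" for s \<xi>
    using chart_affine[of s \<xi> \<omega>] by (simp add: w algebra_simps)
  have scale: "(\<integral>\<^sup>+\<xi>. G (\<psi> (s *\<^sub>R \<omega> + (1 - s) *\<^sub>R \<xi>) + (s * h) *\<^sub>R \<nu>) * indicator {0..1/2} s \<partial>lborel)
      \<le> 4 * (\<integral>\<^sup>+\<xi>. G (\<psi> \<xi> + (s * h) *\<^sub>R \<nu>) \<partial>lborel)" for s
  proof (cases "s \<in> {0..1/2}")
    case True
    then have s: "1 - s \<noteq> 0" "1/2 \<le> 1 - s" by auto
    let ?J = "\<integral>\<^sup>+\<xi>. G (\<psi> (s *\<^sub>R \<omega> + (1 - s) *\<^sub>R \<xi>) + (s * h) *\<^sub>R \<nu>) \<partial>lborel"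
    \<comment> \<open>The base plane is scaled by 1 - s \<ge> 1/2, so the planar Jacobian is at
      least 1/4; this is why segments are followed only up to s = 1/2.\<close>
    have "(1/4 :: real) \<le> \<bar>1 - s\<bar>\<^sup>2" using power_mono[OF s(2), of 2] by (simp add: power2_eq_square)
    then have "ennreal 1 \<le> ennreal (4 * \<bar>1 - s\<bar>\<^sup>2)" by (intro ennreal_leI) simp
    then have "1 \<le> 4 * ennreal (\<bar>1 - s\<bar>\<^sup>2)" by (simp only: ennreal_1 ennreal_mult' ennreal_numeral)
    then have "1 * ?J \<le> 4 * ennreal (\<bar>1 - s\<bar>\<^sup>2) * ?J" by (rule mult_right_mono) simp
    also have "\<dots> = 4 * (\<integral>\<^sup>+\<xi>. G (\<psi> \<xi> + (s * h) *\<^sub>R \<nu>) \<partial>lborel)"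
      using nn_integral_affine[of "\<lambda>\<xi>. G (\<psi> \<xi> + (s * h) *\<^sub>R \<nu>)" "1 - s" "s *\<^sub>R \<omega>"] s(1)
      by (simp add: mult.assoc)
    finally show ?thesis using True by simp
  qed simp
  have "(\<integral>\<^sup>+\<xi>. \<integral>\<^sup>+s. G ((1 - s) *\<^sub>R \<psi> \<xi> + s *\<^sub>R w) * indicator {0..1/2} s \<partial>lborel \<partial>lborel)
      = (\<integral>\<^sup>+s. \<integral>\<^sup>+\<xi>. G (\<psi> (s *\<^sub>R \<omega> + (1 - s) *\<^sub>R \<xi>) + (s * h) *\<^sub>R \<nu>) * indicator {0..1/2} s \<partial>lborel \<partial>lborel)"
    unfolding pt by (rule lborel_pair.Fubini'[symmetric]) measurable
  also have "\<dots> \<le> (\<integral>\<^sup>+s. 4 * (\<integral>\<^sup>+\<xi>. G (\<psi> \<xi> + (s * h) *\<^sub>R \<nu>) \<partial>lborel) \<partial>lborel)"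
    by (intro nn_integral_mono scale)
  also have "\<dots> = 4 * (\<integral>\<^sup>+s. (\<integral>\<^sup>+\<xi>. G (\<psi> \<xi> + (s * h) *\<^sub>R \<nu>) \<partial>lborel) \<partial>lborel)"
    by (rule nn_integral_cmult) measurable
  \<comment> \<open>The substitution t = s h turns the parameter of the segment into the height over
    the plane.\<close>
  also have "(\<integral>\<^sup>+s. (\<integral>\<^sup>+\<xi>. G (\<psi> \<xi> + (s * h) *\<^sub>R \<nu>) \<partial>lborel) \<partial>lborel)
      = ennreal (1 / \<bar>h\<bar>) * (\<integral>\<^sup>+t. \<integral>\<^sup>+\<xi>. G (\<psi> \<xi> + t *\<^sub>R \<nu>) \<partial>lborel \<partial>lborel)"
    using nn_integral_real_affine[of "\<lambda>t. \<integral>\<^sup>+\<xi>. G (\<psi> \<xi> + t *\<^sub>R \<nu>) \<partial>lborel" h 0] h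
    by (simp add: mult.assoc[symmetric] ennreal_mult'[symmetric] mult.commute)
  also have "(\<integral>\<^sup>+t. \<integral>\<^sup>+\<xi>. G (\<psi> \<xi> + t *\<^sub>R \<nu>) \<partial>lborel \<partial>lborel) = (\<integral>\<^sup>+x. G x \<partial>lborel)"
    by (subst nn_integral_chart, measurable, rule lborel_pair.Fubini') measurable
  also have "4 * (ennreal (1 / \<bar>h\<bar>) * (\<integral>\<^sup>+x. G x \<partial>lborel)) = ennreal (4 / \<bar>h\<bar>) * (\<integral>\<^sup>+x. G x \<partial>lborel)"
    by (simp add: mult.assoc[symmetric] ennreal_mult'[symmetric] flip: ennreal_numeral)
  finally show ?thesis .
qed

end

section \<open>Polyhedral domains and their facets\<close>

locale polyhedral_domain =
  fixes \<Omega> :: "(real^3) set"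
  assumes domain: "convex_polyhedral_domain \<Omega>"
begin

abbreviation facets :: "(real^3) set set" where
  "facets \<equiv> {F. F facet_of closure \<Omega>}"

abbreviation \<sigma> :: "(real^3) measure" where
  "\<sigma> \<equiv> surface_measure \<Omega>"

lemma open_domain: "open \<Omega>" and convex_domain: "convex \<Omega>" and nonempty_domain: "\<Omega> \<noteq> {}"
  and polyhedron_closure: "polyhedron (closure \<Omega>)" and compact_closure: "compact (closure \<Omega>)"
  using domain polytope_imp_polyhedron polytope_imp_compact unfolding convex_polyhedral_domain_def by blast+

lemma bounded_domain: "bounded \<Omega>"
  using compact_closure compact_imp_bounded bounded_subset closure_subset by blast

lemma borel_domain [measurable]: "\<Omega> \<in> sets borel"
  using open_domain by simp

lemma finite_facets: "finite facets"
  by (rule finite_polyhedron_facets[OF polyhedron_closure])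

lemma interior_closure_domain: "interior (closure \<Omega>) = \<Omega>"
  by (simp add: convex_interior_closure convex_domain interior_open open_domain)

lemma frontier_eq_facets: "frontier \<Omega> = \<Union>facets"
proof -
  have "rel_interior (closure \<Omega>) = \<Omega>"
    using rel_interior_nonempty_interior[of "closure \<Omega>"] interior_closure_domain nonempty_domain by simp
  moreover have "\<Union>facets \<subseteq> closure \<Omega>" using facet_of_imp_subset by blast
  ultimately have "\<Union>facets = closure \<Omega> - \<Omega>"
    using rel_boundary_of_polyhedron[OF polyhedron_closure] by (simp only:)
  then show ?thesis unfolding frontier_def interior_open[OF open_domain] by (rule sym)
qed

lemma closed_facet:
  assumes "F \<in> facets" shows "closed F"
proof -
  have "F facet_of closure \<Omega>" using assms by simp
  from face_of_polyhedron_polyhedron[OF polyhedron_closure facet_of_imp_face_of[OF this]]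
  show ?thesis by (rule polyhedron_imp_closed)
qed

lemma borel_facet: "F \<in> facets \<Longrightarrow> F \<in> sets borel"
  by (rule borel_closed[OF closed_facet])

lemma convex_facet: "F \<in> facets \<Longrightarrow> convex F"
  by (rule face_of_imp_convex[OF facet_of_imp_face_of]) simp

lemma facet_subset:
  assumes "F \<in> facets" shows "F \<subseteq> frontier \<Omega>" "F \<subseteq> closure \<Omega>"
  using assms unfolding frontier_eq_facets by (blast, simp add: facet_of_imp_subset)

lemma facet_nonempty: "F \<in> facets \<Longrightarrow> F \<noteq> {}"
  by (auto simp: facet_of_def)

text \<open>One vector for the whole facet, whereas \<open>outer_normal\<close> chooses point by
  point; \<open>outer_normal_eq\<close> shows that both agree on the open facet. The description of
  F as a section of the closure is included because later arguments recover F from its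
  plane.\<close>

definition facet_normal :: "(real^3) set \<Rightarrow> real^3" where
  "facet_normal F = (SOME \<nu>. norm \<nu> = 1 \<and>
     (\<forall>x\<in>F. F = closure \<Omega> \<inter> {y. \<nu> \<bullet> (y - x) = 0} \<and> (\<forall>y\<in>\<Omega>. \<nu> \<bullet> (y - x) < 0)))"

text \<open>Faces of a polyhedron are exposed, so a supporting hyperplane cuts out F. Normalising
  its normal vector gives a witness for the choice.\<close>

lemma facet_normal:
  assumes F: "F \<in> facets"
  shows norm_facet_normal: "norm (facet_normal F) = 1"
    and facet_eq: "x \<in> F \<Longrightarrow> F = closure \<Omega> \<inter> {y. facet_normal F \<bullet> (y - x) = 0}"
    and facet_normal_outer: "x \<in> F \<Longrightarrow> y \<in> \<Omega> \<Longrightarrow> facet_normal F \<bullet> (y - x) < 0"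
proof -
  have "F exposed_face_of closure \<Omega>"
    using exposed_face_of_polyhedron[OF polyhedron_closure] F facet_of_imp_face_of by blast
  then obtain a b where ab: "closure \<Omega> \<subseteq> {x. a \<bullet> x \<le> b}" "F = closure \<Omega> \<inter> {x. a \<bullet> x = b}"
    by (auto simp: exposed_face_of_def)
  have a: "a \<noteq> 0"
  proof
    assume "a = 0"
    with ab facet_nonempty[OF F] have "F = closure \<Omega>" by auto
    with F show False by simp
  qed
  \<comment> \<open>A point of the open set can be moved a little in the direction \<open>a\<close>
    without violating the supporting inequality, so it cannot lie on the hyperplane.\<close>
  have strict: "a \<bullet> y < b" if y: "y \<in> \<Omega>" for y
  proof -
    obtain e where e: "e > 0" "cball y e \<subseteq> \<Omega>" using open_domain y open_contains_cball by blast
    have "y + (e / norm a) *\<^sub>R a \<in> cball y e" using e a by (simp add: dist_norm)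
    then have "a \<bullet> (y + (e / norm a) *\<^sub>R a) \<le> b" using e ab closure_subset by blast
    moreover have "0 < (e / norm a) * (a \<bullet> a)" using e a by simp
    ultimately show ?thesis by (simp add: inner_add_right)
  qed
  let ?n = "(1 / norm a) *\<^sub>R a"
  have "norm ?n = 1 \<and> (\<forall>x\<in>F. F = closure \<Omega> \<inter> {y. ?n \<bullet> (y - x) = 0} \<and> (\<forall>y\<in>\<Omega>. ?n \<bullet> (y - x) < 0))"
    using a strict ab by (auto simp: inner_diff_right intro!: divide_strict_right_mono)
  then have *: "norm (facet_normal F) = 1 \<and> (\<forall>x\<in>F. F = closure \<Omega> \<inter> {y. facet_normal F \<bullet> (y - x) = 0} \<and> (\<forall>y\<in>\<Omega>. facet_normal F \<bullet> (y - x) < 0))"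
    unfolding facet_normal_def by (rule someI)
  then show "norm (facet_normal F) = 1" by blast
  show "x \<in> F \<Longrightarrow> F = closure \<Omega> \<inter> {y. facet_normal F \<bullet> (y - x) = 0}"
    and "x \<in> F \<Longrightarrow> y \<in> \<Omega> \<Longrightarrow> facet_normal F \<bullet> (y - x) < 0" using * by blast+
qed

lemma affine_hull_facet_orthogonal:
  assumes "x \<in> F" "\<And>y. y \<in> F \<Longrightarrow> \<nu> \<bullet> (y - x) = 0" "y \<in> affine hull F"
  shows "\<nu> \<bullet> (y - x) = 0"
proof -
  have "affine hull F \<subseteq> {y. \<nu> \<bullet> y = \<nu> \<bullet> x}"
    by (intro hull_minimal affine_hyperplane) (use assms(2) in \<open>auto simp: inner_diff_right\<close>)
  then show ?thesis using assms(3) by (auto simp: inner_diff_right)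
qed

lemma plane_chart_facet:
  assumes F: "F \<in> facets"
  shows "plane_chart (facet_chart F) (facet_normal F)"
proof
  show "dist (facet_chart F \<xi>) (facet_chart F \<eta>) = dist \<xi> \<eta>" for \<xi> \<eta>
    using facet_chart_works(1)[OF domain] F by simp
  show "norm (facet_normal F) = 1" by (rule norm_facet_normal[OF F])
  obtain x where x: "x \<in> F" using facet_nonempty[OF F] by auto
  have "facet_normal F \<bullet> (facet_chart F \<xi> - x) = 0" for \<xi>
    by (rule affine_hull_facet_orthogonal[OF x])
      (use facet_eq[OF F x] facet_chart_works(2)[OF domain, of F] F in auto)
  from this[of \<xi> for \<xi>] this[of \<eta> for \<eta>]
  show "facet_normal F \<bullet> (facet_chart F \<xi> - facet_chart F \<eta>) = 0" for \<xi> \<eta>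
    using \<open>\<And>\<xi>. facet_normal F \<bullet> (facet_chart F \<xi> - x) = 0\<close>[of \<xi>] \<open>\<And>\<xi>. facet_normal F \<bullet> (facet_chart F \<xi> - x) = 0\<close>[of \<eta>]
    by (simp add: inner_diff_right)
qed

lemma range_facet_chart: "F \<in> facets \<Longrightarrow> range (facet_chart F) = affine hull F"
  using facet_chart_works(2)[OF domain] by simp

lemma facet_in_range: assumes "F \<in> facets" "x \<in> F" obtains \<xi> where "x = facet_chart F \<xi>"
  using range_facet_chart[OF assms(1)] assms(2) hull_inc[of x F affine] by (metis imageE)

lemma borel_facet_chart: "F \<in> facets \<Longrightarrow> facet_chart F \<in> borel_measurable borel"
  by (rule plane_chart.borel_chart[OF plane_chart_facet])

text \<open>A face that meets the relative interior of F contains F, and a proper face has smaller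
  dimension, while all facets have the same dimension.\<close>

lemma rel_interior_facets_disjoint:
  assumes "F \<in> facets" "G \<in> facets" "x \<in> rel_interior F" "x \<in> G"
  shows "F = G"
proof -
  have FG: "F face_of closure \<Omega>" "G face_of closure \<Omega>" "F \<subseteq> closure \<Omega>" "G \<subseteq> closure \<Omega>"
    using assms(1,2) by (simp_all add: facet_of_imp_face_of facet_of_imp_subset)
  have "F \<subseteq> G"
    by (rule subset_of_face_of[OF FG(2,3)]) (use assms(3,4) in blast)
  then have "F face_of G" using face_of_subset[OF FG(1) _ FG(4)] by blast
  moreover have "aff_dim F = aff_dim G" using assms by (simp add: facet_of_def)
  moreover have "convex G" by (rule convex_facet[OF assms(2)])
  ultimately show ?thesis using face_of_aff_dim_lt by fastforce
qed

text \<open>For the description operator uniqueness is the point. The facet of x is unique; a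
  competing vector is orthogonal to the plane, so in the coordinates of \<open>straighten\<close>
  only its third component survives. Unit length leaves the sign, and the position of \<Omega> fixes
  it.\<close>

lemma outer_normal_eq:
  assumes F: "F \<in> facets" and x: "x \<in> rel_interior F"
  shows "outer_normal \<Omega> x = facet_normal F"
  unfolding outer_normal_def
proof (rule the_equality)
  have xF: "x \<in> F" using x rel_interior_subset by blast
  show "norm (facet_normal F) = 1 \<and> (\<exists>G. G facet_of closure \<Omega> \<and> x \<in> rel_interior G \<and>
      (\<forall>y\<in>G. facet_normal F \<bullet> (y - x) = 0) \<and> (\<forall>y\<in>\<Omega>. facet_normal F \<bullet> (y - x) < 0))"
    using F x xF norm_facet_normal[OF F] facet_eq[OF F xF] facet_normal_outer[OF F xF] by blast
  fix \<mu>
  assume "norm \<mu> = 1 \<and> (\<exists>G. G facet_of closure \<Omega> \<and> x \<in> rel_interior G \<and>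
      (\<forall>y\<in>G. \<mu> \<bullet> (y - x) = 0) \<and> (\<forall>y\<in>\<Omega>. \<mu> \<bullet> (y - x) < 0))"
  then obtain G where G: "norm \<mu> = 1" "G \<in> facets" "x \<in> rel_interior G"
    "\<And>y. y \<in> G \<Longrightarrow> \<mu> \<bullet> (y - x) = 0" "\<And>y. y \<in> \<Omega> \<Longrightarrow> \<mu> \<bullet> (y - x) < 0" by auto
  have "G = F" using rel_interior_facets_disjoint[OF F G(2) x] G(3) rel_interior_subset by blast
  interpret plane_chart "facet_chart F" "facet_normal F" by (rule plane_chart_facet[OF F])
  have perp: "\<mu> \<bullet> (facet_chart F \<xi> - x) = 0" for \<xi>
    by (rule affine_hull_facet_orthogonal[OF xF]) (use G(4) \<open>G = F\<close> range_facet_chart[OF F] in auto)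
  then have perp: "\<mu> \<bullet> (facet_chart F \<xi> - facet_chart F 0) = 0" for \<xi>
    using perp[of \<xi>] perp[of 0] by (simp add: inner_diff_right)
  obtain z where z: "\<mu> = straighten z"
    using orthogonal_transformation_surj[OF orthogonal_straighten] by (metis surjD)
  have pres: "straighten u \<bullet> straighten v = u \<bullet> v" for u v
    using orthogonal_straighten by (simp add: orthogonal_transformation_def)
  define v where "v = (vector [z $ 1, z $ 2, 0] :: real^3)"
  have "straighten v = facet_chart F (vector [z $ 1, z $ 2]) - facet_chart F 0"
    by (simp add: straighten_def v_def)
  then have "z \<bullet> v = 0" using perp pres[of z v] z by simp
  then have "z $ 1 * z $ 1 + z $ 2 * z $ 2 = 0" by (simp add: inner_vec_def sum_3 v_def)
  then have z12: "z $ 1 = 0" "z $ 2 = 0" by (simp_all add: add_nonneg_eq_0_iff)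
  have "vector [0, 0] = (0 :: real^2)" by (simp add: vec_eq_iff forall_2)
  then have \<mu>: "\<mu> = z $ 3 *\<^sub>R facet_normal F" using z z12 by (simp add: straighten_def)
  with G(1) have "\<bar>z $ 3\<bar> = 1" using norm_facet_normal[OF F] by simp
  moreover obtain y where "y \<in> \<Omega>" using nonempty_domain by auto
  then have "z $ 3 > 0"
    using G(5)[of y] facet_normal_outer[OF F xF, of y] \<mu> by (simp add: mult_less_0_iff)
  ultimately show "\<mu> = facet_normal F" using \<mu> by simp
qed

lemma sets_surface_measure_iff: "A \<in> sets \<sigma> \<longleftrightarrow> A \<in> sets borel \<and> A \<subseteq> frontier \<Omega>"
  by (subst sets_surface_measure, subst sets_restrict_space_iff) auto

text \<open>For indicators this is the construction of the measure; multiples, sums and monotone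
  limits commute with the finite sum over the facets.\<close>

lemma nn_integral_surface:
  assumes [measurable]: "g \<in> borel_measurable borel"
  shows "(\<integral>\<^sup>+x. g x \<partial>\<sigma>) = (\<Sum>F\<in>facets. \<integral>\<^sup>+\<xi>. g (facet_chart F \<xi>) * indicator F (facet_chart F \<xi>) \<partial>lborel)"
proof -
  have m: "f \<in> borel_measurable \<sigma>" if "f \<in> borel_measurable borel" for f :: "real^3 \<Rightarrow> ennreal"
    using measurable_restrict_space1[OF that, of "frontier \<Omega>"]
    by (simp only: measurable_cong_sets[OF sets_surface_measure refl])
  have mF: "(\<lambda>\<xi>. f (facet_chart F \<xi>) * indicator F (facet_chart F \<xi>)) \<in> borel_measurable borel"
    if "f \<in> borel_measurable borel" "F \<in> facets" for f :: "real^3 \<Rightarrow> ennreal" and F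
  proof -
    note [measurable] = borel_facet_chart[OF that(2)] borel_facet[OF that(2)] that(1)
    show ?thesis by measurable
  qed
  show ?thesis
    using assms
  proof (induction rule: borel_measurable_induct)
    case (cong f g)
    then show ?case by (simp cong: nn_integral_cong)
  next
    case (set A)
    let ?A = "A \<inter> frontier \<Omega>"
    have A: "?A \<in> sets \<sigma>" using set frontier_closed[of \<Omega>] by (simp only: sets_surface_measure_iff sets.Int borel_closed) simp
    have "(\<integral>\<^sup>+x. indicator A x \<partial>\<sigma>) = (\<integral>\<^sup>+x. indicator ?A x \<partial>\<sigma>)"
      by (intro nn_integral_cong) (auto split: split_indicator)
    also have "\<dots> = (\<Sum>F\<in>facets. emeasure lborel (facet_chart F -` (?A \<inter> F)))"
      using A emeasure_surface_measure[OF domain A] by simp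
    also have "\<dots> = (\<Sum>F\<in>facets. \<integral>\<^sup>+\<xi>. indicator A (facet_chart F \<xi>) * indicator F (facet_chart F \<xi>) \<partial>lborel)"
    proof (rule sum.cong[OF refl])
      fix F assume F: "F \<in> facets"
      have eq: "?A \<inter> F = A \<inter> F" using facet_subset(1)[OF F] by auto
      note [measurable] = borel_facet_chart[OF F] sets.Int[OF set borel_facet[OF F]]
      have "emeasure lborel (facet_chart F -` (A \<inter> F)) = (\<integral>\<^sup>+\<xi>. indicator (facet_chart F -` (A \<inter> F)) \<xi> \<partial>lborel)"
        using measurable_sets_borel[of "facet_chart F" borel "A \<inter> F"] by simp
      also have "\<dots> = (\<integral>\<^sup>+\<xi>. indicator A (facet_chart F \<xi>) * indicator F (facet_chart F \<xi>) \<partial>lborel)"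
        by (intro nn_integral_cong) (auto split: split_indicator)
      finally show "emeasure lborel (facet_chart F -` (?A \<inter> F)) = (\<integral>\<^sup>+\<xi>. indicator A (facet_chart F \<xi>) * indicator F (facet_chart F \<xi>) \<partial>lborel)"
        unfolding eq .
    qed
    finally show ?case .
  next
    case (mult u c)
    have "(\<integral>\<^sup>+\<xi>. c * u (facet_chart F \<xi>) * indicator F (facet_chart F \<xi>) \<partial>lborel)
        = c * (\<integral>\<^sup>+\<xi>. u (facet_chart F \<xi>) * indicator F (facet_chart F \<xi>) \<partial>lborel)" if "F \<in> facets" for F
      unfolding mult.assoc using mF[OF mult(2) that] by (intro nn_integral_cmult) simp
    then show ?case
      unfolding nn_integral_cmult[OF m[OF mult(2)]] mult(4) sum_distrib_left by (intro sum.cong) simp_all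
  next
    case (add u v)
    have "(\<integral>\<^sup>+\<xi>. (v (facet_chart F \<xi>) + u (facet_chart F \<xi>)) * indicator F (facet_chart F \<xi>) \<partial>lborel)
        = (\<integral>\<^sup>+\<xi>. v (facet_chart F \<xi>) * indicator F (facet_chart F \<xi>) \<partial>lborel)
          + (\<integral>\<^sup>+\<xi>. u (facet_chart F \<xi>) * indicator F (facet_chart F \<xi>) \<partial>lborel)" if "F \<in> facets" for F
      unfolding distrib_right using mF[OF add(1) that] mF[OF add(3) that] by (intro nn_integral_add) simp_all
    then show ?case
      unfolding nn_integral_add[OF m[OF add(3)] m[OF add(1)]] add(6,7) sum.distrib[symmetric]
      by (intro sum.cong) simp_all
  next
    case (seq U)
    have mono: "(\<integral>\<^sup>+\<xi>. (SUP i. U i) (facet_chart F \<xi>) * indicator F (facet_chart F \<xi>) \<partial>lborel)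
        = (SUP i. \<integral>\<^sup>+\<xi>. U i (facet_chart F \<xi>) * indicator F (facet_chart F \<xi>) \<partial>lborel)" if F: "F \<in> facets" for F
    proof (subst nn_integral_monotone_convergence_SUP[symmetric])
      show "incseq (\<lambda>i \<xi>. U i (facet_chart F \<xi>) * indicator F (facet_chart F \<xi>))"
        using seq(3) by (auto simp: incseq_def le_fun_def intro!: mult_right_mono)
      show "(\<lambda>\<xi>. U i (facet_chart F \<xi>) * indicator F (facet_chart F \<xi>)) \<in> borel_measurable lborel" for i
        using mF[OF seq(1) F] by simp
      show "(\<integral>\<^sup>+\<xi>. (SUP i. U i) (facet_chart F \<xi>) * indicator F (facet_chart F \<xi>) \<partial>lborel)
          = (\<integral>\<^sup>+\<xi>. (SUP i. U i (facet_chart F \<xi>) * indicator F (facet_chart F \<xi>)) \<partial>lborel)"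
        by (simp add: SUP_mult_right_ennreal[symmetric] image_comp)
    qed
    have "(\<integral>\<^sup>+x. (SUP i. U i) x \<partial>\<sigma>) = (SUP i. \<integral>\<^sup>+x. U i x \<partial>\<sigma>)"
    proof -
      have "(\<lambda>x. (SUP i. U i) x) = (\<lambda>x. SUP i. U i x)" by (simp add: fun_eq_iff image_comp)
      then have "(\<integral>\<^sup>+x. (SUP i. U i) x \<partial>\<sigma>) = (\<integral>\<^sup>+x. (SUP i. U i x) \<partial>\<sigma>)" by (simp only:)
      also have "\<dots> = (SUP i. \<integral>\<^sup>+x. U i x \<partial>\<sigma>)"
        by (rule nn_integral_monotone_convergence_SUP[OF seq(3) m[OF seq(1)]])
      finally show ?thesis .
    qed
    also have "\<dots> = (SUP i. \<Sum>F\<in>facets. \<integral>\<^sup>+\<xi>. U i (facet_chart F \<xi>) * indicator F (facet_chart F \<xi>) \<partial>lborel)"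
      by (simp only: seq.IH)
    also have "\<dots> = (\<Sum>F\<in>facets. SUP i. \<integral>\<^sup>+\<xi>. U i (facet_chart F \<xi>) * indicator F (facet_chart F \<xi>) \<partial>lborel)"
      by (rule ennreal_SUP_sum) (use seq(3) in \<open>auto simp: incseq_def le_fun_def intro!: nn_integral_mono mult_right_mono\<close>)
    finally show ?case using mono by simp
  qed
qed

end

text \<open>The l^p norm of the gradient, not the Euclidean one, to the power p: this matches the
  sum over multi-indices in \<open>sobolev_norm\<close>.\<close>

definition grad_powr :: "real \<Rightarrow> (real^3 \<Rightarrow> real) \<Rightarrow> real^3 \<Rightarrow> real" where
  "grad_powr p f x = (\<Sum>i\<in>UNIV. \<bar>partial_deriv i f x\<bar> powr p)"

lemma grad_powr_nonneg [simp]: "0 \<le> grad_powr p f x"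
  by (simp add: grad_powr_def sum_nonneg)

lemma borel_grad_powr: assumes "smooth f" shows "grad_powr p f \<in> borel_measurable borel"
proof -
  have [measurable]: "partial_deriv i f \<in> borel_measurable borel" for i
    by (rule smooth_borel[OF smooth_partial_deriv[OF assms]])
  show ?thesis unfolding grad_powr_def[abs_def] by measurable
qed

lemma dir_deriv_powr_le:
  assumes p: "0 < p" and D: "norm v \<le> D"
  shows "\<bar>dir_deriv v f x\<bar> powr p \<le> (3 * D) powr p * grad_powr p f x"
proof -
  have D0: "0 \<le> D" using D norm_ge_zero order_trans by blast
  have "\<bar>dir_deriv v f x\<bar> \<le> (\<Sum>i\<in>UNIV. \<bar>v $ i * partial_deriv i f x\<bar>)"
    unfolding dir_deriv_def by (rule sum_abs)
  also have "\<dots> \<le> (\<Sum>i\<in>UNIV. D * \<bar>partial_deriv i f x\<bar>)"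
    unfolding abs_mult using component_le_norm_cart[of v] D
    by (intro sum_mono mult_right_mono) (auto intro: order_trans)
  finally have "\<bar>dir_deriv v f x\<bar> powr p \<le> (D * (\<Sum>i\<in>UNIV. \<bar>partial_deriv i f x\<bar>)) powr p"
    using p by (intro powr_mono2) (auto simp: sum_distrib_left)
  also have "\<dots> = D powr p * (\<Sum>i\<in>UNIV. \<bar>partial_deriv i f x\<bar>) powr p"
    using D0 by (simp add: powr_mult sum_nonneg)
  also have "\<dots> \<le> D powr p * (3 powr p * grad_powr p f x)"
    using sum_powr_le[of "UNIV :: 3 set" p "\<lambda>i. \<bar>partial_deriv i f x\<bar>"] p
    by (intro mult_left_mono) (auto simp: grad_powr_def)
  also have "\<dots> = (3 * D) powr p * grad_powr p f x"
    using D0 by (simp add: powr_mult)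
  finally show ?thesis .
qed

text \<open>This is \<open>hardy\<close> for u s = f (x + s (w - x)) - f x, whose derivative is the
  derivative of f along w - x, a vector of length at most D.\<close>

lemma hardy_segment:
  assumes f: "smooth f" and p: "1 < p" and D: "norm (w - x) \<le> D"
  shows "(\<integral>\<^sup>+s. ennreal ((\<bar>f ((1 - s) *\<^sub>R x + s *\<^sub>R w) - f x\<bar> / s) powr p) * indicator {0<..1/2} s \<partial>lborel)
    \<le> ennreal (hardy_const p * (3 * D) powr p) *
      (\<integral>\<^sup>+s. ennreal (grad_powr p f ((1 - s) *\<^sub>R x + s *\<^sub>R w)) * indicator {0<..1/2} s \<partial>lborel)"
proof -
  have pt: "(1 - s) *\<^sub>R x + s *\<^sub>R w = x + s *\<^sub>R (w - x)" for s by (simp add: algebra_simps)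
  have [measurable]: "grad_powr p f \<in> borel_measurable borel" by (rule borel_grad_powr[OF f])
  have "((\<lambda>s. f (x + s *\<^sub>R (w - x)) - f x) has_real_derivative dir_deriv (w - x) f (x + s *\<^sub>R (w - x)) - 0) (at s)" for s
    by (intro DERIV_diff smooth_line_derivative f DERIV_const)
  then have der: "((\<lambda>s. f (x + s *\<^sub>R (w - x)) - f x) has_real_derivative dir_deriv (w - x) f (x + s *\<^sub>R (w - x))) (at s)" for s
    by simp
  have cont: "continuous_on UNIV (\<lambda>s. dir_deriv (w - x) f (x + s *\<^sub>R (w - x)))"
    by (rule continuous_on_compose2[OF smooth_continuous[OF smooth_dir_deriv[OF f], of UNIV]])
      (auto intro!: continuous_intros)
  have "(\<integral>\<^sup>+s. ennreal ((\<bar>f (x + s *\<^sub>R (w - x)) - f x\<bar> / s) powr p) * indicator {0<..1/2} s \<partial>lborel)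
      \<le> ennreal (hardy_const p) * (\<integral>\<^sup>+s. ennreal (\<bar>dir_deriv (w - x) f (x + s *\<^sub>R (w - x))\<bar> powr p) * indicator {0..1/2} s \<partial>lborel)"
    by (rule hardy[OF p _ _ der cont]) auto
  also have "(\<integral>\<^sup>+s. ennreal (\<bar>dir_deriv (w - x) f (x + s *\<^sub>R (w - x))\<bar> powr p) * indicator {0..1/2} s \<partial>lborel)
      \<le> (\<integral>\<^sup>+s. ennreal ((3 * D) powr p) * (ennreal (grad_powr p f (x + s *\<^sub>R (w - x))) * indicator {0<..1/2} s) \<partial>lborel)"
  proof (rule nn_integral_mono_AE)
    have "AE s in lborel. s \<noteq> (0::real)" by (rule AE_lborel_singleton)
    then show "AE s in lborel. ennreal (\<bar>dir_deriv (w - x) f (x + s *\<^sub>R (w - x))\<bar> powr p) * indicator {0..1/2} s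
      \<le> ennreal ((3 * D) powr p) * (ennreal (grad_powr p f (x + s *\<^sub>R (w - x))) * indicator {0<..1/2} s)"
    proof eventually_elim
      case (elim s)
      have "ennreal (\<bar>dir_deriv (w - x) f (x + s *\<^sub>R (w - x))\<bar> powr p) \<le> ennreal ((3 * D) powr p) * ennreal (grad_powr p f (x + s *\<^sub>R (w - x)))"
        using p D by (subst ennreal_mult[symmetric]) (auto intro!: ennreal_leI dir_deriv_powr_le)
      then show ?case using elim by (auto split: split_indicator)
    qed
  qed
  also have "\<dots> = ennreal ((3 * D) powr p) * (\<integral>\<^sup>+s. ennreal (grad_powr p f (x + s *\<^sub>R (w - x))) * indicator {0<..1/2} s \<partial>lborel)"
    by (rule nn_integral_cmult) measurable
  finally show ?thesis
    unfolding pt using hardy_const_pos[OF p] by (simp add: ennreal_mult mult.assoc mult_left_mono)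
qed

section \<open>The surface measure on the whole space and cones over the facets\<close>

context polyhedral_domain begin

text \<open>The surface measure as a Borel measure on the whole space.\<close>

definition S :: "(real^3) measure" where
  "S = distr \<sigma> borel (\<lambda>x. x)"

lemma sets_S [measurable_cong]: "sets S = sets borel" and space_S [simp]: "space S = UNIV"
  by (simp_all add: S_def)

lemma measurable_id_surface: "(\<lambda>x. x) \<in> \<sigma> \<rightarrow>\<^sub>M borel"
  using measurable_restrict_space1[of "\<lambda>x. x" borel borel "frontier \<Omega>"]
  by (simp only: measurable_cong_sets[OF sets_surface_measure refl] measurable_ident_sets)

lemma borel_measurable_surface: "f \<in> measurable borel N \<Longrightarrow> f \<in> measurable \<sigma> N"
  by (rule measurable_compose[OF measurable_id_surface])

lemma nn_integral_S: "g \<in> borel_measurable borel \<Longrightarrow> (\<integral>\<^sup>+x. g x \<partial>S) = (\<integral>\<^sup>+x. g x \<partial>\<sigma>)"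
  unfolding S_def by (intro nn_integral_distr measurable_id_surface) simp

lemma nn_integral_S_facets:
  "g \<in> borel_measurable borel \<Longrightarrow>
    (\<integral>\<^sup>+x. g x \<partial>S) = (\<Sum>F\<in>facets. \<integral>\<^sup>+\<xi>. g (facet_chart F \<xi>) * indicator F (facet_chart F \<xi>) \<partial>lborel)"
  by (simp only: nn_integral_S nn_integral_surface)

lemma AE_S: "AE x in S. x \<in> frontier \<Omega>"
  unfolding S_def by (subst AE_distr_iff[OF measurable_id_surface]) auto

text \<open>If the plane of a facet meets the ball, its part in the ball lies in a disc of radius 2
  r about any of its points there. The quadratic growth, uniform in the centre, is what the
  Gagliardo estimate needs.\<close>

lemma S_cball:
  assumes "0 \<le> r"
  shows "emeasure S (cball x r) \<le> ennreal (real (card facets) * unit_ball_vol 2 * 4 * r\<^sup>2)"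
proof -
  have "emeasure S (cball x r) = (\<integral>\<^sup>+y. indicator (cball x r) y \<partial>S)"
    by (subst nn_integral_indicator) (auto simp: sets_S)
  also have "\<dots> = (\<Sum>F\<in>facets. \<integral>\<^sup>+\<xi>. indicator (cball x r) (facet_chart F \<xi>) * indicator F (facet_chart F \<xi>) \<partial>lborel)"
    by (rule nn_integral_S_facets) (intro borel_measurable_indicator borel_closed closed_cball)
  also have "\<dots> \<le> (\<Sum>F\<in>facets. ennreal (unit_ball_vol 2 * (2 * r) ^ 2))"
  proof (rule sum_mono)
    fix F assume F: "F \<in> facets"
    interpret plane_chart "facet_chart F" "facet_normal F" by (rule plane_chart_facet[OF F])
    show "(\<integral>\<^sup>+\<xi>. indicator (cball x r) (facet_chart F \<xi>) * indicator F (facet_chart F \<xi>) \<partial>lborel) \<le> ennreal (unit_ball_vol 2 * (2 * r) ^ 2)"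
    proof (cases "\<exists>\<eta>. facet_chart F \<eta> \<in> cball x r")
      case True
      then obtain \<eta> where \<eta>: "dist x (facet_chart F \<eta>) \<le> r" by auto
      have "\<xi> \<in> cball \<eta> (2 * r)" if "facet_chart F \<xi> \<in> cball x r" for \<xi>
        using dist_triangle2[of "facet_chart F \<eta>" "facet_chart F \<xi>" x] \<eta> that
        by (simp add: isometric dist_commute)
      then have "(\<integral>\<^sup>+\<xi>. indicator (cball x r) (facet_chart F \<xi>) * indicator F (facet_chart F \<xi>) \<partial>lborel) \<le> (\<integral>\<^sup>+\<xi>. indicator (cball \<eta> (2 * r)) \<xi> \<partial>lborel)"
        by (intro nn_integral_mono) (auto split: split_indicator)
      also have "\<dots> = ennreal (unit_ball_vol 2 * (2 * r) ^ 2)"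
        using assms emeasure_cball[of "2 * r" \<eta>] by simp
      finally show ?thesis .
    next
      case False
      then have "indicator (cball x r) (facet_chart F \<xi>) = (0::ennreal)" for \<xi> by (auto simp del: mem_cball)
      then show ?thesis by simp
    qed
  qed
  also have "\<dots> = of_nat (card facets) * ennreal (unit_ball_vol 2 * (2 * r) ^ 2)" by (simp only: sum_constant)
  also have "\<dots> = ennreal (real (card facets) * (unit_ball_vol 2 * (2 * r) ^ 2))"
    by (simp add: ennreal_mult ennreal_of_nat_eq_real_of_nat)
  finally show ?thesis by (simp add: power2_eq_square ac_simps)
qed

lemma finite_measure_S: "finite_measure S"
proof
  obtain R where R: "closure \<Omega> \<subseteq> cball 0 R" "0 < R"
    using compact_imp_bounded[OF compact_closure] unfolding bounded_pos by (auto simp: subset_iff)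
  have "AE x in S. x \<in> cball 0 R"
    using AE_S by eventually_elim (use R in \<open>auto simp: frontier_def\<close>)
  then have "AE x in S. x \<in> space S \<longleftrightarrow> x \<in> cball 0 R" by simp
  then have "emeasure S (space S) = emeasure S (cball 0 R)"
    by (rule emeasure_eq_AE) (auto simp: sets_S)
  also have "\<dots> < \<infinity>" using S_cball[of R 0] R(2) by (auto intro: le_less_trans)
  finally show "emeasure S (space S) \<noteq> \<infinity>" by simp
qed

sublocale S: finite_measure S by (rule finite_measure_S)

sublocale S_lborel: pair_sigma_finite S "lborel :: 'b::euclidean_space measure" ..

sublocale S_S: pair_sigma_finite S S ..

lemma segment_in_domain:
  assumes "x \<in> closure \<Omega>" "w \<in> \<Omega>" "0 < s" "s \<le> 1"
  shows "(1 - s) *\<^sub>R x + s *\<^sub>R w \<in> \<Omega>"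
proof -
  have "x - s *\<^sub>R (x - w) \<in> interior \<Omega>"
    by (rule mem_interior_closure_convex_shrink[OF convex_domain]) (use assms open_domain in \<open>auto simp: interior_open\<close>)
  then show ?thesis using open_domain by (simp add: interior_open algebra_simps)
qed

text \<open>The three radii have separate uses: end points of segments are averaged over radius
  \<rho>, a shift by at most \<rho> keeps them within 2 \<rho>, and the remaining margin separates
  them by more than \<rho> from the plane of every facet.\<close>

definition inner_ball :: "real^3 \<Rightarrow> real \<Rightarrow> bool" where
  "inner_ball x0 \<rho> \<longleftrightarrow> 0 < \<rho> \<and> cball x0 (3 * \<rho>) \<subseteq> \<Omega>"

lemma inner_ball_exists: obtains x0 \<rho> where "inner_ball x0 \<rho>"
proof -
  obtain x0 where "x0 \<in> \<Omega>" using nonempty_domain by auto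
  then obtain e where "0 < e" "cball x0 e \<subseteq> \<Omega>" using open_domain open_contains_cball by blast
  then have "inner_ball x0 (e / 3)" by (simp add: inner_ball_def)
  then show thesis by (rule that)
qed

lemma inner_ball_subset: "inner_ball x0 \<rho> \<Longrightarrow> w \<in> cball x0 (2 * \<rho>) \<Longrightarrow> w \<in> \<Omega>"
  unfolding inner_ball_def using subset_cball[of "2 * \<rho>" "3 * \<rho>" x0] by (auto simp del: mem_cball)

text \<open>Over each facet the segments sweep out part of a cone with apex w, which lies in
  \<Omega> for s > 0 by convexity. The height of w over the plane of the facet is at least \<rho>,
  so the constant does not depend on w.\<close>

lemma nn_integral_surface_cone:
  assumes G [measurable]: "G \<in> borel_measurable borel" and b: "inner_ball x0 \<rho>" and w: "w \<in> cball x0 (2 * \<rho>)"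
  shows "(\<integral>\<^sup>+x. \<integral>\<^sup>+s. G ((1 - s) *\<^sub>R x + s *\<^sub>R w) * indicator {0<..1/2} s \<partial>lborel \<partial>S)
    \<le> ennreal (real (card facets) * (4 / \<rho>)) * (\<integral>\<^sup>+x. G x * indicator \<Omega> x \<partial>lborel)"
proof -
  have \<rho>: "0 < \<rho>" "cball x0 (3 * \<rho>) \<subseteq> \<Omega>" using b by (auto simp: inner_ball_def)
  let ?I = "\<integral>\<^sup>+x. G x * indicator \<Omega> x \<partial>lborel"
  have "(\<integral>\<^sup>+x. \<integral>\<^sup>+s. G ((1 - s) *\<^sub>R x + s *\<^sub>R w) * indicator {0<..1/2} s \<partial>lborel \<partial>S)
      = (\<Sum>F\<in>facets. \<integral>\<^sup>+\<xi>. (\<integral>\<^sup>+s. G ((1 - s) *\<^sub>R facet_chart F \<xi> + s *\<^sub>R w) * indicator {0<..1/2} s \<partial>lborel) * indicator F (facet_chart F \<xi>) \<partial>lborel)"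
    by (rule nn_integral_S_facets) measurable
  also have "\<dots> \<le> (\<Sum>F\<in>facets. ennreal (4 / \<rho>) * ?I)"
  proof (rule sum_mono)
    fix F assume F: "F \<in> facets"
    interpret plane_chart "facet_chart F" "facet_normal F" by (rule plane_chart_facet[OF F])
    obtain a where a: "a \<in> F" using facet_nonempty[OF F] by auto
    obtain z \<omega> h where wz: "w = facet_chart F \<omega> + h *\<^sub>R facet_normal F" 
    proof -
      obtain z where z: "w - facet_chart F 0 = straighten z"
        using orthogonal_transformation_surj[OF orthogonal_straighten] by (metis surjD)
      then have "w = facet_chart F (vector [z $ 1, z $ 2]) + z $ 3 *\<^sub>R facet_normal F"
        by (simp add: straighten_def algebra_simps)
      then show thesis by (rule that)
    qed
    have nn: "facet_normal F \<bullet> facet_normal F = 1" using unit_normal by (simp add: norm_eq_1)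
    obtain \<alpha> where \<alpha>: "a = facet_chart F \<alpha>" using facet_in_range[OF F a] .
    have "facet_normal F \<bullet> (w - a) = facet_normal F \<bullet> (facet_chart F \<omega> - facet_chart F \<alpha>) + h"
      using nn by (simp add: wz \<alpha> inner_diff_right inner_add_right)
    then have h_eq: "facet_normal F \<bullet> (w - a) = h" using normal by simp
    \<comment> \<open>Even after a move by \<rho> along the outer normal the apex is in \<Omega>,
      hence strictly below the plane; so the signed height is less than -\<rho>.\<close>
    have "w + \<rho> *\<^sub>R facet_normal F \<in> cball x0 (3 * \<rho>)"
      using w \<rho> norm_triangle_ineq[of "w - x0" "\<rho> *\<^sub>R facet_normal F"] unit_normal
      by (simp add: dist_norm norm_minus_commute algebra_simps)
    then have "facet_normal F \<bullet> (w + \<rho> *\<^sub>R facet_normal F - a) < 0"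
      using \<rho> facet_normal_outer[OF F a] by blast
    then have "h < - \<rho>" using h_eq nn by (simp add: inner_add_right inner_diff_right)
    then have h: "h \<noteq> 0" "\<rho> \<le> \<bar>h\<bar>" using \<rho> by auto
    have "(\<integral>\<^sup>+\<xi>. (\<integral>\<^sup>+s. G ((1 - s) *\<^sub>R facet_chart F \<xi> + s *\<^sub>R w) * indicator {0<..1/2} s \<partial>lborel) * indicator F (facet_chart F \<xi>) \<partial>lborel)
        \<le> (\<integral>\<^sup>+\<xi>. \<integral>\<^sup>+s. (\<lambda>x. G x * indicator \<Omega> x) ((1 - s) *\<^sub>R facet_chart F \<xi> + s *\<^sub>R w) * indicator {0..1/2} s \<partial>lborel \<partial>lborel)"
    proof (rule nn_integral_mono)
      fix \<xi>
      have "G ((1 - s) *\<^sub>R facet_chart F \<xi> + s *\<^sub>R w) * indicator {0<..1/2} s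
          \<le> (G ((1 - s) *\<^sub>R facet_chart F \<xi> + s *\<^sub>R w) * indicator \<Omega> ((1 - s) *\<^sub>R facet_chart F \<xi> + s *\<^sub>R w)) * indicator {0..1/2} s"
        if "facet_chart F \<xi> \<in> F" for s
        using segment_in_domain[OF _ inner_ball_subset[OF b w], of "facet_chart F \<xi>" s] that facet_subset(2)[OF F]
        by (auto split: split_indicator)
      then show "(\<integral>\<^sup>+s. G ((1 - s) *\<^sub>R facet_chart F \<xi> + s *\<^sub>R w) * indicator {0<..1/2} s \<partial>lborel) * indicator F (facet_chart F \<xi>)
          \<le> (\<integral>\<^sup>+s. (\<lambda>x. G x * indicator \<Omega> x) ((1 - s) *\<^sub>R facet_chart F \<xi> + s *\<^sub>R w) * indicator {0..1/2} s \<partial>lborel)"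
        by (auto intro!: nn_integral_mono split: split_indicator)
    qed
    also have "\<dots> \<le> ennreal (4 / \<bar>h\<bar>) * ?I"
      by (rule nn_integral_cone[OF _ wz h(1)]) measurable
    also have "\<dots> \<le> ennreal (4 / \<rho>) * ?I"
      using h \<rho> by (intro mult_right_mono ennreal_leI divide_left_mono) auto
    finally show "(\<integral>\<^sup>+\<xi>. (\<integral>\<^sup>+s. G ((1 - s) *\<^sub>R facet_chart F \<xi> + s *\<^sub>R w) * indicator {0<..1/2} s \<partial>lborel) * indicator F (facet_chart F \<xi>) \<partial>lborel)
        \<le> ennreal (4 / \<rho>) * ?I" .
  qed
  also have "\<dots> = of_nat (card facets) * (ennreal (4 / \<rho>) * ?I)" by (simp only: sum_constant)
  also have "\<dots> = ennreal (real (card facets) * (4 / \<rho>)) * ?I"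
    using \<rho> by (simp add: ennreal_of_nat_eq_real_of_nat ennreal_mult[symmetric] mult.assoc[symmetric])
  finally show ?thesis .
qed

end

section \<open>Trace inequalities for smooth functions\<close>

text \<open>The averaging device: used over the position on a segment, over the end point of the
  segment, and over the scale l.\<close>

lemma ennreal_integral_le_cmult:
  assumes "\<And>x. x \<in> A \<Longrightarrow> c \<le> C * h x" "h \<in> borel_measurable M" "A \<in> sets M"
  shows "c * emeasure M A \<le> C * (\<integral>\<^sup>+x. h x * indicator A x \<partial>M)"
proof -
  note [measurable] = assms(2,3)
  have "c * emeasure M A = (\<integral>\<^sup>+x. c * indicator A x \<partial>M)"
    using assms(3) by (simp add: nn_integral_cmult_indicator)
  also have "\<dots> \<le> (\<integral>\<^sup>+x. C * (h x * indicator A x) \<partial>M)"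
    by (intro nn_integral_mono) (use assms(1) in \<open>auto split: split_indicator\<close>)
  also have "\<dots> = C * (\<integral>\<^sup>+x. h x * indicator A x \<partial>M)"
    by (intro nn_integral_cmult) measurable
  finally show ?thesis .
qed

section \<open>The L^p trace inequality for smooth functions\<close>

context polyhedral_domain begin

definition diam :: real where "diam = diameter (closure \<Omega>)"

lemma norm_le_diam: "x \<in> closure \<Omega> \<Longrightarrow> y \<in> closure \<Omega> \<Longrightarrow> norm (y - x) \<le> diam"
  unfolding diam_def using diameter_bounded_bound[OF compact_imp_bounded[OF compact_closure], of y x]
  by (simp add: dist_norm)

lemma diam_nonneg: "0 \<le> diam"
  unfolding diam_def using compact_imp_bounded[OF compact_closure] by (rule diameter_ge_0)

text \<open>Hardy's inequality on each segment leaves the gradient along the segment, and the cone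
  estimate integrates it into \<Omega>. Independence of the constant from w allows averaging over w
  later.\<close>

lemma nn_integral_segment_quotient:
  assumes f: "smooth f" and p: "1 < p" and b: "inner_ball x0 \<rho>" and w: "w \<in> cball x0 (2 * \<rho>)"
  shows "(\<integral>\<^sup>+x. \<integral>\<^sup>+s. ennreal ((\<bar>f ((1 - s) *\<^sub>R x + s *\<^sub>R w) - f x\<bar> / s) powr p) * indicator {0<..1/2} s \<partial>lborel \<partial>S)
    \<le> ennreal (hardy_const p * (3 * diam) powr p * (real (card facets) * (4 / \<rho>))) *
      (\<integral>\<^sup>+x. ennreal (grad_powr p f x) * indicator \<Omega> x \<partial>lborel)"
proof -
  let ?A = "hardy_const p * (3 * diam) powr p"
  have A: "0 \<le> ?A" using hardy_const_pos[OF p] by simp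
  have \<rho>: "0 < \<rho>" using b by (simp add: inner_ball_def)
  have [measurable]: "grad_powr p f \<in> borel_measurable borel" by (rule borel_grad_powr[OF f])
  have "(\<integral>\<^sup>+x. \<integral>\<^sup>+s. ennreal ((\<bar>f ((1 - s) *\<^sub>R x + s *\<^sub>R w) - f x\<bar> / s) powr p) * indicator {0<..1/2} s \<partial>lborel \<partial>S)
      \<le> (\<integral>\<^sup>+x. ennreal ?A * (\<integral>\<^sup>+s. ennreal (grad_powr p f ((1 - s) *\<^sub>R x + s *\<^sub>R w)) * indicator {0<..1/2} s \<partial>lborel) \<partial>S)"
  proof (rule nn_integral_mono_AE, rule AE_mp[OF AE_S], rule AE_I2, rule impI)
    fix x assume "x \<in> frontier \<Omega>"
    then have "norm (w - x) \<le> diam"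
      using norm_le_diam[of x w] inner_ball_subset[OF b w] closure_subset by (auto simp: frontier_def)
    from hardy_segment[OF f p this]
    show "(\<integral>\<^sup>+s. ennreal ((\<bar>f ((1 - s) *\<^sub>R x + s *\<^sub>R w) - f x\<bar> / s) powr p) * indicator {0<..1/2} s \<partial>lborel)
      \<le> ennreal ?A * (\<integral>\<^sup>+s. ennreal (grad_powr p f ((1 - s) *\<^sub>R x + s *\<^sub>R w)) * indicator {0<..1/2} s \<partial>lborel)" .
  qed
  also have "\<dots> = ennreal ?A * (\<integral>\<^sup>+x. (\<integral>\<^sup>+s. ennreal (grad_powr p f ((1 - s) *\<^sub>R x + s *\<^sub>R w)) * indicator {0<..1/2} s \<partial>lborel) \<partial>S)"
    by (rule nn_integral_cmult) measurable
  also have "\<dots> \<le> ennreal ?A * (ennreal (real (card facets) * (4 / \<rho>)) * (\<integral>\<^sup>+x. ennreal (grad_powr p f x) * indicator \<Omega> x \<partial>lborel))"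
    by (intro mult_left_mono nn_integral_surface_cone[OF _ b w]) auto
  also have "\<dots> = ennreal (?A * (real (card facets) * (4 / \<rho>))) * (\<integral>\<^sup>+x. ennreal (grad_powr p f x) * indicator \<Omega> x \<partial>lborel)"
    using A \<rho> by (subst ennreal_mult) (auto simp: mult.assoc)
  finally show ?thesis .
qed

text \<open>The p-th power of the \<open>W^(1,p)\<close> norm on \<Omega> of a smooth function, in
  extended reals so that finiteness need not be known beforehand.\<close>

definition sobolev_energy :: "real \<Rightarrow> (real^3 \<Rightarrow> real) \<Rightarrow> ennreal" where
  "sobolev_energy p f = (\<integral>\<^sup>+x. ennreal (\<bar>f x\<bar> powr p) * indicator \<Omega> x \<partial>lborel)
     + (\<integral>\<^sup>+x. ennreal (grad_powr p f x) * indicator \<Omega> x \<partial>lborel)"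

text \<open>The boundary value f x is compared with the values of f on the half segment towards one
  fixed inner point and averaged over the parameter s. The values are handled by the cone estimate,
  the differences by the Hardy quotient.\<close>

lemma trace_Lp_bound:
  assumes p: "1 < p"
  obtains C where "0 < C" "\<And>f. smooth f \<Longrightarrow> (\<integral>\<^sup>+x. ennreal (\<bar>f x\<bar> powr p) \<partial>S) \<le> ennreal C * sobolev_energy p f"
proof -
  obtain x0 \<rho> where b: "inner_ball x0 \<rho>" using inner_ball_exists .
  have \<rho>: "0 < \<rho>" using b by (simp add: inner_ball_def)
  then have w: "x0 \<in> cball x0 (2 * \<rho>)" by simp
  define K where "K = real (card facets) * (4 / \<rho>)"
  define L where "L = hardy_const p * (3 * diam) powr p * K"
  have K: "0 \<le> K" "0 \<le> L" using \<rho> hardy_const_pos[OF p] by (auto simp: K_def L_def)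
  define B where "B = K + L"
  have B: "0 \<le> B" "K \<le> B" "L \<le> B" using K by (auto simp: B_def)
  \<comment> \<open>The 2 undoes the length 1/2 of the interval of averaging,
    \<open>2 powr p\<close> comes from \<open>abs_add_powr_le\<close>, and the 1 makes the constant
    positive in every case.\<close>
  define C where "C = 2 * 2 powr p * B + 1"
  show thesis
  proof (rule that)
    show "0 < C" using B by (simp add: C_def add_nonneg_pos)
    fix f :: "real^3 \<Rightarrow> real" assume f: "smooth f"
    have [measurable]: "f \<in> borel_measurable borel" by (rule smooth_borel[OF f])
    let ?z = "\<lambda>x s. (1 - s) *\<^sub>R x + s *\<^sub>R x0"
    let ?u = "\<lambda>x s. ennreal (\<bar>f (?z x s)\<bar> powr p)"
    let ?v = "\<lambda>x s. ennreal ((\<bar>f (?z x s) - f x\<bar> / s) powr p)"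
    let ?I = "indicator {0<..1/2} :: real \<Rightarrow> ennreal"
    let ?a = "\<integral>\<^sup>+x. ennreal (\<bar>f x\<bar> powr p) * indicator \<Omega> x \<partial>lborel"
    let ?b = "\<integral>\<^sup>+x. ennreal (grad_powr p f x) * indicator \<Omega> x \<partial>lborel"
    have pw: "ennreal (\<bar>f x\<bar> powr p) \<le> ennreal (2 powr p) * (?u x s + ?v x s)" if s: "s \<in> {0<..1/2}" for x s
    proof -
      have "\<bar>f x\<bar> powr p \<le> 2 powr p * (\<bar>f (?z x s)\<bar> powr p + \<bar>f x - f (?z x s)\<bar> powr p)"
        using abs_add_powr_le[of p "f (?z x s)" "f x - f (?z x s)"] p by simp
      \<comment> \<open>As s \<le> 1, division by s only increases the difference and produces the
        Hardy quotient.\<close>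
      also have "\<bar>f x - f (?z x s)\<bar> \<le> \<bar>f (?z x s) - f x\<bar> / s"
        using s by (subst pos_le_divide_eq) (auto intro: mult_left_le simp: abs_minus_commute)
      then have "\<bar>f x - f (?z x s)\<bar> powr p \<le> (\<bar>f (?z x s) - f x\<bar> / s) powr p"
        using p by (intro powr_mono2) auto
      finally have "\<bar>f x\<bar> powr p \<le> 2 powr p * (\<bar>f (?z x s)\<bar> powr p + (\<bar>f (?z x s) - f x\<bar> / s) powr p)"
        by simp
      then show ?thesis by (simp add: ennreal_leI flip: ennreal_plus ennreal_mult)
    qed
    have "(\<integral>\<^sup>+x. ennreal (\<bar>f x\<bar> powr p) \<partial>S) * ennreal (1/2) = (\<integral>\<^sup>+x. ennreal (\<bar>f x\<bar> powr p) * emeasure lborel {0<..1/2::real} \<partial>S)"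
      by (subst nn_integral_multc) auto
    also have "\<dots> \<le> (\<integral>\<^sup>+x. ennreal (2 powr p) * (\<integral>\<^sup>+s. (?u x s + ?v x s) * ?I s \<partial>lborel) \<partial>S)"
      by (intro nn_integral_mono ennreal_integral_le_cmult pw) auto
    also have "\<dots> = ennreal (2 powr p) * ((\<integral>\<^sup>+x. \<integral>\<^sup>+s. ?u x s * ?I s \<partial>lborel \<partial>S) + (\<integral>\<^sup>+x. \<integral>\<^sup>+s. ?v x s * ?I s \<partial>lborel \<partial>S))"
      by (simp add: distrib_right nn_integral_cmult nn_integral_add)
    also have "\<dots> \<le> ennreal (2 powr p) * (ennreal K * ?a + ennreal L * ?b)"
      unfolding K_def L_def
      by (intro mult_left_mono add_mono nn_integral_surface_cone[OF _ b w] nn_integral_segment_quotient[OF f p b w]) auto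
    also have "\<dots> \<le> ennreal (2 powr p) * (ennreal B * ?a + ennreal B * ?b)"
      using B by (intro mult_left_mono add_mono mult_right_mono ennreal_leI) auto
    also have "\<dots> = ennreal (2 powr p * B) * sobolev_energy p f"
      using B by (simp add: sobolev_energy_def distrib_left ennreal_mult mult.assoc)
    finally have *: "(\<integral>\<^sup>+x. ennreal (\<bar>f x\<bar> powr p) \<partial>S) * ennreal (1/2) \<le> ennreal (2 powr p * B) * sobolev_energy p f" .
    have "(\<integral>\<^sup>+x. ennreal (\<bar>f x\<bar> powr p) \<partial>S) = ennreal 2 * ((\<integral>\<^sup>+x. ennreal (\<bar>f x\<bar> powr p) \<partial>S) * ennreal (1/2))"
    proof -
      have "ennreal 2 * ennreal (1/2) = 1" by (subst ennreal_mult[symmetric]) simp_all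
      then show ?thesis by (simp only: mult.left_commute[of "ennreal 2"] mult_1_right)
    qed
    also have "\<dots> \<le> ennreal 2 * (ennreal (2 powr p * B) * sobolev_energy p f)"
      by (intro mult_left_mono *) auto
    also have "\<dots> = ennreal (2 * (2 powr p * B)) * sobolev_energy p f"
      using B by (simp only: ennreal_mult' mult.assoc zero_le_numeral)
    also have "\<dots> \<le> ennreal C * sobolev_energy p f"
      by (intro mult_right_mono ennreal_leI) (auto simp: C_def)
    finally show "(\<integral>\<^sup>+x. ennreal (\<bar>f x\<bar> powr p) \<partial>S) \<le> ennreal C * sobolev_energy p f" .
  qed
qed

end

section \<open>The Gagliardo seminorm of smooth boundary values\<close>

context polyhedral_domain begin

text \<open>Close points x and y are compared through z = (1 - l) x + l w, with w in the inner ball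
  and l between r / \<rho> and 2 r / \<rho> for r = |x - y|. Seen from y, the same z lies on the
  segment to the slightly shifted end point w + a, so both differences have the same form. After
  averaging over w and l, integration over y costs the surface measure O(l^2) of a ball and leaves
  exactly the Hardy quotient of x towards w. Points at distance more than \<rho> / 4 are covered by
  the L^p bound.\<close>

lemma gagliardo_bound:
  assumes p: "1 < p"
  obtains C where "0 < C" "\<And>f. smooth f \<Longrightarrow>
    (\<integral>\<^sup>+x. \<integral>\<^sup>+y. ennreal (\<bar>f x - f y\<bar> powr p / norm (x - y) powr (1 + p)) \<partial>S \<partial>S) \<le> ennreal C * sobolev_energy p f"
proof -
  obtain x0 \<rho> where b: "inner_ball x0 \<rho>" using inner_ball_exists .
  have \<rho>: "0 < \<rho>" using b by (simp add: inner_ball_def)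
  obtain Ct where Ct: "0 < Ct" "\<And>f. smooth f \<Longrightarrow> (\<integral>\<^sup>+x. ennreal (\<bar>f x\<bar> powr p) \<partial>S) \<le> ennreal Ct * sobolev_energy p f"
    using trace_Lp_bound[OF p] by blast
  define v where "v = measure lborel (cball x0 \<rho>)"
  have v: "emeasure lborel (cball x0 \<rho>) = ennreal v" "0 < v"
    unfolding v_def using content_cball_pos[OF \<rho>, of x0] emeasure_lborel_cball_finite[of x0 \<rho>]
    by (auto simp: emeasure_eq_ennreal_measure)
  define v2 where "v2 = measure lborel (cball x0 (2 * \<rho>))"
  have v2: "emeasure lborel (cball x0 (2 * \<rho>)) = ennreal v2" "0 \<le> v2"
    unfolding v2_def using emeasure_lborel_cball_finite[of x0 "2 * \<rho>"] by (auto simp: emeasure_eq_ennreal_measure)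
  define m where "m = measure S UNIV"
  have m: "emeasure S UNIV = ennreal m" "0 \<le> m" by (auto simp: m_def S.emeasure_eq_measure)
  define L where "L = hardy_const p * (3 * diam) powr p * (real (card facets) * (4 / \<rho>))"
  define c\<sigma> where "c\<sigma> = real (card facets) * unit_ball_vol 2 * 4"
  have L: "0 \<le> L" "0 \<le> c\<sigma>" using \<rho> hardy_const_pos[OF p] by (auto simp: L_def c\<sigma>_def)
  \<comment> \<open>Here \<open>v\<close> is the volume of the ball over which w is averaged, the
    first \<rho> undoes the length r / \<rho> of the interval of scales, and
    \<open>(\<rho> / 2) powr (- 2 - p)\<close> comes from r \<ge> \<rho> l / 2.\<close>
  define C1 where "C1 = \<rho> * (2 powr p * (\<rho> / 2) powr (- 2 - p)) / v"
  have C1: "0 \<le> C1" using \<rho> v by (simp add: C1_def)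
  define C2 where "C2 = 2 powr p * (4 / \<rho>) powr (1 + p)"
  define C where "C = C1 * (2 * (c\<sigma> * \<rho>\<^sup>2 * v2 * L)) + C2 * (2 * m * Ct) + 1"
  show thesis
  proof (rule that)
    show "0 < C" using C1 L v2 m Ct by (simp add: C_def C2_def add_nonneg_pos)
    fix f :: "real^3 \<Rightarrow> real" assume f: "smooth f"
    have [measurable]: "f \<in> borel_measurable borel" by (rule smooth_borel[OF f])
    have [measurable]: "cball z r \<in> sets borel" for z :: "real^3" and r by simp
    let ?J = "\<lambda>x y. ennreal (\<bar>f x - f y\<bar> powr p / norm (x - y) powr (1 + p))"
    let ?b = "\<integral>\<^sup>+x. ennreal (grad_powr p f x) * indicator \<Omega> x \<partial>lborel"
    define q where "q x l w = ennreal (\<bar>f x - f ((1 - l) *\<^sub>R x + l *\<^sub>R w)\<bar> powr p)" for x l w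
    have [measurable]: "(\<lambda>(x, l, w). q x l w) \<in> borel_measurable (borel \<Otimes>\<^sub>M borel \<Otimes>\<^sub>M borel)"
      unfolding q_def by measurable
    have q_meas1 [measurable]: "q x l \<in> borel_measurable borel" for x l
      unfolding q_def by measurable
    define \<Phi> where "\<Phi> x l = (\<integral>\<^sup>+w. q x l w * indicator (cball x0 (2 * \<rho>)) w \<partial>lborel)" for x l
    have \<Phi>_meas [measurable]: "(\<lambda>(x, l). \<Phi> x l) \<in> borel_measurable (borel \<Otimes>\<^sub>M borel)"
      unfolding \<Phi>_def q_def by measurable
    \<comment> \<open>The exponent is -(1 + p) - 1: the additional power of l makes up for the
      length of the interval of scales. The last factor restricts to the pairs for which the shift
      of the end point is at most \<rho>.\<close>
    define k where "k x y l = ennreal (l powr (- 2 - p)) * indicator {0<..1/2} l * (if norm (x - y) \<le> \<rho> * l then 1 else 0)"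
      for x y :: "real^3" and l :: real
    have k_meas [measurable]: "(\<lambda>(x, y, l). k x y l) \<in> borel_measurable (borel \<Otimes>\<^sub>M borel \<Otimes>\<^sub>M borel)"
      unfolding k_def by measurable
    define T where "T x y = (\<integral>\<^sup>+l. \<Phi> x l * k x y l \<partial>lborel)" for x y
    have T_meas [measurable]: "(\<lambda>(x, y). T x y) \<in> borel_measurable (borel \<Otimes>\<^sub>M borel)"
      unfolding T_def k_def by measurable
    have average: "ennreal (\<bar>f x - f y\<bar> powr p) * ennreal v \<le> ennreal (2 powr p) * (\<Phi> x l + \<Phi> y l)"
      if l: "0 < l" "l \<le> 1" "norm (x - y) \<le> \<rho> * l" for x y l
    proof -
      let ?z = "\<lambda>w. (1 - l) *\<^sub>R x + l *\<^sub>R w"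
      let ?B = "cball x0 \<rho>"
      \<comment> \<open>The shift solves (1 - l) x + l w = (1 - l) y + l (w + a); it is at most
        \<rho> exactly because |x - y| \<le> \<rho> l and l \<le> 1.\<close>
      define a where "a = ((1 - l) / l) *\<^sub>R (x - y)"
      have "norm a \<le> (1 - l) / l * (\<rho> * l)"
        unfolding a_def using l by (simp add: mult_left_mono del: times_divide_eq_left)
      also have "\<dots> \<le> \<rho>" using l \<rho> by (simp add: mult_left_le_one_le)
      finally have a: "norm a \<le> \<rho>" .
      have "l *\<^sub>R a = (1 - l) *\<^sub>R (x - y)" using l by (simp add: a_def)
      then have z: "?z w = (1 - l) *\<^sub>R y + l *\<^sub>R (w + a)" for w
        by (simp add: scaleR_add_right scaleR_diff_right)
      have aB: "w + a \<in> cball x0 (2 * \<rho>)" if "w \<in> ?B" for w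
        using that a norm_triangle_ineq4[of "x0 - w" a] by (simp add: dist_norm algebra_simps)
      have "ennreal (\<bar>f x - f y\<bar> powr p) * emeasure lborel ?B
          \<le> ennreal (2 powr p) * (\<integral>\<^sup>+w. (q x l w + ennreal (\<bar>f y - f (?z w)\<bar> powr p)) * indicator ?B w \<partial>lborel)"
      proof (rule ennreal_integral_le_cmult)
        fix w
        have "\<bar>f x - f y\<bar> powr p \<le> 2 powr p * (\<bar>f x - f (?z w)\<bar> powr p + \<bar>f y - f (?z w)\<bar> powr p)"
          using abs_add_powr_le[of p "f x - f (?z w)" "f (?z w) - f y"] p by (simp add: abs_minus_commute)
        then show "ennreal (\<bar>f x - f y\<bar> powr p) \<le> ennreal (2 powr p) * (q x l w + ennreal (\<bar>f y - f (?z w)\<bar> powr p))"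
          by (simp add: q_def ennreal_leI flip: ennreal_plus ennreal_mult)
      qed measurable
      also have "(\<integral>\<^sup>+w. (q x l w + ennreal (\<bar>f y - f (?z w)\<bar> powr p)) * indicator ?B w \<partial>lborel)
          = (\<integral>\<^sup>+w. q x l w * indicator ?B w \<partial>lborel) + (\<integral>\<^sup>+w. q y l (w + a) * indicator ?B w \<partial>lborel)"
        unfolding distrib_right z q_def by (rule nn_integral_add) measurable
      finally have split: "ennreal (\<bar>f x - f y\<bar> powr p) * ennreal v \<le> ennreal (2 powr p) *
          ((\<integral>\<^sup>+w. q x l w * indicator ?B w \<partial>lborel) + (\<integral>\<^sup>+w. q y l (w + a) * indicator ?B w \<partial>lborel))"
        unfolding v(1) .
      have 1: "(\<integral>\<^sup>+w. q x l w * indicator ?B w \<partial>lborel) \<le> \<Phi> x l"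
        unfolding \<Phi>_def using \<rho> by (intro nn_integral_mono mult_left_mono) (auto split: split_indicator)
      have "(\<integral>\<^sup>+w. q y l (w + a) * indicator ?B w \<partial>lborel) \<le> (\<integral>\<^sup>+w. q y l (w + a) * indicator (cball x0 (2 * \<rho>)) (w + a) \<partial>lborel)"
        using aB by (intro nn_integral_mono mult_left_mono) (auto split: split_indicator)
      also have "\<dots> = \<Phi> y l"
        unfolding \<Phi>_def by (rule nn_integral_translation) measurable
      finally have 2: "(\<integral>\<^sup>+w. q y l (w + a) * indicator ?B w \<partial>lborel) \<le> \<Phi> y l" .
      show ?thesis by (rule order_trans[OF split mult_left_mono[OF add_mono[OF 1 2]]]) simp
    qed
    have near: "?J x y \<le> ennreal C1 * (T x y + T y x)" if r: "0 < norm (x - y)" "norm (x - y) \<le> \<rho> / 4" for x y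
    proof -
      let ?r = "norm (x - y)"
      \<comment> \<open>The lower end ensures |x - y| \<le> \<rho> l, the upper end makes l
        comparable to |x - y|.\<close>
      let ?A = "{?r / \<rho>..2 * ?r / \<rho>}"
      let ?h = "\<lambda>l. (\<Phi> x l + \<Phi> y l) * k x y l"
      have le: "ennreal (\<bar>f x - f y\<bar> powr p * v * ?r powr (- 2 - p)) \<le> ennreal (2 powr p * (\<rho> / 2) powr (- 2 - p)) * ?h l"
        if l: "l \<in> ?A" for l
      proof -
        have lr: "?r / \<rho> \<le> l" "l \<le> 2 * ?r / \<rho>" using l by auto
        have "0 < ?r / \<rho>" using r(1) \<rho> by (rule divide_pos_pos)
        then have "0 < l" using lr(1) by linarith
        moreover have rl: "?r \<le> \<rho> * l" "\<rho> * l \<le> 2 * ?r"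
          using lr \<rho> by (simp_all add: pos_divide_le_eq pos_le_divide_eq mult.commute)
        \<comment> \<open>The bound |x - y| \<le> \<rho> / 4 enters here: it keeps all scales within
          the half segment.\<close>
        moreover have "\<rho> * l \<le> \<rho> * (1/2)" using rl(2) r(2) by linarith
        then have "l \<le> 1/2" using \<rho> by (simp only: mult_le_cancel_left_pos)
        ultimately have l': "0 < l" "l \<le> 1/2" "?r \<le> \<rho> * l" "\<rho> / 2 * l \<le> ?r" by auto
        have "?r powr (- 2 - p) \<le> (\<rho> / 2 * l) powr (- 2 - p)"
          using l' \<rho> p by (intro powr_mono2') auto
        also have "\<dots> = (\<rho> / 2) powr (- 2 - p) * l powr (- 2 - p)"
          using l' \<rho> by (subst powr_mult) auto
        finally have rr: "?r powr (- 2 - p) \<le> (\<rho> / 2) powr (- 2 - p) * l powr (- 2 - p)" .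
        have "ennreal (\<bar>f x - f y\<bar> powr p * v * ?r powr (- 2 - p))
            = (ennreal (\<bar>f x - f y\<bar> powr p) * ennreal v) * ennreal (?r powr (- 2 - p))"
          using v by (simp add: ennreal_mult)
        also have "\<dots> \<le> (ennreal (2 powr p) * (\<Phi> x l + \<Phi> y l)) * ennreal ((\<rho> / 2) powr (- 2 - p) * l powr (- 2 - p))"
          using l' by (intro mult_mono average ennreal_leI rr) auto
        also have "\<dots> = ennreal (2 powr p * (\<rho> / 2) powr (- 2 - p)) * ?h l"
          using l' by (simp add: k_def ennreal_mult mult_ac)
        finally show ?thesis .
      qed
      have "?J x y * ennreal (v / \<rho>) = ennreal (\<bar>f x - f y\<bar> powr p * v * ?r powr (- 2 - p)) * emeasure lborel ?A"
      proof -
        have "?r powr (- 2 - p) * ?r = 1 / ?r powr (1 + p)"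
          using r powr_add[of ?r "- 2 - p" 1] powr_minus_divide[of ?r "1 + p"] by (simp add: algebra_simps)
        then have "\<bar>f x - f y\<bar> powr p / ?r powr (1 + p) * (v / \<rho>) = \<bar>f x - f y\<bar> powr p * v * ?r powr (- 2 - p) * (2 * ?r / \<rho> - ?r / \<rho>)"
        proof -
          have "2 * ?r / \<rho> - ?r / \<rho> = ?r / \<rho>" by (simp add: field_simps)
          then show ?thesis using \<open>?r powr (- 2 - p) * ?r = 1 / ?r powr (1 + p)\<close>
            by (metis (no_types, opaque_lifting) mult.assoc mult.commute mult_1 times_divide_eq_left times_divide_eq_right)
        qed
        then show ?thesis using r \<rho> v
          by (simp add: ennreal_mult[symmetric] divide_right_mono)
      qed
      also have "\<dots> \<le> ennreal (2 powr p * (\<rho> / 2) powr (- 2 - p)) * (\<integral>\<^sup>+l. ?h l * indicator ?A l \<partial>lborel)"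
        by (rule ennreal_integral_le_cmult[OF le]) measurable
      also have "\<dots> \<le> ennreal (2 powr p * (\<rho> / 2) powr (- 2 - p)) * (\<integral>\<^sup>+l. \<Phi> x l * k x y l + \<Phi> y l * k y x l \<partial>lborel)"
        by (intro mult_left_mono nn_integral_mono)
          (auto simp: k_def norm_minus_commute distrib_right split: split_indicator)
      also have "(\<integral>\<^sup>+l. \<Phi> x l * k x y l + \<Phi> y l * k y x l \<partial>lborel) = T x y + T y x"
        unfolding T_def by (rule nn_integral_add) measurable
      finally have *: "?J x y * ennreal (v / \<rho>) \<le> ennreal (2 powr p * (\<rho> / 2) powr (- 2 - p)) * (T x y + T y x)" .
      have "?J x y = ennreal (\<rho> / v) * (?J x y * ennreal (v / \<rho>))"
      proof -
        have "ennreal (\<rho> / v) * ennreal (v / \<rho>) = 1"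
          using \<rho> v by (subst ennreal_mult[symmetric]) simp_all
        then show ?thesis by (simp only: mult.left_commute[of "ennreal (\<rho> / v)"] mult_1_right)
      qed
      also have "\<dots> \<le> ennreal (\<rho> / v) * (ennreal (2 powr p * (\<rho> / 2) powr (- 2 - p)) * (T x y + T y x))"
        by (intro mult_left_mono *) auto
      also have "\<dots> = ennreal C1 * (T x y + T y x)"
        using \<rho> v by (simp add: C1_def ennreal_mult[symmetric] mult.assoc[symmetric])
      finally show ?thesis .
    qed
    \<comment> \<open>Away from the diagonal the kernel is bounded, and the two values may be
      estimated separately.\<close>
    have far: "?J x y \<le> ennreal C2 * (ennreal (\<bar>f x\<bar> powr p) + ennreal (\<bar>f y\<bar> powr p))" if r: "\<rho> / 4 < norm (x - y)" for x y
    proof -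
      let ?r = "norm (x - y)"
      have "0 < ?r" using r \<rho> by linarith
      have "\<bar>f x - f y\<bar> powr p \<le> 2 powr p * (\<bar>f x\<bar> powr p + \<bar>f y\<bar> powr p)"
        using abs_add_powr_le[of p "f x" "- f y"] p by simp
      moreover have "1 / ?r powr (1 + p) \<le> (4 / \<rho>) powr (1 + p)"
      proof -
        have "(\<rho> / 4) powr (1 + p) \<le> ?r powr (1 + p)" using r \<rho> p by (intro powr_mono2) auto
        then have "1 / ?r powr (1 + p) \<le> 1 / (\<rho> / 4) powr (1 + p)" using \<rho> \<open>0 < ?r\<close> by (intro divide_left_mono) auto
        also have "\<dots> = (4 / \<rho>) powr (1 + p)" using \<rho> by (simp add: powr_divide)
        finally show ?thesis .
      qed
      ultimately have "\<bar>f x - f y\<bar> powr p * (1 / ?r powr (1 + p)) \<le> (2 powr p * (\<bar>f x\<bar> powr p + \<bar>f y\<bar> powr p)) * (4 / \<rho>) powr (1 + p)"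
        by (intro mult_mono) auto
      then have "\<bar>f x - f y\<bar> powr p / ?r powr (1 + p) \<le> C2 * (\<bar>f x\<bar> powr p + \<bar>f y\<bar> powr p)"
        by (simp add: C2_def mult_ac)
      then show ?thesis by (simp add: C2_def ennreal_leI flip: ennreal_plus ennreal_mult)
    qed
    have J: "?J x y \<le> ennreal C1 * (T x y + T y x) + ennreal C2 * (ennreal (\<bar>f x\<bar> powr p) + ennreal (\<bar>f y\<bar> powr p))" for x y
    proof -
      \<comment> \<open>On the diagonal the integrand is 0, since its numerator is
        \<open>0 powr p\<close>.\<close>
      consider "x = y" | "0 < norm (x - y)" "norm (x - y) \<le> \<rho> / 4" | "\<rho> / 4 < norm (x - y)" by force
      then show ?thesis
      proof cases
        case 2 then show ?thesis using near[OF 2] by (simp add: add_increasing2)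
      next
        case 3 then show ?thesis using far[OF 3] by (simp add: add_increasing)
      qed simp
    qed
    have T_int: "(\<integral>\<^sup>+x. \<integral>\<^sup>+y. T x y \<partial>S \<partial>S) \<le> ennreal (c\<sigma> * \<rho>\<^sup>2 * v2 * L) * ?b"
    proof -
      \<comment> \<open>For fixed x and l the kernel is constant on a ball of radius \<rho> l in y;
        its surface measure O(l^2) reduces the weight l^(-2-p) to l^(-p).\<close>
      have inner: "(\<integral>\<^sup>+y. \<Phi> x l * k x y l \<partial>S) \<le> ennreal (c\<sigma> * \<rho>\<^sup>2) * (\<Phi> x l * (ennreal (l powr (- p)) * indicator {0<..1/2} l))" for x l
      proof (cases "l \<in> {0<..1/2}")
        case True
        then have l: "0 < l" by simp
        have "(\<integral>\<^sup>+y. \<Phi> x l * k x y l \<partial>S) = (\<integral>\<^sup>+y. (\<Phi> x l * ennreal (l powr (- 2 - p))) * indicator (cball x (\<rho> * l)) y \<partial>S)"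
          using True by (intro nn_integral_cong) (auto simp: k_def dist_norm split: split_indicator)
        also have "\<dots> = \<Phi> x l * ennreal (l powr (- 2 - p)) * emeasure S (cball x (\<rho> * l))"
          by (rule nn_integral_cmult_indicator) (simp add: sets_S)
        also have "\<dots> \<le> \<Phi> x l * ennreal (l powr (- 2 - p)) * ennreal (c\<sigma> * (\<rho> * l)\<^sup>2)"
          unfolding c\<sigma>_def using l \<rho> by (intro mult_left_mono S_cball) auto
        also have "ennreal (l powr (- 2 - p)) * ennreal (c\<sigma> * (\<rho> * l)\<^sup>2) = ennreal (c\<sigma> * \<rho>\<^sup>2) * ennreal (l powr (- p))"
        proof -
          have "l powr (- 2 - p) * l\<^sup>2 = l powr (- p)"
            using l powr_add[of l "- 2 - p" 2] by (simp add: powr_numeral)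
          then have "l powr (- 2 - p) * (c\<sigma> * (\<rho> * l)\<^sup>2) = (c\<sigma> * \<rho>\<^sup>2) * l powr (- p)"
            by (simp add: power_mult_distrib mult_ac)
          then show ?thesis using L by (simp add: ennreal_mult[symmetric])
        qed
        then have "\<Phi> x l * ennreal (l powr (- 2 - p)) * ennreal (c\<sigma> * (\<rho> * l)\<^sup>2) = ennreal (c\<sigma> * \<rho>\<^sup>2) * (\<Phi> x l * (ennreal (l powr (- p)) * indicator {0<..1/2} l))"
          using True by (simp add: mult_ac)
        finally show ?thesis .
      next
        case False
        then show ?thesis by (simp add: k_def)
      qed
      have "(\<integral>\<^sup>+x. \<integral>\<^sup>+y. T x y \<partial>S \<partial>S) = (\<integral>\<^sup>+x. \<integral>\<^sup>+l. \<integral>\<^sup>+y. \<Phi> x l * k x y l \<partial>S \<partial>lborel \<partial>S)"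
        unfolding T_def by (intro nn_integral_cong S_lborel.Fubini'[symmetric]) measurable
      also have "\<dots> \<le> (\<integral>\<^sup>+x. \<integral>\<^sup>+l. ennreal (c\<sigma> * \<rho>\<^sup>2) * (\<Phi> x l * (ennreal (l powr (- p)) * indicator {0<..1/2} l)) \<partial>lborel \<partial>S)"
        by (intro nn_integral_mono inner)
      also have "\<dots> = ennreal (c\<sigma> * \<rho>\<^sup>2) * (\<integral>\<^sup>+x. \<integral>\<^sup>+l. \<Phi> x l * (ennreal (l powr (- p)) * indicator {0<..1/2} l) \<partial>lborel \<partial>S)"
        by (simp add: nn_integral_cmult)
      also have "(\<integral>\<^sup>+x. \<integral>\<^sup>+l. \<Phi> x l * (ennreal (l powr (- p)) * indicator {0<..1/2} l) \<partial>lborel \<partial>S)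
          = (\<integral>\<^sup>+x. \<integral>\<^sup>+l. \<integral>\<^sup>+w. (q x l w * (ennreal (l powr (- p)) * indicator {0<..1/2} l)) * indicator (cball x0 (2 * \<rho>)) w \<partial>lborel \<partial>lborel \<partial>S)"
        unfolding \<Phi>_def
        by (intro nn_integral_cong, subst nn_integral_multc[symmetric]) (auto intro!: nn_integral_cong simp: mult_ac)
      \<comment> \<open>Two exchanges bring w outermost, so that the Hardy estimate can be applied
        for each fixed end point.\<close>
      also have "\<dots> = (\<integral>\<^sup>+x. \<integral>\<^sup>+w. \<integral>\<^sup>+l. (q x l w * (ennreal (l powr (- p)) * indicator {0<..1/2} l)) * indicator (cball x0 (2 * \<rho>)) w \<partial>lborel \<partial>lborel \<partial>S)"
        unfolding q_def by (intro nn_integral_cong lborel_pair.Fubini') measurable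
      also have "\<dots> = (\<integral>\<^sup>+w. \<integral>\<^sup>+x. \<integral>\<^sup>+l. (q x l w * (ennreal (l powr (- p)) * indicator {0<..1/2} l)) * indicator (cball x0 (2 * \<rho>)) w \<partial>lborel \<partial>S \<partial>lborel)"
        unfolding q_def by (intro S_lborel.Fubini'[symmetric]) measurable
      also have "\<dots> \<le> (\<integral>\<^sup>+w. (ennreal L * ?b) * indicator (cball x0 (2 * \<rho>)) w \<partial>lborel)"
      proof (rule nn_integral_mono)
        fix w
        show "(\<integral>\<^sup>+x. \<integral>\<^sup>+l. (q x l w * (ennreal (l powr (- p)) * indicator {0<..1/2} l)) * indicator (cball x0 (2 * \<rho>)) w \<partial>lborel \<partial>S)
            \<le> (ennreal L * ?b) * indicator (cball x0 (2 * \<rho>)) w"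
        proof (cases "w \<in> cball x0 (2 * \<rho>)")
          case True
          have "q x l w * (ennreal (l powr (- p)) * indicator {0<..1/2} l) = ennreal ((\<bar>f ((1 - l) *\<^sub>R x + l *\<^sub>R w) - f x\<bar> / l) powr p) * indicator {0<..1/2} l" for x l
            by (auto simp: q_def powr_divide powr_minus_divide abs_minus_commute ennreal_mult[symmetric] split: split_indicator)
          then show ?thesis
            using nn_integral_segment_quotient[OF f p b True] True by (simp add: L_def del: mem_cball)
        qed simp
      qed
      also have "\<dots> = ennreal L * ?b * ennreal v2"
        unfolding v2(1)[symmetric] by (rule nn_integral_cmult_indicator) simp
      also have "ennreal (c\<sigma> * \<rho>\<^sup>2) * (ennreal L * ?b * ennreal v2) = ennreal (c\<sigma> * \<rho>\<^sup>2 * v2 * L) * ?b"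
        using L v2 by (simp add: ennreal_mult mult_ac)
      finally show ?thesis by (simp add: mult_left_mono)
    qed
    have "(\<integral>\<^sup>+x. \<integral>\<^sup>+y. ?J x y \<partial>S \<partial>S)
        \<le> (\<integral>\<^sup>+x. \<integral>\<^sup>+y. ennreal C1 * (T x y + T y x) + ennreal C2 * (ennreal (\<bar>f x\<bar> powr p) + ennreal (\<bar>f y\<bar> powr p)) \<partial>S \<partial>S)"
      by (intro nn_integral_mono J)
    also have "\<dots> = ennreal C1 * ((\<integral>\<^sup>+x. \<integral>\<^sup>+y. T x y \<partial>S \<partial>S) + (\<integral>\<^sup>+x. \<integral>\<^sup>+y. T y x \<partial>S \<partial>S))
        + ennreal C2 * ((\<integral>\<^sup>+x. ennreal (\<bar>f x\<bar> powr p) \<partial>S) * ennreal m + (\<integral>\<^sup>+x. ennreal (\<bar>f x\<bar> powr p) \<partial>S) * ennreal m)"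
      by (simp add: nn_integral_add nn_integral_cmult nn_integral_multc m(1) mult.commute)
    also have "(\<integral>\<^sup>+x. \<integral>\<^sup>+y. T y x \<partial>S \<partial>S) = (\<integral>\<^sup>+x. \<integral>\<^sup>+y. T x y \<partial>S \<partial>S)"
      by (rule S_S.Fubini') measurable
    also have "ennreal C1 * ((\<integral>\<^sup>+x. \<integral>\<^sup>+y. T x y \<partial>S \<partial>S) + (\<integral>\<^sup>+x. \<integral>\<^sup>+y. T x y \<partial>S \<partial>S))
        + ennreal C2 * ((\<integral>\<^sup>+x. ennreal (\<bar>f x\<bar> powr p) \<partial>S) * ennreal m + (\<integral>\<^sup>+x. ennreal (\<bar>f x\<bar> powr p) \<partial>S) * ennreal m)
      \<le> ennreal C1 * (ennreal (c\<sigma> * \<rho>\<^sup>2 * v2 * L) * ?b + ennreal (c\<sigma> * \<rho>\<^sup>2 * v2 * L) * ?b)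
        + ennreal C2 * ((ennreal Ct * sobolev_energy p f) * ennreal m + (ennreal Ct * sobolev_energy p f) * ennreal m)"
      by (intro add_mono mult_left_mono mult_right_mono T_int Ct f) auto
    also have "\<dots> \<le> ennreal C1 * (ennreal (c\<sigma> * \<rho>\<^sup>2 * v2 * L) * sobolev_energy p f + ennreal (c\<sigma> * \<rho>\<^sup>2 * v2 * L) * sobolev_energy p f)
        + ennreal C2 * ((ennreal Ct * sobolev_energy p f) * ennreal m + (ennreal Ct * sobolev_energy p f) * ennreal m)"
      by (intro add_mono mult_left_mono order_refl) (auto simp: sobolev_energy_def)
    also have "\<dots> = (ennreal C1 * (ennreal (c\<sigma> * \<rho>\<^sup>2 * v2 * L) + ennreal (c\<sigma> * \<rho>\<^sup>2 * v2 * L))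
        + ennreal C2 * (ennreal Ct * ennreal m + ennreal Ct * ennreal m)) * sobolev_energy p f"
      by (simp add: distrib_left distrib_right mult_ac)
    also have "\<dots> = ennreal (C - 1) * sobolev_energy p f"
    proof -
      have "0 \<le> C2" "0 \<le> Ct" "0 \<le> c\<sigma> * \<rho>\<^sup>2 * v2 * L" using Ct L v2 by (auto simp: C2_def)
      then have "ennreal C1 * (ennreal (c\<sigma> * \<rho>\<^sup>2 * v2 * L) + ennreal (c\<sigma> * \<rho>\<^sup>2 * v2 * L))
        + ennreal C2 * (ennreal Ct * ennreal m + ennreal Ct * ennreal m)
        = ennreal (C1 * (c\<sigma> * \<rho>\<^sup>2 * v2 * L + c\<sigma> * \<rho>\<^sup>2 * v2 * L) + C2 * (Ct * m + Ct * m))"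
        using C1 m by (simp only: ennreal_plus ennreal_mult mult_nonneg_nonneg add_nonneg_nonneg)
      also have "C1 * (c\<sigma> * \<rho>\<^sup>2 * v2 * L + c\<sigma> * \<rho>\<^sup>2 * v2 * L) + C2 * (Ct * m + Ct * m) = C - 1"
        by (simp add: C_def)
      finally show ?thesis by simp
    qed
    also have "\<dots> \<le> ennreal C * sobolev_energy p f" by (intro mult_right_mono ennreal_leI) auto
    finally show "(\<integral>\<^sup>+x. \<integral>\<^sup>+y. ?J x y \<partial>S \<partial>S) \<le> ennreal C * sobolev_energy p f" .
  qed
qed

end

section \<open>Mollification\<close>

lemma test_functionI:
  assumes "smooth f" "closed K" "bounded K" "K \<subseteq> U" "\<And>x. x \<notin> K \<Longrightarrow> f x = 0"
  shows "f \<in> test_functions U"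
proof -
  have "closure {x. f x \<noteq> 0} \<subseteq> K" by (rule closure_minimal) (use assms in auto)
  moreover have "compact (closure {x. f x \<noteq> 0})"
    using bounded_subset[OF assms(3)] closure_subset calculation by (auto simp: compact_eq_bounded_closed)
  ultimately show ?thesis using assms by (auto simp: test_functions_def)
qed

lemma test_function_support:
  assumes "f \<in> test_functions U"
  obtains R where "\<And>x. R < norm x \<Longrightarrow> f x = 0"
proof -
  have "bounded {x. f x \<noteq> 0}"
    using assms bounded_subset[OF compact_imp_bounded closure_subset] by (auto simp: test_functions_def)
  then obtain R where "\<And>x. f x \<noteq> 0 \<Longrightarrow> norm x \<le> R" by (auto simp: bounded_iff)
  then show thesis by (intro that[of R]) force
qed

lemma test_function_smooth: "f \<in> test_functions U \<Longrightarrow> smooth f"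
  by (simp add: test_functions_def)

lemma mollifier_exists:
  assumes "0 < r"
  obtains \<eta> :: "real^3 \<Rightarrow> real" where "smooth \<eta>" "\<And>x. 0 \<le> \<eta> x" "\<And>x. x \<notin> cball z r \<Longrightarrow> \<eta> x = 0"
    "integrable lborel \<eta>" "(LINT x|lborel. \<eta> x) = 1"
proof -
  obtain a b where ab: "z \<in> box a b" "cbox a b \<subseteq> ball z r"
    using open_contains_cbox[OF open_ball, of z z r] assms by (metis centre_in_ball)
  define f where "f = box_bump a b"
  have f: "smooth f" "\<And>x. 0 \<le> f x" "\<And>x. f x = 0 \<longleftrightarrow> x \<notin> box a b"
    by (auto simp: f_def smooth_box_bump box_bump_pos)
  have sub: "box a b \<subseteq> ball z r" using ab box_subset_cbox by blast
  have f0: "f x = 0" if "x \<notin> cball z r" for x using that sub f(3) by (auto simp del: mem_cball dest: subsetD[OF ball_subset_cball])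
  have int: "integrable lborel f"
  proof -
    have "norm x \<le> norm z + r" if "x \<in> cball z r" for x using that norm_triangle_ineq2[of x z] by (simp add: dist_norm norm_minus_commute)
    then have "f x = 0" if "norm z + r < norm x" for x using f0 that by (meson not_le)
    from integrable_bounded_support[OF smooth_continuous[OF f(1)] this, where A=UNIV] show ?thesis by simp
  qed
  have "(LINT x|lborel. f x) \<noteq> 0"
  proof
    assume "(LINT x|lborel. f x) = 0"
    then have "AE x in lborel. f x = 0" using int f(2) by (subst (asm) integral_nonneg_eq_0_iff_AE) auto
    then have "AE x in lborel. x \<notin> box a b" by (simp add: f)
    then have "emeasure lborel (box a b) = 0" by (subst (asm) AE_iff_measurable[where N="box a b"]) auto
    moreover have "emeasure lborel (box a b) > 0"
      using ab(1) by (subst emeasure_lborel_box) (auto simp: mem_box intro!: prod_pos intro: less_imp_le less_trans simp: inner_diff_left)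
    ultimately show False by simp
  qed
  moreover have "0 \<le> (LINT x|lborel. f x)" using f(2) by (intro integral_nonneg_AE) auto
  ultimately have pos: "0 < (LINT x|lborel. f x)" by simp
  have "smooth (\<lambda>x. (1 / (LINT x|lborel. f x)) * f x)" by (intro smooth_mult smooth_const f)
  then show thesis
    by (rule that) (use f f0 int pos in \<open>auto simp del: mem_cball\<close>)
qed

section \<open>Differentiation of convolutions\<close>

lemma integrable_mult_bounded:
  fixes g k :: "'a \<Rightarrow> real"
  assumes "integrable M g" "k \<in> borel_measurable M" "\<And>x. \<bar>k x\<bar> \<le> B"
  shows "integrable M (\<lambda>x. g x * k x)"
proof (rule Bochner_Integration.integrable_bound)
  show "integrable M (\<lambda>x. B * g x)" using assms by simp
  show "(\<lambda>x. g x * k x) \<in> borel_measurable M" using assms(1,2) by measurable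
  have "norm (g x * k x) \<le> norm (B * g x)" for x
    using mult_mono[OF assms(3)[of x], of "\<bar>g x\<bar>" "\<bar>g x\<bar>"] order_trans[OF abs_ge_zero assms(3)[of x]]
    by (simp add: abs_mult mult.commute)
  then show "AE x in M. norm (g x * k x) \<le> norm (B * g x)" by simp
qed

lemma smooth_bounded_support:
  assumes "smooth f" "\<And>x. R < norm x \<Longrightarrow> f x = 0"
  obtains B where "0 \<le> B" "\<And>x. \<bar>f x\<bar> \<le> B"
proof -
  obtain M where M: "0 \<le> M" "\<And>x. \<bar>f x\<bar> \<le> M * indicator (cball 0 R) x"
    using bounded_support_bound[OF smooth_continuous[OF assms(1)] assms(2)] by blast
  have "\<bar>f x\<bar> \<le> M" for x using M(2)[of x] M(1) by (auto split: split_indicator_asm)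
  with M(1) show thesis by (rule that)
qed

text \<open>The second derivatives are continuous with bounded support, hence bounded, and two
  applications of the mean value theorem give a Taylor remainder that is uniform in x.\<close>

lemma smooth_second_order:
  assumes f: "smooth f" and R: "\<And>x. R < norm x \<Longrightarrow> f x = 0"
  obtains B where "0 \<le> B" "\<And>x h. \<bar>f (x + h) - f x - dir_deriv h f x\<bar> \<le> B * (norm h)\<^sup>2"
proof -
  have R1: "partial_deriv i f x = 0" if "R < norm x" for i x
    using dir_deriv_eq_0_outside[OF f R that, of "axis i 1"] by simp
  have R2: "partial_deriv j (partial_deriv i f) x = 0" if "R < norm x" for i j x
    using dir_deriv_eq_0_outside[OF smooth_partial_deriv[OF f] R1 that, of "axis j 1"] by simp
  have "\<exists>B. 0 \<le> B \<and> (\<forall>x. \<bar>partial_deriv j (partial_deriv i f) x\<bar> \<le> B)" for i j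
    using smooth_bounded_support[OF smooth_partial_deriv[OF smooth_partial_deriv[OF f]] R2] by metis
  then have "\<exists>b. \<forall>i j. 0 \<le> b i j \<and> (\<forall>x. \<bar>partial_deriv j (partial_deriv i f) x\<bar> \<le> b i j)"
    by (intro choice allI)
  then obtain b where b: "\<And>i j. 0 \<le> b i j" "\<And>i j x. \<bar>partial_deriv j (partial_deriv i f) x\<bar> \<le> b i j" by blast
  define B where "B = (\<Sum>j\<in>UNIV. \<Sum>i\<in>UNIV. b i j)"
  have dd: "\<bar>dir_deriv h (dir_deriv h f) x\<bar> \<le> B * (norm h)\<^sup>2" for x h
  proof -
    have "partial_deriv j (dir_deriv h f) x = (\<Sum>i\<in>UNIV. h $ i * partial_deriv j (partial_deriv i f) x)" for j
      using dir_deriv_commute[OF f, of "axis j 1" h x] partial_deriv_commute[OF f, of _ j]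
      by (simp add: dir_deriv_def)
    then have "\<bar>dir_deriv h (dir_deriv h f) x\<bar> = \<bar>\<Sum>j\<in>UNIV. \<Sum>i\<in>UNIV. h $ j * h $ i * partial_deriv j (partial_deriv i f) x\<bar>"
      by (simp add: dir_deriv_def[of h "dir_deriv h f"] sum_distrib_left mult.assoc)
    also have "\<dots> \<le> (\<Sum>j\<in>UNIV. \<Sum>i\<in>UNIV. norm h * norm h * b i j)"
      by (rule order_trans[OF sum_abs], intro sum_mono, rule order_trans[OF sum_abs], intro sum_mono)
        (auto simp: abs_mult intro!: mult_mono component_le_norm_cart b)
    also have "\<dots> = B * (norm h)\<^sup>2"
      by (simp add: B_def sum_distrib_right sum_distrib_left power2_eq_square mult.commute)
    finally show ?thesis .
  qed
  show thesis
  proof (rule that)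
    show "0 \<le> B" unfolding B_def by (intro sum_nonneg b)
    fix x h
    obtain s where s: "0 < s" "s < 1" "f (x + 1 *\<^sub>R h) - f (x + 0 *\<^sub>R h) = (1 - 0) * dir_deriv h f (x + s *\<^sub>R h)"
      using MVT2[of 0 1 "\<lambda>t. f (x + t *\<^sub>R h)" "\<lambda>t. dir_deriv h f (x + t *\<^sub>R h)"] smooth_line_derivative[OF f] by force
    obtain t where t: "0 < t" "t < s" "dir_deriv h f (x + s *\<^sub>R h) - dir_deriv h f (x + 0 *\<^sub>R h) = (s - 0) * dir_deriv h (dir_deriv h f) (x + t *\<^sub>R h)"
      using MVT2[of 0 s "\<lambda>t. dir_deriv h f (x + t *\<^sub>R h)" "\<lambda>t. dir_deriv h (dir_deriv h f) (x + t *\<^sub>R h)"]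
        smooth_line_derivative[OF smooth_dir_deriv[OF f]] s(1) by blast
    have "\<bar>f (x + h) - f x - dir_deriv h f x\<bar> = s * \<bar>dir_deriv h (dir_deriv h f) (x + t *\<^sub>R h)\<bar>"
      using s t by (simp add: abs_mult)
    also have "\<dots> \<le> 1 * (B * (norm h)\<^sup>2)" using s dd by (intro mult_mono) auto
    finally show "\<bar>f (x + h) - f x - dir_deriv h f x\<bar> \<le> B * (norm h)\<^sup>2" by simp
  qed
qed

text \<open>The uniform second-order remainder of k, integrated against |g|, is O(|h|^2), so the
  derivative may be taken under the integral for every integrable g. The argument c y + d x of the
  kernel is the form that the contraction produces.\<close>

lemma convolution_has_derivative:
  assumes g: "integrable lborel g" and k: "smooth k" and R: "\<And>x. R < norm x \<Longrightarrow> k x = 0"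
  shows "((\<lambda>x. LINT y|lborel. g y * k (c *\<^sub>R y + d *\<^sub>R x)) has_derivative
    (\<lambda>h. \<Sum>i\<in>UNIV. h $ i * (d * (LINT y|lborel. g y * partial_deriv i k (c *\<^sub>R y + d *\<^sub>R x))))) (at x)"
    (is "(?F has_derivative ?D) _")
proof -
  have R1: "partial_deriv i k x = 0" if "R < norm x" for i x
    using dir_deriv_eq_0_outside[OF k R that, of "axis i 1"] by simp
  have [measurable]: "k \<in> borel_measurable borel" by (rule smooth_borel[OF k])
  have [measurable]: "partial_deriv i k \<in> borel_measurable borel" for i by (rule smooth_borel[OF smooth_partial_deriv[OF k]])
  have [measurable]: "g \<in> borel_measurable borel" using g by auto
  have int: "integrable lborel (\<lambda>y. g y * k (c *\<^sub>R y + d *\<^sub>R x))" for x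
    by (rule smooth_bounded_support[OF k R]) (auto intro!: integrable_mult_bounded[OF g])
  have inti: "integrable lborel (\<lambda>y. g y * partial_deriv i k (c *\<^sub>R y + d *\<^sub>R x))" for x i
    by (rule smooth_bounded_support[OF smooth_partial_deriv[OF k, of i] R1]) (auto intro!: integrable_mult_bounded[OF g])
  have Dd: "?D h = (LINT y|lborel. g y * dir_deriv (d *\<^sub>R h) k (c *\<^sub>R y + d *\<^sub>R x))" for h
  proof -
    have "(LINT y|lborel. g y * dir_deriv (d *\<^sub>R h) k (c *\<^sub>R y + d *\<^sub>R x))
        = (LINT y|lborel. (\<Sum>i\<in>UNIV. (h $ i * d) * (g y * partial_deriv i k (c *\<^sub>R y + d *\<^sub>R x))))"
      by (intro Bochner_Integration.integral_cong) (auto simp: dir_deriv_def sum_distrib_left mult_ac)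
    also have "\<dots> = (\<Sum>i\<in>UNIV. (h $ i * d) * (LINT y|lborel. g y * partial_deriv i k (c *\<^sub>R y + d *\<^sub>R x)))"
      using inti by (subst Bochner_Integration.integral_sum) auto
    finally show ?thesis by (simp add: mult.assoc)
  qed
  have intd: "integrable lborel (\<lambda>y. g y * dir_deriv v k (c *\<^sub>R y + d *\<^sub>R x))" for v x
  proof -
    have "(\<lambda>y. g y * dir_deriv v k (c *\<^sub>R y + d *\<^sub>R x)) = (\<lambda>y. \<Sum>i\<in>UNIV. v $ i * (g y * partial_deriv i k (c *\<^sub>R y + d *\<^sub>R x)))"
      by (auto simp: dir_deriv_def sum_distrib_left mult_ac)
    then show ?thesis using inti by simp
  qed
  obtain B where B: "0 \<le> B" "\<And>x h. \<bar>k (x + h) - k x - dir_deriv h k x\<bar> \<le> B * (norm h)\<^sup>2"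
    using smooth_second_order[OF k R] by blast
  define C where "C = (LINT y|lborel. \<bar>g y\<bar>) * (B * d\<^sup>2)"
  have bnd: "norm (?F (x + h) - ?F x - ?D h) \<le> C * (norm h)\<^sup>2" for h
  proof -
    let ?e = "\<lambda>y. k (c *\<^sub>R y + d *\<^sub>R (x + h)) - k (c *\<^sub>R y + d *\<^sub>R x) - dir_deriv (d *\<^sub>R h) k (c *\<^sub>R y + d *\<^sub>R x)"
    have "?F (x + h) - ?F x - ?D h = (LINT y|lborel. g y * k (c *\<^sub>R y + d *\<^sub>R (x + h))) - (LINT y|lborel. g y * k (c *\<^sub>R y + d *\<^sub>R x))
        - (LINT y|lborel. g y * dir_deriv (d *\<^sub>R h) k (c *\<^sub>R y + d *\<^sub>R x))"
      unfolding Dd by (rule refl)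
    also have "\<dots> = (LINT y|lborel. g y * ?e y)"
      unfolding right_diff_distrib
      by (simp only: Bochner_Integration.integral_diff[OF Bochner_Integration.integrable_diff[OF int int] intd]
        Bochner_Integration.integral_diff[OF int int])
    finally have eq: "?F (x + h) - ?F x - ?D h = (LINT y|lborel. g y * ?e y)" .
    have "integrable lborel (\<lambda>y. g y * ?e y)"
      unfolding right_diff_distrib
      by (rule Bochner_Integration.integrable_diff[OF Bochner_Integration.integrable_diff[OF int int] intd])
    then have inte: "integrable lborel (\<lambda>y. norm (g y * ?e y))" by (rule integrable_norm)
    have intg: "integrable lborel (\<lambda>y. \<bar>g y\<bar> * (B * d\<^sup>2 * (norm h)\<^sup>2))" using g by (intro integrable_mult_left) auto
    have le: "norm (g y * ?e y) \<le> \<bar>g y\<bar> * (B * d\<^sup>2 * (norm h)\<^sup>2)" for y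
    proof -
      have "\<bar>?e y\<bar> \<le> B * (norm (d *\<^sub>R h))\<^sup>2"
        using B(2)[of "c *\<^sub>R y + d *\<^sub>R x" "d *\<^sub>R h"] by (simp add: scaleR_add_right add.assoc)
      then have "\<bar>?e y\<bar> \<le> B * d\<^sup>2 * (norm h)\<^sup>2" by (simp add: power_mult_distrib mult.assoc)
      then show ?thesis unfolding real_norm_def abs_mult by (rule mult_left_mono) simp
    qed
    have "norm (?F (x + h) - ?F x - ?D h) \<le> (LINT y|lborel. norm (g y * ?e y))"
      unfolding eq by (rule integral_norm_bound)
    also have "\<dots> \<le> (LINT y|lborel. \<bar>g y\<bar> * (B * d\<^sup>2 * (norm h)\<^sup>2))"
      by (rule integral_mono[OF inte intg le])
    also have "\<dots> = C * (norm h)\<^sup>2" by (simp add: C_def mult.assoc)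
    finally show ?thesis .
  qed
  show ?thesis
  proof (rule has_derivativeI)
    show "bounded_linear ?D"
      by (intro bounded_linear_sum bounded_linear_mult_const bounded_linear_vec_nth)
    have "((\<lambda>y. norm (?F y - ?F x - ?D (y - x)) / norm (y - x)) \<longlongrightarrow> 0) (at x)"
    proof (rule Lim_null_comparison)
      have "norm (norm (?F y - ?F x - ?D (y - x)) / norm (y - x)) \<le> C * norm (y - x)" if "y \<noteq> x" for y
        using bnd[of "y - x"] that by (simp add: divide_le_eq power2_eq_square mult.assoc)
      then show "\<forall>\<^sub>F y in at x. norm (norm (?F y - ?F x - ?D (y - x)) / norm (y - x)) \<le> C * norm (y - x)"
        by (auto simp: eventually_at_filter)
      show "((\<lambda>y. C * norm (y - x)) \<longlongrightarrow> 0) (at x)" by (auto intro!: tendsto_eq_intros)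
    qed
    then show "((\<lambda>y. (?F y - ?F x - ?D (y - x)) /\<^sub>R norm (y - x)) \<longlongrightarrow> 0) (at x)"
      by (subst tendsto_norm_zero_iff[symmetric]) (simp add: divide_inverse mult.commute abs_mult)
  qed
qed

lemma smooth_convolution:
  assumes g: "integrable lborel g" and k: "smooth k" "\<And>x. R < norm x \<Longrightarrow> k x = 0"
  shows "smooth (\<lambda>x. LINT y|lborel. g y * k (c *\<^sub>R y + d *\<^sub>R x))"
    and partial_deriv_convolution: "partial_deriv i (\<lambda>x. LINT y|lborel. g y * k (c *\<^sub>R y + d *\<^sub>R x)) x
      = d * (LINT y|lborel. g y * partial_deriv i k (c *\<^sub>R y + d *\<^sub>R x))"
proof -
  have pd: "partial_deriv i (\<lambda>x. LINT y|lborel. g y * k (c *\<^sub>R y + d *\<^sub>R x)) x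
      = d * (LINT y|lborel. g y * partial_deriv i k (c *\<^sub>R y + d *\<^sub>R x))"
    if "smooth k" "\<And>x. R < norm x \<Longrightarrow> k x = 0" for k x i
    using partial_derivI[OF convolution_has_derivative[OF g that], where i=i] by simp
  then show "partial_deriv i (\<lambda>x. LINT y|lborel. g y * k (c *\<^sub>R y + d *\<^sub>R x)) x
      = d * (LINT y|lborel. g y * partial_deriv i k (c *\<^sub>R y + d *\<^sub>R x))" using k by blast
  \<comment> \<open>The scalar absorbs the powers of \<open>d\<close>, and one radius R serves all
    kernels, since derivatives vanish where the function vanishes on an open set.\<close>
  let ?C = "{\<lambda>x. a * (LINT y|lborel. g y * k (c *\<^sub>R y + d *\<^sub>R x)) | a k. smooth k \<and> (\<forall>x. R < norm x \<longrightarrow> k x = 0)}"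
  show "smooth (\<lambda>x. LINT y|lborel. g y * k (c *\<^sub>R y + d *\<^sub>R x))"
  proof (rule smooth_coinduct)
    show "(\<lambda>x. LINT y|lborel. g y * k (c *\<^sub>R y + d *\<^sub>R x)) \<in> ?C"
      using k by (intro CollectI exI[of _ 1] exI[of _ k]) auto
    fix f assume "f \<in> ?C"
    then obtain a k where ak: "f = (\<lambda>x. a * (LINT y|lborel. g y * k (c *\<^sub>R y + d *\<^sub>R x)))" "smooth k"
      "\<And>x. R < norm x \<Longrightarrow> k x = 0" by blast
    have D: "(f has_derivative (\<lambda>h. a * (\<Sum>i\<in>UNIV. h $ i * (d * (LINT y|lborel. g y * partial_deriv i k (c *\<^sub>R y + d *\<^sub>R x)))))) (at x)" for x
      unfolding ak(1) by (intro has_derivative_mult_right convolution_has_derivative[OF g ak(2,3)])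
    then show "f differentiable_on UNIV" by (auto simp: differentiable_on_def differentiable_def)
    fix i
    have "partial_deriv i f = (\<lambda>x. (a * d) * (LINT y|lborel. g y * partial_deriv i k (c *\<^sub>R y + d *\<^sub>R x)))"
      by (rule ext, rule trans[OF partial_derivI[OF D]]) simp
    moreover have "\<forall>x. R < norm x \<longrightarrow> partial_deriv i k x = 0"
      using dir_deriv_eq_0_outside[OF ak(2,3), where v="axis i 1"] by simp
    ultimately show "partial_deriv i f \<in> ?C"
      using smooth_partial_deriv[OF ak(2)] by blast
  qed
qed

text \<open>Young's inequality absorbs (p - 1) / 2 of the coefficient p; the first factor is the
  inverse of the remaining (p + 1) / 2 and the rest is the constant of
  \<open>powr_young\<close>.\<close>

definition mean_const :: "real \<Rightarrow> real" where
  "mean_const p = 2 / (p + 1) * (p * ((p - 1) / (2 * p)) powr (1 - p))"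

lemma mean_const_pos: "1 < p \<Longrightarrow> 0 < mean_const p"
  by (simp add: mean_const_def)

text \<open>Jensen's inequality up to a constant, by integrating Young's inequality.\<close>

lemma mean_powr_le:
  assumes p: "1 < p" and \<eta>: "\<And>x. 0 \<le> \<eta> x" "integrable M \<eta>" "(LINT x|M. \<eta> x) = 1"
    and h: "h \<in> borel_measurable M" "integrable M (\<lambda>x. h x * \<eta> x)"
  shows "ennreal (\<bar>LINT x|M. h x * \<eta> x\<bar> powr p) \<le> ennreal (mean_const p) * (\<integral>\<^sup>+x. ennreal (\<bar>h x\<bar> powr p * \<eta> x) \<partial>M)"
proof (cases "(\<integral>\<^sup>+x. ennreal (\<bar>h x\<bar> powr p * \<eta> x) \<partial>M) = \<infinity>")
  case True
  then show ?thesis using mean_const_pos[OF p] by (simp add: ennreal_mult_top)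
next
  case False
  have [measurable]: "h \<in> borel_measurable M" "\<eta> \<in> borel_measurable M" using h \<eta>(2) by auto
  have int: "integrable M (\<lambda>x. \<bar>h x\<bar> powr p * \<eta> x)"
    using False \<eta>(1) by (intro integrableI_nonneg) (auto simp: less_top)
  define I where "I = (LINT x|M. \<bar>h x\<bar> powr p * \<eta> x)"
  define m where "m = (LINT x|M. \<bar>h x\<bar> * \<eta> x)"
  define K where "K = p * ((p - 1) / (2 * p)) powr (1 - p)"
  have inth: "integrable M (\<lambda>x. \<bar>h x\<bar> * \<eta> x)"
    using integrable_norm[OF h(2)] \<eta>(1) by (simp add: abs_mult)
  have m: "\<bar>LINT x|M. h x * \<eta> x\<bar> \<le> m"
    using integral_norm_bound[of M "\<lambda>x. h x * \<eta> x"] \<eta>(1) by (simp add: m_def abs_mult)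
  then have m0: "0 \<le> m" by simp
  \<comment> \<open>Young's inequality with the mean m in the first and |h x| in the second place,
    weighted by \<eta>. As \<eta> has mass 1, both sides contain a multiple of m^p.\<close>
  have "(LINT x|M. p * m powr (p - 1) * (\<bar>h x\<bar> * \<eta> x)) \<le> (LINT x|M. (p - 1) / 2 * m powr p * \<eta> x + K * (\<bar>h x\<bar> powr p * \<eta> x))"
  proof (rule integral_mono)
    show "integrable M (\<lambda>x. p * m powr (p - 1) * (\<bar>h x\<bar> * \<eta> x))" by (rule integrable_mult_right[OF inth])
    show "integrable M (\<lambda>x. (p - 1) / 2 * m powr p * \<eta> x + K * (\<bar>h x\<bar> powr p * \<eta> x))"
      by (rule Bochner_Integration.integrable_add[OF integrable_mult_right[OF \<eta>(2)] integrable_mult_right[OF int]])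
    fix x
    show "p * m powr (p - 1) * (\<bar>h x\<bar> * \<eta> x) \<le> (p - 1) / 2 * m powr p * \<eta> x + K * (\<bar>h x\<bar> powr p * \<eta> x)"
      using mult_right_mono[OF powr_young[OF p m0, of "\<bar>h x\<bar>"] \<eta>(1)[of x]] unfolding K_def[symmetric]
      by (simp add: distrib_right mult.assoc)
  qed
  also have "\<dots> = (p - 1) / 2 * m powr p + K * I"
    unfolding I_def
    by (subst Bochner_Integration.integral_add[OF integrable_mult_right[OF \<eta>(2)] integrable_mult_right[OF int]])
      (simp only: integral_mult_right_zero \<eta>(3) mult_1_right)
  also have "(LINT x|M. p * m powr (p - 1) * (\<bar>h x\<bar> * \<eta> x)) = p * (m powr (p - 1) * m)"
    by (simp only: integral_mult_right_zero m_def mult.assoc)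
  also have "m powr (p - 1) * m = m powr p"
    using m0 p powr_mult_base[of m "p - 1"] by (simp add: mult.commute)
  finally have "(p + 1) / 2 * m powr p \<le> K * I" by (simp add: field_simps)
  then have "2 / (p + 1) * ((p + 1) / 2 * m powr p) \<le> 2 / (p + 1) * (K * I)"
    using p by (intro mult_left_mono) auto
  moreover have "2 / (p + 1) * ((p + 1) / 2 * m powr p) = m powr p" using p by simp
  ultimately have "m powr p \<le> mean_const p * I"
    unfolding mean_const_def K_def[symmetric] by (simp only: mult.assoc)
  moreover have "\<bar>LINT x|M. h x * \<eta> x\<bar> powr p \<le> m powr p" using m p by (intro powr_mono2) auto
  ultimately have "ennreal (\<bar>LINT x|M. h x * \<eta> x\<bar> powr p) \<le> ennreal (mean_const p * I)" by (intro ennreal_leI) linarith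
  also have "\<dots> = ennreal (mean_const p) * ennreal I"
    using mean_const_pos[OF p] \<eta>(1) by (intro ennreal_mult) (auto simp: I_def intro!: integral_nonneg_AE)
  also have "ennreal I = (\<integral>\<^sup>+x. ennreal (\<bar>h x\<bar> powr p * \<eta> x) \<partial>M)"
    unfolding I_def using \<eta>(1) by (intro nn_integral_eq_integral[symmetric] int) auto
  finally show ?thesis .
qed

text \<open>The spatial Jacobian (1 - \<delta>)^3 is at least 1/8.\<close>

lemma nn_integral_dilation_le:
  assumes [measurable]: "h \<in> borel_measurable borel" and \<delta>: "\<delta> \<le> 1/2"
  shows "(\<integral>\<^sup>+x. h ((1 - \<delta>) *\<^sub>R x + \<delta> *\<^sub>R w) \<partial>lborel) \<le> 8 * (\<integral>\<^sup>+x. h x \<partial>(lborel :: (real^3) measure))"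
proof -
  let ?J = "\<integral>\<^sup>+x. h (\<delta> *\<^sub>R w + (1 - \<delta>) *\<^sub>R x) \<partial>lborel"
  have "(1/2) ^ 3 \<le> \<bar>1 - \<delta>\<bar> ^ 3" using \<delta> by (intro power_mono) auto
  then have "1 \<le> 8 * \<bar>1 - \<delta>\<bar> ^ 3" by (simp add: power3_eq_cube)
  then have "ennreal 1 \<le> ennreal (8 * \<bar>1 - \<delta>\<bar> ^ 3)" by (rule ennreal_leI)
  then have "1 \<le> 8 * ennreal (\<bar>1 - \<delta>\<bar> ^ 3)" by (simp only: ennreal_1 ennreal_mult' ennreal_numeral)
  then have "1 * ?J \<le> 8 * ennreal (\<bar>1 - \<delta>\<bar> ^ 3) * ?J" by (rule mult_right_mono) simp
  also have "\<dots> = 8 * (\<integral>\<^sup>+x. h x \<partial>lborel)"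
    using nn_integral_affine[of h "1 - \<delta>" "\<delta> *\<^sub>R w"] \<delta> by (simp add: mult.assoc)
  finally show ?thesis by (simp add: add.commute)
qed

section \<open>Continuity of contractions in L^p\<close>

context polyhedral_domain begin

definition dilation_error :: "real \<Rightarrow> (real^3 \<Rightarrow> real) \<Rightarrow> real \<Rightarrow> real^3 \<Rightarrow> ennreal" where
  "dilation_error p g \<delta> w = (\<integral>\<^sup>+x. ennreal (\<bar>g ((1 - \<delta>) *\<^sub>R x + \<delta> *\<^sub>R w) - g x\<bar> powr p) * indicator \<Omega> x \<partial>lborel)"

text \<open>Continuity at \<delta> = 0 of contractions in L^p, uniform in the centre w. Uniformity
  matters because the mollification averages over the centres.\<close>

definition dilation_continuous :: "real \<Rightarrow> (real^3 \<Rightarrow> real) \<Rightarrow> bool" where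
  "dilation_continuous p g \<longleftrightarrow> (\<forall>e>0. \<exists>d>0. \<forall>\<delta> w. 0 < \<delta> \<longrightarrow> \<delta> < d \<longrightarrow> \<delta> \<le> 1/2 \<longrightarrow> w \<in> \<Omega> \<longrightarrow> dilation_error p g \<delta> w \<le> ennreal e)"

lemma dilation_continuousD:
  assumes "dilation_continuous p g" "0 < e"
  obtains d where "0 < d" "\<And>\<delta> w. 0 < \<delta> \<Longrightarrow> \<delta> < d \<Longrightarrow> \<delta> \<le> 1/2 \<Longrightarrow> w \<in> \<Omega> \<Longrightarrow> dilation_error p g \<delta> w \<le> ennreal e"
  using assms unfolding dilation_continuous_def by metis

text \<open>By regularity, A lies between a compact K and an open U with small gaps. Once points are
  displaced by less than the distance from K to the complement of U, a point x and its image can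
  disagree about A only if one of them lies in U - A or in A - K.\<close>

lemma dilation_continuous_indicator:
  assumes p: "0 < p" and A: "A \<in> sets borel" "A \<subseteq> \<Omega>"
  shows "dilation_continuous p (indicator A)"
  unfolding dilation_continuous_def
proof (intro allI impI)
  fix e :: real assume "0 < e"
  \<comment> \<open>The number 18 is 8 + 8 + 1 + 1: each of the two gaps is counted once at the
    image point, at the cost of the Jacobian factor 8, and once at x.\<close>
  then have e: "0 < e / 18" by simp
  have AL: "A \<in> sets lebesgue" using A(1) by simp
  obtain U where U: "open U" "A \<subseteq> U" "emeasure lebesgue (U - A) < ennreal (e / 18)"
    using sets_lebesgue_outer_open[OF AL e] by metis
  obtain K where K: "closed K" "K \<subseteq> A" "emeasure lebesgue (A - K) < ennreal (e / 18)"
    using sets_lebesgue_inner_closed[OF AL e] by metis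
  have [measurable]: "U \<in> sets borel" "K \<in> sets borel" "A \<in> sets borel" using U K A by auto
  have UA: "emeasure lborel (U - A) \<le> ennreal (e / 18)" "emeasure lborel (A - K) \<le> ennreal (e / 18)"
    using U(3) K(3) by (auto intro: less_imp_le)
  have "bounded K" using K(2) A(2) bounded_domain bounded_subset by blast
  then have "compact K" using K(1) by (simp add: compact_eq_bounded_closed)
  then obtain r where r: "0 < r" "(\<Union>x\<in>K. ball x r) \<subseteq> U"
    using compact_subset_open_imp_ball_epsilon_subset[of K U] K(2) U(1,2) by auto
  show "\<exists>d>0. \<forall>\<delta> w. 0 < \<delta> \<longrightarrow> \<delta> < d \<longrightarrow> \<delta> \<le> 1/2 \<longrightarrow> w \<in> \<Omega> \<longrightarrow> dilation_error p (indicator A) \<delta> w \<le> ennreal e"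
  \<comment> \<open>The displacement is \<delta> |w - x|, at most \<delta> times the diameter; the
    added 1 keeps the denominator positive.\<close>
  proof (intro exI[of _ "r / (diam + 1)"] conjI allI impI)
    show "0 < r / (diam + 1)" using r diam_nonneg by (simp add: add_nonneg_pos)
    fix \<delta> w assume \<delta>: "0 < \<delta>" "\<delta> < r / (diam + 1)" "\<delta> \<le> 1/2" and w: "w \<in> \<Omega>"
    let ?T = "\<lambda>x. (1 - \<delta>) *\<^sub>R x + \<delta> *\<^sub>R w"
    have T: "dist (?T x) x < r" if "x \<in> \<Omega>" for x
    proof -
      have "?T x - x = \<delta> *\<^sub>R (w - x)" by (simp add: algebra_simps)
      then have "dist (?T x) x = \<delta> * norm (w - x)" using \<delta> by (simp add: dist_norm)
      also have "\<dots> \<le> \<delta> * (diam + 1)"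
        using norm_le_diam[OF subsetD[OF closure_subset that] subsetD[OF closure_subset w]] \<delta>
        by (intro mult_left_mono) auto
      also have "\<dots> < r" using \<delta> diam_nonneg by (simp add: pos_less_divide_eq add_nonneg_pos)
      finally show ?thesis .
    qed
    let ?i = "\<lambda>B x. indicator B x :: ennreal"
    have "dilation_error p (indicator A) \<delta> w \<le> (\<integral>\<^sup>+x. ?i (U - A) (?T x) + ?i (A - K) (?T x) + (?i (U - A) x + ?i (A - K) x) \<partial>lborel)"
      unfolding dilation_error_def
    proof (intro nn_integral_mono)
      fix x
      show "ennreal (\<bar>indicator A (?T x) - indicator A x\<bar> powr p) * indicator \<Omega> x \<le> ?i (U - A) (?T x) + ?i (A - K) (?T x) + (?i (U - A) x + ?i (A - K) x)"
      proof (cases "x \<in> \<Omega>")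
        case True
        have 1: "?T x \<in> U" if "x \<in> K" using r(2) T[OF True] that by (force simp: dist_commute)
        have 2: "x \<in> U" if "?T x \<in> K" using r(2) T[OF True] that by force
        consider "x \<in> A" "?T x \<notin> A" | "x \<notin> A" "?T x \<in> A" | "x \<in> A \<longleftrightarrow> ?T x \<in> A" by blast
        then show ?thesis
        proof cases
          case 1
          then have "x \<in> A - K \<or> ?T x \<in> U - A" using \<open>x \<in> K \<Longrightarrow> ?T x \<in> U\<close> by blast
          then show ?thesis using 1 True by (auto simp: indicator_def add_increasing add_increasing2)
        next
          case 2
          then have "?T x \<in> A - K \<or> x \<in> U - A" using \<open>?T x \<in> K \<Longrightarrow> x \<in> U\<close> by blast
          then show ?thesis using 2 True by (auto simp: indicator_def add_increasing add_increasing2)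
        next
          case 3 then show ?thesis using p by (simp add: indicator_def)
        qed
      qed simp
    qed
    also have "\<dots> = ((\<integral>\<^sup>+x. ?i (U - A) (?T x) \<partial>lborel) + (\<integral>\<^sup>+x. ?i (A - K) (?T x) \<partial>lborel)) + (emeasure lborel (U - A) + emeasure lborel (A - K))"
      by (simp add: nn_integral_add)
    also have "\<dots> \<le> (8 * emeasure lborel (U - A) + 8 * emeasure lborel (A - K)) + (emeasure lborel (U - A) + emeasure lborel (A - K))"
      using nn_integral_dilation_le[of "?i (U - A)" \<delta> w] nn_integral_dilation_le[of "?i (A - K)" \<delta> w] \<delta>(3)
      by (intro add_mono order_refl) auto
    also have "\<dots> \<le> (8 * ennreal (e / 18) + 8 * ennreal (e / 18)) + (ennreal (e / 18) + ennreal (e / 18))"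
      by (intro add_mono mult_left_mono UA) auto
    also have "\<dots> = ennreal e" using e by (simp add: ennreal_mult'[symmetric] flip: ennreal_numeral ennreal_plus)
    finally show "dilation_error p (indicator A) \<delta> w \<le> ennreal e" .
  qed
qed

lemma dilation_continuous_add:
  assumes p: "0 < p" and g: "dilation_continuous p g" "dilation_continuous p h"
    and [measurable]: "g \<in> borel_measurable borel" "h \<in> borel_measurable borel"
  shows "dilation_continuous p (\<lambda>x. g x + h x)"
  unfolding dilation_continuous_def
proof (intro allI impI)
  fix e :: real assume "0 < e"
  define c where "c = e / (2 * 2 powr p)"
  have c: "0 < c" using \<open>0 < e\<close> by (simp add: c_def)
  obtain d1 where d1: "0 < d1" "\<And>\<delta> w. 0 < \<delta> \<Longrightarrow> \<delta> < d1 \<Longrightarrow> \<delta> \<le> 1/2 \<Longrightarrow> w \<in> \<Omega> \<Longrightarrow> dilation_error p g \<delta> w \<le> ennreal c"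
    using dilation_continuousD[OF g(1) c] by blast
  obtain d2 where d2: "0 < d2" "\<And>\<delta> w. 0 < \<delta> \<Longrightarrow> \<delta> < d2 \<Longrightarrow> \<delta> \<le> 1/2 \<Longrightarrow> w \<in> \<Omega> \<Longrightarrow> dilation_error p h \<delta> w \<le> ennreal c"
    using dilation_continuousD[OF g(2) c] by blast
  show "\<exists>d>0. \<forall>\<delta> w. 0 < \<delta> \<longrightarrow> \<delta> < d \<longrightarrow> \<delta> \<le> 1/2 \<longrightarrow> w \<in> \<Omega> \<longrightarrow> dilation_error p (\<lambda>x. g x + h x) \<delta> w \<le> ennreal e"
  proof (intro exI[of _ "min d1 d2"] conjI allI impI)
    fix \<delta> w assume \<delta>: "0 < \<delta>" "\<delta> < min d1 d2" "\<delta> \<le> 1/2" and w: "w \<in> \<Omega>"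
    let ?T = "\<lambda>x. (1 - \<delta>) *\<^sub>R x + \<delta> *\<^sub>R w"
    have pw: "ennreal (\<bar>(g (?T x) + h (?T x)) - (g x + h x)\<bar> powr p) \<le> ennreal (2 powr p) * (ennreal (\<bar>g (?T x) - g x\<bar> powr p) + ennreal (\<bar>h (?T x) - h x\<bar> powr p))" for x
    proof -
      have "\<bar>(g (?T x) + h (?T x)) - (g x + h x)\<bar> powr p \<le> 2 powr p * (\<bar>g (?T x) - g x\<bar> powr p + \<bar>h (?T x) - h x\<bar> powr p)"
        using abs_add_powr_le[OF p, of "g (?T x) - g x" "h (?T x) - h x"] by (simp add: algebra_simps)
      then show ?thesis by (simp add: ennreal_leI flip: ennreal_plus ennreal_mult)
    qed
    have "dilation_error p (\<lambda>x. g x + h x) \<delta> w \<le> (\<integral>\<^sup>+x. ennreal (2 powr p) * (ennreal (\<bar>g (?T x) - g x\<bar> powr p) * indicator \<Omega> x + ennreal (\<bar>h (?T x) - h x\<bar> powr p) * indicator \<Omega> x) \<partial>lborel)"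
      unfolding dilation_error_def using pw by (intro nn_integral_mono) (auto split: split_indicator)
    also have "\<dots> = ennreal (2 powr p) * (dilation_error p g \<delta> w + dilation_error p h \<delta> w)"
      unfolding dilation_error_def by (simp add: nn_integral_cmult nn_integral_add)
    also have "\<dots> \<le> ennreal (2 powr p) * (ennreal c + ennreal c)"
      using \<delta> w by (intro mult_left_mono add_mono d1 d2) auto
    also have "\<dots> = ennreal (2 powr p * (c + c))"
      using c by (simp only: ennreal_plus ennreal_mult add_nonneg_nonneg less_imp_le powr_ge_zero)
    also have "2 powr p * (c + c) = e" by (simp add: c_def)
    finally show "dilation_error p (\<lambda>x. g x + h x) \<delta> w \<le> ennreal e" .
  qed (use d1 d2 in auto)
qed

lemma dilation_continuous_cmult:
  assumes p: "0 < p" and g: "dilation_continuous p g" and [measurable]: "g \<in> borel_measurable borel"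
  shows "dilation_continuous p (\<lambda>x. c * g x)"
  unfolding dilation_continuous_def
proof (intro allI impI)
  fix e :: real assume e: "0 < e"
  have pos: "0 < \<bar>c\<bar> powr p + 1" by (simp add: add_nonneg_pos)
  then have "0 < e / (\<bar>c\<bar> powr p + 1)" using e by simp
  from dilation_continuousD[OF g this]
  obtain d where d: "0 < d" "\<And>\<delta> w. 0 < \<delta> \<Longrightarrow> \<delta> < d \<Longrightarrow> \<delta> \<le> 1/2 \<Longrightarrow> w \<in> \<Omega> \<Longrightarrow> dilation_error p g \<delta> w \<le> ennreal (e / (\<bar>c\<bar> powr p + 1))"
    by blast
  have eq: "dilation_error p (\<lambda>x. c * g x) \<delta> w = ennreal (\<bar>c\<bar> powr p) * dilation_error p g \<delta> w" for \<delta> w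
    unfolding dilation_error_def right_diff_distrib[symmetric] abs_mult
    by (subst nn_integral_cmult[symmetric]) (auto simp: powr_mult ennreal_mult mult.assoc)
  have le: "\<bar>c\<bar> powr p * (e / (\<bar>c\<bar> powr p + 1)) \<le> e"
    using pos e by (simp add: divide_simps)
  show "\<exists>d>0. \<forall>\<delta> w. 0 < \<delta> \<longrightarrow> \<delta> < d \<longrightarrow> \<delta> \<le> 1/2 \<longrightarrow> w \<in> \<Omega> \<longrightarrow> dilation_error p (\<lambda>x. c * g x) \<delta> w \<le> ennreal e"
  proof (intro exI[of _ d] conjI allI impI d(1))
    fix \<delta> w assume \<delta>: "0 < \<delta>" "\<delta> < d" "\<delta> \<le> 1/2" and w: "w \<in> \<Omega>"
    have "dilation_error p (\<lambda>x. c * g x) \<delta> w \<le> ennreal (\<bar>c\<bar> powr p) * ennreal (e / (\<bar>c\<bar> powr p + 1))"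
      unfolding eq using d(2)[OF \<delta> w] by (rule mult_left_mono) simp
    also have "\<dots> = ennreal (\<bar>c\<bar> powr p * (e / (\<bar>c\<bar> powr p + 1)))"
      using e pos by (intro ennreal_mult[symmetric]) auto
    also have "\<dots> \<le> ennreal e" by (rule ennreal_leI[OF le])
    finally show "dilation_error p (\<lambda>x. c * g x) \<delta> w \<le> ennreal e" .
  qed
qed

lemma dilation_continuous_const_0: "dilation_continuous p (\<lambda>x. 0)"
  unfolding dilation_continuous_def dilation_error_def by (auto intro!: exI[of _ 1])

lemma dilation_continuous_sum:
  assumes p: "0 < p" and "finite I" "\<And>i. i \<in> I \<Longrightarrow> dilation_continuous p (g i)" "\<And>i. i \<in> I \<Longrightarrow> g i \<in> borel_measurable borel"
  shows "dilation_continuous p (\<lambda>x. \<Sum>i\<in>I. g i x)"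
  using assms(2-4)
proof (induction I rule: finite_induct)
  case empty then show ?case by (simp add: dilation_continuous_const_0)
next
  case (insert i I)
  have "(\<lambda>x. \<Sum>i\<in>I. g i x) \<in> borel_measurable borel" using insert by (intro borel_measurable_sum) auto
  with insert show ?case by (simp add: dilation_continuous_add[OF p])
qed

lemma dilation_continuous_simple:
  assumes p: "0 < p" and s: "simple_function borel s" and out: "\<And>x. x \<notin> \<Omega> \<Longrightarrow> s x = 0"
  shows "dilation_continuous p (s :: real^3 \<Rightarrow> real)"
proof -
  have fin: "finite (range s)" using s by (simp add: simple_function_def)
  have A [measurable]: "s -` {y} \<in> sets borel" for y
    using measurable_sets_borel[OF borel_measurable_simple_function[OF s], of "{y}"] by simp
  have "s x = (\<Sum>y\<in>range s. y * indicator (s -` {y}) x)" for x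
  proof -
    have "(\<Sum>y\<in>range s. y * indicator (s -` {y}) x) = (\<Sum>y\<in>range s. if y = s x then s x else 0)"
      by (rule sum.cong) (auto split: split_indicator)
    also have "\<dots> = s x" using fin by (subst sum.delta) auto
    finally show ?thesis by (rule sym)
  qed
  then have eq: "s = (\<lambda>x. \<Sum>y\<in>range s. y * indicator (s -` {y}) x)" by (rule ext)
  have "dilation_continuous p (\<lambda>x. \<Sum>y\<in>range s. y * indicator (s -` {y}) x)"
  proof (rule dilation_continuous_sum[OF p fin])
    fix y
    show "dilation_continuous p (\<lambda>x. y * indicator (s -` {y}) x)"
    proof (cases "y = 0")
      case False
      then have "s -` {y} \<subseteq> \<Omega>" using out by auto
      then show ?thesis using A by (intro dilation_continuous_cmult[OF p] dilation_continuous_indicator[OF p]) auto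
    qed (simp add: dilation_continuous_const_0)
    show "(\<lambda>x. y * indicator (s -` {y}) x) \<in> borel_measurable borel" by measurable
  qed
  then show ?thesis by (subst eq)
qed

text \<open>Simple functions bounded by 2 |g| vanish outside \<Omega> and approximate g in L^p. Two
  of the three error terms are approximation errors, one of them at the contracted point.\<close>

lemma dilation_continuous_Lp:
  assumes p: "0 < p" and [measurable]: "g \<in> borel_measurable borel" and out: "\<And>x. x \<notin> \<Omega> \<Longrightarrow> g x = 0"
    and fin: "(\<integral>\<^sup>+x. ennreal (\<bar>g x\<bar> powr p) \<partial>lborel) < \<infinity>"
  shows "dilation_continuous p (g :: real^3 \<Rightarrow> real)"
proof -
  obtain s where s: "\<And>i. simple_function borel (s i)" "\<And>x. (\<lambda>i. s i x) \<longlonglongrightarrow> g x" "\<And>i x. norm (s i x) \<le> 2 * norm (g x)"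
    using borel_measurable_implies_sequence_metric[of g borel 0] by (auto simp: dist_norm)
  have [measurable]: "s i \<in> borel_measurable borel" for i by (rule borel_measurable_simple_function[OF s(1)])
  have s0: "s i x = 0" if "x \<notin> \<Omega>" for i x using s(3)[of i x] out[OF that] by simp
  have lim: "(\<lambda>i. \<integral>\<^sup>+x. ennreal (\<bar>g x - s i x\<bar> powr p) \<partial>lborel) \<longlonglongrightarrow> (\<integral>\<^sup>+(x::real^3). 0 \<partial>lborel)"
  proof (rule nn_integral_dominated_convergence[where M=lborel and u="\<lambda>i x. ennreal (\<bar>g x - s i x\<bar> powr p)" and u'="\<lambda>_. 0" and w="\<lambda>x. ennreal (3 powr p * \<bar>g x\<bar> powr p)"])
    show "(\<integral>\<^sup>+x. ennreal (3 powr p * \<bar>g x\<bar> powr p) \<partial>lborel) < \<infinity>"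
      using fin by (simp add: ennreal_mult nn_integral_cmult ennreal_mult_less_top)
    show "AE x in lborel. ennreal (\<bar>g x - s i x\<bar> powr p) \<le> ennreal (3 powr p * \<bar>g x\<bar> powr p)" for i
    proof (intro AE_I2 ennreal_leI)
      fix x
      have "\<bar>g x - s i x\<bar> \<le> 3 * \<bar>g x\<bar>" using s(3)[of i x] by simp
      then have "\<bar>g x - s i x\<bar> powr p \<le> (3 * \<bar>g x\<bar>) powr p" using p by (intro powr_mono2) auto
      then show "\<bar>g x - s i x\<bar> powr p \<le> 3 powr p * \<bar>g x\<bar> powr p" by (simp add: powr_mult)
    qed
    show "AE x in lborel. (\<lambda>i. ennreal (\<bar>g x - s i x\<bar> powr p)) \<longlonglongrightarrow> 0"
    proof (intro AE_I2)
      fix x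
      have "(\<lambda>i. \<bar>g x - s i x\<bar>) \<longlonglongrightarrow> \<bar>g x - g x\<bar>" by (intro tendsto_intros s)
      then have "(\<lambda>i. \<bar>g x - s i x\<bar> powr p) \<longlonglongrightarrow> 0 powr p" using p by (intro tendsto_powr') auto
      then show "(\<lambda>i. ennreal (\<bar>g x - s i x\<bar> powr p)) \<longlonglongrightarrow> 0" using p by (simp add: tendsto_ennrealI flip: ennreal_0)
    qed
  qed measurable
  show ?thesis
    unfolding dilation_continuous_def
  proof (intro allI impI)
    fix e :: real assume e: "0 < e"
    \<comment> \<open>The number 10 is 8 + 1 + 1: the approximation error at the contracted point
      costs the factor 8.\<close>
    define c where "c = e / (3 powr p * 10)"
    have c: "0 < c" using e by (simp add: c_def)
    have "\<forall>\<^sub>F i in sequentially. (\<integral>\<^sup>+x. ennreal (\<bar>g x - s i x\<bar> powr p) \<partial>lborel) < ennreal c"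
      using order_tendstoD(2)[OF lim, of "ennreal c"] c by simp
    then obtain i where i: "(\<integral>\<^sup>+x. ennreal (\<bar>g x - s i x\<bar> powr p) \<partial>lborel) \<le> ennreal c"
      by (metis (no_types, lifting) eventually_sequentially order_refl less_imp_le)
    obtain d where d: "0 < d" "\<And>\<delta> w. 0 < \<delta> \<Longrightarrow> \<delta> < d \<Longrightarrow> \<delta> \<le> 1/2 \<Longrightarrow> w \<in> \<Omega> \<Longrightarrow> dilation_error p (s i) \<delta> w \<le> ennreal c"
      using dilation_continuousD[OF dilation_continuous_simple[OF p s(1) s0] c] by blast
    show "\<exists>d>0. \<forall>\<delta> w. 0 < \<delta> \<longrightarrow> \<delta> < d \<longrightarrow> \<delta> \<le> 1/2 \<longrightarrow> w \<in> \<Omega> \<longrightarrow> dilation_error p g \<delta> w \<le> ennreal e"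
    proof (intro exI[of _ d] conjI allI impI d(1))
      fix \<delta> w assume \<delta>: "0 < \<delta>" "\<delta> < d" "\<delta> \<le> 1/2" and w: "w \<in> \<Omega>"
      let ?T = "\<lambda>x. (1 - \<delta>) *\<^sub>R x + \<delta> *\<^sub>R w"
      let ?n = "\<lambda>x. ennreal (\<bar>g x - s i x\<bar> powr p)"
      let ?m = "\<lambda>x. ennreal (\<bar>s i (?T x) - s i x\<bar> powr p) * indicator \<Omega> x"
      have pw: "ennreal (\<bar>g (?T x) - g x\<bar> powr p) * indicator \<Omega> x \<le> ennreal (3 powr p) * (?n (?T x) + ?m x + ?n x)" for x
      proof (cases "x \<in> \<Omega>")
        case True
        have "\<bar>g (?T x) - g x\<bar> powr p \<le> (\<bar>g (?T x) - s i (?T x)\<bar> + \<bar>s i (?T x) - s i x\<bar> + \<bar>g x - s i x\<bar>) powr p"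
          using p by (intro powr_mono2) auto
        also have "\<dots> \<le> 3 powr p * (\<bar>g (?T x) - s i (?T x)\<bar> powr p + \<bar>s i (?T x) - s i x\<bar> powr p + \<bar>g x - s i x\<bar> powr p)"
          using sum_powr_le[of "{0,1,2::nat}" p "\<lambda>j. if j = 0 then \<bar>g (?T x) - s i (?T x)\<bar> else if j = 1 then \<bar>s i (?T x) - s i x\<bar> else \<bar>g x - s i x\<bar>"] p
          by (simp add: add.assoc)
        finally show ?thesis using True by (simp add: ennreal_leI flip: ennreal_plus ennreal_mult)
      qed simp
      have "dilation_error p g \<delta> w \<le> (\<integral>\<^sup>+x. ennreal (3 powr p) * (?n (?T x) + ?m x + ?n x) \<partial>lborel)"
        unfolding dilation_error_def by (intro nn_integral_mono pw)
      also have "\<dots> = ennreal (3 powr p) * ((\<integral>\<^sup>+x. ?n (?T x) \<partial>lborel) + dilation_error p (s i) \<delta> w + (\<integral>\<^sup>+x. ?n x \<partial>lborel))"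
        unfolding dilation_error_def by (simp add: nn_integral_cmult nn_integral_add)
      also have "\<dots> \<le> ennreal (3 powr p) * (8 * ennreal c + ennreal c + ennreal c)"
        using order_trans[OF nn_integral_dilation_le[of ?n \<delta> w] mult_left_mono[OF i, of 8]] \<delta>(3)
        by (intro mult_left_mono add_mono i d \<delta> w) auto
      also have "\<dots> = ennreal (3 powr p * (8 * c + c + c))"
        using c by (simp only: ennreal_plus ennreal_mult add_nonneg_nonneg mult_nonneg_nonneg
          less_imp_le powr_ge_zero zero_le_numeral ennreal_numeral)
      also have "3 powr p * (8 * c + c + c) = e" by (simp add: c_def)
      finally show "dilation_error p g \<delta> w \<le> ennreal e" .
    qed
  qed
qed

end

lemma LINT_affine:
  fixes f :: "'a::euclidean_space \<Rightarrow> real"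
  assumes [measurable]: "f \<in> borel_measurable borel" and c: "c \<noteq> 0"
  shows "(LINT x|lborel. f x) = \<bar>c\<bar> ^ DIM('a) * (LINT x|lborel. f (a + c *\<^sub>R x))"
  by (subst lborel_affine[OF c, of a], subst integral_density) (auto simp: integral_distr)

lemma integrable_affine:
  fixes f :: "'a::euclidean_space \<Rightarrow> real"
  assumes f: "integrable lborel f" and c: "c \<noteq> 0"
  shows "integrable lborel (\<lambda>x. f (a + c *\<^sub>R x))"
proof -
  have [measurable]: "f \<in> borel_measurable borel" using f by auto
  have "integrable (density (distr lborel borel (\<lambda>x. a + c *\<^sub>R x)) (\<lambda>_. ennreal (\<bar>c\<bar> ^ DIM('a)))) f"
    using f by (subst (asm) lborel_affine[OF c, of a])
  then have "integrable (distr lborel borel (\<lambda>x. a + c *\<^sub>R x)) (\<lambda>x. (\<bar>c\<bar> ^ DIM('a)) *\<^sub>R f x)"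
    by (subst (asm) integrable_density) auto
  then have "integrable lborel (\<lambda>x. (\<bar>c\<bar> ^ DIM('a)) *\<^sub>R f (a + c *\<^sub>R x))"
    by (subst (asm) integrable_distr_eq) auto
  then show ?thesis using c by simp
qed

section \<open>Mollification along contractions\<close>

context polyhedral_domain begin

text \<open>L^p functions on \<Omega> as Borel functions extended by 0, so that all integrals run
  over the whole space with \<open>lborel\<close>.\<close>

definition Lp_fun :: "real \<Rightarrow> (real^3 \<Rightarrow> real) \<Rightarrow> bool" where
  "Lp_fun p g \<longleftrightarrow> g \<in> borel_measurable borel \<and> (\<forall>x. x \<notin> \<Omega> \<longrightarrow> g x = 0) \<and> (\<integral>\<^sup>+x. ennreal (\<bar>g x\<bar> powr p) \<partial>lborel) < \<infinity>"

definition weak_partial :: "3 \<Rightarrow> (real^3 \<Rightarrow> real) \<Rightarrow> (real^3 \<Rightarrow> real) \<Rightarrow> bool" where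
  "weak_partial i g W \<longleftrightarrow> (\<forall>\<phi>\<in>test_functions \<Omega>. (LINT y|lborel. g y * partial_deriv i \<phi> y) = - (LINT y|lborel. W y * \<phi> y))"

lemma emeasure_domain_finite: "emeasure lborel \<Omega> < \<infinity>"
  using emeasure_bounded_finite[OF bounded_domain] by simp

text \<open>On a set of finite measure |g| \<le> 1 + |g|^p is enough.\<close>

lemma Lp_fun_integrable:
  assumes p: "1 < p" and g: "Lp_fun p g"
  shows "integrable lborel g"
proof -
  have [measurable]: "g \<in> borel_measurable borel" using g by (simp add: Lp_fun_def)
  have "ennreal (norm (g x)) \<le> indicator \<Omega> x + ennreal (\<bar>g x\<bar> powr p)" for x
  proof (cases "x \<in> \<Omega>")
    case True
    have "\<bar>g x\<bar> \<le> 1 + \<bar>g x\<bar> powr p"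
    proof (cases "\<bar>g x\<bar> \<le> 1")
      case False
      then have "\<bar>g x\<bar> powr 1 \<le> \<bar>g x\<bar> powr p" using p by (intro powr_mono) auto
      then show ?thesis using False by simp
    qed (simp add: add_increasing2)
    then have "ennreal (norm (g x)) \<le> ennreal (1 + \<bar>g x\<bar> powr p)" by (intro ennreal_leI) simp
    then show ?thesis using True by simp
  qed (use g in \<open>simp add: Lp_fun_def\<close>)
  then have "(\<integral>\<^sup>+x. ennreal (norm (g x)) \<partial>lborel) \<le> (\<integral>\<^sup>+x. indicator \<Omega> x + ennreal (\<bar>g x\<bar> powr p) \<partial>lborel)"
    by (rule nn_integral_mono)
  also have "\<dots> = emeasure lborel \<Omega> + (\<integral>\<^sup>+x. ennreal (\<bar>g x\<bar> powr p) \<partial>lborel)"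
    by (simp add: nn_integral_add)
  also have "\<dots> < \<infinity>" using emeasure_domain_finite g by (simp add: Lp_fun_def)
  finally show ?thesis by (simp add: integrable_iff_bounded)
qed

end

locale mollifier = polyhedral_domain +
  fixes x0 :: "real^3" and \<rho> :: real and \<eta> :: "real^3 \<Rightarrow> real"
  assumes ball: "inner_ball x0 \<rho>" and smooth_kernel: "smooth \<eta>" and kernel_nonneg: "0 \<le> \<eta> x"
    and kernel_support: "x \<notin> cball x0 \<rho> \<Longrightarrow> \<eta> x = 0"
    and integrable_kernel: "integrable lborel \<eta>" and kernel_mass: "(LINT x|lborel. \<eta> x) = 1"
begin

lemma kernel_ball_subset: "w \<in> cball x0 \<rho> \<Longrightarrow> w \<in> \<Omega>"
  using inner_ball_subset[OF ball] ball unfolding inner_ball_def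
  by (metis mem_cball mult_2 less_imp_le add_increasing order_trans)

lemma borel_kernel [measurable]: "\<eta> \<in> borel_measurable borel"
  by (rule smooth_borel[OF smooth_kernel])

lemma kernel_far: "norm x0 + \<rho> < norm x \<Longrightarrow> \<eta> x = 0"
  using norm_triangle_ineq2[of x x0] by (intro kernel_support) (simp add: dist_norm norm_minus_commute)

text \<open>An average of g over contractions towards the points of the kernel ball. For x in the
  closure and 0 < \<delta> \<le> 1 only values of g inside \<Omega> enter, so the jump of the
  extension by 0 is not seen there; yet the formula makes sense on the whole space, as approximants
  in \<open>has_trace\<close> must.\<close>

definition mollify :: "real \<Rightarrow> (real^3 \<Rightarrow> real) \<Rightarrow> real^3 \<Rightarrow> real" where
  "mollify \<delta> g x = (LINT w|lborel. g ((1 - \<delta>) *\<^sub>R x + \<delta> *\<^sub>R w) * \<eta> w)"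

text \<open>The substitution y = (1 - \<delta>) x + \<delta> w moves x from g into the smooth
  kernel.\<close>

lemma mollify_eq_convolution:
  assumes g: "integrable lborel g" and \<delta>: "0 < \<delta>"
  shows "mollify \<delta> g x = (1 / \<delta> ^ 3) * (LINT y|lborel. g y * \<eta> ((1 / \<delta>) *\<^sub>R y + (- (1 - \<delta>) / \<delta>) *\<^sub>R x))"
proof -
  have [measurable]: "g \<in> borel_measurable borel" using g by auto
  have eq: "(1 / \<delta>) *\<^sub>R ((1 - \<delta>) *\<^sub>R x + \<delta> *\<^sub>R w) + (- (1 - \<delta>) / \<delta>) *\<^sub>R x = w" for w
    using \<delta> by (simp add: scaleR_add_right scaleR_left_diff_distrib diff_divide_distrib algebra_simps)
  have "(LINT y|lborel. g y * \<eta> ((1 / \<delta>) *\<^sub>R y + (- (1 - \<delta>) / \<delta>) *\<^sub>R x)) = \<bar>\<delta>\<bar> ^ DIM(real^3) *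
      (LINT w|lborel. g ((1 - \<delta>) *\<^sub>R x + \<delta> *\<^sub>R w) * \<eta> ((1 / \<delta>) *\<^sub>R ((1 - \<delta>) *\<^sub>R x + \<delta> *\<^sub>R w) + (- (1 - \<delta>) / \<delta>) *\<^sub>R x))"
    using \<delta> by (intro LINT_affine) auto
  then show ?thesis using \<delta> unfolding eq mollify_def by simp
qed

lemma smooth_mollify:
  assumes "integrable lborel g" "0 < \<delta>"
  shows "smooth (mollify \<delta> g)"
proof -
  have "mollify \<delta> g = (\<lambda>x. (1 / \<delta> ^ 3) * (LINT y|lborel. g y * \<eta> ((1 / \<delta>) *\<^sub>R y + (- (1 - \<delta>) / \<delta>) *\<^sub>R x)))"
    by (rule ext) (rule mollify_eq_convolution[OF assms])
  moreover have "smooth (\<lambda>x. LINT y|lborel. g y * \<eta> ((1 / \<delta>) *\<^sub>R y + (- (1 - \<delta>) / \<delta>) *\<^sub>R x))"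
    by (rule smooth_convolution(1)[OF assms(1) smooth_kernel kernel_far])
  ultimately show ?thesis using smooth_mult[OF smooth_const] by (simp only:)
qed

text \<open>For x in the closure the rescaled kernel is supported in the contracted kernel ball,
  inside \<Omega>, so it is an admissible test function even when x is a boundary point. The factor
  1 - \<delta> is the chain rule for the contraction.\<close>

lemma partial_deriv_mollify:
  assumes g: "integrable lborel g" and W: "integrable lborel W" and gW: "weak_partial i g W"
    and \<delta>: "0 < \<delta>" "\<delta> < 1" and x: "x \<in> closure \<Omega>"
  shows "partial_deriv i (mollify \<delta> g) x = (1 - \<delta>) * mollify \<delta> W x"
proof -
  let ?d = "- (1 - \<delta>) / \<delta>"
  let ?\<zeta> = "\<lambda>y. \<eta> ((1 / \<delta>) *\<^sub>R y + ?d *\<^sub>R x)"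
  have sm: "smooth ?\<zeta>" by (rule smooth_affine[OF smooth_kernel])
  have "?\<zeta> \<in> test_functions \<Omega>"
  proof (rule test_functionI[OF sm])
    let ?K = "(\<lambda>y. (1 / \<delta>) *\<^sub>R y + ?d *\<^sub>R x) -` cball x0 \<rho>"
    show "closed ?K" by (intro closed_vimage continuous_intros) auto
    show sub: "?K \<subseteq> \<Omega>"
    proof
      fix y assume "y \<in> ?K"
      then have w: "(1 / \<delta>) *\<^sub>R y + ?d *\<^sub>R x \<in> \<Omega>" by (auto intro: kernel_ball_subset simp del: mem_cball)
      have "y = (1 - \<delta>) *\<^sub>R x + \<delta> *\<^sub>R ((1 / \<delta>) *\<^sub>R y + ?d *\<^sub>R x)"
        using \<delta> by (simp add: scaleR_add_right) (simp add: algebra_simps)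
      also have "\<dots> \<in> \<Omega>" by (rule segment_in_domain[OF x w]) (use \<delta> in auto)
      finally show "y \<in> \<Omega>" .
    qed
    show "bounded ?K" by (rule bounded_subset[OF bounded_domain sub])
    show "\<And>y. y \<notin> ?K \<Longrightarrow> ?\<zeta> y = 0" using kernel_support by blast
  qed
  then have "(LINT y|lborel. g y * partial_deriv i ?\<zeta> y) = - (LINT y|lborel. W y * ?\<zeta> y)"
    using gW by (auto simp: weak_partial_def)
  moreover have "(LINT y|lborel. g y * partial_deriv i ?\<zeta> y) = (1 / \<delta>) * (LINT y|lborel. g y * partial_deriv i \<eta> ((1 / \<delta>) *\<^sub>R y + ?d *\<^sub>R x))"
    unfolding partial_deriv_affine[OF smooth_kernel] integral_mult_right_zero[symmetric]
    by (intro Bochner_Integration.integral_cong) auto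
  ultimately have dI: "(LINT y|lborel. g y * partial_deriv i \<eta> ((1 / \<delta>) *\<^sub>R y + ?d *\<^sub>R x)) = - \<delta> * (LINT y|lborel. W y * ?\<zeta> y)"
    using \<delta> by (simp add: field_simps)
  have "mollify \<delta> g = (\<lambda>x. (1 / \<delta> ^ 3) * (LINT y|lborel. g y * \<eta> ((1 / \<delta>) *\<^sub>R y + ?d *\<^sub>R x)))"
    by (rule ext) (rule mollify_eq_convolution[OF g \<delta>(1)])
  then have "partial_deriv i (mollify \<delta> g) x = (1 / \<delta> ^ 3) * (?d * (LINT y|lborel. g y * partial_deriv i \<eta> ((1 / \<delta>) *\<^sub>R y + ?d *\<^sub>R x)))"
    by (simp only: partial_deriv_cmult[OF smooth_convolution(1)[OF g smooth_kernel kernel_far]]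
      partial_deriv_convolution[OF g smooth_kernel kernel_far])
  also have "\<dots> = (1 - \<delta>) * ((1 / \<delta> ^ 3) * (LINT y|lborel. W y * ?\<zeta> y))"
  proof -
    have "?d * - \<delta> = 1 - \<delta>" using \<delta> by simp
    then show ?thesis unfolding dI by (simp only: mult.assoc[symmetric, of ?d] mult.left_commute[of "1 / \<delta> ^ 3"])
  qed
  also have "(1 / \<delta> ^ 3) * (LINT y|lborel. W y * ?\<zeta> y) = mollify \<delta> W x"
    by (rule mollify_eq_convolution[OF W \<delta>(1), symmetric])
  finally show ?thesis .
qed

text \<open>The inequality of means in w for fixed x, then Fubini: what remains is the dilation
  error averaged with weight \<eta>, which is bounded uniformly in w.\<close>

lemma mollify_error:
  assumes p: "1 < p" and g: "integrable lborel g" and \<delta>: "0 < \<delta>"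
    and err: "\<And>w. w \<in> \<Omega> \<Longrightarrow> dilation_error p g \<delta> w \<le> ennreal e"
  shows "(\<integral>\<^sup>+x. ennreal (\<bar>mollify \<delta> g x - g x\<bar> powr p) * indicator \<Omega> x \<partial>lborel) \<le> ennreal (mean_const p) * ennreal e"
proof -
  have [measurable]: "g \<in> borel_measurable borel" using g by auto
  let ?h = "\<lambda>x w. g ((1 - \<delta>) *\<^sub>R x + \<delta> *\<^sub>R w) - g x"
  let ?k = "\<lambda>x w. ennreal (\<bar>?h x w\<bar> powr p * \<eta> w)"
  have pw: "ennreal (\<bar>mollify \<delta> g x - g x\<bar> powr p) \<le> ennreal (mean_const p) * (\<integral>\<^sup>+w. ?k x w \<partial>lborel)" for x
  proof -
    obtain B where "\<And>w. \<bar>\<eta> w\<bar> \<le> B" using smooth_bounded_support[OF smooth_kernel kernel_far] by blast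
    then have int: "integrable lborel (\<lambda>w. g ((1 - \<delta>) *\<^sub>R x + \<delta> *\<^sub>R w) * \<eta> w)"
      using \<delta> by (intro integrable_mult_bounded integrable_affine g) auto
    have int': "integrable lborel (\<lambda>w. g x * \<eta> w)" by (rule integrable_mult_right[OF integrable_kernel])
    have "mollify \<delta> g x - g x = (LINT w|lborel. ?h x w * \<eta> w)"
      unfolding mollify_def left_diff_distrib Bochner_Integration.integral_diff[OF int int']
      by (simp add: kernel_mass)
    moreover have "integrable lborel (\<lambda>w. ?h x w * \<eta> w)"
      unfolding left_diff_distrib by (rule Bochner_Integration.integrable_diff[OF int int'])
    ultimately show ?thesis
      using mean_powr_le[OF p kernel_nonneg integrable_kernel kernel_mass, of "?h x"] by simp
  qed
  have "(\<integral>\<^sup>+x. ennreal (\<bar>mollify \<delta> g x - g x\<bar> powr p) * indicator \<Omega> x \<partial>lborel)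
      \<le> (\<integral>\<^sup>+x. ennreal (mean_const p) * (\<integral>\<^sup>+w. ?k x w * indicator \<Omega> x \<partial>lborel) \<partial>lborel)"
    using pw by (intro nn_integral_mono) (auto split: split_indicator)
  also have "\<dots> = ennreal (mean_const p) * (\<integral>\<^sup>+x. \<integral>\<^sup>+w. ?k x w * indicator \<Omega> x \<partial>lborel \<partial>lborel)"
    by (rule nn_integral_cmult) measurable
  also have "(\<integral>\<^sup>+x. \<integral>\<^sup>+w. ?k x w * indicator \<Omega> x \<partial>lborel \<partial>lborel) = (\<integral>\<^sup>+w. \<integral>\<^sup>+x. ?k x w * indicator \<Omega> x \<partial>lborel \<partial>lborel)"
    by (rule lborel_pair.Fubini') measurable
  also have "\<dots> = (\<integral>\<^sup>+w. dilation_error p g \<delta> w * ennreal (\<eta> w) \<partial>lborel)"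
    unfolding dilation_error_def
    by (intro nn_integral_cong, subst nn_integral_multc[symmetric])
      (auto intro!: nn_integral_cong simp: ennreal_mult kernel_nonneg mult_ac)
  also have "\<dots> \<le> (\<integral>\<^sup>+w. ennreal e * ennreal (\<eta> w) \<partial>lborel)"
  proof (rule nn_integral_mono)
    fix w
    show "dilation_error p g \<delta> w * ennreal (\<eta> w) \<le> ennreal e * ennreal (\<eta> w)"
      using err[OF kernel_ball_subset, of w] kernel_support[of w]
      by (cases "w \<in> cball x0 \<rho>") (auto intro: mult_right_mono simp del: mem_cball)
  qed
  also have "\<dots> = ennreal e * (\<integral>\<^sup>+w. ennreal (\<eta> w) \<partial>lborel)" by (rule nn_integral_cmult) measurable
  also have "(\<integral>\<^sup>+w. ennreal (\<eta> w) \<partial>lborel) = 1"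
    using nn_integral_eq_integral[OF integrable_kernel] kernel_nonneg kernel_mass by simp
  finally show ?thesis by (simp add: mult_left_mono)
qed

text \<open>The shift by 2 keeps the parameter at most 1/2 from n = 0 on.\<close>

definition step :: "nat \<Rightarrow> real" where "step n = 1 / (real n + 2)"

lemma step: "0 < step n" "step n \<le> 1/2" "step n < 1" "step \<longlonglongrightarrow> 0"
proof -
  show "0 < step n" "step n \<le> 1/2" "step n < 1" by (auto simp: step_def field_simps)
  show "step \<longlonglongrightarrow> 0"
    using LIMSEQ_ignore_initial_segment[OF lim_inverse_n', of 2] by (simp add: step_def[abs_def] add.commute)
qed

lemma mollify_converges:
  assumes p: "1 < p" and g: "Lp_fun p g"
  shows "(\<lambda>n. \<integral>\<^sup>+x. ennreal (\<bar>mollify (step n) g x - g x\<bar> powr p) * indicator \<Omega> x \<partial>lborel) \<longlonglongrightarrow> 0"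
    (is "?I \<longlonglongrightarrow> 0")
proof (rule order_tendstoI)
  fix a :: ennreal assume "0 < a"
  then obtain b where b: "0 < b" "b < a" using dense by blast
  then obtain e where e: "b = ennreal e" "0 < e"
    by (cases b) (auto simp: ennreal_zero_less_top)
  define c where "c = e / mean_const p"
  have c: "0 < c" using e mean_const_pos[OF p] by (simp add: c_def)
  have "dilation_continuous p g"
    using g p by (intro dilation_continuous_Lp) (auto simp: Lp_fun_def)
  from dilation_continuousD[OF this c] obtain d where d: "0 < d"
    "\<And>\<delta> w. 0 < \<delta> \<Longrightarrow> \<delta> < d \<Longrightarrow> \<delta> \<le> 1/2 \<Longrightarrow> w \<in> \<Omega> \<Longrightarrow> dilation_error p g \<delta> w \<le> ennreal c" by blast
  have "\<forall>\<^sub>F n in sequentially. step n < d" using order_tendstoD(2)[OF step(4) d(1)] .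
  then show "\<forall>\<^sub>F n in sequentially. ?I n < a"
  proof eventually_elim
    case (elim n)
    have "?I n \<le> ennreal (mean_const p) * ennreal c"
      by (rule mollify_error[OF p Lp_fun_integrable[OF p g] step(1) d(2)[OF step(1) elim step(2)]])
    also have "\<dots> = b" using c mean_const_pos[OF p] unfolding e(1) by (subst ennreal_mult[symmetric]) (auto simp: c_def)
    finally show ?case using b by simp
  qed
qed simp

end

section \<open>Weak derivatives\<close>

lemma lebesgue_measurable_AE:
  fixes f f' :: "'a::euclidean_space \<Rightarrow> real"
  assumes [measurable]: "f' \<in> borel_measurable borel" and eq: "AE x in lborel. f x = f' x"
  shows "f \<in> borel_measurable lebesgue"
proof -
  have eq': "AE x in lebesgue. f x = f' x" using eq by (rule AE_completion)
  have "{x \<in> space lebesgue. f x \<le> a} \<in> sets lebesgue" for a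
  proof (rule completion.in_sets_AE)
    show "AE x in lebesgue. x \<in> {x. f' x \<le> a} \<longleftrightarrow> x \<in> {x \<in> space lebesgue. f x \<le> a}"
      using eq' by eventually_elim auto
    have "{x \<in> space borel. f' x \<le> a} \<in> sets borel" by measurable
    then show "{x. f' x \<le> a} \<in> sets lebesgue" by simp
  qed auto
  then show ?thesis by (simp add: borel_measurable_iff_le)
qed

definition unit_index :: "3 \<Rightarrow> 3 \<Rightarrow> nat" where "unit_index i = (\<lambda>_. 0)(i := 1)"

lemma multi_deriv_0: "multi_deriv (\<lambda>_. 0) f = f"
  by (simp add: multi_deriv_def fun_eq_iff)

lemma multi_deriv_unit_index: "multi_deriv (unit_index i) f = partial_deriv i f"
  using exhaust_3[of i] by (auto simp: multi_deriv_def unit_index_def fun_eq_iff)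

text \<open>\<open>multi_deriv\<close> differentiates in one fixed order, so the mixed cases need
  the symmetry of second derivatives.\<close>

lemma multi_deriv_unit_index_2:
  assumes "smooth f" shows "multi_deriv (\<lambda>k. unit_index i k + unit_index j k) f = partial_deriv i (partial_deriv j f)"
  using exhaust_3[of i] exhaust_3[of j] partial_deriv_commute[OF assms, of 1 2] partial_deriv_commute[OF assms, of 1 3]
    partial_deriv_commute[OF assms, of 2 3]
  by (auto simp: multi_deriv_def unit_index_def fun_eq_iff numeral_2_eq_2)

lemma sum_unit_index [simp]: "sum (unit_index i) UNIV = 1"
  by (simp add: unit_index_def fun_upd_def)

lemma unit_index_values: "unit_index i j = (if j = i then 1 else 0)"
  by (simp add: unit_index_def)

lemma distinct_indices: "(1::3) \<noteq> 2" "(1::3) \<noteq> 3" "(2::3) \<noteq> 1" "(2::3) \<noteq> 3" "(3::3) \<noteq> 1" "(3::3) \<noteq> 2"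
  by simp_all

lemma multi_indices_1: "{\<alpha> :: 3 \<Rightarrow> nat. sum \<alpha> UNIV \<le> 1} = insert (\<lambda>_. 0) (range unit_index)"
proof (rule set_eqI)
  fix \<alpha> :: "3 \<Rightarrow> nat"
  have arith: "a + b + c \<le> 1 \<longleftrightarrow> (a = 0 \<and> b = 0 \<and> c = 0) \<or> (a = 1 \<and> b = 0 \<and> c = 0)
      \<or> (a = 0 \<and> b = 1 \<and> c = 0) \<or> (a = 0 \<and> b = 0 \<and> c = 1)" for a b c :: nat by linarith
  have "sum \<alpha> UNIV \<le> 1 \<longleftrightarrow> \<alpha> = (\<lambda>_. 0) \<or> \<alpha> = unit_index 1 \<or> \<alpha> = unit_index 2 \<or> \<alpha> = unit_index 3"
    by (simp only: sum_3 arith fun_eq_iff forall_3 unit_index_values distinct_indices if_True if_False simp_thms)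
  also have "\<dots> \<longleftrightarrow> \<alpha> \<in> insert (\<lambda>_. 0) (range unit_index)"
    unfolding UNIV_3 by blast
  finally show "\<alpha> \<in> {\<alpha>. sum \<alpha> UNIV \<le> 1} \<longleftrightarrow> \<alpha> \<in> insert (\<lambda>_. 0) (range unit_index)"
    by (simp only: mem_Collect_eq)
qed

lemma inj_unit_index: "inj unit_index" "(\<lambda>_. 0) \<notin> range unit_index"
  by (auto simp: inj_def unit_index_def fun_eq_iff split: if_splits)

section \<open>Borel representatives and uniqueness of weak derivatives\<close>

context polyhedral_domain begin

text \<open>The bridge between the Lebesgue measurable functions on \<Omega> of the definitions and
  Borel functions on the whole space. The analysis takes place on the side of
  \<open>g\<close>.\<close>

definition represents :: "(real^3 \<Rightarrow> real) \<Rightarrow> (real^3 \<Rightarrow> real) \<Rightarrow> bool" where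
  "represents g u \<longleftrightarrow> g \<in> borel_measurable borel \<and> (\<forall>x. x \<notin> \<Omega> \<longrightarrow> g x = 0) \<and> (AE x in lborel. x \<in> \<Omega> \<longrightarrow> u x = g x)"

lemma representsD:
  assumes "represents g u"
  shows represents_borel: "g \<in> borel_measurable borel" and represents_outside: "x \<notin> \<Omega> \<Longrightarrow> g x = 0"
    and represents_AE: "AE x in lborel. x \<in> \<Omega> \<longrightarrow> u x = g x"
  using assms by (auto simp: represents_def)

lemma represents_measurable:
  assumes r: "represents g u" and [measurable]: "\<phi> \<in> borel_measurable borel"
  shows "(\<lambda>x. indicator \<Omega> x * (u x * \<phi> x)) \<in> borel_measurable lebesgue"
proof (rule lebesgue_measurable_AE)
  have [measurable]: "g \<in> borel_measurable borel" using represents_borel[OF r] .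
  show "(\<lambda>x. g x * \<phi> x) \<in> borel_measurable borel" by measurable
  show "AE x in lborel. indicator \<Omega> x * (u x * \<phi> x) = g x * \<phi> x"
    using represents_AE[OF r] by eventually_elim (auto simp: represents_outside[OF r] split: split_indicator)
qed

lemma measurable_lebesgue_on_iff:
  fixes u :: "real^3 \<Rightarrow> real"
  shows "u \<in> borel_measurable (lebesgue_on \<Omega>) \<longleftrightarrow> (\<lambda>x. indicator \<Omega> x * u x) \<in> borel_measurable lebesgue"
  by (subst borel_measurable_restrict_space_iff) auto

lemma represents_exists:
  assumes "u \<in> borel_measurable (lebesgue_on \<Omega>)"
  obtains g where "represents g u"
proof -
  from completion_ex_borel_measurable_real[OF assms[unfolded measurable_lebesgue_on_iff]]
  obtain g' where g': "g' \<in> borel_measurable borel" "AE x in lborel. indicator \<Omega> x * u x = g' x" by auto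
  have "represents (\<lambda>x. g' x * indicator \<Omega> x) u"
    unfolding represents_def using g' by (auto elim!: eventually_mono split: split_indicator)
  then show thesis by (rule that)
qed

lemma represents_imp_measurable: "represents g u \<Longrightarrow> u \<in> borel_measurable (lebesgue_on \<Omega>)"
  unfolding measurable_lebesgue_on_iff using represents_measurable[of g u "\<lambda>_. 1"] by simp

lemma represents_cong_AE:
  assumes "represents g u" "AE x in lborel. x \<in> \<Omega> \<longrightarrow> u x = u' x" shows "represents g u'"
proof -
  have "AE x in lborel. x \<in> \<Omega> \<longrightarrow> u' x = g x"
    using represents_AE[OF assms(1)] assms(2) by eventually_elim simp
  then show ?thesis using assms(1) by (simp add: represents_def)
qed

lemma represents_LINT:
  assumes r: "represents g u" and [measurable]: "\<phi> \<in> borel_measurable borel"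
  shows "(LINT x|lebesgue_on \<Omega>. u x * \<phi> x) = (LINT x|lborel. g x * \<phi> x)"
proof -
  have [measurable]: "g \<in> borel_measurable borel" using represents_borel[OF r] .
  have "(LINT x|lebesgue_on \<Omega>. u x * \<phi> x) = (LINT x|lebesgue. indicator \<Omega> x * (u x * \<phi> x))"
    by (subst integral_restrict_space) auto
  also have "\<dots> = (LINT x|lebesgue. g x * \<phi> x)"
  proof (rule integral_cong_AE[OF represents_measurable[OF r]])
    show "(\<lambda>x. g x * \<phi> x) \<in> borel_measurable lebesgue" by (rule measurable_completion) measurable
    show "AE x in lebesgue. indicator \<Omega> x * (u x * \<phi> x) = g x * \<phi> x"
      using AE_completion[OF represents_AE[OF r]]
      by eventually_elim (auto simp: represents_outside[OF r] split: split_indicator)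
  qed measurable
  also have "\<dots> = (LINT x|lborel. g x * \<phi> x)" by (rule integral_completion) measurable
  finally show ?thesis .
qed

lemma represents_nn_integral:
  assumes r: "represents g u" and p: "0 < p"
  shows "(\<integral>\<^sup>+x. ennreal (\<bar>u x\<bar> powr p) \<partial>lebesgue_on \<Omega>) = (\<integral>\<^sup>+x. ennreal (\<bar>g x\<bar> powr p) \<partial>lborel)"
proof -
  have "(\<integral>\<^sup>+x. ennreal (\<bar>u x\<bar> powr p) \<partial>lebesgue_on \<Omega>) = (\<integral>\<^sup>+x. ennreal (\<bar>u x\<bar> powr p) * indicator \<Omega> x \<partial>lborel)"
    by (subst nn_integral_restrict_space) (auto simp: nn_integral_completion)
  also have "\<dots> = (\<integral>\<^sup>+x. ennreal (\<bar>g x\<bar> powr p) \<partial>lborel)"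
    by (rule nn_integral_cong_AE, rule AE_mp[OF represents_AE[OF r]], rule AE_I2)
      (use p in \<open>auto simp: represents_outside[OF r] split: split_indicator\<close>)
  finally show ?thesis .
qed

lemma represents_Lp_iff:
  assumes r: "represents g u" and p: "0 < p"
  shows "u \<in> Lp (lebesgue_on \<Omega>) p \<longleftrightarrow> Lp_fun p g"
proof -
  have [measurable]: "u \<in> borel_measurable (lebesgue_on \<Omega>)" by (rule represents_imp_measurable[OF r])
  show ?thesis
    unfolding Lp_def Lp_fun_def using represents_nn_integral[OF r p] represents_borel[OF r] represents_outside[OF r]
    by (auto simp: integrable_iff_bounded)
qed

lemma represents_Lp_norm:
  assumes r: "represents g u" and p: "0 < p" and "Lp_fun p g"
  shows "ennreal (Lp_norm (lebesgue_on \<Omega>) p u powr p) = (\<integral>\<^sup>+x. ennreal (\<bar>g x\<bar> powr p) \<partial>lborel)"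
proof -
  have "integrable (lebesgue_on \<Omega>) (\<lambda>x. \<bar>u x\<bar> powr p)"
    using represents_Lp_iff[OF r p] assms(3) by (simp add: Lp_def)
  then have "ennreal (LINT x|lebesgue_on \<Omega>. \<bar>u x\<bar> powr p) = (\<integral>\<^sup>+x. ennreal (\<bar>g x\<bar> powr p) \<partial>lborel)"
    using nn_integral_eq_integral[of "lebesgue_on \<Omega>" "\<lambda>x. \<bar>u x\<bar> powr p"] represents_nn_integral[OF r p] by simp
  then show ?thesis using p by (simp add: Lp_norm_def powr_powr integral_nonneg_AE)
qed

lemma represents_locally_integrable:
  assumes r: "represents g u" and g: "integrable lborel g"
  shows "locally_integrable \<Omega> u"
  unfolding locally_integrable_def
proof (intro allI impI)
  fix K assume K: "compact K \<and> K \<subseteq> \<Omega>"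
  have Kb [measurable]: "K \<in> sets borel" using K by (intro borel_closed compact_imp_closed) simp
  have [measurable]: "g \<in> borel_measurable borel" using represents_borel[OF r] .
  have "integrable lborel (\<lambda>x. indicator K x * g x)"
    using integrable_real_mult_indicator[OF _ g, of K] by (simp add: mult.commute)
  then have int: "integrable lebesgue (\<lambda>x. indicator K x * g x)" by (subst integrable_completion) auto
  have eq: "AE x in lborel. indicator K x * g x = indicator K x * u x"
    using represents_AE[OF r] by eventually_elim (use K in \<open>auto split: split_indicator\<close>)
  show "set_integrable lebesgue K u"
    unfolding set_integrable_def
  proof (subst integrable_cong_AE[symmetric])
    show "(\<lambda>x. indicator K x * g x) \<in> borel_measurable lebesgue" using int by simp
    show "(\<lambda>x. indicator K x *\<^sub>R u x) \<in> borel_measurable lebesgue"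
      by (rule lebesgue_measurable_AE[of "\<lambda>x. indicator K x * g x"]) (use eq in \<open>auto elim: eventually_mono\<close>)
    show "AE x in lebesgue. indicator K x * g x = indicator K x *\<^sub>R u x" using AE_completion[OF eq] by simp
  qed (rule int)
qed

text \<open>Required because \<open>weak_deriv\<close> is a choice and
  \<open>has_normal_deriv\<close> admits any weak gradient. Weak derivatives are only locally
  integrable, so the argument is confined to a closed box, where the difference is integrable and
  orthogonal to all cutoffs.\<close>

lemma weak_deriv_unique:
  assumes "has_weak_deriv \<Omega> \<alpha> u w" "has_weak_deriv \<Omega> \<alpha> u w'"
  shows "AE x in lborel. x \<in> \<Omega> \<longrightarrow> w x = w' x"
proof (rule AE_local)
  fix x assume "x \<in> \<Omega>"
  then obtain a b where ab: "x \<in> box a b" "cbox a b \<subseteq> \<Omega>"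
    using open_domain by (meson open_contains_cbox)
  let ?f = "\<lambda>x. indicator (cbox a b) x * (w x - w' x)"
  have wi: "set_integrable lebesgue (cbox a b) w" "set_integrable lebesgue (cbox a b) w'"
    using assms ab(2) unfolding has_weak_deriv_def locally_integrable_def by auto
  then have int: "integrable lebesgue ?f"
    using Bochner_Integration.integrable_diff[of lebesgue "\<lambda>x. indicator (cbox a b) x *\<^sub>R w x" "\<lambda>x. indicator (cbox a b) x *\<^sub>R w' x"]
    by (simp add: set_integrable_def right_diff_distrib)
  \<comment> \<open>The orthogonality lemma speaks of measures on the Borel sets, hence a Borel
    version of the difference.\<close>
  obtain F where F [measurable]: "F \<in> borel_measurable borel" and eq: "AE x in lborel. ?f x = F x"
    using completion_ex_borel_measurable_real[OF borel_measurable_integrable[OF int]] by auto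
  have mF: "F \<in> borel_measurable lebesgue" by (rule measurable_completion) simp
  have "integrable lebesgue F" by (rule integrable_cong_AE_imp[OF int mF AE_completion[OF eq]])
  then have intF: "integrable lborel F" by (subst (asm) integrable_completion) auto
  have "AE x in lborel. x \<in> box a b \<longrightarrow> F x = 0"
  proof (rule orthogonal_test_functions_box[OF _ intF])
    fix n c d assume cd: "cbox c d \<subseteq> cbox a b"
    let ?\<phi> = "cutoff n c d"
    have test: "?\<phi> \<in> test_functions \<Omega>" using cutoff_test_function cd ab by blast
    have [measurable]: "?\<phi> \<in> borel_measurable borel" by (rule smooth_borel[OF smooth_cutoff])
    have out: "?\<phi> x = 0" if "x \<notin> cbox a b" for x
      using that cutoff_support[of x c d n] cd box_subset_cbox by blast
    have "(LINT x|lebesgue_on \<Omega>. u x * multi_deriv \<alpha> ?\<phi> x) = (-1) ^ sum \<alpha> UNIV * (LINT x|lebesgue_on \<Omega>. w x * ?\<phi> x)"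
      "(LINT x|lebesgue_on \<Omega>. u x * multi_deriv \<alpha> ?\<phi> x) = (-1) ^ sum \<alpha> UNIV * (LINT x|lebesgue_on \<Omega>. w' x * ?\<phi> x)"
      using assms test unfolding has_weak_deriv_def by blast+
    from trans[OF sym[OF this(1)] this(2)]
    have ww': "(LINT x|lebesgue_on \<Omega>. w x * ?\<phi> x) = (LINT x|lebesgue_on \<Omega>. w' x * ?\<phi> x)" by simp
    have wphi: "(LINT x|lebesgue. (indicator (cbox a b) x * w x) * ?\<phi> x) = (LINT x|lebesgue. (indicator (cbox a b) x * w' x) * ?\<phi> x)"
    proof -
      have "(LINT x|lebesgue_on \<Omega>. v x * ?\<phi> x) = (LINT x|lebesgue. (indicator (cbox a b) x * v x) * ?\<phi> x)" for v
        by (subst integral_restrict_space)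
          (use ab out in \<open>auto intro!: Bochner_Integration.integral_cong split: split_indicator\<close>)
      from this[of w] this[of w'] ww' show ?thesis by (simp only:)
    qed
    have intphi: "integrable lebesgue (\<lambda>x. (indicator (cbox a b) x * v x) * ?\<phi> x)" if "set_integrable lebesgue (cbox a b) v" for v
    proof (rule integrable_mult_bounded)
      show "integrable lebesgue (\<lambda>x. indicator (cbox a b) x * v x)" using that by (simp add: set_integrable_def)
      show "?\<phi> \<in> borel_measurable lebesgue" by (rule measurable_completion) simp
      show "\<bar>?\<phi> x\<bar> \<le> 1" for x using cutoff_range[of n c d x] by simp
    qed
    have "(LINT x|lborel. F x * ?\<phi> x) = (LINT x|lebesgue. F x * ?\<phi> x)"
      by (subst integral_completion) auto
    also have "\<dots> = (LINT x|lebesgue. ?f x * ?\<phi> x)"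
    proof (rule integral_cong_AE)
      show "AE x in lebesgue. F x * ?\<phi> x = ?f x * ?\<phi> x" using AE_completion[OF eq] by eventually_elim simp
      show "(\<lambda>x. F x * ?\<phi> x) \<in> borel_measurable lebesgue" by (rule measurable_completion) measurable
      show "(\<lambda>x. ?f x * ?\<phi> x) \<in> borel_measurable lebesgue"
        by (rule borel_measurable_times[OF borel_measurable_integrable[OF int] measurable_completion]) simp
    qed
    also have "\<dots> = (LINT x|lebesgue. (indicator (cbox a b) x * w x) * ?\<phi> x - (indicator (cbox a b) x * w' x) * ?\<phi> x)"
      by (intro Bochner_Integration.integral_cong) (auto simp: algebra_simps)
    also have "\<dots> = 0"
      using wphi by (subst Bochner_Integration.integral_diff[OF intphi[OF wi(1)] intphi[OF wi(2)]]) simp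
    finally show "(LINT x|lborel. F x * ?\<phi> x) = 0" .
  qed simp
  with eq have "AE y in lborel. y \<in> box a b \<longrightarrow> w y = w' y"
    by eventually_elim (use box_subset_cbox in \<open>auto split: split_indicator_asm\<close>)
  then show "\<exists>V. open V \<and> x \<in> V \<and> (AE y in lborel. y \<in> V \<longrightarrow> w y = w' y)"
    using ab by (intro exI[of _ "box a b"]) (auto simp: open_box)
qed

lemma represents_weak_deriv:
  assumes "has_weak_deriv \<Omega> \<alpha> u w" "represents W w"
  shows "represents W (weak_deriv \<Omega> \<alpha> u)"
proof -
  have "has_weak_deriv \<Omega> \<alpha> u (weak_deriv \<Omega> \<alpha> u)" 
    unfolding weak_deriv_def using assms(1) by (rule someI[of "has_weak_deriv \<Omega> \<alpha> u"])
  from represents_cong_AE[OF assms(2) weak_deriv_unique[OF assms(1) this]] show ?thesis .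
qed

end

lemma tendsto_0_powr_iff:
  fixes x :: "nat \<Rightarrow> real"
  assumes "\<And>n. 0 \<le> x n" "0 < p"
  shows "x \<longlonglongrightarrow> 0 \<longleftrightarrow> (\<lambda>n. ennreal (x n powr p)) \<longlonglongrightarrow> 0"
proof
  assume "x \<longlonglongrightarrow> 0"
  then have "(\<lambda>n. x n powr p) \<longlonglongrightarrow> 0 powr p" using assms by (intro tendsto_powr') auto
  from tendsto_ennrealI[OF this] show "(\<lambda>n. ennreal (x n powr p)) \<longlonglongrightarrow> 0" using assms by simp
next
  assume "(\<lambda>n. ennreal (x n powr p)) \<longlonglongrightarrow> 0"
  then have "(\<lambda>n. x n powr p) \<longlonglongrightarrow> 0" using tendsto_ennreal_iff[of "\<lambda>n. x n powr p" sequentially 0] by simp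
  then have "(\<lambda>n. (x n powr p) powr (1 / p)) \<longlonglongrightarrow> 0 powr (1 / p)" using assms by (intro tendsto_powr') auto
  then show "x \<longlonglongrightarrow> 0" using assms by (simp add: powr_powr)
qed

lemma test_function_partial_deriv:
  assumes "\<phi> \<in> test_functions U" shows "partial_deriv i \<phi> \<in> test_functions U"
proof (rule test_functionI)
  show "smooth (partial_deriv i \<phi>)" using assms by (simp add: test_functions_def smooth_partial_deriv)
  let ?K = "closure {x. \<phi> x \<noteq> 0}"
  show "closed ?K" "bounded ?K" "?K \<subseteq> U" using assms by (auto simp: test_functions_def compact_eq_bounded_closed)
  fix x assume x: "x \<notin> ?K"
  have "(\<phi> has_derivative (\<lambda>h. 0)) (at x)"
    by (rule has_derivative_transform_within_open[OF has_derivative_const[of 0], of "- ?K"])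
      (use x closure_subset[of "{x. \<phi> x \<noteq> 0}"] in auto)
  from partial_derivI[OF this] show "partial_deriv i \<phi> x = 0" .
qed

text \<open>The product has bounded support although \<phi> need not, so its partial derivative
  integrates to 0 over the whole space.\<close>

lemma LINT_partial_deriv_product:
  assumes \<phi>: "smooth \<phi>" and \<psi>: "\<psi> \<in> test_functions U"
  shows "(LINT x|lborel. \<phi> x * partial_deriv i \<psi> x) = - (LINT x|lborel. partial_deriv i \<phi> x * \<psi> x)"
proof -
  have sm: "smooth \<psi>" using \<psi> by (rule test_function_smooth)
  obtain R where R: "\<And>x. R < norm x \<Longrightarrow> \<psi> x = 0" using test_function_support[OF \<psi>] by blast
  obtain R' where R': "\<And>x. R' < norm x \<Longrightarrow> partial_deriv i \<psi> x = 0"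
    using test_function_support[OF test_function_partial_deriv[OF \<psi>]] by blast
  have int1: "integrable lborel (\<lambda>x. \<phi> x * partial_deriv i \<psi> x)"
    using integrable_bounded_support[of "\<lambda>x. \<phi> x * partial_deriv i \<psi> x" R' UNIV] R' \<phi> sm
    by (auto intro!: smooth_continuous smooth_mult smooth_partial_deriv)
  have int2: "integrable lborel (\<lambda>x. partial_deriv i \<phi> x * \<psi> x)"
    using integrable_bounded_support[of "\<lambda>x. partial_deriv i \<phi> x * \<psi> x" R UNIV] R \<phi> sm
    by (auto intro!: smooth_continuous smooth_mult smooth_partial_deriv)
  have "(LINT x|lborel. indicator UNIV x * dir_deriv (axis i 1) (\<lambda>x. \<phi> x * \<psi> x) x) = 0"
    by (rule LINT_dir_deriv_eq_0[of _ R]) (use R in \<open>auto intro!: smooth_mult \<phi> sm\<close>)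
  moreover have "indicator UNIV x * dir_deriv (axis i 1) (\<lambda>x. \<phi> x * \<psi> x) x = \<phi> x * partial_deriv i \<psi> x + partial_deriv i \<phi> x * \<psi> x" for x
    using partial_deriv_mult[OF smooth_differentiable[OF \<phi>] smooth_differentiable[OF sm]] by simp
  ultimately have "(LINT x|lborel. \<phi> x * partial_deriv i \<psi> x + partial_deriv i \<phi> x * \<psi> x) = 0" by (simp only:)
  then show ?thesis by (simp add: Bochner_Integration.integral_add[OF int1 int2])
qed

section \<open>First-order Sobolev functions through representatives\<close>

context polyhedral_domain begin

lemma Lp_funD:
  assumes "Lp_fun p g"
  shows Lp_fun_borel: "g \<in> borel_measurable borel" and Lp_fun_outside: "x \<notin> \<Omega> \<Longrightarrow> g x = 0"
    and Lp_fun_finite: "(\<integral>\<^sup>+x. ennreal (\<bar>g x\<bar> powr p) \<partial>lborel) < \<infinity>"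
  using assms by (auto simp: Lp_fun_def)

lemma Lp_fun_diff:
  assumes p: "0 < p" and g: "Lp_fun p g" and h: "Lp_fun p h"
  shows "Lp_fun p (\<lambda>x. g x - h x)"
proof -
  have [measurable]: "g \<in> borel_measurable borel" "h \<in> borel_measurable borel" using g h by (auto simp: Lp_fun_def)
  have "(\<integral>\<^sup>+x. ennreal (\<bar>g x - h x\<bar> powr p) \<partial>lborel) \<le> (\<integral>\<^sup>+x. ennreal (2 powr p) * (ennreal (\<bar>g x\<bar> powr p) + ennreal (\<bar>h x\<bar> powr p)) \<partial>lborel)"
    by (intro nn_integral_mono) (use abs_add_powr_le[OF p, of "g _" "- h _"] in \<open>simp add: ennreal_leI flip: ennreal_plus ennreal_mult\<close>)
  also have "\<dots> = ennreal (2 powr p) * ((\<integral>\<^sup>+x. ennreal (\<bar>g x\<bar> powr p) \<partial>lborel) + (\<integral>\<^sup>+x. ennreal (\<bar>h x\<bar> powr p) \<partial>lborel))"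
    by (simp add: nn_integral_cmult nn_integral_add)
  also have "\<dots> < \<infinity>" using g h by (simp add: Lp_fun_def ennreal_mult_less_top)
  finally show ?thesis using g h by (simp add: Lp_fun_def)
qed

definition cut :: "(real^3 \<Rightarrow> real) \<Rightarrow> real^3 \<Rightarrow> real" where "cut f x = f x * indicator \<Omega> x"

lemma cut_Lp:
  assumes p: "0 < p" and f: "smooth f" shows "Lp_fun p (cut f)"
proof -
  have [measurable]: "f \<in> borel_measurable borel" by (rule smooth_borel[OF f])
  have "bounded (f ` closure \<Omega>)"
    by (intro compact_imp_bounded compact_continuous_image smooth_continuous f compact_closure)
  then obtain M where M: "\<And>x. x \<in> closure \<Omega> \<Longrightarrow> \<bar>f x\<bar> \<le> M" unfolding bounded_iff by (metis imageI real_norm_def)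
  have "(\<integral>\<^sup>+x. ennreal (\<bar>cut f x\<bar> powr p) \<partial>lborel) \<le> (\<integral>\<^sup>+x. ennreal (M powr p) * indicator \<Omega> x \<partial>lborel)"
  proof (intro nn_integral_mono)
    fix x
    show "ennreal (\<bar>cut f x\<bar> powr p) \<le> ennreal (M powr p) * indicator \<Omega> x"
    proof (cases "x \<in> \<Omega>")
      case True
      then have "\<bar>f x\<bar> powr p \<le> M powr p" using M[OF subsetD[OF closure_subset True]] p by (intro powr_mono2) auto
      then show ?thesis using True by (simp add: cut_def ennreal_leI)
    qed (use p in \<open>simp add: cut_def\<close>)
  qed
  also have "\<dots> < \<infinity>" using emeasure_domain_finite by (simp add: nn_integral_cmult_indicator ennreal_mult_less_top)
  finally show ?thesis unfolding Lp_fun_def cut_def[abs_def] by simp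
qed

lemma cut_weak_partial:
  assumes f: "smooth f" shows "weak_partial i (cut f) (cut (partial_deriv i f))"
  unfolding weak_partial_def
proof
  fix \<phi> assume \<phi>: "\<phi> \<in> test_functions \<Omega>"
  have out: "\<psi> x = 0" if "\<psi> \<in> test_functions \<Omega>" "x \<notin> \<Omega>" for \<psi> x
    using that closure_subset[of "{x. \<psi> x \<noteq> 0}"] by (auto simp: test_functions_def)
  have eq: "cut h x * \<psi> x = h x * \<psi> x" if "\<psi> \<in> test_functions \<Omega>" for h \<psi> x
    using out[OF that] by (auto simp: cut_def split: split_indicator)
  show "(LINT y|lborel. cut f y * partial_deriv i \<phi> y) = - (LINT y|lborel. cut (partial_deriv i f) y * \<phi> y)"
    unfolding eq[OF \<phi>] eq[OF test_function_partial_deriv[OF \<phi>]] by (rule LINT_partial_deriv_product[OF f \<phi>])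
qed

lemma has_weak_deriv_iff:
  assumes p: "1 < p" and g: "represents g u" "Lp_fun p g" and W: "represents W w" "Lp_fun p W"
  shows "has_weak_deriv \<Omega> \<alpha> u w \<longleftrightarrow>
    (\<forall>\<phi>\<in>test_functions \<Omega>. (LINT x|lborel. g x * multi_deriv \<alpha> \<phi> x) = (-1) ^ sum \<alpha> UNIV * (LINT x|lborel. W x * \<phi> x))"
proof -
  have "smooth (multi_deriv \<alpha> \<phi>)" if "smooth \<phi>" for \<phi>
  proof -
    have "smooth ((partial_deriv i ^^ n) f)" if "smooth f" for f i n
      using that by (induction n) auto
    then show ?thesis unfolding multi_deriv_def using that by blast
  qed
  then have b: "multi_deriv \<alpha> \<phi> \<in> borel_measurable borel" "\<phi> \<in> borel_measurable borel" if "\<phi> \<in> test_functions \<Omega>" for \<phi>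
    using that smooth_borel test_function_smooth by auto
  have "locally_integrable \<Omega> u" "locally_integrable \<Omega> w"
    using represents_locally_integrable[OF g(1) Lp_fun_integrable[OF p g(2)]]
      represents_locally_integrable[OF W(1) Lp_fun_integrable[OF p W(2)]] by auto
  then show ?thesis
    unfolding has_weak_deriv_def using represents_LINT[OF g(1) b(1)] represents_LINT[OF W(1) b(2)] by simp
qed

lemma has_weak_deriv_unit_index:
  assumes "1 < p" "represents g u" "Lp_fun p g" "represents W w" "Lp_fun p W"
  shows "has_weak_deriv \<Omega> (unit_index i) u w \<longleftrightarrow> weak_partial i g W"
  unfolding has_weak_deriv_iff[OF assms] weak_partial_def multi_deriv_unit_index by simp

lemma has_weak_deriv_0:
  assumes "1 < p" "represents g u" "Lp_fun p g"
  shows "has_weak_deriv \<Omega> (\<lambda>_. 0) u u"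
  unfolding has_weak_deriv_iff[OF assms assms(2,3)] multi_deriv_0 by simp

lemma represents_self: "Lp_fun p g \<Longrightarrow> represents g g"
  by (simp add: Lp_fun_def represents_def)

text \<open>Keeps a function together with explicit representatives of itself and of its weak
  gradient. Norms become integrals of these representatives, and the choice hidden in
  \<open>weak_deriv\<close> is dealt with once, in \<open>W1_norm\<close>.\<close>

definition W1 :: "real \<Rightarrow> (real^3 \<Rightarrow> real) \<Rightarrow> (real^3 \<Rightarrow> real) \<Rightarrow> (3 \<Rightarrow> real^3 \<Rightarrow> real) \<Rightarrow> bool" where
  "W1 p u g W \<longleftrightarrow> represents g u \<and> Lp_fun p g \<and> (\<forall>i. Lp_fun p (W i) \<and> weak_partial i g (W i))"

definition Lp_energy :: "real \<Rightarrow> (real^3 \<Rightarrow> real) \<Rightarrow> ennreal" where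
  "Lp_energy p g = (\<integral>\<^sup>+x. ennreal (\<bar>g x\<bar> powr p) \<partial>lborel)"

lemma sobolev_norm_powr:
  assumes p: "0 < p"
  shows "ennreal (sobolev_norm k p \<Omega> u powr p) =
    (\<Sum>\<alpha> | sum \<alpha> UNIV \<le> k. ennreal (Lp_norm (lebesgue_on \<Omega>) p (weak_deriv \<Omega> \<alpha> u) powr p))"
  using p unfolding sobolev_norm_def by (simp add: powr_powr sum_nonneg sum_ennreal)

lemma weak_deriv_energy:
  assumes p: "0 < p" and w: "has_weak_deriv \<Omega> \<alpha> u w" "represents W w" "Lp_fun p W"
  shows "ennreal (Lp_norm (lebesgue_on \<Omega>) p (weak_deriv \<Omega> \<alpha> u) powr p) = Lp_energy p W"
  unfolding Lp_energy_def by (rule represents_Lp_norm[OF represents_weak_deriv[OF w(1,2)] p w(3)])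

lemma W1_sobolev_space:
  assumes p: "1 < p" and W: "W1 p u g W"
  shows "u \<in> sobolev_space 1 p \<Omega>"
    and W1_norm: "ennreal (sobolev_norm 1 p \<Omega> u powr p) = Lp_energy p g + (\<Sum>i\<in>UNIV. Lp_energy p (W i))"
proof -
  have p0: "0 < p" using p by simp
  have g: "represents g u" "Lp_fun p g" and Wi: "Lp_fun p (W i)" "weak_partial i g (W i)" for i
    using W by (auto simp: W1_def)
  have h0: "has_weak_deriv \<Omega> (\<lambda>_. 0) u u" by (rule has_weak_deriv_0[OF p g])
  have h1: "has_weak_deriv \<Omega> (unit_index i) u (W i)" for i
    using has_weak_deriv_unit_index[OF p g represents_self[OF Wi(1)] Wi(1)] Wi(2) by blast
  have u: "u \<in> Lp (lebesgue_on \<Omega>) p" using represents_Lp_iff[OF g(1) p0] g(2) by simp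
  have w: "W i \<in> Lp (lebesgue_on \<Omega>) p" for i using represents_Lp_iff[OF represents_self[OF Wi(1)] p0] Wi(1) by simp
  have "\<exists>w\<in>Lp (lebesgue_on \<Omega>) p. has_weak_deriv \<Omega> \<alpha> u w" if "sum \<alpha> UNIV \<le> 1" for \<alpha>
  proof -
    have "\<alpha> \<in> insert (\<lambda>_. 0) (range unit_index)" using that unfolding multi_indices_1[symmetric] by simp
    then show ?thesis using h0 h1 u w by auto
  qed
  then show "u \<in> sobolev_space 1 p \<Omega>" using u by (simp add: sobolev_space_def)
  have "(\<Sum>\<alpha> | sum \<alpha> UNIV \<le> 1. ennreal (Lp_norm (lebesgue_on \<Omega>) p (weak_deriv \<Omega> \<alpha> u) powr p))
      = Lp_energy p g + (\<Sum>i\<in>UNIV. Lp_energy p (W i))"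
    unfolding multi_indices_1 using inj_unit_index
    by (simp add: sum.reindex weak_deriv_energy[OF p0 h0 g] weak_deriv_energy[OF p0 h1 represents_self[OF Wi(1)] Wi(1)]
      del: sum_ennreal)
  then show "ennreal (sobolev_norm 1 p \<Omega> u powr p) = Lp_energy p g + (\<Sum>i\<in>UNIV. Lp_energy p (W i))"
    unfolding sobolev_norm_powr[OF p0] .
qed

lemma sobolev_space_deriv:
  assumes p: "1 < p" and u: "u \<in> sobolev_space k p \<Omega>" and "sum \<alpha> UNIV \<le> k"
  obtains w W where "has_weak_deriv \<Omega> \<alpha> u w" "represents W w" "Lp_fun p W"
    "Lp_energy p W = ennreal (Lp_norm (lebesgue_on \<Omega>) p (weak_deriv \<Omega> \<alpha> u) powr p)"
proof -
  have p0: "0 < p" using p by simp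
  obtain w where w: "w \<in> Lp (lebesgue_on \<Omega>) p" "has_weak_deriv \<Omega> \<alpha> u w"
    using u assms(3) unfolding sobolev_space_def by blast
  then obtain W where W: "represents W w" using represents_exists[of w] by (auto simp: Lp_def)
  have "Lp_fun p W" using represents_Lp_iff[OF W p0] w(1) by simp
  with w W weak_deriv_energy[OF p0 w(2) W this] show thesis by (intro that) auto
qed

lemma sobolev_space_represents:
  assumes p: "1 < p" and u: "u \<in> sobolev_space k p \<Omega>"
  obtains g where "represents g u" "Lp_fun p g"
proof -
  have "u \<in> Lp (lebesgue_on \<Omega>) p" using u by (simp add: sobolev_space_def)
  moreover then obtain g where "represents g u" using represents_exists[of u] by (auto simp: Lp_def)
  ultimately show thesis using represents_Lp_iff[of g u p] p by (intro that) auto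
qed

text \<open>By \<open>W1_norm\<close> and \<open>W1_diff\<close> this is the p-th power of the
  \<open>W^(1,p)\<close> distance to a smooth function.\<close>

definition dist_energy :: "real \<Rightarrow> (real^3 \<Rightarrow> real) \<Rightarrow> (3 \<Rightarrow> real^3 \<Rightarrow> real) \<Rightarrow> (real^3 \<Rightarrow> real) \<Rightarrow> ennreal" where
  "dist_energy p g W \<phi> = Lp_energy p (\<lambda>x. g x - cut \<phi> x) + (\<Sum>i\<in>UNIV. Lp_energy p (\<lambda>x. W i x - cut (partial_deriv i \<phi>) x))"

lemma W1_diff:
  assumes p: "1 < p" and W: "W1 p u g W" and \<phi>: "smooth \<phi>"
  shows "W1 p (\<lambda>x. u x - \<phi> x) (\<lambda>x. g x - cut \<phi> x) (\<lambda>i x. W i x - cut (partial_deriv i \<phi>) x)"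
  unfolding W1_def
proof (intro conjI allI)
  have p0: "0 < p" using p by simp
  have g: "represents g u" "Lp_fun p g" and Wi: "Lp_fun p (W i)" "weak_partial i g (W i)" for i
    using W by (auto simp: W1_def)
  show Lg: "Lp_fun p (\<lambda>x. g x - cut \<phi> x)" by (rule Lp_fun_diff[OF p0 g(2) cut_Lp[OF p0 \<phi>]])
  show "represents (\<lambda>x. g x - cut \<phi> x) (\<lambda>x. u x - \<phi> x)"
    using Lg represents_AE[OF g(1)] by (auto simp: represents_def Lp_fun_def cut_def elim!: eventually_mono)
  fix i
  show "Lp_fun p (\<lambda>x. W i x - cut (partial_deriv i \<phi>) x)"
    by (rule Lp_fun_diff[OF p0 Wi(1) cut_Lp[OF p0 smooth_partial_deriv[OF \<phi>]]])
  show "weak_partial i (\<lambda>x. g x - cut \<phi> x) (\<lambda>x. W i x - cut (partial_deriv i \<phi>) x)"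
    unfolding weak_partial_def
  proof
    fix \<psi> assume \<psi>: "\<psi> \<in> test_functions \<Omega>"
    have int: "integrable lborel (\<lambda>x. h x * \<theta> x)" if h: "Lp_fun p h" and \<theta>: "\<theta> \<in> test_functions \<Omega>" for h \<theta>
    proof -
      obtain R where "\<And>x. R < norm x \<Longrightarrow> \<theta> x = 0" using test_function_support[OF \<theta>] by blast
      then obtain B where B: "\<And>x. \<bar>\<theta> x\<bar> \<le> B" using smooth_bounded_support[OF test_function_smooth[OF \<theta>]] by blast
      have "\<theta> \<in> borel_measurable lborel" using smooth_borel[OF test_function_smooth[OF \<theta>]] by simp
      then show ?thesis by (rule integrable_mult_bounded[OF Lp_fun_integrable[OF p h] _ B])
    qed
    note \<psi>' = test_function_partial_deriv[OF \<psi>, of i]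
    show "(LINT y|lborel. (g y - cut \<phi> y) * partial_deriv i \<psi> y) = - (LINT y|lborel. (W i y - cut (partial_deriv i \<phi>) y) * \<psi> y)"
      unfolding left_diff_distrib
        Bochner_Integration.integral_diff[OF int[OF g(2) \<psi>'] int[OF cut_Lp[OF p0 \<phi>] \<psi>']]
        Bochner_Integration.integral_diff[OF int[OF Wi(1) \<psi>] int[OF cut_Lp[OF p0 smooth_partial_deriv[OF \<phi>]] \<psi>]]
      using Wi(2) cut_weak_partial[OF \<phi>] \<psi> by (simp add: weak_partial_def)
  qed
qed

lemma sobolev_norm_tendsto_iff:
  assumes p: "1 < p" and W: "W1 p u g W" and \<phi>: "\<And>m. smooth (\<phi> m)"
  shows "(\<lambda>m::nat. sobolev_norm 1 p \<Omega> (\<lambda>x. u x - \<phi> m x)) \<longlonglongrightarrow> 0 \<longleftrightarrow> (\<lambda>m. dist_energy p g W (\<phi> m)) \<longlonglongrightarrow> 0"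
proof -
  have "0 \<le> sobolev_norm 1 p \<Omega> (\<lambda>x. u x - \<phi> m x)" for m by (simp add: sobolev_norm_def)
  then show ?thesis
    using p tendsto_0_powr_iff[of "\<lambda>m. sobolev_norm 1 p \<Omega> (\<lambda>x. u x - \<phi> m x)" p]
    unfolding W1_norm[OF p W1_diff[OF p W \<phi>]] dist_energy_def by simp
qed

end

section \<open>Traces\<close>

text \<open>Indices are picked so that the k-th integral is at most 2^(-k). The sum of the functions
  is then integrable, hence almost everywhere finite, and the terms of a convergent series tend to
  0.\<close>

lemma AE_subsequence:
  fixes f :: "nat \<Rightarrow> 'a \<Rightarrow> ennreal"
  assumes [measurable]: "\<And>n. f n \<in> borel_measurable M" and lim: "(\<lambda>n. \<integral>\<^sup>+x. f n x \<partial>M) \<longlonglongrightarrow> 0"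
  obtains r where "filterlim r at_top sequentially" "AE x in M. (\<lambda>k. f (r k) x) \<longlonglongrightarrow> 0"
proof -
  have "\<exists>n\<ge>k. (\<integral>\<^sup>+x. f n x \<partial>M) \<le> ennreal ((1/2) ^ k)" for k
  proof -
    have "\<forall>\<^sub>F n in sequentially. (\<integral>\<^sup>+x. f n x \<partial>M) < ennreal ((1/2) ^ k)"
      by (rule order_tendstoD(2)[OF lim]) simp
    then show ?thesis using eventually_conj[OF _ eventually_ge_at_top[of k]]
      by (metis (mono_tags, lifting) eventually_sequentially le_cases less_imp_le)
  qed
  then obtain r where r: "\<And>k. k \<le> r k" "\<And>k. (\<integral>\<^sup>+x. f (r k) x \<partial>M) \<le> ennreal ((1/2) ^ k)" by metis
  have "(\<integral>\<^sup>+x. (\<Sum>k. f (r k) x) \<partial>M) = (\<Sum>k. \<integral>\<^sup>+x. f (r k) x \<partial>M)" by (rule nn_integral_suminf) measurable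
  also have "\<dots> \<le> (\<Sum>k. ennreal ((1/2) ^ k))" by (intro suminf_le r) auto
  also have "\<dots> = ennreal (\<Sum>k. (1/2) ^ k)" by (rule suminf_ennreal2) (auto intro: summable_geometric)
  finally have "(\<integral>\<^sup>+x. (\<Sum>k. f (r k) x) \<partial>M) \<noteq> \<infinity>" by (auto simp: top_unique)
  then have "AE x in M. (\<Sum>k. f (r k) x) \<noteq> \<infinity>" by (intro nn_integral_PInf_AE) auto
  then have "AE x in M. (\<lambda>k. f (r k) x) \<longlonglongrightarrow> 0"
  proof eventually_elim
    case (elim x)
    have fin: "f (r k) x \<noteq> \<infinity>" for k
      using elim ennreal_suminf_lessD[of "\<lambda>k. f (r k) x" \<infinity> k] by (auto simp: less_top)
    then have eq: "f (r k) x = ennreal (enn2real (f (r k) x))" for k by (simp add: less_top)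
    have "summable (\<lambda>k. enn2real (f (r k) x))"
      by (rule summable_suminf_not_top) (use elim eq in auto)
    from tendsto_ennrealI[OF summable_LIMSEQ_zero[OF this]] show ?case using eq by simp
  qed
  moreover have "filterlim r at_top sequentially"
    by (rule filterlim_at_top_mono[OF filterlim_ident]) (use r in auto)
  ultimately show thesis by (intro that)
qed

lemma powr_diff_le:
  fixes a b c :: real
  assumes "0 < p"
  shows "ennreal (\<bar>a - c\<bar> powr p) \<le> ennreal (2 powr p) * (ennreal (\<bar>b - a\<bar> powr p) + ennreal (\<bar>b - c\<bar> powr p))"
  using abs_add_powr_le[OF assms, of "a - b" "b - c"]
  by (simp add: ennreal_leI abs_minus_commute flip: ennreal_plus ennreal_mult)

lemma nn_integral_powr_diff_le:
  fixes f g h :: "'a \<Rightarrow> real"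
  assumes p: "0 < p" and [measurable]: "f \<in> borel_measurable M" "g \<in> borel_measurable M" "h \<in> borel_measurable M"
  shows "(\<integral>\<^sup>+x. ennreal (\<bar>f x - h x\<bar> powr p) \<partial>M) \<le> ennreal (2 powr p) *
    ((\<integral>\<^sup>+x. ennreal (\<bar>g x - f x\<bar> powr p) \<partial>M) + (\<integral>\<^sup>+x. ennreal (\<bar>g x - h x\<bar> powr p) \<partial>M))"
proof -
  have "(\<integral>\<^sup>+x. ennreal (\<bar>f x - h x\<bar> powr p) \<partial>M) \<le> (\<integral>\<^sup>+x. ennreal (2 powr p) * (ennreal (\<bar>g x - f x\<bar> powr p) + ennreal (\<bar>g x - h x\<bar> powr p)) \<partial>M)"
    by (intro nn_integral_mono powr_diff_le p)
  also have "\<dots> = ennreal (2 powr p) *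
    ((\<integral>\<^sup>+x. ennreal (\<bar>g x - f x\<bar> powr p) \<partial>M) + (\<integral>\<^sup>+x. ennreal (\<bar>g x - h x\<bar> powr p) \<partial>M))"
    by (simp add: nn_integral_cmult nn_integral_add)
  finally show ?thesis .
qed

section \<open>Uniqueness of traces and bounds for them\<close>

context polyhedral_domain begin

definition W1_energy :: "real \<Rightarrow> (real^3 \<Rightarrow> real) \<Rightarrow> (3 \<Rightarrow> real^3 \<Rightarrow> real) \<Rightarrow> ennreal" where
  "W1_energy p g W = Lp_energy p g + (\<Sum>i\<in>UNIV. Lp_energy p (W i))"

lemma borel_cut: "smooth f \<Longrightarrow> cut f \<in> borel_measurable borel"
  unfolding cut_def[abs_def] by (intro borel_measurable_times smooth_borel borel_measurable_indicator borel_domain)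

lemma sobolev_energy_cut:
  assumes p: "0 < p" and f: "smooth f"
  shows "sobolev_energy p f = W1_energy p (cut f) (\<lambda>i. cut (partial_deriv i f))"
proof -
  have [measurable]: "partial_deriv i f \<in> borel_measurable borel" for i by (rule smooth_borel[OF smooth_partial_deriv[OF f]])
  have eq: "ennreal (\<bar>cut h x\<bar> powr p) = ennreal (\<bar>h x\<bar> powr p) * indicator \<Omega> x" for h x
    using p by (simp add: cut_def split: split_indicator)
  have "ennreal (grad_powr p f x) * indicator \<Omega> x = (\<Sum>i\<in>UNIV. ennreal (\<bar>cut (partial_deriv i f) x\<bar> powr p))" for x
    unfolding eq grad_powr_def by (simp add: sum_ennreal[symmetric] sum_distrib_right del: sum_ennreal)
  then have "(\<integral>\<^sup>+x. ennreal (grad_powr p f x) * indicator \<Omega> x \<partial>lborel) = (\<Sum>i\<in>UNIV. \<integral>\<^sup>+x. ennreal (\<bar>cut (partial_deriv i f) x\<bar> powr p) \<partial>lborel)"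
    using borel_cut[OF smooth_partial_deriv[OF f]] by (simp add: nn_integral_sum del: sum_ennreal)
  then show ?thesis unfolding sobolev_energy_def W1_energy_def Lp_energy_def eq by simp
qed

lemma W1D:
  assumes "W1 p u g W"
  shows "represents g u" "Lp_fun p g" "Lp_fun p (W i)" "weak_partial i g (W i)"
  using assms by (auto simp: W1_def)

lemma sobolev_energy_diff_le:
  assumes p: "0 < p" and g: "Lp_fun p g" "\<And>i. Lp_fun p (W i)" and f: "smooth \<phi>" "smooth \<psi>"
  shows "sobolev_energy p (\<lambda>x. \<phi> x - \<psi> x) \<le> ennreal (2 powr p) * (dist_energy p g W \<phi> + dist_energy p g W \<psi>)"
proof -
  have "cut (\<lambda>x. \<phi> x - \<psi> x) = (\<lambda>x. cut \<phi> x - cut \<psi> x)"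
    "cut (partial_deriv i (\<lambda>x. \<phi> x - \<psi> x)) = (\<lambda>x. cut (partial_deriv i \<phi>) x - cut (partial_deriv i \<psi>) x)" for i
    by (auto simp: cut_def partial_deriv_diff[OF f] left_diff_distrib)
  then have "sobolev_energy p (\<lambda>x. \<phi> x - \<psi> x) = Lp_energy p (\<lambda>x. cut \<phi> x - cut \<psi> x)
      + (\<Sum>i\<in>UNIV. Lp_energy p (\<lambda>x. cut (partial_deriv i \<phi>) x - cut (partial_deriv i \<psi>) x))"
    by (simp add: sobolev_energy_cut[OF p smooth_diff[OF f]] W1_energy_def)
  also have "\<dots> \<le> ennreal (2 powr p) * (Lp_energy p (\<lambda>x. g x - cut \<phi> x) + Lp_energy p (\<lambda>x. g x - cut \<psi> x))
      + (\<Sum>i\<in>UNIV. ennreal (2 powr p) * (Lp_energy p (\<lambda>x. W i x - cut (partial_deriv i \<phi>) x) + Lp_energy p (\<lambda>x. W i x - cut (partial_deriv i \<psi>) x)))"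
    unfolding Lp_energy_def
    using borel_cut[OF f(1)] borel_cut[OF f(2)] borel_cut[OF smooth_partial_deriv[OF f(1)]] borel_cut[OF smooth_partial_deriv[OF f(2)]]
      Lp_fun_borel[OF g(1)] Lp_fun_borel[OF g(2)]
    by (intro add_mono sum_mono nn_integral_powr_diff_le p) auto
  also have "\<dots> = ennreal (2 powr p) * (dist_energy p g W \<phi> + dist_energy p g W \<psi>)"
    by (simp add: dist_energy_def distrib_left sum.distrib sum_distrib_left add_ac)
  finally show ?thesis .
qed

lemma sobolev_energy_le:
  assumes p: "0 < p" and g: "Lp_fun p g" "\<And>i. Lp_fun p (W i)" and f: "smooth \<phi>"
  shows "sobolev_energy p \<phi> \<le> ennreal (2 powr p) * (dist_energy p g W \<phi> + W1_energy p g W)"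
proof -
  have "smooth (\<lambda>_. 0)" by (rule smooth_const)
  \<comment> \<open>The zero function serves as second approximant: its distance from the data is
    the energy of the data.\<close>
  moreover have "dist_energy p g W (\<lambda>_. 0) = W1_energy p g W"
    by (simp add: dist_energy_def W1_energy_def cut_def partial_deriv_const)
  ultimately show ?thesis using sobolev_energy_diff_le[OF p g(1) _ f, where W=W and \<psi>="\<lambda>_. 0"] g(2) by simp
qed

text \<open>\<open>has_trace\<close> in terms of representatives, with a Borel function on the whole
  space and p-th powers in place of norms.\<close>

definition trace_limit :: "real \<Rightarrow> (real^3 \<Rightarrow> real) \<Rightarrow> (3 \<Rightarrow> real^3 \<Rightarrow> real) \<Rightarrow> (real^3 \<Rightarrow> real) \<Rightarrow> bool" where
  "trace_limit p g W t \<longleftrightarrow> t \<in> borel_measurable borel \<and> (\<exists>\<phi>. (\<forall>m. smooth (\<phi> m)) \<and> (\<lambda>m::nat. dist_energy p g W (\<phi> m)) \<longlonglongrightarrow> 0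
    \<and> (\<lambda>m. \<integral>\<^sup>+x. ennreal (\<bar>t x - \<phi> m x\<bar> powr p) \<partial>S) \<longlonglongrightarrow> 0)"

text \<open>The double integral of the Slobodeckij norm for s = 1 - 1/p, where the exponent 2 + s p
  equals 1 + p.\<close>

definition slobodeckij_double :: "real \<Rightarrow> (real^3 \<Rightarrow> real) \<Rightarrow> ennreal" where
  "slobodeckij_double p f = (\<integral>\<^sup>+x. \<integral>\<^sup>+y. ennreal (\<bar>f x - f y\<bar> powr p / norm (x - y) powr (1 + p)) \<partial>S \<partial>S)"

lemma borel_S: "f \<in> borel_measurable borel \<Longrightarrow> f \<in> borel_measurable S"
  by (simp add: measurable_cong_sets[OF sets_S refl])

lemma trace_differences_tendsto_0:
  assumes p: "1 < p" and g: "Lp_fun p g" "\<And>i. Lp_fun p (W i)" and sm: "\<And>m. smooth (\<phi> m)" "\<And>m. smooth (\<psi> m)"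
    and C: "\<And>f. smooth f \<Longrightarrow> (\<integral>\<^sup>+x. ennreal (\<bar>f x\<bar> powr p) \<partial>S) \<le> ennreal C * sobolev_energy p f"
  shows "(\<integral>\<^sup>+x. ennreal (\<bar>\<phi> m x - \<psi> n x\<bar> powr p) \<partial>S) \<le> ennreal C * (ennreal (2 powr p) * (dist_energy p g W (\<phi> m) + dist_energy p g W (\<psi> n)))"
  using order_trans[OF C[OF smooth_diff[OF sm(1) sm(2)]] mult_left_mono[OF sobolev_energy_diff_le[OF _ g sm(1) sm(2)]]] p by simp

text \<open>Approximants of the two sequences differ by smooth functions of vanishing energy, and by
  the trace inequality so do their boundary values. Two triangle inequalities lead from t over both
  approximants to t'.\<close>

lemma trace_limit_unique:
  assumes p: "1 < p" and g: "Lp_fun p g" "\<And>i. Lp_fun p (W i)" and t: "trace_limit p g W t" "trace_limit p g W t'"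
  shows "AE x in S. t x = t' x"
proof -
  have p0: "0 < p" using p by simp
  obtain C where C: "\<And>f. smooth f \<Longrightarrow> (\<integral>\<^sup>+x. ennreal (\<bar>f x\<bar> powr p) \<partial>S) \<le> ennreal C * sobolev_energy p f"
    using trace_Lp_bound[OF p] by blast
  obtain \<phi> where \<phi>: "\<And>m. smooth (\<phi> m)" "(\<lambda>m::nat. dist_energy p g W (\<phi> m)) \<longlonglongrightarrow> 0" "(\<lambda>m. \<integral>\<^sup>+x. ennreal (\<bar>t x - \<phi> m x\<bar> powr p) \<partial>S) \<longlonglongrightarrow> 0"
    using t(1) unfolding trace_limit_def by blast
  obtain \<psi> where \<psi>: "\<And>m. smooth (\<psi> m)" "(\<lambda>m::nat. dist_energy p g W (\<psi> m)) \<longlonglongrightarrow> 0" "(\<lambda>m. \<integral>\<^sup>+x. ennreal (\<bar>t' x - \<psi> m x\<bar> powr p) \<partial>S) \<longlonglongrightarrow> 0"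
    using t(2) unfolding trace_limit_def by blast
  have [measurable]: "t \<in> borel_measurable S" "t' \<in> borel_measurable S" "\<phi> m \<in> borel_measurable S" "\<psi> m \<in> borel_measurable S" for m
    using t \<phi>(1) \<psi>(1) by (auto simp: trace_limit_def intro: borel_S smooth_borel)
  let ?c = "ennreal (2 powr p)"
  have bnd: "(\<integral>\<^sup>+x. ennreal (\<bar>t x - t' x\<bar> powr p) \<partial>S) \<le> ?c * ((\<integral>\<^sup>+x. ennreal (\<bar>t x - \<phi> m x\<bar> powr p) \<partial>S)
      + ?c * (ennreal C * (?c * (dist_energy p g W (\<psi> m) + dist_energy p g W (\<phi> m))) + (\<integral>\<^sup>+x. ennreal (\<bar>t' x - \<psi> m x\<bar> powr p) \<partial>S)))" for m
  proof -
    have "(\<integral>\<^sup>+x. ennreal (\<bar>\<phi> m x - t' x\<bar> powr p) \<partial>S) \<le> ?c * ((\<integral>\<^sup>+x. ennreal (\<bar>\<psi> m x - \<phi> m x\<bar> powr p) \<partial>S) + (\<integral>\<^sup>+x. ennreal (\<bar>\<psi> m x - t' x\<bar> powr p) \<partial>S))"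
      by (rule nn_integral_powr_diff_le[OF p0]) measurable
    also have "\<dots> \<le> ?c * (ennreal C * (?c * (dist_energy p g W (\<psi> m) + dist_energy p g W (\<phi> m))) + (\<integral>\<^sup>+x. ennreal (\<bar>t' x - \<psi> m x\<bar> powr p) \<partial>S))"
      by (intro mult_left_mono add_mono trace_differences_tendsto_0[OF p g \<psi>(1) \<phi>(1) C]) (auto simp: abs_minus_commute)
    finally have 1: "(\<integral>\<^sup>+x. ennreal (\<bar>\<phi> m x - t' x\<bar> powr p) \<partial>S) \<le> \<dots>" .
    have "(\<integral>\<^sup>+x. ennreal (\<bar>t x - t' x\<bar> powr p) \<partial>S) \<le> ?c * ((\<integral>\<^sup>+x. ennreal (\<bar>\<phi> m x - t x\<bar> powr p) \<partial>S) + (\<integral>\<^sup>+x. ennreal (\<bar>\<phi> m x - t' x\<bar> powr p) \<partial>S))"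
      by (rule nn_integral_powr_diff_le[OF p0]) measurable
    also have "\<dots> \<le> ?c * ((\<integral>\<^sup>+x. ennreal (\<bar>t x - \<phi> m x\<bar> powr p) \<partial>S)
      + ?c * (ennreal C * (?c * (dist_energy p g W (\<psi> m) + dist_energy p g W (\<phi> m))) + (\<integral>\<^sup>+x. ennreal (\<bar>t' x - \<psi> m x\<bar> powr p) \<partial>S)))"
      by (intro mult_left_mono add_mono 1) (auto simp: abs_minus_commute)
    finally show ?thesis .
  qed
  have "(\<lambda>m. ?c * ((\<integral>\<^sup>+x. ennreal (\<bar>t x - \<phi> m x\<bar> powr p) \<partial>S)
      + ?c * (ennreal C * (?c * (dist_energy p g W (\<psi> m) + dist_energy p g W (\<phi> m))) + (\<integral>\<^sup>+x. ennreal (\<bar>t' x - \<psi> m x\<bar> powr p) \<partial>S))))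
      \<longlonglongrightarrow> ?c * (0 + ?c * (ennreal C * (?c * (0 + 0)) + 0))"
    by (intro tendsto_add ennreal_tendsto_cmult \<phi> \<psi>) auto
  from tendsto_lowerbound[OF this always_eventually] bnd
  have "(\<integral>\<^sup>+x. ennreal (\<bar>t x - t' x\<bar> powr p) \<partial>S) \<le> 0" by simp
  then have "(\<integral>\<^sup>+x. ennreal (\<bar>t x - t' x\<bar> powr p) \<partial>S) = 0" by simp
  then have "AE x in S. ennreal (\<bar>t x - t' x\<bar> powr p) = 0" by (subst (asm) nn_integral_0_iff_AE) auto
  then show ?thesis by eventually_elim simp
qed

text \<open>Along a subsequence the boundary values converge almost everywhere, and Fatou's lemma,
  applied once for the norm and twice for the double integral, carries the inequalities for smooth
  functions to the trace.\<close>

lemma trace_limit_bounds: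
  assumes p: "1 < p"
  obtains C where "0 < C" "\<And>g W t. Lp_fun p g \<Longrightarrow> (\<And>i. Lp_fun p (W i)) \<Longrightarrow> trace_limit p g W t \<Longrightarrow>
    (\<integral>\<^sup>+x. ennreal (\<bar>t x\<bar> powr p) \<partial>S) + slobodeckij_double p t \<le> ennreal C * W1_energy p g W"
proof -
  have p0: "0 < p" using p by simp
  obtain C1 where C1: "0 < C1" "\<And>f. smooth f \<Longrightarrow> (\<integral>\<^sup>+x. ennreal (\<bar>f x\<bar> powr p) \<partial>S) \<le> ennreal C1 * sobolev_energy p f"
    using trace_Lp_bound[OF p] by blast
  obtain C2 where C2: "0 < C2" "\<And>f. smooth f \<Longrightarrow> slobodeckij_double p f \<le> ennreal C2 * sobolev_energy p f"
    using gagliardo_bound[OF p] unfolding slobodeckij_double_def by blast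
  show thesis
  proof (rule that[of "(C1 + C2) * 2 powr p"])
    show "0 < (C1 + C2) * 2 powr p" using C1 C2 by simp
    fix g W t assume g: "Lp_fun p g" "\<And>i. Lp_fun p (W i)" and t: "trace_limit p g W t"
    obtain \<phi> where \<phi>: "\<And>m. smooth (\<phi> m)" "(\<lambda>m::nat. dist_energy p g W (\<phi> m)) \<longlonglongrightarrow> 0" "(\<lambda>m. \<integral>\<^sup>+x. ennreal (\<bar>t x - \<phi> m x\<bar> powr p) \<partial>S) \<longlonglongrightarrow> 0"
      using t unfolding trace_limit_def by blast
    have tb [measurable]: "t \<in> borel_measurable borel" using t by (simp add: trace_limit_def)
    have \<phi>b [measurable]: "\<phi> m \<in> borel_measurable borel" for m by (rule smooth_borel[OF \<phi>(1)])
    obtain r where r: "filterlim r at_top sequentially" "AE x in S. (\<lambda>k. ennreal (\<bar>t x - \<phi> (r k) x\<bar> powr p)) \<longlonglongrightarrow> 0"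
      by (rule AE_subsequence[OF _ \<phi>(3)]) measurable
    have lim: "AE x in S. (\<lambda>k. \<phi> (r k) x) \<longlonglongrightarrow> t x"
      using r(2)
    proof eventually_elim
      case (elim x)
      then have "(\<lambda>k. \<bar>t x - \<phi> (r k) x\<bar>) \<longlonglongrightarrow> 0" using tendsto_0_powr_iff[of "\<lambda>k. \<bar>t x - \<phi> (r k) x\<bar>" p] p0 by simp
      then have "(\<lambda>k. t x - \<phi> (r k) x) \<longlonglongrightarrow> 0" by (simp add: tendsto_rabs_zero_iff)
      from tendsto_diff[OF tendsto_const[of "t x"] this] show ?case by simp
    qed
    let ?e = "\<lambda>k. ennreal (2 powr p) * (dist_energy p g W (\<phi> (r k)) + W1_energy p g W)"
    have e: "?e \<longlonglongrightarrow> ennreal (2 powr p) * (0 + W1_energy p g W)"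
      by (intro ennreal_tendsto_cmult tendsto_add tendsto_const filterlim_compose[OF \<phi>(2) r(1)]) auto
    have bound: "sobolev_energy p (\<phi> (r k)) \<le> ?e k" for k by (rule sobolev_energy_le[OF p0 g \<phi>(1)])
    have "(\<integral>\<^sup>+x. ennreal (\<bar>t x\<bar> powr p) \<partial>S) \<le> (\<integral>\<^sup>+x. liminf (\<lambda>k. ennreal (\<bar>\<phi> (r k) x\<bar> powr p)) \<partial>S)"
    proof (rule nn_integral_mono_AE)
      show "AE x in S. ennreal (\<bar>t x\<bar> powr p) \<le> liminf (\<lambda>k. ennreal (\<bar>\<phi> (r k) x\<bar> powr p))"
        using lim
      proof eventually_elim
        case (elim x)
        have "(\<lambda>k. ennreal (\<bar>\<phi> (r k) x\<bar> powr p)) \<longlonglongrightarrow> ennreal (\<bar>t x\<bar> powr p)"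
          using p0 elim by (intro tendsto_ennrealI tendsto_powr' tendsto_rabs) auto
        from lim_imp_Liminf[OF sequentially_bot this] show ?case by simp
      qed
    qed
    also have "\<dots> \<le> liminf (\<lambda>k. \<integral>\<^sup>+x. ennreal (\<bar>\<phi> (r k) x\<bar> powr p) \<partial>S)" by (rule nn_integral_liminf) measurable
    also have "\<dots> \<le> liminf (\<lambda>k. ennreal C1 * ?e k)"
      by (intro Liminf_mono always_eventually allI order_trans[OF C1(2)[OF \<phi>(1)]] mult_left_mono bound) auto
    also have "\<dots> = ennreal C1 * (ennreal (2 powr p) * (0 + W1_energy p g W))"
      by (rule lim_imp_Liminf[OF sequentially_bot ennreal_tendsto_cmult[OF _ e]]) simp
    finally have 1: "(\<integral>\<^sup>+x. ennreal (\<bar>t x\<bar> powr p) \<partial>S) \<le> ennreal C1 * (ennreal (2 powr p) * (0 + W1_energy p g W))" .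
    let ?J = "\<lambda>f x y. ennreal (\<bar>f x - f y\<bar> powr p / norm (x - y) powr (1 + p))"
    have "slobodeckij_double p t \<le> (\<integral>\<^sup>+x. \<integral>\<^sup>+y. liminf (\<lambda>k. ?J (\<phi> (r k)) x y) \<partial>S \<partial>S)"
      unfolding slobodeckij_double_def
    proof (rule nn_integral_mono_AE)
      show "AE x in S. (\<integral>\<^sup>+y. ?J t x y \<partial>S) \<le> (\<integral>\<^sup>+y. liminf (\<lambda>k. ?J (\<phi> (r k)) x y) \<partial>S)"
        using lim
      proof eventually_elim
        case x: (elim x)
        show ?case
        proof (rule nn_integral_mono_AE)
          show "AE y in S. ?J t x y \<le> liminf (\<lambda>k. ?J (\<phi> (r k)) x y)"
            using lim
          proof eventually_elim
            case (elim y)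
            have "(\<lambda>k. \<bar>\<phi> (r k) x - \<phi> (r k) y\<bar> powr p) \<longlonglongrightarrow> \<bar>t x - t y\<bar> powr p"
              using p0 x elim by (intro tendsto_powr' tendsto_rabs tendsto_diff) auto
            from tendsto_ennrealI[OF tendsto_mult_right[OF this, of "1 / norm (x - y) powr (1 + p)"]]
            have "(\<lambda>k. ?J (\<phi> (r k)) x y) \<longlonglongrightarrow> ?J t x y" by simp
            from lim_imp_Liminf[OF sequentially_bot this] show ?case by simp
          qed
        qed
      qed
    qed
    also have "\<dots> \<le> (\<integral>\<^sup>+x. liminf (\<lambda>k. \<integral>\<^sup>+y. ?J (\<phi> (r k)) x y \<partial>S) \<partial>S)"
      by (intro nn_integral_mono nn_integral_liminf) measurable
    also have "\<dots> \<le> liminf (\<lambda>k. slobodeckij_double p (\<phi> (r k)))"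
      unfolding slobodeckij_double_def by (rule nn_integral_liminf) measurable
    also have "\<dots> \<le> liminf (\<lambda>k. ennreal C2 * ?e k)"
      by (intro Liminf_mono always_eventually allI order_trans[OF C2(2)[OF \<phi>(1)]] mult_left_mono bound) auto
    also have "\<dots> = ennreal C2 * (ennreal (2 powr p) * (0 + W1_energy p g W))"
      by (rule lim_imp_Liminf[OF sequentially_bot ennreal_tendsto_cmult[OF _ e]]) simp
    finally have 2: "slobodeckij_double p t \<le> ennreal C2 * (ennreal (2 powr p) * (0 + W1_energy p g W))" .
    show "(\<integral>\<^sup>+x. ennreal (\<bar>t x\<bar> powr p) \<partial>S) + slobodeckij_double p t \<le> ennreal ((C1 + C2) * 2 powr p) * W1_energy p g W"
      using add_mono[OF 1 2] C1 C2 by (simp add: ennreal_mult distrib_right mult.assoc)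
  qed
qed

end

text \<open>Splitting at the level \<epsilon>: below it |h| is at most \<epsilon> on A, above it |h|
  is at most \<epsilon>^(1-p) |h|^p.\<close>

lemma nn_integral_abs_le_powr:
  fixes h :: "'a \<Rightarrow> real"
  assumes p: "1 < p" and \<epsilon>: "0 < \<epsilon>" and [measurable]: "h \<in> borel_measurable M" "A \<in> sets M" and out: "\<And>x. x \<notin> A \<Longrightarrow> h x = 0"
  shows "(\<integral>\<^sup>+x. ennreal \<bar>h x\<bar> \<partial>M) \<le> ennreal \<epsilon> * emeasure M A + ennreal (\<epsilon> powr (1 - p)) * (\<integral>\<^sup>+x. ennreal (\<bar>h x\<bar> powr p) \<partial>M)"
proof -
  have "ennreal \<bar>h x\<bar> \<le> ennreal \<epsilon> * indicator A x + ennreal (\<epsilon> powr (1 - p)) * ennreal (\<bar>h x\<bar> powr p)" for x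
  proof (cases "\<bar>h x\<bar> \<le> \<epsilon>")
    case True
    then show ?thesis
    proof (cases "x \<in> A")
      case A: True
      have "ennreal \<bar>h x\<bar> \<le> ennreal \<epsilon>" using True by (rule ennreal_leI)
      then show ?thesis using A by (simp add: add_increasing2)
    qed (simp add: out)
  next
    case False
    then have h: "0 < \<bar>h x\<bar>" "\<epsilon> \<le> \<bar>h x\<bar>" using \<epsilon> by auto
    have "\<bar>h x\<bar> = \<bar>h x\<bar> powr (1 - p) * \<bar>h x\<bar> powr p" using h by (simp flip: powr_add)
    also have "\<dots> \<le> \<epsilon> powr (1 - p) * \<bar>h x\<bar> powr p"
      using h \<epsilon> p by (intro mult_right_mono powr_mono2') auto
    finally have "ennreal \<bar>h x\<bar> \<le> ennreal (\<epsilon> powr (1 - p)) * ennreal (\<bar>h x\<bar> powr p)"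
      by (simp add: ennreal_leI flip: ennreal_mult)
    then show ?thesis by (simp add: add_increasing)
  qed
  then have "(\<integral>\<^sup>+x. ennreal \<bar>h x\<bar> \<partial>M) \<le> (\<integral>\<^sup>+x. ennreal \<epsilon> * indicator A x + ennreal (\<epsilon> powr (1 - p)) * ennreal (\<bar>h x\<bar> powr p) \<partial>M)"
    by (rule nn_integral_mono)
  also have "\<dots> = ennreal \<epsilon> * emeasure M A + ennreal (\<epsilon> powr (1 - p)) * (\<integral>\<^sup>+x. ennreal (\<bar>h x\<bar> powr p) \<partial>M)"
    by (simp add: nn_integral_add nn_integral_cmult nn_integral_cmult_indicator)
  finally show ?thesis .
qed

lemma Lp_null_imp_L1_null:
  fixes h :: "nat \<Rightarrow> 'a \<Rightarrow> real"
  assumes p: "1 < p" and h: "\<And>m. h m \<in> borel_measurable M" and A: "A \<in> sets M" "emeasure M A < \<infinity>" and out: "\<And>m x. x \<notin> A \<Longrightarrow> h m x = 0"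
    and lim: "(\<lambda>m. \<integral>\<^sup>+x. ennreal (\<bar>h m x\<bar> powr p) \<partial>M) \<longlonglongrightarrow> 0"
  shows "(\<lambda>m. \<integral>\<^sup>+x. ennreal \<bar>h m x\<bar> \<partial>M) \<longlonglongrightarrow> 0"
proof (rule order_tendstoI)
  fix a :: ennreal assume "0 < a"
  then obtain b where b: "0 < b" "b < a" using dense by blast
  then obtain e where e: "b = ennreal e" "0 < e" by (cases b) (auto simp: ennreal_zero_less_top)
  define K where "K = measure M A"
  have K: "emeasure M A = ennreal K" "0 \<le> K" using A by (auto simp: K_def emeasure_eq_ennreal_measure less_top[symmetric])
  \<comment> \<open>Half of the tolerance goes to the set A, whose measure may be 0;
    \<open>d\<close> below spends the other half.\<close>
  define \<epsilon> where "\<epsilon> = e / (2 * (K + 1))"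
  have \<epsilon>: "0 < \<epsilon>" "\<epsilon> * K \<le> e / 2" using e K by (auto simp: \<epsilon>_def field_simps)
  define d where "d = e / 2 / \<epsilon> powr (1 - p)"
  have d: "0 < d" using e \<epsilon> by (simp add: d_def)
  have "\<forall>\<^sub>F m in sequentially. (\<integral>\<^sup>+x. ennreal (\<bar>h m x\<bar> powr p) \<partial>M) < ennreal d"
    using d by (intro order_tendstoD(2)[OF lim]) simp
  then show "\<forall>\<^sub>F m in sequentially. (\<integral>\<^sup>+x. ennreal \<bar>h m x\<bar> \<partial>M) < a"
  proof eventually_elim
    case (elim m)
    have "(\<integral>\<^sup>+x. ennreal \<bar>h m x\<bar> \<partial>M) \<le> ennreal \<epsilon> * emeasure M A + ennreal (\<epsilon> powr (1 - p)) * (\<integral>\<^sup>+x. ennreal (\<bar>h m x\<bar> powr p) \<partial>M)"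
      by (rule nn_integral_abs_le_powr[OF p \<epsilon>(1) h A(1) out])
    also have "\<dots> \<le> ennreal \<epsilon> * ennreal K + ennreal (\<epsilon> powr (1 - p)) * ennreal d"
      unfolding K(1) using elim by (intro add_mono mult_left_mono) auto
    also have "\<dots> = ennreal (\<epsilon> * K + \<epsilon> powr (1 - p) * d)"
      using \<epsilon>(1) K(2) d by (simp only: ennreal_plus ennreal_mult mult_nonneg_nonneg less_imp_le powr_ge_zero)
    also have "\<dots> \<le> ennreal e" using \<epsilon> by (intro ennreal_leI) (simp add: d_def)
    finally show ?case using b e by simp
  qed
qed simp

lemma ennreal_tendsto_0_le:
  fixes f g :: "nat \<Rightarrow> ennreal"
  assumes "g \<longlonglongrightarrow> 0" "\<And>m. f m \<le> g m" shows "f \<longlonglongrightarrow> 0"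
  by (rule tendsto_sandwich[OF _ _ tendsto_const assms(1)]) (simp_all add: assms(2))

lemma LINT_tendsto_of_L1:
  fixes h :: "nat \<Rightarrow> 'a \<Rightarrow> real"
  assumes [measurable]: "f \<in> borel_measurable M" "\<And>m. h m \<in> borel_measurable M" "\<theta> \<in> borel_measurable M"
    and int: "integrable M f" "\<And>m. integrable M (h m)" and B: "\<And>x. \<bar>\<theta> x\<bar> \<le> B"
    and lim: "(\<lambda>m. \<integral>\<^sup>+x. ennreal \<bar>f x - h m x\<bar> \<partial>M) \<longlonglongrightarrow> 0"
  shows "(\<lambda>m. LINT x|M. h m x * \<theta> x) \<longlonglongrightarrow> (LINT x|M. f x * \<theta> x)"
proof (rule tendsto_L1_int)
  show "integrable M (\<lambda>x. h m x * \<theta> x)" for m by (rule integrable_mult_bounded[OF int(2) _ B]) measurable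
  show "integrable M (\<lambda>x. f x * \<theta> x)" by (rule integrable_mult_bounded[OF int(1) _ B]) measurable
  have B0: "0 \<le> B" using order_trans[OF abs_ge_zero B] .
  have "(\<integral>\<^sup>+x. ennreal (norm (h m x * \<theta> x - f x * \<theta> x)) \<partial>M) \<le> ennreal B * (\<integral>\<^sup>+x. ennreal \<bar>f x - h m x\<bar> \<partial>M)" for m
  proof -
    have "norm (h m x * \<theta> x - f x * \<theta> x) \<le> B * \<bar>f x - h m x\<bar>" for x
      using mult_right_mono[OF B[of x], of "\<bar>f x - h m x\<bar>"] unfolding left_diff_distrib[symmetric] real_norm_def abs_mult
      by (simp add: mult.commute abs_minus_commute)
    then have "(\<integral>\<^sup>+x. ennreal (norm (h m x * \<theta> x - f x * \<theta> x)) \<partial>M) \<le> (\<integral>\<^sup>+x. ennreal B * ennreal \<bar>f x - h m x\<bar> \<partial>M)"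
      using B0 by (intro nn_integral_mono) (simp add: ennreal_leI flip: ennreal_mult)
    also have "\<dots> = ennreal B * (\<integral>\<^sup>+x. ennreal \<bar>f x - h m x\<bar> \<partial>M)" by (rule nn_integral_cmult) measurable
    finally show ?thesis .
  qed
  moreover have "(\<lambda>m. ennreal B * (\<integral>\<^sup>+x. ennreal \<bar>f x - h m x\<bar> \<partial>M)) \<longlonglongrightarrow> ennreal B * 0"
    by (intro ennreal_tendsto_cmult lim) simp
  ultimately have b: "\<And>m. (\<integral>\<^sup>+x. ennreal (norm (h m x * \<theta> x - f x * \<theta> x)) \<partial>M) \<le> ennreal B * (\<integral>\<^sup>+x. ennreal \<bar>f x - h m x\<bar> \<partial>M)"
    and l: "(\<lambda>m. ennreal B * (\<integral>\<^sup>+x. ennreal \<bar>f x - h m x\<bar> \<partial>M)) \<longlonglongrightarrow> 0" by simp_all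
  show "(\<lambda>m. \<integral>\<^sup>+x. ennreal (norm (h m x * \<theta> x - f x * \<theta> x)) \<partial>M) \<longlonglongrightarrow> 0"
    by (rule ennreal_tendsto_0_le[OF l b])
qed

lemma Lp_iff: "h \<in> Lp M p \<longleftrightarrow> h \<in> borel_measurable M \<and> (\<integral>\<^sup>+x. ennreal (\<bar>h x\<bar> powr p) \<partial>M) < \<infinity>"
  unfolding Lp_def by (auto simp: integrable_iff_bounded)

lemma Lp_norm_powr:
  assumes "h \<in> Lp M p" "0 < p"
  shows "ennreal (Lp_norm M p h powr p) = (\<integral>\<^sup>+x. ennreal (\<bar>h x\<bar> powr p) \<partial>M)"
  using assms nn_integral_eq_integral[of M "\<lambda>x. \<bar>h x\<bar> powr p"]
  by (simp add: Lp_def Lp_norm_def powr_powr integral_nonneg_AE)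

section \<open>Existence of traces and agreement with \<open>has_trace\<close>\<close>

context polyhedral_domain begin

lemma W1_energy_finite: "Lp_fun p g \<Longrightarrow> (\<And>i. Lp_fun p (W i)) \<Longrightarrow> W1_energy p g W < \<infinity>"
  unfolding W1_energy_def Lp_energy_def sum_3 using Lp_fun_finite[unfolded infinity_ennreal_def] by (simp add: infinity_ennreal_def)

lemma S_powr_finite:
  assumes p: "1 < p" and f: "smooth f" shows "(\<integral>\<^sup>+x. ennreal (\<bar>f x\<bar> powr p) \<partial>S) < \<infinity>"
proof -
  have p0: "0 < p" using p by simp
  obtain C where C: "\<And>f. smooth f \<Longrightarrow> (\<integral>\<^sup>+x. ennreal (\<bar>f x\<bar> powr p) \<partial>S) \<le> ennreal C * sobolev_energy p f"
    using trace_Lp_bound[OF p] by blast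
  have "sobolev_energy p f < \<infinity>"
    unfolding sobolev_energy_cut[OF p0 f] by (intro W1_energy_finite cut_Lp p0 f smooth_partial_deriv)
  then show ?thesis using C[OF f] by (auto simp: ennreal_mult_less_top intro: le_less_trans)
qed

lemma integrable_S_of_Lp:
  fixes h :: "real^3 \<Rightarrow> real"
  assumes p: "1 < p" and h: "h \<in> borel_measurable borel" "(\<integral>\<^sup>+x. ennreal (\<bar>h x\<bar> powr p) \<partial>S) < \<infinity>"
  shows "integrable S h"
proof -
  have hS: "h \<in> borel_measurable S" by (rule borel_S[OF h(1)])
  have "UNIV \<in> sets S" by (simp add: sets_S)
  from nn_integral_abs_le_powr[OF p zero_less_one hS this]
  have "(\<integral>\<^sup>+x. ennreal \<bar>h x\<bar> \<partial>S) \<le> emeasure S UNIV + (\<integral>\<^sup>+x. ennreal (\<bar>h x\<bar> powr p) \<partial>S)" by simp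
  also have "\<dots> < \<infinity>" using h(2) by (simp add: S.emeasure_eq_measure)
  finally show ?thesis using hS by (simp add: integrable_iff_bounded)
qed

text \<open>The boundary values are Cauchy in L^p by the trace inequality, hence in L^1 as the
  surface has finite measure. An almost everywhere convergent subsequence defines the limit, and
  Fatou's lemma gives convergence in L^p of the whole sequence.\<close>

lemma trace_limit_exists:
  assumes p: "1 < p" and g: "Lp_fun p g" "\<And>i. Lp_fun p (W i)" and sm: "\<And>m. smooth (\<phi> m)" and lim: "(\<lambda>m::nat. dist_energy p g W (\<phi> m)) \<longlonglongrightarrow> 0"
  obtains t where "t \<in> borel_measurable borel" "(\<lambda>m. \<integral>\<^sup>+x. ennreal (\<bar>t x - \<phi> m x\<bar> powr p) \<partial>S) \<longlonglongrightarrow> 0"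
proof -
  have p0: "0 < p" using p by simp
  obtain C where C: "\<And>f. smooth f \<Longrightarrow> (\<integral>\<^sup>+x. ennreal (\<bar>f x\<bar> powr p) \<partial>S) \<le> ennreal C * sobolev_energy p f"
    using trace_Lp_bound[OF p] by blast
  let ?c = "\<lambda>x. ennreal C * (ennreal (2 powr p) * x)"
  let ?d = "\<lambda>m. dist_energy p g W (\<phi> m)"
  note diff = trace_differences_tendsto_0[OF p g sm sm C]
  have [measurable]: "\<phi> m \<in> borel_measurable borel" for m by (rule smooth_borel[OF sm])
  have \<phi>S: "\<phi> m \<in> borel_measurable S" for m by (rule borel_S) measurable
  have int: "integrable S (\<phi> m)" for m by (rule integrable_S_of_Lp[OF p _ S_powr_finite[OF p sm]]) measurable
  define K where "K = measure S UNIV"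
  have K: "emeasure S UNIV = ennreal K" "0 \<le> K" by (auto simp: K_def S.emeasure_eq_measure)
  have "\<exists>N. \<forall>i\<ge>N. \<forall>j\<ge>N. (LINT x|S. norm (\<phi> i x - \<phi> j x)) < e" if e: "0 < e" for e
  proof -
    \<comment> \<open>Three contributions of at most e / 4 each leave room for the strict
      inequality.\<close>
    define \<epsilon> where "\<epsilon> = e / (4 * (K + 1))"
    have \<epsilon>: "0 < \<epsilon>" "\<epsilon> * K \<le> e / 4" using e K by (auto simp: \<epsilon>_def field_simps)
    have "(\<lambda>m. ennreal (\<epsilon> powr (1 - p)) * ?c (?d m)) \<longlonglongrightarrow> ennreal (\<epsilon> powr (1 - p)) * ?c 0"
      by (intro ennreal_tendsto_cmult lim) auto
    then have "\<forall>\<^sub>F m in sequentially. ennreal (\<epsilon> powr (1 - p)) * ?c (?d m) < ennreal (e / 4)"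
      using e by (intro order_tendstoD(2)) auto
    then obtain N where N: "\<And>m. N \<le> m \<Longrightarrow> ennreal (\<epsilon> powr (1 - p)) * ?c (?d m) < ennreal (e / 4)"
      unfolding eventually_sequentially by blast
    have "(LINT x|S. norm (\<phi> i x - \<phi> j x)) < e" if ij: "N \<le> i" "N \<le> j" for i j
    proof -
      have "ennreal (LINT x|S. norm (\<phi> i x - \<phi> j x)) = (\<integral>\<^sup>+x. ennreal \<bar>\<phi> i x - \<phi> j x\<bar> \<partial>S)"
        using int by (subst nn_integral_eq_integral) auto
      also have "\<dots> \<le> ennreal \<epsilon> * emeasure S UNIV + ennreal (\<epsilon> powr (1 - p)) * (\<integral>\<^sup>+x. ennreal (\<bar>\<phi> i x - \<phi> j x\<bar> powr p) \<partial>S)"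
        using \<phi>S by (intro nn_integral_abs_le_powr p \<epsilon>) (auto simp: sets_S)
      also have "\<dots> \<le> ennreal \<epsilon> * ennreal K + ennreal (\<epsilon> powr (1 - p)) * ?c (?d i + ?d j)"
        unfolding K(1) by (intro add_mono mult_left_mono diff) auto
      also have "\<dots> = ennreal (\<epsilon> * K) + (ennreal (\<epsilon> powr (1 - p)) * ?c (?d i) + ennreal (\<epsilon> powr (1 - p)) * ?c (?d j))"
        using \<epsilon>(1) K(2) by (simp add: distrib_left ennreal_mult)
      also have "\<dots> \<le> ennreal (e / 4) + (ennreal (e / 4) + ennreal (e / 4))"
        using N[OF ij(1)] N[OF ij(2)] \<epsilon>(2) by (intro add_mono ennreal_leI) auto
      also have "\<dots> = ennreal (e / 4 + (e / 4 + e / 4))" using e by (simp only: ennreal_plus add_nonneg_nonneg divide_nonneg_nonneg less_imp_le zero_le_numeral)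
      finally show ?thesis using e by (subst (asm) ennreal_le_iff) auto
    qed
    then show ?thesis by blast
  qed
  from cauchy_L1_AE_cauchy_subseq[OF int this] obtain r where r: "strict_mono r" "AE x in S. Cauchy (\<lambda>i. \<phi> (r i) x)" by blast
  \<comment> \<open>Where the subsequence diverges, on a null set, \<open>lim\<close> has an
    unspecified value; t is Borel all the same.\<close>
  define t where "t x = lim (\<lambda>i. \<phi> (r i) x)" for x
  have tb [measurable]: "t \<in> borel_measurable borel" unfolding t_def by measurable
  have conv: "AE x in S. (\<lambda>i. \<phi> (r i) x) \<longlonglongrightarrow> t x"
    using r(2) by eventually_elim (auto simp: t_def Cauchy_convergent_iff convergent_LIMSEQ_iff)
  have dr: "(\<lambda>k. ?d (r k)) \<longlonglongrightarrow> 0" using LIMSEQ_subseq_LIMSEQ[OF lim r(1)] by (simp add: comp_def)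
  have bound: "(\<integral>\<^sup>+x. ennreal (\<bar>t x - \<phi> m x\<bar> powr p) \<partial>S) \<le> ?c (?d m)" for m
  proof -
    have "(\<integral>\<^sup>+x. ennreal (\<bar>t x - \<phi> m x\<bar> powr p) \<partial>S) \<le> (\<integral>\<^sup>+x. liminf (\<lambda>k. ennreal (\<bar>\<phi> (r k) x - \<phi> m x\<bar> powr p)) \<partial>S)"
    proof (rule nn_integral_mono_AE)
      show "AE x in S. ennreal (\<bar>t x - \<phi> m x\<bar> powr p) \<le> liminf (\<lambda>k. ennreal (\<bar>\<phi> (r k) x - \<phi> m x\<bar> powr p))"
        using conv
      proof eventually_elim
        case (elim x)
        have "(\<lambda>k. ennreal (\<bar>\<phi> (r k) x - \<phi> m x\<bar> powr p)) \<longlonglongrightarrow> ennreal (\<bar>t x - \<phi> m x\<bar> powr p)"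
          using p0 elim by (intro tendsto_ennrealI tendsto_powr' tendsto_rabs tendsto_diff) auto
        from lim_imp_Liminf[OF sequentially_bot this] show ?case by simp
      qed
    qed
    also have "\<dots> \<le> liminf (\<lambda>k. \<integral>\<^sup>+x. ennreal (\<bar>\<phi> (r k) x - \<phi> m x\<bar> powr p) \<partial>S)" by (rule nn_integral_liminf) measurable
    also have "\<dots> \<le> liminf (\<lambda>k. ?c (?d (r k) + ?d m))"
      by (intro Liminf_mono always_eventually allI diff)
    also have "\<dots> = ?c (0 + ?d m)"
      by (rule lim_imp_Liminf[OF sequentially_bot]) (intro ennreal_tendsto_cmult tendsto_add dr tendsto_const; simp)
    finally show ?thesis by simp
  qed
  have l: "(\<lambda>m. ?c (?d m)) \<longlonglongrightarrow> ?c 0" by (intro ennreal_tendsto_cmult lim) auto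
  have "(\<lambda>m. ?c (?d m)) \<longlonglongrightarrow> 0" using l by simp
  from ennreal_tendsto_0_le[OF this bound] have "(\<lambda>m. \<integral>\<^sup>+x. ennreal (\<bar>t x - \<phi> m x\<bar> powr p) \<partial>S) \<longlonglongrightarrow> 0" .
  then show thesis using tb by (intro that)
qed

text \<open>A trace in the sense of \<open>has_trace\<close> is arbitrary off the boundary; the cut
  makes it a Borel function on the whole space without changing its class.\<close>

definition on_boundary :: "(real^3 \<Rightarrow> real) \<Rightarrow> real^3 \<Rightarrow> real" where "on_boundary t x = t x * indicator (frontier \<Omega>) x"

lemma borel_on_boundary: "t \<in> borel_measurable \<sigma> \<longleftrightarrow> on_boundary t \<in> borel_measurable borel"
proof -
  have "t \<in> borel_measurable \<sigma> \<longleftrightarrow> t \<in> borel_measurable (restrict_space borel (frontier \<Omega>))"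
    by (rule measurable_cong_sets[OF sets_surface_measure refl, THEN eqset_imp_iff])
  also have "\<dots> \<longleftrightarrow> (\<lambda>x. indicator (frontier \<Omega>) x *\<^sub>R t x) \<in> borel_measurable borel"
    by (rule borel_measurable_restrict_space_iff) (simp add: borel_closed)
  finally show ?thesis by (simp add: on_boundary_def[abs_def] mult.commute)
qed

lemma nn_integral_on_boundary:
  assumes "on_boundary t \<in> borel_measurable borel" "f \<in> borel_measurable borel"
  shows "(\<integral>\<^sup>+x. ennreal (\<bar>t x - f x\<bar> powr p) \<partial>\<sigma>) = (\<integral>\<^sup>+x. ennreal (\<bar>on_boundary t x - f x\<bar> powr p) \<partial>S)"
proof -
  have "(\<integral>\<^sup>+x. ennreal (\<bar>t x - f x\<bar> powr p) \<partial>\<sigma>) = (\<integral>\<^sup>+x. ennreal (\<bar>on_boundary t x - f x\<bar> powr p) \<partial>\<sigma>)"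
    by (intro nn_integral_cong) (auto simp: on_boundary_def)
  also have "\<dots> = (\<integral>\<^sup>+x. ennreal (\<bar>on_boundary t x - f x\<bar> powr p) \<partial>S)"
    using assms by (intro nn_integral_S[symmetric]) measurable
  finally show ?thesis .
qed

lemma Lp_surface_diff:
  assumes p: "1 < p" and t: "t \<in> Lp \<sigma> p" and f: "smooth f"
  shows "(\<lambda>x. t x - f x) \<in> Lp \<sigma> p"
proof -
  have p0: "0 < p" using p by simp
  have tm: "t \<in> borel_measurable \<sigma>" "(\<integral>\<^sup>+x. ennreal (\<bar>t x\<bar> powr p) \<partial>\<sigma>) < \<infinity>" using t by (auto simp: Lp_iff)
  have fb: "f \<in> borel_measurable borel" by (rule smooth_borel[OF f])
  then have fm: "f \<in> borel_measurable \<sigma>" by (rule borel_measurable_surface)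
  have "(\<integral>\<^sup>+x. ennreal (\<bar>f x\<bar> powr p) \<partial>\<sigma>) < \<infinity>"
    using S_powr_finite[OF p f] nn_integral_S[of "\<lambda>x. ennreal (\<bar>f x\<bar> powr p)"] fb by simp
  with tm have "ennreal (2 powr p) * ((\<integral>\<^sup>+x. ennreal (\<bar>0 - t x\<bar> powr p) \<partial>\<sigma>) + (\<integral>\<^sup>+x. ennreal (\<bar>0 - f x\<bar> powr p) \<partial>\<sigma>)) < \<infinity>"
    by (simp add: ennreal_mult_less_top)
  with nn_integral_powr_diff_le[OF p0 tm(1) borel_measurable_const fm, of 0]
  have "(\<integral>\<^sup>+x. ennreal (\<bar>t x - f x\<bar> powr p) \<partial>\<sigma>) < \<infinity>" by (rule le_less_trans)
  then show ?thesis using tm(1) fm by (simp add: Lp_iff)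
qed

lemma Lp_surface_tendsto_iff:
  assumes p: "1 < p" and t: "t \<in> Lp \<sigma> p" and f: "\<And>m. smooth (\<phi> m)"
  shows "(\<lambda>m::nat. Lp_norm \<sigma> p (\<lambda>x. t x - \<phi> m x)) \<longlonglongrightarrow> 0 \<longleftrightarrow> (\<lambda>m. \<integral>\<^sup>+x. ennreal (\<bar>on_boundary t x - \<phi> m x\<bar> powr p) \<partial>S) \<longlonglongrightarrow> 0"
proof -
  have p0: "0 < p" using p by simp
  have tb: "on_boundary t \<in> borel_measurable borel" using t by (simp add: Lp_iff borel_on_boundary)
  have "0 \<le> Lp_norm \<sigma> p (\<lambda>x. t x - \<phi> m x)" for m by (simp add: Lp_norm_def)
  from tendsto_0_powr_iff[OF this p0] show ?thesis
    unfolding Lp_norm_powr[OF Lp_surface_diff[OF p t f] p0] nn_integral_on_boundary[OF tb smooth_borel[OF f]] .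
qed

lemma has_trace_imp_trace_limit:
  assumes p: "1 < p" and W: "W1 p u g W" and t: "has_trace p \<Omega> u t"
  shows "trace_limit p g W (on_boundary t)"
proof -
  have tL: "t \<in> Lp \<sigma> p" using t by (simp add: has_trace_def)
  obtain \<phi> where \<phi>: "\<And>m. smooth (\<phi> m)" "(\<lambda>m::nat. sobolev_norm 1 p \<Omega> (\<lambda>x. u x - \<phi> m x)) \<longlonglongrightarrow> 0"
    "(\<lambda>m. Lp_norm \<sigma> p (\<lambda>x. t x - \<phi> m x)) \<longlonglongrightarrow> 0"
    using t unfolding has_trace_def by blast
  show ?thesis
    unfolding trace_limit_def
    using \<phi> tL sobolev_norm_tendsto_iff[OF p W \<phi>(1)] Lp_surface_tendsto_iff[OF p tL \<phi>(1)]
    by (auto simp: Lp_iff borel_on_boundary)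
qed

lemma on_boundary_AE: "AE x in S. on_boundary t x = t x"
  using AE_S by eventually_elim (simp add: on_boundary_def)

text \<open>Membership of t in L^p of the surface, which \<open>has_trace\<close> demands, is
  supplied by \<open>trace_limit_bounds\<close>.\<close>

lemma trace_limit_imp_has_trace:
  assumes p: "1 < p" and W: "W1 p u g W" and t: "trace_limit p g W t"
  shows "has_trace p \<Omega> u t"
proof -
  have tb: "t \<in> borel_measurable borel" using t by (simp add: trace_limit_def)
  have t\<sigma>: "t \<in> borel_measurable \<sigma>" by (rule borel_measurable_surface[OF tb])
  obtain C where C: "(\<integral>\<^sup>+x. ennreal (\<bar>t x\<bar> powr p) \<partial>S) + slobodeckij_double p t \<le> ennreal C * W1_energy p g W"
    using trace_limit_bounds[OF p] W1D(2,3)[OF W] t by metis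
  have "(\<integral>\<^sup>+x. ennreal (\<bar>t x\<bar> powr p) \<partial>S) < \<infinity>"
  proof -
    have "ennreal C * W1_energy p g W < \<infinity>" using W1_energy_finite[OF W1D(2,3)[OF W]] by (simp add: ennreal_mult_less_top)
    then show ?thesis using C by (metis add_increasing2 le_less_trans order_trans zero_le order_refl)
  qed
  then have tL: "t \<in> Lp \<sigma> p"
    using t\<sigma> nn_integral_S[of "\<lambda>x. ennreal (\<bar>t x\<bar> powr p)"] tb by (simp add: Lp_iff)
  obtain \<phi> where \<phi>: "\<And>m. smooth (\<phi> m)" "(\<lambda>m::nat. dist_energy p g W (\<phi> m)) \<longlonglongrightarrow> 0" "(\<lambda>m. \<integral>\<^sup>+x. ennreal (\<bar>t x - \<phi> m x\<bar> powr p) \<partial>S) \<longlonglongrightarrow> 0"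
    using t unfolding trace_limit_def by blast
  have "(\<integral>\<^sup>+x. ennreal (\<bar>on_boundary t x - \<phi> m x\<bar> powr p) \<partial>S) = (\<integral>\<^sup>+x. ennreal (\<bar>t x - \<phi> m x\<bar> powr p) \<partial>S)" for m
    by (intro nn_integral_cong_AE eventually_mono[OF on_boundary_AE[of t]]) simp
  then have "(\<lambda>m. Lp_norm \<sigma> p (\<lambda>x. t x - \<phi> m x)) \<longlonglongrightarrow> 0"
    using Lp_surface_tendsto_iff[OF p tL \<phi>(1)] \<phi>(3) by simp
  moreover have "(\<lambda>m. sobolev_norm 1 p \<Omega> (\<lambda>x. u x - \<phi> m x)) \<longlonglongrightarrow> 0"
    using \<phi>(2) unfolding sobolev_norm_tendsto_iff[OF p W \<phi>(1)] .
  ultimately show ?thesis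
    unfolding has_trace_def by (intro conjI exI[of _ \<phi>] allI W1_sobolev_space[OF p W] tL \<phi>(1))
qed

end

section \<open>The tangential gradient of a function with zero trace\<close>

lemma LINT_sum_mult:
  fixes f :: "'i \<Rightarrow> 'a \<Rightarrow> real"
  assumes "\<And>i. integrable M (\<lambda>x. f i x * k x)"
  shows "(LINT x|M. (\<Sum>i\<in>A. c i * f i x) * k x) = (\<Sum>i\<in>A. c i * (LINT x|M. f i x * k x))"
proof -
  have "(LINT x|M. (\<Sum>i\<in>A. c i * f i x) * k x) = (LINT x|M. (\<Sum>i\<in>A. c i * (f i x * k x)))"
    by (simp only: sum_distrib_right mult.assoc)
  also have "\<dots> = (\<Sum>i\<in>A. LINT x|M. c i * (f i x * k x))"
    by (rule Bochner_Integration.integral_sum) (intro integrable_mult_right assms)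
  finally show ?thesis by simp
qed

lemma dir_deriv_mult:
  assumes "smooth f" "smooth g"
  shows "dir_deriv v (\<lambda>x. f x * g x) x = f x * dir_deriv v g x + dir_deriv v f x * g x"
  unfolding dir_deriv_def partial_deriv_mult[OF smooth_differentiable[OF assms(1)] smooth_differentiable[OF assms(2)]]
  by (simp add: distrib_left sum.distrib sum_distrib_left sum_distrib_right mult_ac)

lemma test_function_outside: "f \<in> test_functions U \<Longrightarrow> x \<notin> U \<Longrightarrow> f x = 0"
  using closure_subset[of "{x. f x \<noteq> 0}"] by (auto simp: test_functions_def)

lemma test_function_dir_deriv_outside: "f \<in> test_functions U \<Longrightarrow> x \<notin> U \<Longrightarrow> dir_deriv v f x = 0"
  unfolding dir_deriv_def using test_function_outside[OF test_function_partial_deriv] by (simp add: sum.neutral)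

section \<open>Localisation at one facet and the tangential components\<close>

context polyhedral_domain begin

text \<open>In such a ball the boundary is a flat disc in one facet and \<Omega> is a half ball, so
  Gauss's theorem for a half-space applies to functions supported there.\<close>

definition facet_ball :: "(real^3) set \<Rightarrow> real^3 \<Rightarrow> real \<Rightarrow> bool" where
  "facet_ball F x r \<longleftrightarrow> F \<in> facets \<and> 0 < r \<and> (\<forall>G\<in>facets. G \<noteq> F \<longrightarrow> ball x r \<inter> G = {}) \<and> ball x r \<inter> affine hull F \<subseteq> F
    \<and> (\<forall>y\<in>ball x r. y \<in> \<Omega> \<longleftrightarrow> facet_normal F \<bullet> (y - facet_chart F 0) < 0)"

text \<open>In a small ball that misses the other facets, the half ball below the plane of F is
  connected, misses the boundary, and meets \<Omega> because x is in the closure. Hence it lies in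
  \<Omega>.\<close>

lemma facet_ball_exists:
  assumes F: "F \<in> facets" and x: "x \<in> rel_interior F"
  obtains r where "facet_ball F x r"
proof -
  let ?\<nu> = "facet_normal F"
  obtain r1 where xF: "x \<in> F" and r1: "0 < r1" "ball x r1 \<inter> affine hull F \<subseteq> F"
    using mem_rel_interior_ball[THEN iffD1, OF x] by blast
  let ?K = "\<Union>(facets - {F})"
  have "closed ?K" by (rule closed_Union[OF finite_Diff[OF finite_facets]], rule ballI, rule closed_facet, erule DiffD1)
  moreover have "x \<notin> ?K" using rel_interior_facets_disjoint[OF F _ x] by blast
  ultimately obtain r2 where r2: "0 < r2" "ball x r2 \<subseteq> - ?K"
    using open_contains_ball[of "- ?K"] by blast
  define r where "r = min r1 r2"
  have r: "0 < r" "ball x r \<subseteq> ball x r1" "ball x r \<subseteq> ball x r2" using r1 r2 by (auto simp: r_def)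
  have other: "ball x r \<inter> G = {}" if "G \<in> facets" "G \<noteq> F" for G
    using r(3) r2(2) that by blast
  obtain \<xi> where \<xi>: "x = facet_chart F \<xi>" by (rule facet_in_range[OF F xF])
  have "?\<nu> \<bullet> (x - facet_chart F 0) = 0" unfolding \<xi> by (rule plane_chart.normal[OF plane_chart_facet[OF F]])
  then have eq: "?\<nu> \<bullet> (y - facet_chart F 0) = ?\<nu> \<bullet> (y - x)" for y by (simp add: inner_diff_right)
  let ?A = "ball x r \<inter> {y. ?\<nu> \<bullet> y < ?\<nu> \<bullet> x}"
  have "convex ?A" by (intro convex_Int convex_ball convex_halfspace_lt)
  then have conn: "connected ?A" by (rule convex_connected)
  have fr: "?A \<inter> frontier \<Omega> = {}"
  proof (rule ccontr)
    assume "?A \<inter> frontier \<Omega> \<noteq> {}"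
    then obtain y where y: "y \<in> ball x r" "?\<nu> \<bullet> y < ?\<nu> \<bullet> x" "y \<in> frontier \<Omega>" by blast
    then obtain G where G: "G \<in> facets" "y \<in> G" unfolding frontier_eq_facets by blast
    then have "G = F" using other y(1) by blast
    then have "y \<in> closure \<Omega> \<inter> {y. ?\<nu> \<bullet> (y - x) = 0}" using facet_eq[OF F xF] G(2) by blast
    then show False using y(2) by (simp add: inner_diff_right)
  qed
  have "x \<in> closure \<Omega>" using facet_subset(2)[OF F] xF by blast
  then obtain y where y: "y \<in> \<Omega>" "dist y x < r" using r(1) unfolding closure_approachable by blast
  then have "y \<in> ?A" using facet_normal_outer[OF F xF y(1)] by (simp add: inner_diff_right dist_commute)
  then have "?A \<inter> \<Omega> \<noteq> {}" using y by blast
  then have sub: "?A - \<Omega> = {}" using connected_Int_frontier[OF conn] fr by blast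
  have "y \<in> \<Omega> \<longleftrightarrow> ?\<nu> \<bullet> (y - facet_chart F 0) < 0" if "y \<in> ball x r" for y
    unfolding eq using facet_normal_outer[OF F xF, of y] sub that by (auto simp: inner_diff_right)
  then have "facet_ball F x r" unfolding facet_ball_def using F r r1(2) other by blast
  then show thesis by (rule that)
qed

lemma nn_integral_S_local:
  assumes loc: "facet_ball F x r" and g: "g \<in> borel_measurable borel" and out: "\<And>y. y \<notin> ball x r \<Longrightarrow> g y = 0"
  shows "(\<integral>\<^sup>+y. g y \<partial>S) = (\<integral>\<^sup>+\<xi>. g (facet_chart F \<xi>) \<partial>lborel)"
proof -
  have F: "F \<in> facets" using loc by (simp add: facet_ball_def)
  have "(\<integral>\<^sup>+\<xi>. g (facet_chart G \<xi>) * indicator G (facet_chart G \<xi>) \<partial>lborel) = 0" if G: "G \<in> facets - {F}" for G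
  proof -
    have "ball x r \<inter> G = {}" using loc G unfolding facet_ball_def by blast
    then have "y \<in> G \<Longrightarrow> y \<notin> ball x r" for y by blast
    then have pw: "g y * indicator G y = 0" for y using out[of y] by (cases "y \<in> G") (simp_all del: mem_ball)
    show ?thesis unfolding pw by simp
  qed
  then have "(\<Sum>G\<in>facets - {F}. \<integral>\<^sup>+\<xi>. g (facet_chart G \<xi>) * indicator G (facet_chart G \<xi>) \<partial>lborel) = 0"
    by (rule sum.neutral[OF ballI])
  then have "(\<integral>\<^sup>+y. g y \<partial>S) = (\<integral>\<^sup>+\<xi>. g (facet_chart F \<xi>) * indicator F (facet_chart F \<xi>) \<partial>lborel)"
    unfolding nn_integral_S_facets[OF g] sum.remove[OF finite_facets F] by (simp only: add_0_right)
  also have "\<dots> = (\<integral>\<^sup>+\<xi>. g (facet_chart F \<xi>) \<partial>lborel)"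
  proof (rule nn_integral_cong)
    fix \<xi>
    have "facet_chart F \<xi> \<in> affine hull F" using range_facet_chart[OF F] by blast
    then have "facet_chart F \<xi> \<in> ball x r \<Longrightarrow> facet_chart F \<xi> \<in> F" using loc unfolding facet_ball_def by blast
    then show "g (facet_chart F \<xi>) * indicator F (facet_chart F \<xi>) = g (facet_chart F \<xi>)"
      using out[of "facet_chart F \<xi>"] by (cases "facet_chart F \<xi> \<in> ball x r") (simp_all del: mem_ball)
  qed
  finally show ?thesis .
qed

lemma integrable_S_smooth: "smooth f \<Longrightarrow> integrable S f"
  by (rule integrable_S_of_Lp[of 2]) (use S_powr_finite[of 2 f] smooth_borel in auto)

lemma LINT_S_local:
  assumes loc: "facet_ball F x r" and f: "smooth f" and out: "\<And>y. y \<notin> ball x r \<Longrightarrow> f y = 0"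
  shows "(LINT y|S. f y) = (LINT \<xi>|lborel. f (facet_chart F \<xi>))"
proof -
  have F: "F \<in> facets" using loc by (simp add: facet_ball_def)
  have fb [measurable]: "f \<in> borel_measurable borel" by (rule smooth_borel[OF f])
  have [measurable]: "facet_chart F \<in> borel_measurable borel" by (rule borel_facet_chart[OF F])
  have nn: "(\<integral>\<^sup>+y. ennreal (h (f y)) \<partial>S) = (\<integral>\<^sup>+\<xi>. ennreal (h (f (facet_chart F \<xi>))) \<partial>lborel)"
    if [measurable]: "h \<in> borel_measurable borel" and "h 0 = 0" for h :: "real \<Rightarrow> real"
    by (rule nn_integral_S_local[OF loc]) (measurable, simp add: out that(2))
  have intS: "integrable S f" by (rule integrable_S_smooth[OF f])
  have int: "integrable lborel (\<lambda>\<xi>. f (facet_chart F \<xi>))"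
    using intS nn[of abs] by (simp add: integrable_iff_bounded)
  have "(\<integral>\<^sup>+y. ennreal (f y) \<partial>S) = (\<integral>\<^sup>+\<xi>. ennreal (f (facet_chart F \<xi>)) \<partial>lborel)"
    "(\<integral>\<^sup>+y. ennreal (- f y) \<partial>S) = (\<integral>\<^sup>+\<xi>. ennreal (- f (facet_chart F \<xi>)) \<partial>lborel)"
    using nn[of "\<lambda>y. y"] nn[of uminus] by simp_all
  then show ?thesis unfolding real_lebesgue_integral_def[OF intS] real_lebesgue_integral_def[OF int] by (simp only:)
qed

text \<open>Gauss's theorem is applied in the normal direction to the product of the
  \<tau>-derivative of \<phi> with \<psi>, and in the direction \<tau> to the product of the normal
  derivative with \<psi>. In the difference the mixed second derivatives of \<phi> cancel, so the
  right side contains first derivatives of \<phi> only and is stable under convergence in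
  \<open>W^(1,p)\<close>.\<close>

lemma tangential_gauss:
  assumes loc: "facet_ball F x r" and \<phi>: "smooth \<phi>" and \<psi>: "\<psi> \<in> test_functions (ball x r)" and \<tau>: "\<tau> \<bullet> facet_normal F = 0"
  shows "(LINT y|S. dir_deriv \<tau> \<phi> y * \<psi> y) =
    (LINT y|lborel. cut (dir_deriv \<tau> \<phi>) y * dir_deriv (facet_normal F) \<psi> y)
    - (LINT y|lborel. cut (dir_deriv (facet_normal F) \<phi>) y * dir_deriv \<tau> \<psi> y)"
proof -
  let ?\<nu> = "facet_normal F"
  let ?H = "{y. ?\<nu> \<bullet> (y - facet_chart F 0) < 0}"
  have F: "F \<in> facets" using loc by (simp add: facet_ball_def)
  interpret plane_chart "facet_chart F" ?\<nu> by (rule plane_chart_facet[OF F])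
  have s\<psi>: "smooth \<psi>" by (rule test_function_smooth[OF \<psi>])
  obtain R where R: "\<And>y. R < norm y \<Longrightarrow> \<psi> y = 0" using test_function_support[OF \<psi>] by blast
  have H: "?H \<in> sets borel" by (intro borel_open open_Collect_less continuous_intros)
  have sm: "smooth (\<lambda>y. dir_deriv v \<phi> y * \<psi> y)" for v by (intro smooth_mult smooth_dir_deriv \<phi> s\<psi>)
  have RP: "dir_deriv v \<phi> y * \<psi> y = 0" if "R < norm y" for v y using R[OF that] by simp
  have outP: "dir_deriv v \<phi> y * \<psi> y = 0" if "y \<notin> ball x r" for v y using test_function_outside[OF \<psi> that] by simp
  have gauss: "(LINT y|S. dir_deriv \<tau> \<phi> y * \<psi> y) = (LINT y|lborel. indicator ?H y * dir_deriv ?\<nu> (\<lambda>y. dir_deriv \<tau> \<phi> y * \<psi> y) y)"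
    by (rule trans[OF LINT_S_local[OF loc sm outP] halfspace_gauss_normal[OF sm RP, symmetric]])
  have tang: "(LINT y|lborel. indicator ?H y * dir_deriv \<tau> (\<lambda>y. dir_deriv ?\<nu> \<phi> y * \<psi> y) y) = 0"
    by (rule halfspace_gauss_tangential[OF sm RP \<tau>])
  have int: "integrable lborel (\<lambda>y. indicator A y * f y)" if "smooth f" "\<And>y. R < norm y \<Longrightarrow> f y = 0" "A \<in> sets borel" for f :: "real^3 \<Rightarrow> real" and A
    using that by (intro integrable_bounded_support smooth_continuous) auto
  have intH: "integrable lborel (\<lambda>y. indicator ?H y * dir_deriv w (\<lambda>y. dir_deriv v \<phi> y * \<psi> y) y)" for v w
    by (rule int[OF smooth_dir_deriv[OF sm] dir_deriv_eq_0_outside[OF sm RP] H])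
  have intc: "integrable lborel (\<lambda>y. cut (dir_deriv v \<phi>) y * dir_deriv w \<psi> y)" for v w
  proof -
    have "integrable lborel (\<lambda>y. indicator \<Omega> y * (dir_deriv v \<phi> y * dir_deriv w \<psi> y))"
      using dir_deriv_eq_0_outside[OF s\<psi> R] by (intro int borel_domain smooth_mult smooth_dir_deriv \<phi> s\<psi>) simp
    then show ?thesis by (simp add: cut_def mult_ac)
  qed
  \<comment> \<open>Inside the ball the half-space may be replaced by \<Omega>; outside, everything
    vanishes together with \<psi> and its derivatives.\<close>
  have pw: "indicator ?H y * dir_deriv ?\<nu> (\<lambda>y. dir_deriv \<tau> \<phi> y * \<psi> y) y - indicator ?H y * dir_deriv \<tau> (\<lambda>y. dir_deriv ?\<nu> \<phi> y * \<psi> y) y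
      = cut (dir_deriv \<tau> \<phi>) y * dir_deriv ?\<nu> \<psi> y - cut (dir_deriv ?\<nu> \<phi>) y * dir_deriv \<tau> \<psi> y" for y
  proof (cases "y \<in> ball x r")
    case True
    then have "y \<in> ?H \<longleftrightarrow> y \<in> \<Omega>" using loc unfolding facet_ball_def by blast
    then have "indicator ?H y = (indicator \<Omega> y :: real)" by (simp add: indicator_def)
    then show ?thesis
      unfolding dir_deriv_mult[OF smooth_dir_deriv[OF \<phi>] s\<psi>] dir_deriv_commute[OF \<phi>, of \<tau> ?\<nu>] cut_def
      by (simp only:) (simp add: algebra_simps)
  next
    case False
    then show ?thesis
      unfolding dir_deriv_mult[OF smooth_dir_deriv[OF \<phi>] s\<psi>]
      using test_function_outside[OF \<psi> False] test_function_dir_deriv_outside[OF \<psi> False] by simp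
  qed
  have "(LINT y|S. dir_deriv \<tau> \<phi> y * \<psi> y) = (LINT y|lborel. indicator ?H y * dir_deriv ?\<nu> (\<lambda>y. dir_deriv \<tau> \<phi> y * \<psi> y) y
     - indicator ?H y * dir_deriv \<tau> (\<lambda>y. dir_deriv ?\<nu> \<phi> y * \<psi> y) y)"
    unfolding Bochner_Integration.integral_diff[OF intH intH] gauss tang by simp
  then show ?thesis unfolding pw Bochner_Integration.integral_diff[OF intc intc] .
qed

lemma LINT_tendsto_Lp:
  assumes p: "1 < p" and g: "Lp_fun p g" and f: "\<And>m. Lp_fun p (f m)"
    and lim: "(\<lambda>m::nat. Lp_energy p (\<lambda>x. g x - f m x)) \<longlonglongrightarrow> 0" and \<theta>: "smooth \<theta>" "\<And>x. R < norm x \<Longrightarrow> \<theta> x = 0"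
  shows "(\<lambda>m. LINT x|lborel. f m x * \<theta> x) \<longlonglongrightarrow> (LINT x|lborel. g x * \<theta> x)"
proof -
  have [measurable]: "g \<in> borel_measurable borel" "f m \<in> borel_measurable borel" "\<theta> \<in> borel_measurable borel" for m
    using Lp_fun_borel g f smooth_borel \<theta>(1) by auto
  obtain B where B: "\<And>x. \<bar>\<theta> x\<bar> \<le> B" using smooth_bounded_support[OF \<theta>] by blast
  have "(\<lambda>m. \<integral>\<^sup>+x. ennreal \<bar>g x - f m x\<bar> \<partial>lborel) \<longlonglongrightarrow> 0"
  proof (rule Lp_null_imp_L1_null[OF p])
    show "\<Omega> \<in> sets lborel" "emeasure lborel \<Omega> < \<infinity>" using borel_domain emeasure_domain_finite by auto
    show "g x - f m x = 0" if "x \<notin> \<Omega>" for m x using Lp_fun_outside[OF g that] Lp_fun_outside[OF f that] by simp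
    show "(\<lambda>m. \<integral>\<^sup>+x. ennreal (\<bar>g x - f m x\<bar> powr p) \<partial>lborel) \<longlonglongrightarrow> 0" using lim by (simp add: Lp_energy_def)
  qed measurable
  then show ?thesis
    by (intro LINT_tendsto_of_L1[OF _ _ _ Lp_fun_integrable[OF p g] Lp_fun_integrable[OF p f] B]) measurable
qed

lemma dist_energy_parts:
  assumes "(\<lambda>m::nat. dist_energy p g W (\<phi> m)) \<longlonglongrightarrow> 0"
  shows "(\<lambda>m. Lp_energy p (\<lambda>x. g x - cut (\<phi> m) x)) \<longlonglongrightarrow> 0"
    and "(\<lambda>m. Lp_energy p (\<lambda>x. W i x - cut (partial_deriv i (\<phi> m)) x)) \<longlonglongrightarrow> 0"
proof -
  have "Lp_energy p (\<lambda>x. W i x - cut (partial_deriv i (\<phi> m)) x) \<le> (\<Sum>i\<in>UNIV. Lp_energy p (\<lambda>x. W i x - cut (partial_deriv i (\<phi> m)) x))" for m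
    by (rule member_le_sum) auto
  then show "(\<lambda>m. Lp_energy p (\<lambda>x. W i x - cut (partial_deriv i (\<phi> m)) x)) \<longlonglongrightarrow> 0"
    by (intro ennreal_tendsto_0_le[OF assms]) (simp add: dist_energy_def add_increasing)
  show "(\<lambda>m. Lp_energy p (\<lambda>x. g x - cut (\<phi> m) x)) \<longlonglongrightarrow> 0"
    by (rule ennreal_tendsto_0_le[OF assms]) (simp add: dist_energy_def)
qed

text \<open>The only use of the zero boundary values: v is a limit of functions with compact support
  in \<Omega>, so integration by parts holds against functions \<theta> that do not vanish near the
  boundary.\<close>

lemma zero_boundary_parts:
  assumes p: "1 < p" and v: "v \<in> sobolev_space_0 1 p \<Omega>" and W: "W1 p v g W"
    and \<theta>: "smooth \<theta>" "\<And>x. R < norm x \<Longrightarrow> \<theta> x = 0"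
  shows "(LINT x|lborel. W i x * \<theta> x) = - (LINT x|lborel. g x * partial_deriv i \<theta> x)"
proof -
  have p0: "0 < p" using p by simp
  obtain \<phi> where \<phi>: "\<And>m. \<phi> m \<in> test_functions \<Omega>" "(\<lambda>m::nat. sobolev_norm 1 p \<Omega> (\<lambda>x. v x - \<phi> m x)) \<longlonglongrightarrow> 0"
    using v unfolding sobolev_space_0_def by blast
  have sm: "smooth (\<phi> m)" for m by (rule test_function_smooth[OF \<phi>(1)])
  have de: "(\<lambda>m. dist_energy p g W (\<phi> m)) \<longlonglongrightarrow> 0" using \<phi>(2) unfolding sobolev_norm_tendsto_iff[OF p W sm] .
  have R': "partial_deriv i \<theta> x = 0" if "R < norm x" for x
    using dir_deriv_eq_0_outside[OF \<theta> that, of "axis i 1"] by simp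
  have c: "cut f = f" if "f \<in> test_functions \<Omega>" for f
    using test_function_outside[OF that] by (auto simp: cut_def fun_eq_iff split: split_indicator)
  have A: "(\<lambda>m. LINT x|lborel. cut (partial_deriv i (\<phi> m)) x * \<theta> x) \<longlonglongrightarrow> (LINT x|lborel. W i x * \<theta> x)"
    by (rule LINT_tendsto_Lp[OF p W1D(3)[OF W] cut_Lp[OF p0 smooth_partial_deriv[OF sm]] dist_energy_parts(2)[OF de] \<theta>])
  have "(\<lambda>m. - (LINT x|lborel. cut (\<phi> m) x * partial_deriv i \<theta> x)) \<longlonglongrightarrow> - (LINT x|lborel. g x * partial_deriv i \<theta> x)"
    by (intro tendsto_minus LINT_tendsto_Lp[OF p W1D(2)[OF W] cut_Lp[OF p0 sm] dist_energy_parts(1)[OF de] smooth_partial_deriv[OF \<theta>(1)] R'])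
  moreover have "- (LINT x|lborel. cut (\<phi> m) x * partial_deriv i \<theta> x) = (LINT x|lborel. cut (partial_deriv i (\<phi> m)) x * \<theta> x)" for m
    unfolding c[OF \<phi>(1)] c[OF test_function_partial_deriv[OF \<phi>(1)]]
    using LINT_partial_deriv_product[OF \<theta>(1) \<phi>(1), of i m] by (simp add: mult.commute)
  ultimately have B: "(\<lambda>m. LINT x|lborel. cut (partial_deriv i (\<phi> m)) x * \<theta> x) \<longlonglongrightarrow> - (LINT x|lborel. g x * partial_deriv i \<theta> x)"
    by simp
  show ?thesis by (rule LIMSEQ_unique[OF A B])
qed

lemma cut_dir_deriv: "cut (dir_deriv v f) x = (\<Sum>i\<in>UNIV. v $ i * cut (partial_deriv i f) x)"
  by (simp add: cut_def dir_deriv_def sum_distrib_right mult.assoc)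

lemma Lp_fun_integrable_mult:
  assumes "1 < p" "Lp_fun p g" "smooth \<theta>" "\<And>x. R < norm x \<Longrightarrow> \<theta> x = 0"
  shows "integrable lborel (\<lambda>x. g x * \<theta> x)"
proof -
  obtain B where "\<And>x. \<bar>\<theta> x\<bar> \<le> B" using smooth_bounded_support[OF assms(3,4)] by blast
  then show ?thesis using smooth_borel[OF assms(3)] by (intro integrable_mult_bounded Lp_fun_integrable[OF assms(1,2)]) auto
qed

lemma LINT_gradient_parts:
  assumes p: "1 < p" and v: "v \<in> sobolev_space_0 1 p \<Omega>" and W: "W1 p v g W"
    and \<theta>: "smooth \<theta>" "\<And>x. R < norm x \<Longrightarrow> \<theta> x = 0"
  shows "(\<Sum>i\<in>UNIV. a $ i * (LINT x|lborel. W i x * \<theta> x)) = - (LINT x|lborel. g x * dir_deriv a \<theta> x)"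
proof -
  have R': "partial_deriv i \<theta> x = 0" if "R < norm x" for x i
    using dir_deriv_eq_0_outside[OF \<theta> that, of "axis i 1"] by simp
  have "(LINT x|lborel. g x * dir_deriv a \<theta> x) = (LINT x|lborel. (\<Sum>i\<in>UNIV. a $ i * partial_deriv i \<theta> x) * g x)"
    unfolding dir_deriv_def by (simp only: mult.commute)
  also have "\<dots> = (\<Sum>i\<in>UNIV. a $ i * (LINT x|lborel. partial_deriv i \<theta> x * g x))"
    by (rule LINT_sum_mult) (use Lp_fun_integrable_mult[OF p W1D(2)[OF W] smooth_partial_deriv[OF \<theta>(1)] R'] in \<open>simp only: mult.commute\<close>)
  finally have e: "(LINT x|lborel. g x * dir_deriv a \<theta> x) = (\<Sum>i\<in>UNIV. a $ i * (LINT x|lborel. g x * partial_deriv i \<theta> x))"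
    by (simp only: mult.commute[of "partial_deriv _ _ _"])
  have z: "(LINT x|lborel. W i x * \<theta> x) = - (LINT x|lborel. g x * partial_deriv i \<theta> x)" for i
    by (rule zero_boundary_parts[OF p v W \<theta>])
  show ?thesis unfolding z e by (simp add: sum_negf)
qed

text \<open>\<open>X\<close> consists of globally smooth functions that agree with the partial
  derivatives of the approximants on the closure only; their boundary values converge to t. In the
  limit of \<open>tangential_gauss\<close> the gradient W stands against first derivatives of
  \<psi>, and a further integration by parts leaves g against second derivatives of \<psi>, which
  cancel.\<close>

lemma tangential_trace_local:
  assumes p: "1 < p" and v: "v \<in> sobolev_space_0 1 p \<Omega>" and W: "W1 p v g W"
    and \<phi>: "\<And>m. smooth (\<phi> m)" "(\<lambda>m::nat. dist_energy p g W (\<phi> m)) \<longlonglongrightarrow> 0"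
    and \<chi>: "\<And>i m. smooth (X i m)" "\<And>i m x. x \<in> closure \<Omega> \<Longrightarrow> partial_deriv i (\<phi> m) x = X i m x"
    and t: "\<And>i. t i \<in> borel_measurable borel" "\<And>i. (\<lambda>m. \<integral>\<^sup>+x. ennreal (\<bar>t i x - X i m x\<bar> powr p) \<partial>S) \<longlonglongrightarrow> 0"
    and loc: "facet_ball F x r" and \<tau>: "\<tau> \<bullet> facet_normal F = 0"
  shows "AE y in S. y \<in> ball x r \<longrightarrow> (\<Sum>i\<in>UNIV. \<tau> $ i * t i y) = 0"
proof -
  have p0: "0 < p" using p by simp
  let ?\<nu> = "facet_normal F"
  have tS [measurable]: "t i \<in> borel_measurable S" for i by (rule borel_S[OF t(1)])
  have XS [measurable]: "X i m \<in> borel_measurable S" for i m by (rule borel_S[OF smooth_borel[OF \<chi>(1)]])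
  have intt: "integrable S (t i)" for i
  proof -
    have "\<forall>\<^sub>F m in sequentially. (\<integral>\<^sup>+x. ennreal (\<bar>t i x - X i m x\<bar> powr p) \<partial>S) < 1"
      by (rule order_tendstoD(2)[OF t(2)]) simp
    then obtain m where m: "(\<integral>\<^sup>+x. ennreal (\<bar>t i x - X i m x\<bar> powr p) \<partial>S) < 1"
      unfolding eventually_sequentially by blast
    have "integrable S (\<lambda>x. t i x - X i m x)"
      by (rule integrable_S_of_Lp[OF p borel_measurable_diff[OF t(1) smooth_borel[OF \<chi>(1)]]])
        (use m in \<open>auto intro: less_trans\<close>)
    from Bochner_Integration.integrable_add[OF this integrable_S_smooth[OF \<chi>(1)[of i m]]] show ?thesis by simp
  qed
  have L1: "(\<lambda>m. \<integral>\<^sup>+x. ennreal \<bar>t i x - X i m x\<bar> \<partial>S) \<longlonglongrightarrow> 0" for i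
  proof (rule Lp_null_imp_L1_null[OF p _ _ _ _ t(2)])
    show "UNIV \<in> sets S" "emeasure S UNIV < \<infinity>" by (simp_all add: sets_S S.emeasure_eq_measure)
  qed (simp_all, measurable)
  show ?thesis
  proof (rule orthogonal_test_functions[OF sets_S _ open_ball])
    show "integrable S (\<lambda>y. \<Sum>i\<in>UNIV. \<tau> $ i * t i y)" by (intro Bochner_Integration.integrable_sum integrable_mult_right intt)
    fix \<psi> assume \<psi>: "\<psi> \<in> test_functions (ball x r)"
    have s\<psi>: "smooth \<psi>" by (rule test_function_smooth[OF \<psi>])
    obtain R where R: "\<And>y. R < norm y \<Longrightarrow> \<psi> y = 0" using test_function_support[OF \<psi>] by blast
    note Rd = dir_deriv_eq_0_outside[OF s\<psi> R] and sd = smooth_dir_deriv[OF s\<psi>]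
    obtain B where B: "\<And>y. \<bar>\<psi> y\<bar> \<le> B" using smooth_bounded_support[OF s\<psi> R] by blast
    have [measurable]: "\<psi> \<in> borel_measurable S" by (rule borel_S[OF smooth_borel[OF s\<psi>]])
    have trace: "(LINT y|S. dir_deriv \<tau> (\<phi> m) y * \<psi> y) = (\<Sum>i\<in>UNIV. \<tau> $ i * (LINT y|S. X i m y * \<psi> y))" for m
    proof -
      have sm: "smooth (\<lambda>y. dir_deriv \<tau> (\<phi> m) y * \<psi> y)" "smooth (\<lambda>y. (\<Sum>i\<in>UNIV. \<tau> $ i * X i m y) * \<psi> y)"
        by (intro smooth_mult smooth_dir_deriv smooth_sum smooth_const \<phi> \<chi>(1) s\<psi>)+
      have "(LINT y|S. dir_deriv \<tau> (\<phi> m) y * \<psi> y) = (LINT y|S. (\<Sum>i\<in>UNIV. \<tau> $ i * X i m y) * \<psi> y)"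
      proof (rule integral_cong_AE)
        show "AE y in S. dir_deriv \<tau> (\<phi> m) y * \<psi> y = (\<Sum>i\<in>UNIV. \<tau> $ i * X i m y) * \<psi> y"
          using AE_S by eventually_elim (simp add: dir_deriv_def \<chi>(2) frontier_def)
      qed (intro borel_S smooth_borel sm)+
      also have "\<dots> = (\<Sum>i\<in>UNIV. \<tau> $ i * (LINT y|S. X i m y * \<psi> y))"
        by (rule LINT_sum_mult) (intro integrable_S_smooth smooth_mult \<chi>(1) s\<psi>)
      finally show ?thesis .
    qed
    have intc: "integrable lborel (\<lambda>y. cut (partial_deriv i (\<phi> m)) y * dir_deriv w \<psi> y)" for i m w
      by (rule Lp_fun_integrable_mult[OF p cut_Lp[OF p0 smooth_partial_deriv[OF \<phi>(1)]] sd Rd])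
    have gauss: "(LINT y|S. dir_deriv \<tau> (\<phi> m) y * \<psi> y) =
        (\<Sum>i\<in>UNIV. \<tau> $ i * (LINT y|lborel. cut (partial_deriv i (\<phi> m)) y * dir_deriv ?\<nu> \<psi> y))
        - (\<Sum>i\<in>UNIV. ?\<nu> $ i * (LINT y|lborel. cut (partial_deriv i (\<phi> m)) y * dir_deriv \<tau> \<psi> y))" for m
      unfolding tangential_gauss[OF loc \<phi>(1) \<psi> \<tau>] cut_dir_deriv LINT_sum_mult[OF intc] ..
    show "(LINT y|S. (\<Sum>i\<in>UNIV. \<tau> $ i * t i y) * \<psi> y) = 0"
    proof (rule LIMSEQ_unique)
      have "(\<lambda>m. LINT y|S. X i m y * \<psi> y) \<longlonglongrightarrow> (LINT y|S. t i y * \<psi> y)" for i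
        by (rule LINT_tendsto_of_L1[OF _ _ _ intt integrable_S_smooth[OF \<chi>(1)] B L1]) measurable
      then have "(\<lambda>m. \<Sum>i\<in>UNIV. \<tau> $ i * (LINT y|S. X i m y * \<psi> y)) \<longlonglongrightarrow> (\<Sum>i\<in>UNIV. \<tau> $ i * (LINT y|S. t i y * \<psi> y))"
        by (intro tendsto_sum tendsto_mult tendsto_const)
      moreover have "(LINT y|S. (\<Sum>i\<in>UNIV. \<tau> $ i * t i y) * \<psi> y) = (\<Sum>i\<in>UNIV. \<tau> $ i * (LINT y|S. t i y * \<psi> y))"
        by (rule LINT_sum_mult, rule integrable_mult_bounded[OF intt _ B]) measurable
      ultimately show "(\<lambda>m. LINT y|S. dir_deriv \<tau> (\<phi> m) y * \<psi> y) \<longlonglongrightarrow> (LINT y|S. (\<Sum>i\<in>UNIV. \<tau> $ i * t i y) * \<psi> y)"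
        by (simp only: trace)
      have lim: "(\<lambda>m. LINT y|lborel. cut (partial_deriv i (\<phi> m)) y * dir_deriv w \<psi> y) \<longlonglongrightarrow> (LINT y|lborel. W i y * dir_deriv w \<psi> y)" for i w
        by (rule LINT_tendsto_Lp[OF p W1D(3)[OF W] cut_Lp[OF p0 smooth_partial_deriv[OF \<phi>(1)]] dist_energy_parts(2)[OF \<phi>(2)] sd Rd])
      have "(\<lambda>m. LINT y|S. dir_deriv \<tau> (\<phi> m) y * \<psi> y) \<longlonglongrightarrow>
         (\<Sum>i\<in>UNIV. \<tau> $ i * (LINT y|lborel. W i y * dir_deriv ?\<nu> \<psi> y)) - (\<Sum>i\<in>UNIV. ?\<nu> $ i * (LINT y|lborel. W i y * dir_deriv \<tau> \<psi> y))"
        unfolding gauss by (intro tendsto_diff tendsto_sum tendsto_mult tendsto_const lim)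
      \<comment> \<open>Both sums become the integral of -g against a mixed second derivative of
        \<psi>, once in each order.\<close>
      also have "(\<Sum>i\<in>UNIV. \<tau> $ i * (LINT y|lborel. W i y * dir_deriv ?\<nu> \<psi> y)) = - (LINT y|lborel. g y * dir_deriv \<tau> (dir_deriv ?\<nu> \<psi>) y)"
        by (rule LINT_gradient_parts[OF p v W sd Rd])
      also have "(\<Sum>i\<in>UNIV. ?\<nu> $ i * (LINT y|lborel. W i y * dir_deriv \<tau> \<psi> y)) = - (LINT y|lborel. g y * dir_deriv ?\<nu> (dir_deriv \<tau> \<psi>) y)"
        by (rule LINT_gradient_parts[OF p v W sd Rd])
      finally show "(\<lambda>m. LINT y|S. dir_deriv \<tau> (\<phi> m) y * \<psi> y) \<longlonglongrightarrow> 0"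
        by (simp only: dir_deriv_commute[OF s\<psi>, of \<tau> ?\<nu>]) simp
    qed
  qed
qed

lemma tangential_trace:
  assumes p: "1 < p" and v: "v \<in> sobolev_space_0 1 p \<Omega>" and W: "W1 p v g W"
    and \<phi>: "\<And>m. smooth (\<phi> m)" "(\<lambda>m::nat. dist_energy p g W (\<phi> m)) \<longlonglongrightarrow> 0"
    and \<chi>: "\<And>i m. smooth (X i m)" "\<And>i m x. x \<in> closure \<Omega> \<Longrightarrow> partial_deriv i (\<phi> m) x = X i m x"
    and t: "\<And>i. t i \<in> borel_measurable borel" "\<And>i. (\<lambda>m. \<integral>\<^sup>+x. ennreal (\<bar>t i x - X i m x\<bar> powr p) \<partial>S) \<longlonglongrightarrow> 0"
  shows "AE x in S. \<forall>F\<in>facets. x \<in> rel_interior F \<longrightarrow>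
    (\<forall>i. t i x = (\<Sum>j\<in>UNIV. t j x * facet_normal F $ j) * facet_normal F $ i)"
proof -
  have "AE x in S. \<forall>F\<in>facets. \<forall>i\<in>(UNIV::3 set). x \<in> rel_interior F \<longrightarrow>
    t i x = (\<Sum>j\<in>UNIV. t j x * facet_normal F $ j) * facet_normal F $ i"
  proof (intro AE_finite_allI finite_facets finite)
    fix F and i :: 3 assume F: "F \<in> facets"
    let ?\<nu> = "facet_normal F"
    \<comment> \<open>The projection of a coordinate vector to the plane: that t has no component
      along it is the i-th coordinate of the claim.\<close>
    let ?\<tau> = "axis i 1 - ?\<nu> $ i *\<^sub>R ?\<nu>"
    have "?\<nu> \<bullet> ?\<nu> = 1" using norm_facet_normal[OF F] by (simp add: norm_eq_1)
    then have \<tau>: "?\<tau> \<bullet> ?\<nu> = 0" by (simp add: inner_diff_left inner_axis')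
    show "AE x in S. x \<in> rel_interior F \<longrightarrow> t i x = (\<Sum>j\<in>UNIV. t j x * ?\<nu> $ j) * ?\<nu> $ i"
    proof (rule AE_local)
      fix x assume "x \<in> rel_interior F"
      then obtain r where r: "facet_ball F x r" using facet_ball_exists[OF F] by blast
      have "AE y in S. y \<in> ball x r \<longrightarrow> (\<Sum>j\<in>UNIV. ?\<tau> $ j * t j y) = 0"
        by (rule tangential_trace_local[OF p v W \<phi> \<chi> t r \<tau>])
      moreover have "(\<Sum>j\<in>UNIV. ?\<tau> $ j * t j y) = t i y - (\<Sum>j\<in>UNIV. t j y * ?\<nu> $ j) * ?\<nu> $ i" for y
      proof -
        have "(\<Sum>j\<in>UNIV. axis i 1 $ j * t j y) = (\<Sum>j\<in>UNIV. if j = i then t j y else 0)"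
          by (rule sum.cong) (auto simp: axis_def)
        then show ?thesis by (simp add: left_diff_distrib right_diff_distrib sum_subtractf sum_distrib_left sum_distrib_right mult_ac)
      qed
      ultimately have "AE y in S. y \<in> ball x r \<longrightarrow> t i y = (\<Sum>j\<in>UNIV. t j y * ?\<nu> $ j) * ?\<nu> $ i"
        by (auto elim!: eventually_mono)
      then show "\<exists>V. open V \<and> x \<in> V \<and> (AE y in S. y \<in> V \<longrightarrow> t i y = (\<Sum>j\<in>UNIV. t j y * ?\<nu> $ j) * ?\<nu> $ i)"
        using r by (intro exI[of _ "ball x r"]) (simp add: facet_ball_def)
    qed
  qed
  then show ?thesis by eventually_elim blast
qed

end

section \<open>Convergence of mollified functions with their gradients\<close>

context mollifier begin

text \<open>The factor allows for the powers of 1 - \<delta> that arise whenever a mollified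
  function is differentiated.\<close>

lemma scaled_mollify_converges:
  assumes p: "1 < p" and g: "Lp_fun p g" and c: "c \<longlonglongrightarrow> 1" "\<And>m. \<bar>c m\<bar> \<le> 1"
  shows "(\<lambda>m. Lp_energy p (\<lambda>x. g x - cut (\<lambda>x. c m * mollify (step m) g x) x)) \<longlonglongrightarrow> 0"
proof (rule ennreal_tendsto_0_le)
  have p0: "0 < p" using p by simp
  let ?M = "\<lambda>m. mollify (step m) g"
  let ?E = "\<lambda>m. \<integral>\<^sup>+x. ennreal (\<bar>?M m x - g x\<bar> powr p) * indicator \<Omega> x \<partial>lborel"
  have [measurable]: "g \<in> borel_measurable borel" by (rule Lp_fun_borel[OF g])
  have [measurable]: "?M m \<in> borel_measurable borel" for m by (rule smooth_borel[OF smooth_mollify[OF Lp_fun_integrable[OF p g] step(1)]])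
  have "Lp_energy p g < \<infinity>" using Lp_fun_finite[OF g] by (simp add: Lp_energy_def)
  moreover have "(\<lambda>m. ennreal (\<bar>1 - c m\<bar> powr p)) \<longlonglongrightarrow> ennreal (\<bar>1 - 1\<bar> powr p)"
    using p0 by (intro tendsto_ennrealI tendsto_powr' tendsto_rabs tendsto_diff tendsto_const c) auto
  ultimately have "(\<lambda>m. ennreal (2 powr p) * (Lp_energy p g * ennreal (\<bar>1 - c m\<bar> powr p) + ?E m)) \<longlonglongrightarrow> ennreal (2 powr p) * (Lp_energy p g * ennreal (\<bar>1 - 1\<bar> powr p) + 0)"
    by (intro ennreal_tendsto_cmult tendsto_add mollify_converges[OF p g]) auto
  then show "(\<lambda>m. ennreal (2 powr p) * (Lp_energy p g * ennreal (\<bar>1 - c m\<bar> powr p) + ?E m)) \<longlonglongrightarrow> 0" using p0 by simp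
  fix m
  have "ennreal (\<bar>g x - cut (\<lambda>x. c m * ?M m x) x\<bar> powr p) \<le>
      ennreal (2 powr p) * (ennreal (\<bar>1 - c m\<bar> powr p) * ennreal (\<bar>g x\<bar> powr p) + ennreal (\<bar>?M m x - g x\<bar> powr p) * indicator \<Omega> x)" for x
  proof (cases "x \<in> \<Omega>")
    case True
    have "\<bar>g x - c m * ?M m x\<bar> powr p \<le> 2 powr p * (\<bar>(1 - c m) * g x\<bar> powr p + \<bar>c m * (g x - ?M m x)\<bar> powr p)"
      using abs_add_powr_le[OF p0, of "(1 - c m) * g x" "c m * (g x - ?M m x)"] by (simp add: algebra_simps)
    also have "\<bar>c m * (g x - ?M m x)\<bar> powr p \<le> \<bar>?M m x - g x\<bar> powr p"
      using c(2)[of m] p0 by (intro powr_mono2) (auto simp: abs_mult abs_minus_commute mult_left_le_one_le)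
    finally have "\<bar>g x - c m * ?M m x\<bar> powr p \<le> 2 powr p * (\<bar>1 - c m\<bar> powr p * \<bar>g x\<bar> powr p + \<bar>?M m x - g x\<bar> powr p)"
      by (simp add: abs_mult powr_mult)
    from ennreal_leI[OF this] True show ?thesis
      by (simp add: cut_def ennreal_mult)
  next
    case False
    then show ?thesis using Lp_fun_outside[OF g False] p0 by (simp add: cut_def)
  qed
  then have "Lp_energy p (\<lambda>x. g x - cut (\<lambda>x. c m * ?M m x) x) \<le> (\<integral>\<^sup>+x. ennreal (2 powr p) *
      (ennreal (\<bar>1 - c m\<bar> powr p) * ennreal (\<bar>g x\<bar> powr p) + ennreal (\<bar>?M m x - g x\<bar> powr p) * indicator \<Omega> x) \<partial>lborel)"
    unfolding Lp_energy_def by (rule nn_integral_mono)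
  also have "\<dots> = ennreal (2 powr p) * (Lp_energy p g * ennreal (\<bar>1 - c m\<bar> powr p) + ?E m)"
    unfolding Lp_energy_def by (simp add: nn_integral_cmult nn_integral_add mult.commute[of "\<integral>\<^sup>+x. ennreal (\<bar>g x\<bar> powr p) \<partial>lborel"])
  finally show "Lp_energy p (\<lambda>x. g x - cut (\<lambda>x. c m * ?M m x) x) \<le> ennreal (2 powr p) * (Lp_energy p g * ennreal (\<bar>1 - c m\<bar> powr p) + ?E m)" .
qed

lemma mollify_dist_energy:
  assumes p: "1 < p" and g: "Lp_fun p g" and W: "\<And>i. Lp_fun p (W i)" "\<And>i. weak_partial i g (W i)"
    and c: "c \<longlonglongrightarrow> 1" "\<And>m. \<bar>c m\<bar> \<le> 1"
  shows "(\<lambda>m. dist_energy p g W (\<lambda>x. c m * mollify (step m) g x)) \<longlonglongrightarrow> 0"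
proof -
  have ig: "integrable lborel g" and iW: "integrable lborel (W i)" for i by (intro Lp_fun_integrable[OF p] g W)+
  have sm: "smooth (mollify (step m) g)" for m by (rule smooth_mollify[OF ig step(1)])
  have pd: "cut (partial_deriv i (\<lambda>x. c m * mollify (step m) g x)) = cut (\<lambda>x. (c m * (1 - step m)) * mollify (step m) (W i) x)" for i m
  proof
    fix x
    show "cut (partial_deriv i (\<lambda>x. c m * mollify (step m) g x)) x = cut (\<lambda>x. (c m * (1 - step m)) * mollify (step m) (W i) x) x"
    proof (cases "x \<in> \<Omega>")
      case True
      then have "x \<in> closure \<Omega>" using closure_subset by blast
      from partial_deriv_mollify[OF ig iW W(2) step(1) step(3) this] show ?thesis
        by (simp add: cut_def partial_deriv_cmult[OF sm])
    qed (simp add: cut_def)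
  qed
  have c': "(\<lambda>m. c m * (1 - step m)) \<longlonglongrightarrow> 1"
    using tendsto_mult[OF c(1) tendsto_diff[OF tendsto_const step(4)], of 1] by simp
  have c'': "\<bar>c m * (1 - step m)\<bar> \<le> 1" for m
    unfolding abs_mult using c(2)[of m] step(1,3)[of m] by (intro mult_le_one) auto
  have "(\<lambda>m. dist_energy p g W (\<lambda>x. c m * mollify (step m) g x)) \<longlonglongrightarrow> 0 + (\<Sum>i\<in>(UNIV::3 set). 0)"
    unfolding dist_energy_def pd
    by (intro tendsto_add tendsto_sum scaled_mollify_converges p g W c c' c'')
  then show ?thesis by simp
qed

end

context polyhedral_domain begin

text \<open>One family of approximants serves two purposes: mollified v converges with its gradient,
  and on the closure that gradient is 1 - \<delta> times mollified W, which converges in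
  \<open>W^(1,p)\<close> as well and so has boundary values. Hence the fields in Gauss's theorem and
  in the definition of t are the same.\<close>

lemma normal_trace:
  assumes p: "1 < p" and v: "v \<in> sobolev_space_0 1 p \<Omega>" and W: "W1 p v g W"
    and V: "\<And>i. W1 p (W i) (W i) (V i)"
  obtains t where "\<And>i. trace_limit p (W i) (V i) (t i)"
    "AE x in S. \<forall>F\<in>facets. x \<in> rel_interior F \<longrightarrow>
      (\<forall>i. t i x = (\<Sum>j\<in>UNIV. t j x * facet_normal F $ j) * facet_normal F $ i)"
proof -
  obtain x0 \<rho> where b: "inner_ball x0 \<rho>" using inner_ball_exists .
  then have "0 < \<rho>" by (simp add: inner_ball_def)
  from mollifier_exists[OF this, of x0] obtain \<eta> where \<eta>: "smooth \<eta>" "\<And>x. 0 \<le> \<eta> x" "\<And>x. x \<notin> cball x0 \<rho> \<Longrightarrow> \<eta> x = 0"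
    "integrable lborel \<eta>" "(LINT x|lborel. \<eta> x) = 1" by blast
  interpret mollifier \<Omega> x0 \<rho> \<eta> by unfold_locales (fact b \<eta>)+
  define \<phi> where "\<phi> m = mollify (step m) g" for m
  define X where "X i m = (\<lambda>x. (1 - step m) * mollify (step m) (W i) x)" for i m
  have ig: "integrable lborel g" and iW: "integrable lborel (W i)" for i
    using Lp_fun_integrable[OF p] W1D(2,3)[OF W] by auto
  have \<phi>1: "smooth (\<phi> m)" for m unfolding \<phi>_def by (rule smooth_mollify[OF ig step(1)])
  have \<phi>2: "(\<lambda>m. dist_energy p g W (\<phi> m)) \<longlonglongrightarrow> 0"
    using mollify_dist_energy[OF p W1D(2-4)[OF W], of "\<lambda>_. 1"] by (simp add: \<phi>_def)
  have X1: "smooth (X i m)" for i m unfolding X_def by (intro smooth_mult smooth_const smooth_mollify[OF iW step(1)])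
  have X2: "partial_deriv i (\<phi> m) x = X i m x" if "x \<in> closure \<Omega>" for i m x
    unfolding X_def \<phi>_def by (rule partial_deriv_mollify[OF ig iW W1D(4)[OF W] step(1) step(3) that])
  have c: "(\<lambda>m. 1 - step m) \<longlonglongrightarrow> 1" "\<bar>1 - step m\<bar> \<le> 1" for m
    using tendsto_diff[OF tendsto_const step(4), of 1] step(1,3)[of m] by auto
  have X3: "(\<lambda>m. dist_energy p (W i) (V i) (X i m)) \<longlonglongrightarrow> 0" for i
    unfolding X_def by (rule mollify_dist_energy[OF p W1D(2)[OF V[of i]] W1D(3)[OF V[of i]] W1D(4)[OF V[of i]], where c="\<lambda>m. 1 - step m"]) (rule c)+
  let ?P = "\<lambda>i s. s \<in> borel_measurable borel \<and> (\<lambda>m. \<integral>\<^sup>+x. ennreal (\<bar>s x - X i m x\<bar> powr p) \<partial>S) \<longlonglongrightarrow> 0"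
  have "\<forall>i. \<exists>s. ?P i s"
  proof
    fix i
    obtain s where "s \<in> borel_measurable borel" "(\<lambda>m. \<integral>\<^sup>+x. ennreal (\<bar>s x - X i m x\<bar> powr p) \<partial>S) \<longlonglongrightarrow> 0"
      by (rule trace_limit_exists[OF p W1D(2)[OF V[of i]] W1D(3)[OF V[of i]] X1[of i] X3[of i]])
    then show "\<exists>s. ?P i s" by (intro exI conjI)
  qed
  from choice[OF this] obtain t where P: "\<forall>i. ?P i (t i)" ..
  have t: "t i \<in> borel_measurable borel" "(\<lambda>m. \<integral>\<^sup>+x. ennreal (\<bar>t i x - X i m x\<bar> powr p) \<partial>S) \<longlonglongrightarrow> 0" for i
    using P by simp_all
  have "trace_limit p (W i) (V i) (t i)" for i
    unfolding trace_limit_def by (intro conjI exI[of _ "X i"] allI t X1 X3)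
  then show thesis by (rule that) (rule tangential_trace[OF p v W \<phi>1 \<phi>2 X1 X2 t])
qed

end

section \<open>The normal derivative\<close>

text \<open>With c = a \<bullet> b, twice the square of |s a - r b| equals (1 + c) (s - r)^2 + (1 -
  c) (s + r)^2, and the second term is nonnegative.\<close>

lemma unit_multiples_difference:
  fixes a b :: "'a::real_inner"
  assumes a: "norm a = 1" and b: "norm b = 1" and ab: "- 1 < a \<bullet> b"
  shows "\<bar>s - r\<bar> \<le> sqrt (2 / (1 + a \<bullet> b)) * norm (s *\<^sub>R a - r *\<^sub>R b)"
proof -
  let ?c = "a \<bullet> b"
  have aa: "a \<bullet> a = 1" "b \<bullet> b = 1" using a b by (simp_all add: norm_eq_1)
  have c1: "?c \<le> 1" using norm_cauchy_schwarz[of a b] a b by simp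
  have "(norm (s *\<^sub>R a - r *\<^sub>R b))\<^sup>2 = s * s + r * r - 2 * ?c * s * r"
    unfolding power2_norm_eq_inner by (simp add: inner_diff_left inner_diff_right aa inner_commute[of b a] algebra_simps)
  then have "2 * (norm (s *\<^sub>R a - r *\<^sub>R b))\<^sup>2 = (1 + ?c) * (s - r)\<^sup>2 + (1 - ?c) * (s + r)\<^sup>2"
    by (simp add: power2_eq_square algebra_simps)
  moreover have "0 \<le> (1 - ?c) * (s + r)\<^sup>2" using c1 by simp
  ultimately have "(1 + ?c) * (s - r)\<^sup>2 \<le> 2 * (norm (s *\<^sub>R a - r *\<^sub>R b))\<^sup>2" by linarith
  then have "(s - r)\<^sup>2 \<le> 2 / (1 + ?c) * (norm (s *\<^sub>R a - r *\<^sub>R b))\<^sup>2"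
    using ab by (simp add: field_simps)
  from real_sqrt_le_mono[OF this] show ?thesis by (simp only: real_sqrt_mult real_sqrt_abs abs_norm_cancel)
qed

lemma borel_rel_interior: "rel_interior (F::'a::euclidean_space set) \<in> sets borel"
proof -
  obtain T where "open T" "rel_interior F = affine hull F \<inter> T"
    using openin_rel_interior[of F] unfolding openin_open by blast
  then show ?thesis by (simp add: borel_closed borel_open sets.Int)
qed

section \<open>From the trace of the gradient to its normal component\<close>

context polyhedral_domain begin

text \<open>In its chart a facet is a convex planar set, whose frontier is a null set; interior
  points of that set correspond to relative interior points of the facet because the chart is
  isometric.\<close>

lemma AE_rel_interior: "AE x in S. \<exists>F\<in>facets. x \<in> rel_interior F"
proof (rule AE_I)
  let ?N = "- (\<Union>F\<in>facets. rel_interior F)"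
  have N: "?N \<in> sets borel"
    using borel_rel_interior by (intro borel_comp sets.finite_UN finite_facets) auto
  then show "?N \<in> sets S" by (simp add: sets_S)
  show "{x \<in> space S. \<not> (\<exists>F\<in>facets. x \<in> rel_interior F)} \<subseteq> ?N" by blast
  have "(\<integral>\<^sup>+\<xi>. indicator ?N (facet_chart G \<xi>) * indicator G (facet_chart G \<xi>) \<partial>lborel) = 0" if G: "G \<in> facets" for G
  proof -
    interpret plane_chart "facet_chart G" "facet_normal G" by (rule plane_chart_facet[OF G])
    let ?C = "facet_chart G -` G"
    have "convex ?C"
      unfolding convex_alt using convex_facet[OF G] by (auto simp: chart_affine convex_alt)
    then have "negligible (frontier ?C)" by (rule negligible_convex_frontier)
    moreover have "frontier ?C \<in> sets lborel" by (simp add: borel_closed)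
    ultimately have "frontier ?C \<in> null_sets lborel"
      unfolding negligible_iff_null_sets by (simp only: null_sets_completion_iff)
    then have "AE \<xi> in lborel. \<xi> \<notin> frontier ?C" by (rule AE_not_in)
    then have "AE \<xi> in lborel. indicator ?N (facet_chart G \<xi>) * indicator G (facet_chart G \<xi>) = (0::ennreal)"
    proof eventually_elim
      case (elim \<xi>)
      have "facet_chart G \<xi> \<in> rel_interior G" if xG: "facet_chart G \<xi> \<in> G"
      proof -
        have "\<xi> \<in> interior ?C" using elim xG closure_subset[of ?C] by (auto simp: frontier_def)
        then obtain e where e: "0 < e" "ball \<xi> e \<subseteq> ?C" unfolding mem_interior by blast
        have "ball (facet_chart G \<xi>) e \<inter> affine hull G \<subseteq> G"
        proof
          fix y assume y: "y \<in> ball (facet_chart G \<xi>) e \<inter> affine hull G"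
          then obtain \<eta> where \<eta>: "y = facet_chart G \<eta>" using range_facet_chart[OF G] by blast
          have "\<eta> \<in> ball \<xi> e" using y unfolding \<eta> by (simp add: isometric)
          then show "y \<in> G" using e(2) \<eta> by blast
        qed
        with e(1) xG show ?thesis unfolding mem_rel_interior_ball by blast
      qed
      then show ?case using G by (auto simp: indicator_def)
    qed
    then have "(\<integral>\<^sup>+\<xi>. indicator ?N (facet_chart G \<xi>) * indicator G (facet_chart G \<xi>) \<partial>lborel) = (\<integral>\<^sup>+\<xi>. 0 \<partial>(lborel :: (real^2) measure))"
      by (rule nn_integral_cong_AE)
    then show ?thesis by simp
  qed
  then have "(\<integral>\<^sup>+x. indicator ?N x \<partial>S) = 0"
    using nn_integral_S_facets[of "indicator ?N"] N by (simp add: sum.neutral)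
  moreover have "emeasure S ?N = (\<integral>\<^sup>+x. indicator ?N x \<partial>S)"
    by (rule nn_integral_indicator[symmetric]) (use N in \<open>simp add: sets_S\<close>)
  ultimately show "emeasure S ?N = 0" by simp
qed

lemma AE_S_imp_surface:
  assumes "AE x in S. P x" shows "AE x in \<sigma>. P x"
  using AE_distrD[OF measurable_id_surface assms[unfolded S_def]] .

text \<open>Built from facet normals, with value 0 off the open facets, since
  \<open>outer_normal\<close> is unspecified there. The result is Borel on the whole space.\<close>

definition normal_component :: "(3 \<Rightarrow> real^3 \<Rightarrow> real) \<Rightarrow> real^3 \<Rightarrow> real" where
  "normal_component t x = (\<Sum>F\<in>facets. indicator (rel_interior F) x * (\<Sum>i\<in>UNIV. t i x * facet_normal F $ i))"

lemma borel_normal_component: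
  assumes [measurable]: "\<And>i. t i \<in> borel_measurable borel"
  shows "normal_component t \<in> borel_measurable borel"
proof -
  note borel_rel_interior [measurable]
  show ?thesis unfolding normal_component_def[abs_def] by measurable
qed

lemma normal_component_eq:
  assumes F: "F \<in> facets" and x: "x \<in> rel_interior F"
  shows "normal_component t x = (\<Sum>i\<in>UNIV. t i x * facet_normal F $ i)"
proof -
  have "indicator (rel_interior G) x * (\<Sum>i\<in>UNIV. t i x * facet_normal G $ i) = (if G = F then (\<Sum>i\<in>UNIV. t i x * facet_normal F $ i) else 0)"
    if "G \<in> facets" for G
    using x rel_interior_facets_disjoint[OF F that x] rel_interior_subset[of G] by (auto simp: indicator_def)
  then have "normal_component t x = (\<Sum>G\<in>facets. if G = F then (\<Sum>i\<in>UNIV. t i x * facet_normal F $ i) else 0)"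
    unfolding normal_component_def by (rule sum.cong[OF refl])
  also have "\<dots> = (\<Sum>i\<in>UNIV. t i x * facet_normal F $ i)"
    using F by (simp add: sum.delta[OF finite_facets])
  finally show ?thesis .
qed

text \<open>The right side has a form that serves both cases: the first term suffices when the
  normals are not opposite, the last two when they are. The first case includes F = G.\<close>

lemma facet_pair_bound:
  assumes p: "0 < p" and F: "F \<in> facets" and G: "G \<in> facets"
  obtains K where "0 \<le> K" "\<And>x y s r. x \<in> F \<Longrightarrow> y \<in> G \<Longrightarrow> \<bar>s - r\<bar> powr p / norm (x - y) powr (1 + p) \<le>
    K * (norm (s *\<^sub>R facet_normal F - r *\<^sub>R facet_normal G) powr p / norm (x - y) powr (1 + p) + \<bar>s\<bar> powr p + \<bar>r\<bar> powr p)"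
proof (cases "facet_normal F \<bullet> facet_normal G = - 1")
  case False
  let ?a = "facet_normal F" and ?b = "facet_normal G"
  have "\<bar>?a \<bullet> ?b\<bar> \<le> 1" using Cauchy_Schwarz_ineq2[of ?a ?b] norm_facet_normal F G by simp
  with False have ab: "- 1 < ?a \<bullet> ?b" by simp
  define K where "K = sqrt (2 / (1 + ?a \<bullet> ?b)) powr p"
  show thesis
  proof (rule that[of K])
    show "0 \<le> K" by (simp add: K_def)
    fix x y s r assume "x \<in> F" "y \<in> G"
    have "\<bar>s - r\<bar> powr p \<le> (sqrt (2 / (1 + ?a \<bullet> ?b)) * norm (s *\<^sub>R ?a - r *\<^sub>R ?b)) powr p"
      using unit_multiples_difference[OF norm_facet_normal[OF F] norm_facet_normal[OF G] ab, of s r] p by (intro powr_mono2) auto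
    also have "\<dots> = K * norm (s *\<^sub>R ?a - r *\<^sub>R ?b) powr p" unfolding K_def by (rule powr_mult)
    finally have "\<bar>s - r\<bar> powr p / norm (x - y) powr (1 + p) \<le> K * (norm (s *\<^sub>R ?a - r *\<^sub>R ?b) powr p / norm (x - y) powr (1 + p))"
      using divide_right_mono[of "\<bar>s - r\<bar> powr p" "K * norm (s *\<^sub>R ?a - r *\<^sub>R ?b) powr p" "norm (x - y) powr (1 + p)"] by simp
    also have "\<dots> \<le> K * (norm (s *\<^sub>R ?a - r *\<^sub>R ?b) powr p / norm (x - y) powr (1 + p) + \<bar>s\<bar> powr p + \<bar>r\<bar> powr p)"
      by (intro mult_left_mono) (auto simp: K_def)
    finally show "\<bar>s - r\<bar> powr p / norm (x - y) powr (1 + p) \<le> K * (norm (s *\<^sub>R ?a - r *\<^sub>R ?b) powr p / norm (x - y) powr (1 + p) + \<bar>s\<bar> powr p + \<bar>r\<bar> powr p)" .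
  qed
next
  case True
  let ?a = "facet_normal F" and ?b = "facet_normal G"
  have "(norm (?a + ?b))\<^sup>2 = ?a \<bullet> ?a + 2 * (?a \<bullet> ?b) + ?b \<bullet> ?b"
    unfolding power2_norm_eq_inner by (simp add: inner_add_left inner_add_right inner_commute)
  also have "\<dots> = 0" using True norm_facet_normal[OF F] norm_facet_normal[OF G] by (simp add: norm_eq_1)
  finally have b: "?b = - ?a" by (simp add: eq_neg_iff_add_eq_0 add.commute)
  obtain w where w: "w \<in> \<Omega>" using nonempty_domain by blast
  \<comment> \<open>Through a common point, a point of \<Omega> would lie strictly below both
    planes, which is impossible for opposite normals.\<close>
  have disj: "F \<inter> G = {}"
  proof (rule ccontr)
    assume "F \<inter> G \<noteq> {}"
    then obtain z where "z \<in> F" "z \<in> G" by blast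
    then have "?a \<bullet> (w - z) < 0" "?b \<bullet> (w - z) < 0"
      using facet_normal_outer[OF F _ w] facet_normal_outer[OF G _ w] by blast+
    then show False unfolding b by simp
  qed
  have "compact F" using closed_facet[OF F] facet_subset(2)[OF F] compact_closure
    by (metis compact_Int_closed inf.absorb_iff2)
  from separate_compact_closed[OF this closed_facet[OF G] disj] obtain \<delta> where
    \<delta>: "0 < \<delta>" "\<And>x y. x \<in> F \<Longrightarrow> y \<in> G \<Longrightarrow> \<delta> \<le> dist x y" by blast
  define K where "K = 2 powr p / \<delta> powr (1 + p)"
  show thesis
  proof (rule that[of K])
    show "0 \<le> K" by (simp add: K_def)
    fix x y s r assume xy: "x \<in> F" "y \<in> G"
    have "\<delta> powr (1 + p) \<le> norm (x - y) powr (1 + p)" using \<delta>(1) \<delta>(2)[OF xy] p by (intro powr_mono2) (auto simp: dist_norm)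
    moreover have "\<bar>s - r\<bar> powr p \<le> 2 powr p * (\<bar>s\<bar> powr p + \<bar>r\<bar> powr p)" using abs_add_powr_le[OF p, of s "- r"] by simp
    ultimately have "\<bar>s - r\<bar> powr p / norm (x - y) powr (1 + p) \<le> 2 powr p * (\<bar>s\<bar> powr p + \<bar>r\<bar> powr p) / \<delta> powr (1 + p)"
      using \<delta>(1) by (intro frac_le) auto
    also have "\<dots> = K * (\<bar>s\<bar> powr p + \<bar>r\<bar> powr p)" by (simp add: K_def)
    also have "\<dots> \<le> K * (norm (s *\<^sub>R ?a - r *\<^sub>R ?b) powr p / norm (x - y) powr (1 + p) + \<bar>s\<bar> powr p + \<bar>r\<bar> powr p)"
      by (intro mult_left_mono) (auto simp: K_def)
    finally show "\<bar>s - r\<bar> powr p / norm (x - y) powr (1 + p) \<le> K * (norm (s *\<^sub>R ?a - r *\<^sub>R ?b) powr p / norm (x - y) powr (1 + p) + \<bar>s\<bar> powr p + \<bar>r\<bar> powr p)" .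
  qed
qed

lemma facet_pairs_bound:
  assumes p: "0 < p"
  obtains K where "0 \<le> K" "\<And>F G x y s r. F \<in> facets \<Longrightarrow> G \<in> facets \<Longrightarrow> x \<in> F \<Longrightarrow> y \<in> G \<Longrightarrow> \<bar>s - r\<bar> powr p / norm (x - y) powr (1 + p) \<le>
    K * (norm (s *\<^sub>R facet_normal F - r *\<^sub>R facet_normal G) powr p / norm (x - y) powr (1 + p) + \<bar>s\<bar> powr p + \<bar>r\<bar> powr p)"
proof -
  let ?B = "\<lambda>F G x y s r. norm (s *\<^sub>R facet_normal F - r *\<^sub>R facet_normal G) powr p / norm (x - y) powr (1 + p) + \<bar>s\<bar> powr p + \<bar>r\<bar> powr p"
  let ?P = "\<lambda>z K. 0 \<le> K \<and> (\<forall>x y s r. x \<in> fst z \<longrightarrow> y \<in> snd z \<longrightarrow> \<bar>s - r\<bar> powr p / norm (x - y) powr (1 + p) \<le> K * ?B (fst z) (snd z) x y s r)"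
  have "\<exists>K. ?P z K" if z: "z \<in> facets \<times> facets" for z
  proof -
    have "fst z \<in> facets" "snd z \<in> facets" using z by auto
    from facet_pair_bound[OF p this] show ?thesis by (metis (no_types, lifting))
  qed
  from bchoice[OF ballI[OF this]] obtain k where "\<forall>z\<in>facets \<times> facets. ?P z (k z)" ..
  note k = bspec[OF this]
  have fin: "finite (facets \<times> facets)" using finite_facets by (rule finite_cartesian_product[OF finite_facets])
  show thesis
  \<comment> \<open>The constants are nonnegative, so their sum dominates the constant of every
    pair.\<close>
  proof (rule that[of "sum k (facets \<times> facets)"])
    show "0 \<le> sum k (facets \<times> facets)" using k by (intro sum_nonneg) blast
    fix F G x y s r assume FG: "F \<in> facets" "G \<in> facets" and xy: "x \<in> F" "y \<in> G"
    have z: "(F, G) \<in> facets \<times> facets" using FG by blast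
    have "k (F, G) \<le> sum k (facets \<times> facets)" using k by (intro member_le_sum[OF z _ fin]) blast
    then have "k (F, G) * ?B F G x y s r \<le> sum k (facets \<times> facets) * ?B F G x y s r"
      by (intro mult_right_mono) auto
    moreover have "\<bar>s - r\<bar> powr p / norm (x - y) powr (1 + p) \<le> k (F, G) * ?B F G x y s r"
      using k[OF z] xy by simp
    ultimately show "\<bar>s - r\<bar> powr p / norm (x - y) powr (1 + p) \<le> sum k (facets \<times> facets) * ?B F G x y s r" by linarith
  qed
qed

lemma norm_powr_le:
  fixes z :: "real^3"
  assumes "0 < p" shows "norm z powr p \<le> 3 powr p * (\<Sum>i\<in>UNIV. \<bar>z $ i\<bar> powr p)"
proof -
  have "norm z powr p \<le> (\<Sum>i\<in>UNIV. \<bar>z $ i\<bar>) powr p" using assms norm_le_l1_cart by (intro powr_mono2) auto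
  also have "\<dots> \<le> real (card (UNIV::3 set)) powr p * (\<Sum>i\<in>UNIV. \<bar>z $ i\<bar> powr p)" by (rule sum_powr_le) (use assms in auto)
  finally show ?thesis by simp
qed

definition surface_energy :: "real \<Rightarrow> (real^3 \<Rightarrow> real) \<Rightarrow> ennreal" where
  "surface_energy p f = (\<integral>\<^sup>+x. ennreal (\<bar>f x\<bar> powr p) \<partial>S) + slobodeckij_double p f"

lemma normal_component_energy:
  assumes p: "0 < p"
  obtains C where "0 < C" "\<And>t. (\<And>i. t i \<in> borel_measurable borel) \<Longrightarrow>
    AE x in S. \<forall>F\<in>facets. x \<in> rel_interior F \<longrightarrow> (\<forall>i. t i x = (\<Sum>j\<in>UNIV. t j x * facet_normal F $ j) * facet_normal F $ i) \<Longrightarrow>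
    surface_energy p (normal_component t) \<le> ennreal C * (\<Sum>i\<in>UNIV. surface_energy p (t i))"
proof -
  obtain K where K: "0 \<le> K" "\<And>F G x y s r. F \<in> facets \<Longrightarrow> G \<in> facets \<Longrightarrow> x \<in> F \<Longrightarrow> y \<in> G \<Longrightarrow> \<bar>s - r\<bar> powr p / norm (x - y) powr (1 + p) \<le>
    K * (norm (s *\<^sub>R facet_normal F - r *\<^sub>R facet_normal G) powr p / norm (x - y) powr (1 + p) + \<bar>s\<bar> powr p + \<bar>r\<bar> powr p)"
    using facet_pairs_bound[OF p] by blast
  define M where "M = measure S UNIV"
  have M: "emeasure S UNIV = ennreal M" "0 \<le> M" by (auto simp: M_def S.emeasure_eq_measure)
  let ?c = "3 powr p :: real"
  show thesis
  \<comment> \<open>The first summand is for the L^p norm of d, the second for the differences of t,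
    the third for the terms |d x|^p and |d y|^p, each integrated over the other variable at the cost
    of the total surface measure M.\<close>
  proof (rule that[of "?c + K * ?c + 2 * K * M * ?c"])
    show "0 < ?c + K * ?c + 2 * K * M * ?c" using K(1) M(2) by (simp add: add_pos_nonneg)
    fix t :: "3 \<Rightarrow> real^3 \<Rightarrow> real"
    assume t [measurable]: "\<And>i. t i \<in> borel_measurable borel"
      and AE: "AE x in S. \<forall>F\<in>facets. x \<in> rel_interior F \<longrightarrow> (\<forall>i. t i x = (\<Sum>j\<in>UNIV. t j x * facet_normal F $ j) * facet_normal F $ i)"
    let ?d = "normal_component t"
    have [measurable]: "?d \<in> borel_measurable borel" by (rule borel_normal_component[OF t])
    \<comment> \<open>Records what \<open>facet_pairs_bound\<close> asks for: some facet through x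
      along whose normal t points, with coefficient d.\<close>
    define Q where "Q x F \<longleftrightarrow> F \<in> facets \<and> x \<in> F \<and> (\<forall>i. t i x = ?d x * facet_normal F $ i)" for x F
    have Q: "AE x in S. \<exists>F. Q x F"
      using AE AE_rel_interior
    proof eventually_elim
      case (elim x)
      then obtain F where F: "F \<in> facets" "x \<in> rel_interior F" by blast
      then have "\<forall>i. t i x = ?d x * facet_normal F $ i" using elim(1) normal_component_eq[OF F] by simp
      then show ?case using F rel_interior_subset[of F] unfolding Q_def by blast
    qed
    let ?N = "\<integral>\<^sup>+x. ennreal (\<bar>?d x\<bar> powr p) \<partial>S"
    let ?T = "\<Sum>i\<in>UNIV. \<integral>\<^sup>+x. ennreal (\<bar>t i x\<bar> powr p) \<partial>S"
    let ?D = "\<Sum>i\<in>UNIV. slobodeckij_double p (t i)"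
    have N: "?N \<le> ennreal ?c * ?T"
    proof -
      have "?N \<le> (\<integral>\<^sup>+x. ennreal ?c * (\<Sum>i\<in>UNIV. ennreal (\<bar>t i x\<bar> powr p)) \<partial>S)"
      proof (rule nn_integral_mono_AE)
        show "AE x in S. ennreal (\<bar>?d x\<bar> powr p) \<le> ennreal ?c * (\<Sum>i\<in>UNIV. ennreal (\<bar>t i x\<bar> powr p))"
          using Q
        proof eventually_elim
          case (elim x)
          then obtain F where F: "F \<in> facets" "\<And>i. t i x = ?d x * facet_normal F $ i" unfolding Q_def by blast
          have "\<bar>?d x\<bar> = norm (?d x *\<^sub>R facet_normal F)" using norm_facet_normal[OF F(1)] by simp
          then have "\<bar>?d x\<bar> powr p \<le> ?c * (\<Sum>i\<in>UNIV. \<bar>t i x\<bar> powr p)"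
            using norm_powr_le[OF p, of "?d x *\<^sub>R facet_normal F"] by (simp add: F(2) norm_facet_normal[OF F(1)])
          from ennreal_leI[OF this] show ?case by (simp add: ennreal_mult sum_nonneg)
        qed
      qed
      also have "\<dots> = ennreal ?c * ?T" by (simp add: nn_integral_cmult nn_integral_sum del: sum_ennreal)
      finally show ?thesis .
    qed
    let ?q = "\<lambda>i x y. ennreal (\<bar>t i x - t i y\<bar> powr p / norm (x - y) powr (1 + p))"
    let ?e = "\<lambda>x. ennreal (\<bar>?d x\<bar> powr p)"
    have pw: "ennreal (\<bar>?d x - ?d y\<bar> powr p / norm (x - y) powr (1 + p)) \<le> ennreal K * (ennreal ?c * (\<Sum>i\<in>UNIV. ?q i x y) + ?e x + ?e y)"
      if x: "Q x F" and y: "Q y G" for x y F G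
    proof -
      have F: "F \<in> facets" "x \<in> F" "\<And>i. t i x = ?d x * facet_normal F $ i" and G: "G \<in> facets" "y \<in> G" "\<And>i. t i y = ?d y * facet_normal G $ i"
        using x y by (auto simp: Q_def)
      have "\<bar>?d x - ?d y\<bar> powr p / norm (x - y) powr (1 + p) \<le> K * (norm (?d x *\<^sub>R facet_normal F - ?d y *\<^sub>R facet_normal G) powr p / norm (x - y) powr (1 + p) + \<bar>?d x\<bar> powr p + \<bar>?d y\<bar> powr p)"
        by (rule K(2)[OF F(1) G(1) F(2) G(2)])
      also have "\<dots> \<le> K * ((?c * (\<Sum>i\<in>UNIV. \<bar>t i x - t i y\<bar> powr p)) / norm (x - y) powr (1 + p) + \<bar>?d x\<bar> powr p + \<bar>?d y\<bar> powr p)"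
        using norm_powr_le[OF p, of "?d x *\<^sub>R facet_normal F - ?d y *\<^sub>R facet_normal G"] K(1)
        by (intro mult_left_mono add_mono divide_right_mono) (simp_all add: F(3) G(3))
      also have "\<dots> = K * (?c * (\<Sum>i\<in>UNIV. \<bar>t i x - t i y\<bar> powr p / norm (x - y) powr (1 + p)) + \<bar>?d x\<bar> powr p + \<bar>?d y\<bar> powr p)"
        by (simp only: sum_divide_distrib[symmetric] times_divide_eq_right)
      finally have "ennreal (\<bar>?d x - ?d y\<bar> powr p / norm (x - y) powr (1 + p)) \<le> ennreal (K * (?c * (\<Sum>i\<in>UNIV. \<bar>t i x - t i y\<bar> powr p / norm (x - y) powr (1 + p)) + \<bar>?d x\<bar> powr p + \<bar>?d y\<bar> powr p))"
        by (rule ennreal_leI)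
      also have "\<dots> = ennreal K * (ennreal ?c * (\<Sum>i\<in>UNIV. ?q i x y) + ?e x + ?e y)"
        using K(1) by (subst ennreal_mult) (auto simp: ennreal_plus ennreal_mult sum_nonneg)
      finally show ?thesis .
    qed
    have "slobodeckij_double p ?d \<le> (\<integral>\<^sup>+x. \<integral>\<^sup>+y. ennreal K * (ennreal ?c * (\<Sum>i\<in>UNIV. ?q i x y) + ?e x + ?e y) \<partial>S \<partial>S)"
      unfolding slobodeckij_double_def
    proof (rule nn_integral_mono_AE)
      show "AE x in S. (\<integral>\<^sup>+y. ennreal (\<bar>?d x - ?d y\<bar> powr p / norm (x - y) powr (1 + p)) \<partial>S)
        \<le> (\<integral>\<^sup>+y. ennreal K * (ennreal ?c * (\<Sum>i\<in>UNIV. ?q i x y) + ?e x + ?e y) \<partial>S)"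
        using Q
      proof eventually_elim
        case (elim x)
        then obtain F where F: "Q x F" by blast
        show ?case
        proof (rule nn_integral_mono_AE)
          show "AE y in S. ennreal (\<bar>?d x - ?d y\<bar> powr p / norm (x - y) powr (1 + p)) \<le> ennreal K * (ennreal ?c * (\<Sum>i\<in>UNIV. ?q i x y) + ?e x + ?e y)"
            using Q by eventually_elim (use pw[OF F] in blast)
        qed
      qed
    qed
    also have "\<dots> = (\<integral>\<^sup>+x. ennreal K * (ennreal ?c * (\<Sum>i\<in>UNIV. \<integral>\<^sup>+y. ?q i x y \<partial>S) + ?e x * ennreal M + ?N) \<partial>S)"
      by (simp add: nn_integral_cmult nn_integral_add nn_integral_sum M(1) del: sum_ennreal)
    also have "\<dots> = ennreal K * (ennreal ?c * ?D + ?N * ennreal M + ?N * ennreal M)"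
      unfolding slobodeckij_double_def by (simp add: nn_integral_cmult nn_integral_multc nn_integral_add nn_integral_sum M(1) del: sum_ennreal)
    also have "\<dots> \<le> ennreal K * (ennreal ?c * ?D + (ennreal ?c * ?T) * ennreal M + (ennreal ?c * ?T) * ennreal M)"
      by (intro mult_left_mono add_mono mult_right_mono N) auto
    finally have D: "slobodeckij_double p ?d \<le> ennreal K * (ennreal ?c * ?D + (ennreal ?c * ?T) * ennreal M + (ennreal ?c * ?T) * ennreal M)" .
    have "ennreal (K * M * ?c) = ennreal K * (ennreal ?c * ennreal M)" "ennreal (K * ?c) = ennreal K * ennreal ?c"
      using K(1) M(2) by (simp_all add: ennreal_mult mult_ac)
    then have "ennreal K * (ennreal ?c * ?D + (ennreal ?c * ?T) * ennreal M + (ennreal ?c * ?T) * ennreal M)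
       = ennreal (K * ?c) * ?D + (ennreal (K * M * ?c) + ennreal (K * M * ?c)) * ?T"
      by (simp only: distrib_left distrib_right mult_ac add_ac)
    also have "ennreal (K * M * ?c) + ennreal (K * M * ?c) = ennreal (2 * K * M * ?c)"
      using K(1) M(2) by (simp flip: ennreal_plus)
    finally have "surface_energy p ?d \<le> ennreal ?c * ?T + (ennreal (K * ?c) * ?D + ennreal (2 * K * M * ?c) * ?T)"
      unfolding surface_energy_def using add_mono[OF N D] by simp
    also have "\<dots> \<le> ennreal ?c * (?T + ?D) + (ennreal (K * ?c) * (?T + ?D) + ennreal (2 * K * M * ?c) * (?T + ?D))"
      by (intro add_mono mult_left_mono) auto
    also have "\<dots> = ennreal (?c + K * ?c + 2 * K * M * ?c) * (\<Sum>i\<in>UNIV. surface_energy p (t i))"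
      using K(1) M(2) by (simp add: surface_energy_def sum.distrib distrib_right ennreal_plus add.assoc)
    finally show "surface_energy p ?d \<le> ennreal (?c + K * ?c + 2 * K * M * ?c) * (\<Sum>i\<in>UNIV. surface_energy p (t i))" .
  qed
qed

end

section \<open>Assembly of the estimate\<close>

context polyhedral_domain begin

text \<open>\<open>sobolev_space\<close> provides second weak derivatives of v rather than weak
  derivatives of its gradient. Inserting a derivative of a test function into the first-order
  identity shows that they are the same.\<close>

lemma second_derivatives:
  assumes p: "1 < p" and v: "v \<in> sobolev_space 2 p \<Omega>"
  obtains g W V where "W1 p v g W" "\<And>i. W1 p (W i) (W i) (V i)"
    "(\<Sum>i\<in>UNIV. W1_energy p (W i) (V i)) \<le> ennreal 12 * ennreal (sobolev_norm 2 p \<Omega> v powr p)"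
proof -
  have p0: "0 < p" using p by simp
  let ?N = "ennreal (sobolev_norm 2 p \<Omega> v powr p)"
  obtain g where g: "represents g v" "Lp_fun p g" using sobolev_space_represents[OF p v] .
  have order2: "\<exists>W. Lp_fun p W \<and> Lp_energy p W \<le> ?N \<and>
      (\<forall>\<phi>\<in>test_functions \<Omega>. (LINT x|lborel. g x * multi_deriv \<alpha> \<phi> x) = (-1) ^ sum \<alpha> UNIV * (LINT x|lborel. W x * \<phi> x))"
    if \<alpha>: "sum \<alpha> UNIV \<le> 2" for \<alpha>
  proof -
    obtain w W where w: "has_weak_deriv \<Omega> \<alpha> v w" "represents W w" "Lp_fun p W"
      "Lp_energy p W = ennreal (Lp_norm (lebesgue_on \<Omega>) p (weak_deriv \<Omega> \<alpha> v) powr p)"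
      using sobolev_space_deriv[OF p v \<alpha>] by blast
    have "Lp_energy p W \<le> ?N"
      unfolding w(4) sobolev_norm_powr[OF p0]
      by (rule member_le_sum[where f="\<lambda>\<alpha>. ennreal (Lp_norm (lebesgue_on \<Omega>) p (weak_deriv \<Omega> \<alpha> v) powr p)"])
        (use \<alpha> finite_multi_indices in auto)
    moreover have "\<forall>\<phi>\<in>test_functions \<Omega>. (LINT x|lborel. g x * multi_deriv \<alpha> \<phi> x) = (-1) ^ sum \<alpha> UNIV * (LINT x|lborel. W x * \<phi> x)"
      using w(1) unfolding has_weak_deriv_iff[OF p g w(2,3)] .
    ultimately show ?thesis using w(3) by (intro exI[of _ W] conjI)
  qed
  have "\<exists>W. Lp_fun p W \<and> Lp_energy p W \<le> ?N \<and> weak_partial i g W" for i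
    using order2[of "unit_index i"] unfolding weak_partial_def multi_deriv_unit_index by simp
  from choice[OF allI[OF this]] obtain W where "\<forall>i. Lp_fun p (W i) \<and> Lp_energy p (W i) \<le> ?N \<and> weak_partial i g (W i)" ..
  then have W: "Lp_fun p (W i)" "Lp_energy p (W i) \<le> ?N" "weak_partial i g (W i)" for i by blast+
  have "\<exists>V. Lp_fun p V \<and> Lp_energy p V \<le> ?N \<and> weak_partial j (W i) V" for i j
  proof -
    have s: "sum (\<lambda>k. unit_index i k + unit_index j k) UNIV = 2" by (simp add: sum.distrib)
    then obtain V where V: "Lp_fun p V" "Lp_energy p V \<le> ?N"
      "\<And>\<phi>. \<phi> \<in> test_functions \<Omega> \<Longrightarrow> (LINT x|lborel. g x * multi_deriv (\<lambda>k. unit_index i k + unit_index j k) \<phi> x) = (LINT x|lborel. V x * \<phi> x)"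
      using order2[of "\<lambda>k. unit_index i k + unit_index j k"] by auto
    have "weak_partial j (W i) V"
      unfolding weak_partial_def
    proof
      fix \<phi> assume \<phi>: "\<phi> \<in> test_functions \<Omega>"
      have "(LINT x|lborel. g x * partial_deriv i (partial_deriv j \<phi>) x) = - (LINT x|lborel. W i x * partial_deriv j \<phi> x)"
        using W(3)[of i] test_function_partial_deriv[OF \<phi>, of j] unfolding weak_partial_def by blast
      then show "(LINT x|lborel. W i x * partial_deriv j \<phi> x) = - (LINT x|lborel. V x * \<phi> x)"
        using V(3)[OF \<phi>] unfolding multi_deriv_unit_index_2[OF test_function_smooth[OF \<phi>]] by simp
    qed
    with V(1,2) show ?thesis by blast
  qed
  then have "\<forall>z. \<exists>V. Lp_fun p V \<and> Lp_energy p V \<le> ?N \<and> weak_partial (snd z) (W (fst z)) V" by blast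
  from choice[OF this] obtain V' where V': "\<forall>z. Lp_fun p (V' z) \<and> Lp_energy p (V' z) \<le> ?N \<and> weak_partial (snd z) (W (fst z)) (V' z)" ..
  define V where "V i j = V' (i, j)" for i j
  have V: "Lp_fun p (V i j)" "Lp_energy p (V i j) \<le> ?N" "weak_partial j (W i) (V i j)" for i j
    using V'[rule_format, of "(i, j)"] by (simp_all add: V_def)
  \<comment> \<open>The 12 counts three first and nine second derivatives, each with energy at most
    the p-th power of the norm; mixed ones occur twice.\<close>
  have "(\<Sum>i\<in>UNIV. W1_energy p (W i) (V i)) \<le> (\<Sum>i\<in>(UNIV::3 set). ?N + (\<Sum>j\<in>(UNIV::3 set). ?N))"
    unfolding W1_energy_def by (intro sum_mono add_mono W V)
  also have "\<dots> = ennreal 12 * ?N"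
  proof -
    define x where "x = sobolev_norm 2 p \<Omega> v powr p"
    have x0: "0 \<le> x" by (simp add: x_def)
    have "(\<Sum>i\<in>(UNIV::3 set). ennreal x + (\<Sum>j\<in>(UNIV::3 set). ennreal x)) = ennreal ((x + (x + x + x)) + (x + (x + x + x)) + (x + (x + x + x)))"
      unfolding sum_3 using x0 by (simp only: ennreal_plus add_nonneg_nonneg)
    also have "\<dots> = ennreal (12 * x)" by simp
    also have "\<dots> = ennreal 12 * ennreal x" using x0 by (simp only: ennreal_mult zero_le_numeral)
    finally show ?thesis unfolding x_def .
  qed
  finally have "(\<Sum>i\<in>UNIV. W1_energy p (W i) (V i)) \<le> ennreal 12 * ?N" .
  moreover have "W1 p v g W" using g W by (simp add: W1_def)
  moreover have "W1 p (W i) (W i) (V i)" for i using represents_self[OF W(1)] W(1) V by (simp add: W1_def)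
  ultimately show thesis by (intro that)
qed

lemma surface_energy_surface:
  assumes p: "0 < p" and f [measurable]: "f \<in> borel_measurable borel" and d: "AE x in \<sigma>. d x = f x"
  shows "(\<integral>\<^sup>+x. ennreal (\<bar>d x\<bar> powr p) \<partial>\<sigma>) = (\<integral>\<^sup>+x. ennreal (\<bar>f x\<bar> powr p) \<partial>S)"
    and "slobodeckij_energy (1 - 1 / p) p \<Omega> d = surface_energy p f"
proof -
  have e: "2 + (1 - 1 / p) * p = 1 + p" using p by (simp add: field_simps)
  have "(\<integral>\<^sup>+x. ennreal (\<bar>d x\<bar> powr p) \<partial>\<sigma>) = (\<integral>\<^sup>+x. ennreal (\<bar>f x\<bar> powr p) \<partial>\<sigma>)"
    by (intro nn_integral_cong_AE eventually_mono[OF d]) simp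
  also have "\<dots> = (\<integral>\<^sup>+x. ennreal (\<bar>f x\<bar> powr p) \<partial>S)" by (rule nn_integral_S[symmetric]) measurable
  finally show 1: "(\<integral>\<^sup>+x. ennreal (\<bar>d x\<bar> powr p) \<partial>\<sigma>) = (\<integral>\<^sup>+x. ennreal (\<bar>f x\<bar> powr p) \<partial>S)" .
  have "(\<integral>\<^sup>+x. \<integral>\<^sup>+y. ennreal (\<bar>d x - d y\<bar> powr p / norm (x - y) powr (1 + p)) \<partial>\<sigma> \<partial>\<sigma>)
      = (\<integral>\<^sup>+x. \<integral>\<^sup>+y. ennreal (\<bar>f x - f y\<bar> powr p / norm (x - y) powr (1 + p)) \<partial>S \<partial>\<sigma>)"
  proof (rule nn_integral_cong_AE, use d in eventually_elim)
    case (elim x)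
    have "(\<integral>\<^sup>+y. ennreal (\<bar>d x - d y\<bar> powr p / norm (x - y) powr (1 + p)) \<partial>\<sigma>) = (\<integral>\<^sup>+y. ennreal (\<bar>f x - f y\<bar> powr p / norm (x - y) powr (1 + p)) \<partial>\<sigma>)"
      using elim by (intro nn_integral_cong_AE eventually_mono[OF d]) simp
    also have "\<dots> = (\<integral>\<^sup>+y. ennreal (\<bar>f x - f y\<bar> powr p / norm (x - y) powr (1 + p)) \<partial>S)"
      by (rule nn_integral_S[symmetric]) measurable
    finally show ?case .
  qed
  also have "\<dots> = slobodeckij_double p f"
    unfolding slobodeckij_double_def by (rule nn_integral_S[symmetric]) measurable
  finally show "slobodeckij_energy (1 - 1 / p) p \<Omega> d = surface_energy p f"
    unfolding slobodeckij_energy_def surface_energy_def e 1 by simp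
qed

lemma AE_normal_component: "AE x in \<sigma>. normal_component t x = (\<Sum>i\<in>UNIV. t i x * outer_normal \<Omega> x $ i)"
  using AE_S_imp_surface[OF AE_rel_interior]
proof eventually_elim
  case (elim x)
  then obtain F where F: "F \<in> facets" "x \<in> rel_interior F" by blast
  show ?case unfolding normal_component_eq[OF F] outer_normal_eq[OF F] ..
qed

lemma has_normal_deriv_normal_component:
  assumes p: "1 < p" and v: "W1 p v g W" and V: "\<And>i. W1 p (W i) (W i) (V i)" and t: "\<And>i. trace_limit p (W i) (V i) (t i)"
  shows "has_normal_deriv p \<Omega> v (normal_component t)"
proof -
  have tb: "t i \<in> borel_measurable borel" for i using t[of i] by (simp add: trace_limit_def)
  have "has_weak_deriv \<Omega> ((\<lambda>_. 0)(i := 1)) v (W i)" for i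
    using has_weak_deriv_unit_index[OF p W1D(1,2)[OF v] represents_self[OF W1D(3)[OF v]] W1D(3)[OF v], of i i] W1D(4)[OF v, of i]
    by (simp add: unit_index_def)
  note wd = this
  have tr: "has_trace p \<Omega> (W i) (t i)" for i by (rule trace_limit_imp_has_trace[OF p V t])
  have nb: "normal_component t \<in> borel_measurable \<sigma>" by (intro borel_measurable_surface borel_normal_component tb)
  show ?thesis
    unfolding has_normal_deriv_def by (intro conjI exI[of _ W] exI[of _ t] allI wd tr nb AE_normal_component)
qed

text \<open>Another weak gradient with other traces is an admissible witness of
  \<open>has_normal_deriv\<close>, but uniqueness of weak derivatives makes W represent it too, and
  uniqueness of traces then applies.\<close>

lemma has_normal_deriv_imp_AE:
  assumes p: "1 < p" and v: "W1 p v g W" and V: "\<And>i. W1 p (W i) (W i) (V i)" and t: "\<And>i. trace_limit p (W i) (V i) (t i)"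
    and d: "has_normal_deriv p \<Omega> v d"
  shows "AE x in \<sigma>. d x = normal_component t x"
proof -
  obtain w s where w: "\<And>i. has_weak_deriv \<Omega> (unit_index i) v (w i)" and s: "\<And>i. has_trace p \<Omega> (w i) (s i)"
    and AE: "AE x in \<sigma>. d x = (\<Sum>i\<in>UNIV. s i x * outer_normal \<Omega> x $ i)"
    using d unfolding has_normal_deriv_def unit_index_def by blast
  have eq: "AE x in \<sigma>. s i x = t i x" for i
  proof -
    have r: "represents (W i) (W i)" by (rule W1D(1)[OF V])
    have "has_weak_deriv \<Omega> (unit_index i) v (W i)"
      using has_weak_deriv_unit_index[OF p W1D(1,2)[OF v] r W1D(3)[OF v], of i] W1D(4)[OF v, of i] by blast
    from weak_deriv_unique[OF this w] have "represents (W i) (w i)" by (rule represents_cong_AE[OF r])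
    then have "W1 p (w i) (W i) (V i)" using V[of i] by (simp add: W1_def)
    then have "trace_limit p (W i) (V i) (on_boundary (s i))" by (rule has_trace_imp_trace_limit[OF p _ s])
    from AE_S_imp_surface[OF trace_limit_unique[OF p W1D(2,3)[OF V] this t]]
    have "AE x in \<sigma>. on_boundary (s i) x = t i x" .
    then show ?thesis using AE_space by eventually_elim (simp add: on_boundary_def)
  qed
  have "AE x in \<sigma>. \<forall>i\<in>(UNIV::3 set). s i x = t i x" by (intro AE_finite_allI finite eq)
  then show ?thesis using AE AE_normal_component[of t] by eventually_elim simp
qed

text \<open>The estimate is stated for one Borel version f; every other normal derivative agrees
  with it almost everywhere and has the same surface energy.\<close>

lemma normal_derivative_bound:
  assumes p: "1 < p"
  obtains C where "0 < C" "\<And>v. v \<in> sobolev_space 2 p \<Omega> \<Longrightarrow> v \<in> sobolev_space_0 1 p \<Omega> \<Longrightarrow>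
    \<exists>f. f \<in> borel_measurable borel \<and> has_normal_deriv p \<Omega> v f \<and> (\<forall>d. has_normal_deriv p \<Omega> v d \<longrightarrow> (AE x in \<sigma>. d x = f x))
      \<and> surface_energy p f \<le> ennreal (C * sobolev_norm 2 p \<Omega> v powr p)"
proof -
  have p0: "0 < p" using p by simp
  obtain C1 where C1: "0 < C1" "\<And>g W t. Lp_fun p g \<Longrightarrow> (\<And>i. Lp_fun p (W i)) \<Longrightarrow> trace_limit p g W t \<Longrightarrow>
    surface_energy p t \<le> ennreal C1 * W1_energy p g W"
    using trace_limit_bounds[OF p] unfolding surface_energy_def by blast
  obtain C2 where C2: "0 < C2" "\<And>t. (\<And>i. t i \<in> borel_measurable borel) \<Longrightarrow>
    AE x in S. \<forall>F\<in>facets. x \<in> rel_interior F \<longrightarrow> (\<forall>i. t i x = (\<Sum>j\<in>UNIV. t j x * facet_normal F $ j) * facet_normal F $ i) \<Longrightarrow>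
    surface_energy p (normal_component t) \<le> ennreal C2 * (\<Sum>i\<in>UNIV. surface_energy p (t i))"
    using normal_component_energy[OF p0] by blast
  show thesis
  proof (rule that[of "C2 * (C1 * 12)"])
    show "0 < C2 * (C1 * 12)" using C1 C2 by simp
    fix v assume v2: "v \<in> sobolev_space 2 p \<Omega>" and v0: "v \<in> sobolev_space_0 1 p \<Omega>"
    obtain g W V where v: "W1 p v g W" and V: "\<And>i. W1 p (W i) (W i) (V i)"
      and E: "(\<Sum>i\<in>UNIV. W1_energy p (W i) (V i)) \<le> ennreal 12 * ennreal (sobolev_norm 2 p \<Omega> v powr p)"
      using second_derivatives[OF p v2] by blast
    obtain t where t: "\<And>i. trace_limit p (W i) (V i) (t i)"
      and AE: "AE x in S. \<forall>F\<in>facets. x \<in> rel_interior F \<longrightarrow> (\<forall>i. t i x = (\<Sum>j\<in>UNIV. t j x * facet_normal F $ j) * facet_normal F $ i)"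
      using normal_trace[OF p v0 v V] by blast
    have tb: "t i \<in> borel_measurable borel" for i using t[of i] by (simp add: trace_limit_def)
    have "surface_energy p (normal_component t) \<le> ennreal C2 * (\<Sum>i\<in>UNIV. surface_energy p (t i))" by (rule C2(2)[OF tb AE])
    also have "\<dots> \<le> ennreal C2 * (\<Sum>i\<in>UNIV. ennreal C1 * W1_energy p (W i) (V i))"
      by (intro mult_left_mono sum_mono C1(2)[OF W1D(2,3)[OF V] t]) auto
    also have "\<dots> \<le> ennreal C2 * (ennreal C1 * (ennreal 12 * ennreal (sobolev_norm 2 p \<Omega> v powr p)))"
      unfolding sum_distrib_left[symmetric] by (intro mult_left_mono E) auto
    also have "\<dots> = ennreal (C2 * (C1 * 12) * sobolev_norm 2 p \<Omega> v powr p)"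
      using C1 C2 by (simp only: ennreal_mult mult.assoc less_imp_le powr_ge_zero mult_nonneg_nonneg zero_le_numeral)
    finally have "surface_energy p (normal_component t) \<le> ennreal (C2 * (C1 * 12) * sobolev_norm 2 p \<Omega> v powr p)" .
    then show "\<exists>f. f \<in> borel_measurable borel \<and> has_normal_deriv p \<Omega> v f \<and> (\<forall>d. has_normal_deriv p \<Omega> v d \<longrightarrow> (AE x in \<sigma>. d x = f x))
      \<and> surface_energy p f \<le> ennreal (C2 * (C1 * 12) * sobolev_norm 2 p \<Omega> v powr p)"
      by (intro exI[of _ "normal_component t"] conjI allI impI borel_normal_component tb has_normal_deriv_normal_component[OF p v V t] has_normal_deriv_imp_AE[OF p v V t])
  qed
qed

end

theorem theorem4:
  fixes \<Omega> :: "(real^3) set" and p :: real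
  assumes "convex_polyhedral_domain \<Omega>" and "1 < p"
  shows "\<exists>c>0. \<forall>v \<in> sobolev_space 2 p \<Omega> \<inter> sobolev_space_0 1 p \<Omega>.
    (\<exists>d. has_normal_deriv p \<Omega> v d) \<and>
    (\<forall>d d'. has_normal_deriv p \<Omega> v d \<and> has_normal_deriv p \<Omega> v d' \<longrightarrow>
       (AE x in surface_measure \<Omega>. d x = d' x)) \<and>
    (\<forall>d. has_normal_deriv p \<Omega> v d \<longrightarrow>
       d \<in> slobodeckij_space (1 - 1 / p) p \<Omega> \<and>
       slobodeckij_norm (1 - 1 / p) p \<Omega> d \<le> c * sobolev_norm 2 p \<Omega> v)"
proof -
  interpret polyhedral_domain \<Omega> by unfold_locales (rule assms(1))
  have p0: "0 < p" using assms(2) by simp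
  obtain C where C: "0 < C" "\<And>v. v \<in> sobolev_space 2 p \<Omega> \<Longrightarrow> v \<in> sobolev_space_0 1 p \<Omega> \<Longrightarrow>
    \<exists>f. f \<in> borel_measurable borel \<and> has_normal_deriv p \<Omega> v f \<and> (\<forall>d. has_normal_deriv p \<Omega> v d \<longrightarrow> (AE x in \<sigma>. d x = f x))
      \<and> surface_energy p f \<le> ennreal (C * sobolev_norm 2 p \<Omega> v powr p)"
    using normal_derivative_bound[OF assms(2)] by blast
  show ?thesis
  \<comment> \<open>The energies are p-th powers of norms, hence the p-th root of their
    constant.\<close>
  proof (intro exI[of _ "C powr (1 / p)"] conjI ballI allI impI)
    show "0 < C powr (1 / p)" using C(1) by simp
    fix v assume v: "v \<in> sobolev_space 2 p \<Omega> \<inter> sobolev_space_0 1 p \<Omega>"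
    let ?n = "sobolev_norm 2 p \<Omega> v"
    have n0: "0 \<le> ?n" by (simp add: sobolev_norm_def)
    obtain f where f: "f \<in> borel_measurable borel" "has_normal_deriv p \<Omega> v f"
      "\<And>d. has_normal_deriv p \<Omega> v d \<Longrightarrow> AE x in \<sigma>. d x = f x" "surface_energy p f \<le> ennreal (C * ?n powr p)"
      using C(2)[OF IntD1[OF v] IntD2[OF v]] by blast
    show "\<exists>d. has_normal_deriv p \<Omega> v d" using f(2) by blast
    show "AE x in \<sigma>. d x = d' x" if dd: "has_normal_deriv p \<Omega> v d \<and> has_normal_deriv p \<Omega> v d'" for d d'
      using f(3)[of d] f(3)[of d'] dd by (auto elim: eventually_elim2)
    fix d assume d: "has_normal_deriv p \<Omega> v d"
    note e = surface_energy_surface[OF p0 f(1) f(3)[OF d]]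
    have fin: "surface_energy p f < \<infinity>" using f(4) by (rule le_less_trans) simp
    have "(\<integral>\<^sup>+x. ennreal (\<bar>d x\<bar> powr p) \<partial>\<sigma>) \<le> surface_energy p f" unfolding e(1) surface_energy_def by simp
    then have "(\<integral>\<^sup>+x. ennreal (\<bar>d x\<bar> powr p) \<partial>\<sigma>) < \<infinity>" using fin by (rule le_less_trans)
    then have "d \<in> Lp \<sigma> p" using d by (simp add: Lp_iff has_normal_deriv_def)
    then show "d \<in> slobodeckij_space (1 - 1 / p) p \<Omega>" using fin by (simp add: slobodeckij_space_def e(2))
    have "enn2real (surface_energy p f) \<le> C * ?n powr p"
      using enn2real_mono[OF f(4)] C(1) by simp
    then have "enn2real (surface_energy p f) powr (1 / p) \<le> (C * ?n powr p) powr (1 / p)"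
      using p0 by (intro powr_mono2) auto
    also have "\<dots> = C powr (1 / p) * ?n" using C(1) n0 p0 by (simp add: powr_mult powr_powr)
    finally show "slobodeckij_norm (1 - 1 / p) p \<Omega> d \<le> C powr (1 / p) * ?n" unfolding slobodeckij_norm_def e(2) .
  qed
qed

end
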